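(* Let $k\ge 2$ and let $C:f=0$ be an arrangement of $k$ smooth conics in $\mathbb P^2_{\mathbb C}$ (so $f$ has degree $d=2k$) whose only singularities are nodes, tacnodes, and ordinary triple points. Assume that $C$ is plus-one generated with exponents $(d_1,d_2,d_3)$. Then $$\frac{4}{3}k-2\le d_1\le k.$$ In particular, $k\le 6$.
   Context: Let $S=\mathbb C[x,y,z]$ and let $C:f=0$ be a reduced curve in $\mathbb P^2_{\mathbb C}$, with $f\in S$ homogeneous of degree $d$. Let $J_f=\langle \partial_x f,\partial_y f,\partial_z f\rangle$ be the Jacobian ideal and $M(f)=S/J_f$ the Milnor algebra. $C$ is an $s$-syzygy curve with exponents $(d_1,\dots,d_s)$, $1\le d_1\le\dots\le d_s$, if $M(f)$ has a minimal graded free resolution of the form $$0\to\bigoplus_{i=1}^{s-2}S(-e_i)\to\bigoplus_{j=1}^{s}S(1-d-d_j)\to S^3(1-d)\to S\to M(f)\to 0.$$ (Thus the $d_j$ are the degrees of a minimal set of generators of the graded module of Jacobian syzygies $\{(a,b,c)\in S^3: a\,\partial_xf+b\,\partial_yf+c\,\partial_zf=0\}$, and $d_1$ is the minimal degree of a nonzero Jacobian syzygy.) A reduced $3$-syzygy curve of degree $d$ with exponents $(d_1,d_2,d_3)$ is plus-one generated if $d_1+d_2=d$. An arrangement of $k$ conics is the union of $k$ distinct smooth conics. A node is an $A_1$ singularity (two smooth branches meeting transversally), a tacnode is an $A_3$ singularity (two smooth branches with intersection multiplicity $2$), and an ordinary triple point is a point at which three smooth branches meet pairwise transversally. *)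

theory Defs
  imports
    "HOL-Library.Poly_Mapping"
    "HOL-Library.Numeral_Type"
    "HOL-Computational_Algebra.Squarefree"
    "HOL-Computational_Algebra.Formal_Power_Series"
    "Jordan_Normal_Form.Matrix_Kernel"
begin

section \<open>The polynomial ring \<open>S = \<complex>[x,y,z]\<close>\<close>

text \<open>
  The three variables are indexed by the three-element type \<^typ>\<open>3\<close>; a monomial is its
  exponent function.  Points of the affine cone \<open>\<complex>\<^sup>3\<close> are functions \<^typ>\<open>3 \<Rightarrow> complex\<close>, and a
  point of \<open>\<P>\<^sup>2\<close> is given by any of its nonzero representatives.
\<close>

type_synonym S = "(3 \<Rightarrow>\<^sub>0 nat) \<Rightarrow>\<^sub>0 complex"

definition monom_degree :: "(3 \<Rightarrow>\<^sub>0 nat) \<Rightarrow> nat" where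
  "monom_degree m = (\<Sum>i\<in>UNIV. Poly_Mapping.lookup m i)"

text \<open>Membership in the graded piece \<open>S\<^sub>n\<close>; degrees are integers, and \<open>S\<^sub>n = 0\<close> for \<open>n < 0\<close>.\<close>

definition homogeneous :: "int \<Rightarrow> S \<Rightarrow> bool" where
  "homogeneous n p \<longleftrightarrow> (\<forall>m\<in>Poly_Mapping.keys p. int (monom_degree m) = n)"

definition partial :: "3 \<Rightarrow> S \<Rightarrow> S" where
  "partial i p = (\<Sum>m\<in>Poly_Mapping.keys p.
     Poly_Mapping.single (m - Poly_Mapping.single i 1)
       (of_nat (Poly_Mapping.lookup m i) * Poly_Mapping.lookup p m))"

text \<open>The value of \<open>p\<close> at a triple in a \<open>\<complex>\<close>-algebra with structure map \<open>h\<close>.\<close>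

definition eval_hom :: "(complex \<Rightarrow> 'r) \<Rightarrow> (3 \<Rightarrow> 'r) \<Rightarrow> S \<Rightarrow> 'r::comm_ring_1" where
  "eval_hom h a p = (\<Sum>m\<in>Poly_Mapping.keys p.
     h (Poly_Mapping.lookup p m) * (\<Prod>i\<in>UNIV. a i ^ Poly_Mapping.lookup m i))"

abbreviation eval_at :: "(3 \<Rightarrow> complex) \<Rightarrow> S \<Rightarrow> complex" where
  "eval_at \<equiv> eval_hom (\<lambda>c. c)"

definition generated_ideal :: "'a::comm_ring_1 set \<Rightarrow> 'a set" where
  "generated_ideal B = Modules.module.span (*) B"

section \<open>Plane curves and arrangements of conics\<close>

definition reduced_curve :: "nat \<Rightarrow> S \<Rightarrow> bool" where
  "reduced_curve d f \<longleftrightarrow> 0 < d \<and> homogeneous (int d) f \<and> squarefree f"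

definition zero_set :: "S \<Rightarrow> (3 \<Rightarrow> complex) set" where
  "zero_set f = {P. P \<noteq> (\<lambda>_. 0) \<and> eval_at P f = 0}"

definition singular_points :: "S \<Rightarrow> (3 \<Rightarrow> complex) set" where
  "singular_points f = {P \<in> zero_set f. \<forall>i. eval_at P (partial i f) = 0}"

definition smooth_conic :: "S \<Rightarrow> bool" where
  "smooth_conic q \<longleftrightarrow> homogeneous 2 q \<and> singular_points q = {}"

text \<open>
  The reduced equation of a union of distinct smooth (hence irreducible) conics is the product
  of their equations; a constant factor can be absorbed into one of the \<open>q i\<close>.
\<close>

definition conic_arrangement :: "nat \<Rightarrow> S \<Rightarrow> bool" where
  "conic_arrangement k f \<longleftrightarrow>
     (\<exists>q. (\<forall>i<k. smooth_conic (q i)) \<and> inj_on (\<lambda>i. zero_set (q i)) {..<k} \<and>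
          f = (\<Prod>i<k. q i))"

section \<open>Singularity types\<close>

text \<open>
  Local equations and branches live in the formal power series ring \<open>\<complex>[[u,v]]\<close>, rendered as
  iterated power series with \<open>u\<close> the outer and \<open>v\<close> the inner variable.
\<close>

type_synonym local_series = "complex fps fps"

definition coeff2 :: "local_series \<Rightarrow> nat \<Rightarrow> nat \<Rightarrow> complex" where
  "coeff2 g i j = fps_nth (fps_nth g i) j"

definition const2 :: "complex \<Rightarrow> local_series" where
  "const2 c = fps_const (fps_const c)"

text \<open>
  A frame at \<open>P\<close> is a pair \<open>A, B\<close> completing \<open>P\<close> to a basis of \<open>\<complex>\<^sup>3\<close>. Then
  \<open>(u,v) \<mapsto> [P + u A + v B]\<close> is an affine coordinate system of \<open>\<P>\<^sup>2\<close> centred at \<open>[P]\<close>,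
  and \<open>f(P + u A + v B)\<close> is a local equation of the curve \<open>f = 0\<close> there.
\<close>

definition frame_at :: "(3 \<Rightarrow> complex) \<Rightarrow> (3 \<Rightarrow> complex) \<Rightarrow> (3 \<Rightarrow> complex) \<Rightarrow> bool" where
  "frame_at P A B \<longleftrightarrow>
     (\<forall>a b c. (\<forall>i. a * P i + b * A i + c * B i = 0) \<longrightarrow> a = 0 \<and> b = 0 \<and> c = 0)"

definition local_equation ::
    "S \<Rightarrow> (3 \<Rightarrow> complex) \<Rightarrow> (3 \<Rightarrow> complex) \<Rightarrow> (3 \<Rightarrow> complex) \<Rightarrow> local_series" where
  "local_equation f P A B =
     eval_hom const2
       (\<lambda>i. const2 (P i) + const2 (A i) * fps_X + const2 (B i) * fps_const fps_X) f"

definition smooth_branch :: "local_series \<Rightarrow> bool" where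
  "smooth_branch g \<longleftrightarrow> coeff2 g 0 0 = 0 \<and> (coeff2 g 1 0 \<noteq> 0 \<or> coeff2 g 0 1 \<noteq> 0)"

text \<open>Distinct tangent lines: the linear parts are linearly independent.\<close>

definition transversal :: "local_series \<Rightarrow> local_series \<Rightarrow> bool" where
  "transversal g h \<longleftrightarrow> coeff2 g 1 0 * coeff2 h 0 1 - coeff2 g 0 1 * coeff2 h 1 0 \<noteq> 0"

text \<open>
  The condition \<open>dim \<complex>[[u,v]]/(g,h) = n\<close>: the classes of some \<open>b 0, \<dots>, b (n - 1)\<close> form a
  \<open>\<complex>\<close>-basis of the quotient.
\<close>

definition has_intersection_multiplicity :: "local_series \<Rightarrow> local_series \<Rightarrow> nat \<Rightarrow> bool" where
  "has_intersection_multiplicity g h n \<longleftrightarrow>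
     (\<exists>b :: nat \<Rightarrow> local_series. \<forall>x. \<exists>!c :: nat \<Rightarrow> complex.
        (\<forall>i\<ge>n. c i = 0) \<and> x - (\<Sum>i<n. const2 (c i) * b i) \<in> generated_ideal {g, h})"

text \<open>
  In the next three definitions the existential over frames is harmless: changing the frame
  multiplies the local equation by a unit and applies an automorphism of \<open>\<complex>[[u,v]]\<close>.
\<close>

definition node :: "S \<Rightarrow> (3 \<Rightarrow> complex) \<Rightarrow> bool" where
  "node f P \<longleftrightarrow> (\<exists>A B g h. frame_at P A B \<and> local_equation f P A B = g * h \<and>
     smooth_branch g \<and> smooth_branch h \<and> transversal g h)"

definition tacnode :: "S \<Rightarrow> (3 \<Rightarrow> complex) \<Rightarrow> bool" where
  "tacnode f P \<longleftrightarrow> (\<exists>A B g h. frame_at P A B \<and> local_equation f P A B = g * h \<and>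
     smooth_branch g \<and> smooth_branch h \<and> has_intersection_multiplicity g h 2)"

definition ordinary_triple_point :: "S \<Rightarrow> (3 \<Rightarrow> complex) \<Rightarrow> bool" where
  "ordinary_triple_point f P \<longleftrightarrow>
     (\<exists>A B g h l. frame_at P A B \<and> local_equation f P A B = g * h * l \<and>
        smooth_branch g \<and> smooth_branch h \<and> smooth_branch l \<and>
        transversal g h \<and> transversal g l \<and> transversal h l)"

section \<open>Minimal graded free resolutions and syzygy curves\<close>

text \<open>
  A list \<open>bs\<close> of integers stands for the graded free module \<open>\<Oplus>\<^sub>b S(-b)\<close>, realised on
  \<open>carrier_vec (length bs)\<close>.  A homogeneous map of degree 0 from the module of \<open>cs\<close> to that of
  \<open>bs\<close> is a matrix whose \<open>(r,c)\<close> entry is homogeneous of degree \<open>cs ! c - bs ! r\<close>.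
\<close>

definition graded_map :: "int list \<Rightarrow> int list \<Rightarrow> S mat \<Rightarrow> bool" where
  "graded_map cs bs A \<longleftrightarrow> A \<in> carrier_mat (length bs) (length cs) \<and>
     (\<forall>r<length bs. \<forall>c<length cs. homogeneous (cs ! c - bs ! r) (A $$ (r, c)))"

definition mat_image :: "'a::comm_ring_1 mat \<Rightarrow> 'a vec set" where
  "mat_image A = (\<lambda>v. A *\<^sub>v v) ` carrier_vec (dim_col A)"

text \<open>
  No entry has a constant term, that is, all entries lie in \<open>(x,y,z)\<close>.
\<close>

definition minimal_map :: "S mat \<Rightarrow> bool" where
  "minimal_map A \<longleftrightarrow>
     (\<forall>r<dim_row A. \<forall>c<dim_col A. Poly_Mapping.lookup (A $$ (r, c)) 0 = 0)"

text \<open>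
  \<open>0 \<rightarrow> F\<^sub>3 \<rightarrow> F\<^sub>2 \<rightarrow> F\<^sub>1 \<rightarrow> S \<rightarrow> S/I \<rightarrow> 0\<close> is a minimal graded free resolution, with maps
  \<open>A\<^sub>3, A\<^sub>2, A\<^sub>1\<close> and the canonical projection, where \<open>F\<^sub>i\<close> is the module of the list \<open>bs\<^sub>i\<close>.
\<close>

definition minimal_graded_free_resolution ::
    "S set \<Rightarrow> int list \<Rightarrow> int list \<Rightarrow> int list \<Rightarrow> S mat \<Rightarrow> S mat \<Rightarrow> S mat \<Rightarrow> bool" where
  "minimal_graded_free_resolution I bs1 bs2 bs3 A1 A2 A3 \<longleftrightarrow>
     graded_map bs1 [0] A1 \<and> graded_map bs2 bs1 A2 \<and> graded_map bs3 bs2 A3 \<and>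
     minimal_map A1 \<and> minimal_map A2 \<and> minimal_map A3 \<and>
     mat_image A1 = {v \<in> carrier_vec 1. v $ 0 \<in> I} \<and>
     mat_kernel A1 = mat_image A2 \<and>
     mat_kernel A2 = mat_image A3 \<and>
     mat_kernel A3 = {0\<^sub>v (length bs3)}"

definition jacobian_ideal :: "S \<Rightarrow> S set" where
  "jacobian_ideal f = generated_ideal (range (\<lambda>i. partial i f))"

text \<open>
  \<open>f = 0\<close> is an \<open>s\<close>-syzygy curve of degree \<open>d\<close> with exponents \<open>ds\<close>, where \<open>s = length ds\<close>.
\<close>

definition syzygy_curve :: "nat \<Rightarrow> S \<Rightarrow> nat list \<Rightarrow> bool" where
  "syzygy_curve d f ds \<longleftrightarrow>
     reduced_curve d f \<and> 2 \<le> length ds \<and> sorted ds \<and> (\<forall>e\<in>set ds. 1 \<le> e) \<and>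
     (\<exists>es A1 A2 A3. length es = length ds - 2 \<and>
        minimal_graded_free_resolution (jacobian_ideal f)
          (replicate 3 (int d - 1)) (map (\<lambda>e. int d - 1 + int e) ds) es A1 A2 A3)"

definition plus_one_generated :: "nat \<Rightarrow> S \<Rightarrow> nat \<Rightarrow> nat \<Rightarrow> nat \<Rightarrow> bool" where
  "plus_one_generated d f d1 d2 d3 \<longleftrightarrow> syzygy_curve d f [d1, d2, d3] \<and> d1 + d2 = d"

end

theory Submission
  imports Defs "HOL-Analysis.Analysis" "HOL-Computational_Algebra.Fundamental_Theorem_Algebra"
begin

text \<open>
  Only \<open>d\<^sub>1 \<ge> 4k/3 - 2\<close> needs an argument.  A Jacobian syzygy of degree \<open>r = d\<^sub>1\<close> is a homogeneous vector
  field \<open>\<theta>\<close> with \<open>\<theta> f = 0\<close>; suppose \<open>3 (r + 2) < 4 k\<close>.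

  Because of the types of the singularities, \<open>\<bar>f\<bar> \<le> \<eta>\<close> has volume \<open>O(\<eta>\<^sup>e)\<close> in an annulus for every
  \<open>e < 4/3\<close>.  As \<open>2 (r + 2) / 2k < 4/3\<close>, an integration by parts with the weight \<open>\<bar>f\<bar>\<^bsup>-2\<alpha>\<^esup>\<close>,
  \<open>\<alpha> = (r + 2) / 2k\<close>, has no boundary contribution along the curve and shows that \<open>\<theta>\<close> has divergence zero.

  The field \<open>\<theta>\<close> is tangent to every conic of the arrangement.  On a parametrised conic its tangential
  component is a polynomial of degree at most \<open>2r\<close>.  It vanishes at every node, and it vanishes twice at every
  tacnode and triple point, because there the eigenvalues of the Jacobian matrix of \<open>\<theta>\<close> are determined by
  \<open>\<theta> f = 0\<close> up to a scalar, which is zero as the trace is.  Hence it has \<open>4 (k - 1) > 2r\<close> zeros, so \<open>\<theta>\<close> is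
  radial along the conics.  The minors of \<open>(\<theta> z, z)\<close> have degree \<open>r + 1 < 2k\<close>, so \<open>\<theta>\<close> is radial everywhere, and
  then \<open>\<theta> f = 0\<close> forces \<open>\<theta> = 0\<close>.
\<close>

text \<open>The number 4/3 is twice the log canonical threshold 2/3 of an ordinary triple point.
  Nodes and tacnodes have the larger thresholds 1 and 3/4, so the triple points decide.

  The exponent \<open>(r + 2) / 2k\<close> is forced. To keep a radial cut-off from being
  differentiated, \<open>\<theta>\<close> is made tangent to spheres by subtracting a multiple
  \<open>g\<close> of the Euler field. This contributes \<open>r + 2\<close> times \<open>g\<close>
  to the divergence, and the derivative of the weight contributes \<open>2k \<alpha>\<close> times
  \<open>g\<close> with the opposite sign. For this \<open>\<alpha>\<close> the two cancel; what
  remains is the divergence of \<open>\<theta>\<close>, which is tested against its own conjugate.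

  The inequality \<open>3 (r + 2) < 4 k\<close> acts twice. It makes the regularised integrals
  converge, and it decides the linear algebra at a singular point \<open>P\<close>, where
  \<open>\<theta> P = c P\<close>: the trace equals \<open>c\<close> times a nonzero multiple of
  \<open>3 r - 4 k + 6\<close> at a triple point and of \<open>2 r - 3 k + 4\<close> at a tacnode.
  Both integers are nonzero under the inequality, so zero trace gives \<open>c = 0\<close>.\<close>

no_notation Matrix.vec_index (infixl "$" 100)

section \<open>Volume of the set where two approximate coordinates are small\<close>

lemma emeasure_le_of_diameter:
  fixes S :: "complex set"
  assumes "\<And>x y. x \<in> S \<Longrightarrow> y \<in> S \<Longrightarrow> cmod (x - y) \<le> r" "0 \<le> r"
  shows "emeasure lborel S \<le> ennreal (pi * r\<^sup>2)"
proof (cases "S = {}")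
  case False
  then obtain x where x: "x \<in> S" by blast
  have "S \<subseteq> cball x r" using assms(1)[OF x] by (auto simp: dist_norm)
  then have "emeasure lborel S \<le> emeasure lborel (cball x r)"
    by (intro emeasure_mono) auto
  also have "\<dots> = ennreal (pi * r\<^sup>2)"
    using emeasure_cball[OF assms(2), of x] by (simp add: unit_ball_vol_2)
  finally show ?thesis .
qed auto

text \<open>Fubini with \<open>y\<close> outermost. The first coordinate has to vary little only
  within a single slice, so \<open>A\<close> may be much smaller than the spread of all first
  coordinates.\<close>

lemma emeasure_pair_le_of_diameters:
  fixes S :: "(complex \<times> complex) set"
  assumes S: "S \<in> sets borel" and AB: "0 \<le> A" "0 \<le> B"
    and 1: "\<And>x x' y y'. (x, y) \<in> S \<Longrightarrow> (x', y') \<in> S \<Longrightarrow> cmod (y - y') \<le> B"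
    and 2: "\<And>x x' y. (x, y) \<in> S \<Longrightarrow> (x', y) \<in> S \<Longrightarrow> cmod (x - x') \<le> A"
  shows "emeasure (lborel \<Otimes>\<^sub>M lborel) S \<le> ennreal ((pi * A\<^sup>2) * (pi * B\<^sup>2))"
proof (cases "S = {}")
  case False
  then obtain x0 y0 where p: "(x0, y0) \<in> S" by auto
  have S': "S \<in> sets (lborel \<Otimes>\<^sub>M lborel)" using S by (metis lborel_prod sets_lborel)
  have "emeasure (lborel \<Otimes>\<^sub>M lborel) S
      = (\<integral>\<^sup>+y. emeasure lborel ((\<lambda>x. (x, y)) -` S) \<partial>lborel)"
    by (rule lborel_pair.emeasure_pair_measure_alt2[OF S'])
  also have "\<dots> \<le> (\<integral>\<^sup>+y. ennreal (pi * A\<^sup>2) * indicator (cball y0 B) y \<partial>lborel)"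
  proof (rule nn_integral_mono)
    fix y
    show "emeasure lborel ((\<lambda>x. (x, y)) -` S) \<le> ennreal (pi * A\<^sup>2) * indicator (cball y0 B) y"
    proof (cases "\<exists>x. (x, y) \<in> S")
      case True
      then have "y \<in> cball y0 B" using 1[OF p] by (auto simp: dist_norm)
      moreover have "emeasure lborel ((\<lambda>x. (x, y)) -` S) \<le> ennreal (pi * A\<^sup>2)"
        by (rule emeasure_le_of_diameter) (auto intro: 2 AB)
      ultimately show ?thesis by simp
    next
      case False
      then have "(\<lambda>x. (x, y)) -` S = {}" by auto
      then show ?thesis by simp
    qed
  qed
  also have "\<dots> = ennreal (pi * A\<^sup>2) * emeasure lborel (cball y0 B)"
    by (rule nn_integral_cmult_indicator) auto
  also have "\<dots> = ennreal ((pi * A\<^sup>2) * (pi * B\<^sup>2))"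
    using emeasure_cball[OF AB(2), of y0] AB
    by (simp add: unit_ball_vol_2 ennreal_mult)
  finally show ?thesis .
qed auto

lemma emeasure_pair_swap_le_of_diameters:
  fixes S :: "(complex \<times> complex) set"
  assumes S: "S \<in> sets borel" and AB: "0 \<le> A" "0 \<le> B"
    and 1: "\<And>x x' y y'. (x, y) \<in> S \<Longrightarrow> (x', y') \<in> S \<Longrightarrow> cmod (x - x') \<le> A"
    and 2: "\<And>x y y'. (x, y) \<in> S \<Longrightarrow> (x, y') \<in> S \<Longrightarrow> cmod (y - y') \<le> B"
  shows "emeasure (lborel \<Otimes>\<^sub>M lborel) S \<le> ennreal ((pi * A\<^sup>2) * (pi * B\<^sup>2))"
proof (cases "S = {}")
  case False
  then obtain x0 y0 where p: "(x0, y0) \<in> S" by auto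
  have S': "S \<in> sets (lborel \<Otimes>\<^sub>M lborel)" using S by (metis lborel_prod sets_lborel)
  have "emeasure (lborel \<Otimes>\<^sub>M lborel) S
      = (\<integral>\<^sup>+x. emeasure lborel (Pair x -` S) \<partial>lborel)"
    by (rule lborel.emeasure_pair_measure_alt[OF S'])
  also have "\<dots> \<le> (\<integral>\<^sup>+x. ennreal (pi * B\<^sup>2) * indicator (cball x0 A) x \<partial>lborel)"
  proof (rule nn_integral_mono)
    fix x
    show "emeasure lborel (Pair x -` S) \<le> ennreal (pi * B\<^sup>2) * indicator (cball x0 A) x"
    proof (cases "\<exists>y. (x, y) \<in> S")
      case True
      then have "x \<in> cball x0 A" using 1[OF p] by (auto simp: dist_norm)
      moreover have "emeasure lborel (Pair x -` S) \<le> ennreal (pi * B\<^sup>2)"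
        by (rule emeasure_le_of_diameter) (auto intro: 2 AB)
      ultimately show ?thesis by simp
    next
      case False
      then have "Pair x -` S = {}" by auto
      then show ?thesis by simp
    qed
  qed
  also have "\<dots> = ennreal (pi * B\<^sup>2) * emeasure lborel (cball x0 A)"
    by (rule nn_integral_cmult_indicator) auto
  also have "\<dots> = ennreal ((pi * A\<^sup>2) * (pi * B\<^sup>2))"
    using emeasure_cball[OF AB(1), of x0] AB
    by (simp add: unit_ball_vol_2 ennreal_mult mult.commute)
  finally show ?thesis .
qed auto

text \<open>\<open>S\<close> is to be thought of as the set of parameters at which a map, differing
  from the identity by a Lipschitz error with constant 1/4, takes values in a bidisc of radii
  \<open>a\<close> and \<open>b\<close>. The larger radius bounds the whole spread in its own
  direction by 8/3 of itself, rounded up to 3. The smaller one only controls slices, along which the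
  other difference is zero. Hence the slicing direction depends on which radius is larger, and the
  bound stays \<open>a\<^sup>2 b\<^sup>2\<close> instead of a fourth power of the maximum.\<close>

lemma emeasure_near_identity_le:
  fixes S :: "(complex \<times> complex) set"
  assumes S: "S \<in> sets borel" and ab: "0 \<le> a" "0 \<le> b"
    and 1: "\<And>x x' y y'. (x, y) \<in> S \<Longrightarrow> (x', y') \<in> S \<Longrightarrow>
        cmod (x - x') \<le> 2 * a + max (cmod (x - x')) (cmod (y - y')) / 4"
    and 2: "\<And>x x' y y'. (x, y) \<in> S \<Longrightarrow> (x', y') \<in> S \<Longrightarrow>
        cmod (y - y') \<le> 2 * b + max (cmod (x - x')) (cmod (y - y')) / 4"
  shows "emeasure (lborel \<Otimes>\<^sub>M lborel) S \<le> ennreal (81 * pi\<^sup>2 * a\<^sup>2 * b\<^sup>2)"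
proof -
  have eq: "(pi * (3*a)\<^sup>2) * (pi * (3*b)\<^sup>2) = 81 * pi\<^sup>2 * a\<^sup>2 * b\<^sup>2"
    by (simp add: power2_eq_square)
  have "emeasure (lborel \<Otimes>\<^sub>M lborel) S \<le> ennreal ((pi * (3*a)\<^sup>2) * (pi * (3*b)\<^sup>2))"
  proof (cases "a \<le> b")
    case True
    show ?thesis
    proof (rule emeasure_pair_le_of_diameters[OF S])
      fix x x' y y' assume "(x, y) \<in> S" "(x', y') \<in> S"
      from 1[OF this] 2[OF this] True ab show "cmod (y - y') \<le> 3 * b" by (simp add: max_def split: if_splits)
    next
      fix x x' y assume "(x, y) \<in> S" "(x', y) \<in> S"
      from 1[OF this] ab show "cmod (x - x') \<le> 3 * a" by simp
    qed (use ab in auto)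
  next
    case False
    show ?thesis
    proof (rule emeasure_pair_swap_le_of_diameters[OF S])
      fix x x' y y' assume "(x, y) \<in> S" "(x', y') \<in> S"
      from 1[OF this] 2[OF this] False ab show "cmod (x - x') \<le> 3 * a" by (simp add: max_def split: if_splits)
    next
      fix x y y' assume "(x, y) \<in> S" "(x, y') \<in> S"
      from 2[OF this] ab show "cmod (y - y') \<le> 3 * b" by simp
    qed (use ab in auto)
  qed
  then show ?thesis unfolding eq .
qed

text \<open>Averaging over translations by \<open>\<xi> X + \<eta> Y\<close> replaces a linear change of coordinates.\<close>

lemma emeasure_two_functions_le:
  fixes u w :: "complex^3 \<Rightarrow> complex" and P X Y :: "complex^3"
  assumes cont: "continuous_on UNIV u" "continuous_on UNIV w" and rho: "\<rho> > 0"
    and Hu: "\<And>z \<xi> \<eta>. z \<in> ball P \<rho> \<Longrightarrow> z + \<xi> *s X + \<eta> *s Y \<in> ball P \<rho> \<Longrightarrow>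
        cmod (u (z + \<xi> *s X + \<eta> *s Y) - u z - \<xi>) \<le> max (cmod \<xi>) (cmod \<eta>) / 4"
    and Hw: "\<And>z \<xi> \<eta>. z \<in> ball P \<rho> \<Longrightarrow> z + \<xi> *s X + \<eta> *s Y \<in> ball P \<rho> \<Longrightarrow>
        cmod (w (z + \<xi> *s X + \<eta> *s Y) - w z - \<eta>) \<le> max (cmod \<xi>) (cmod \<eta>) / 4"
  obtains C where "0 \<le> C" "\<And>a b. 0 \<le> a \<Longrightarrow> 0 \<le> b \<Longrightarrow>
    emeasure lborel {z \<in> ball P \<rho>. cmod (u z) \<le> a \<and> cmod (w z) \<le> b} \<le> ennreal (C * a\<^sup>2 * b\<^sup>2)"
proof -
  have nrm: "norm (c *s v) = cmod c * norm v" for c :: complex and v :: "complex^3"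
    by (simp add: norm_vec_def L2_set_def norm_mult power_mult_distrib
      sum_distrib_left[symmetric] real_sqrt_mult)
  \<comment> \<open>Small enough that translations by \<open>m p\<close> with
    \<open>p \<in> D\<close> have length below \<open>\<rho>\<close>: whenever
    \<open>x + m p\<close> lies in the ball of radius \<open>\<rho>\<close>, \<open>x\<close> lies
    in the ball of radius \<open>2 * \<rho>\<close>.\<close>
  define \<tau> where "\<tau> = \<rho> / (2 * (norm X + norm Y + 1))"
  have den: "norm X + norm Y + 1 > 0" using norm_ge_zero[of X] norm_ge_zero[of Y] by linarith
  have "\<rho> * (norm X + norm Y) < \<rho> * (2 * (norm X + norm Y + 1))"
    using rho den by (intro mult_strict_left_mono) simp_all
  then have tau: "\<tau> > 0" "\<tau> * (norm X + norm Y) < \<rho>"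
    using rho den by (simp_all add: \<tau>_def divide_less_eq)
  define D where "D = cball (0::complex) \<tau> \<times> cball (0::complex) \<tau>"
  define m where "m = (\<lambda>p::complex\<times>complex. fst p *s X + snd p *s Y)"
  have m_cont: "continuous_on UNIV m"
    unfolding m_def vector_scalar_mult_def by (intro continuous_intros)
  have mD: "norm (m p) < \<rho>" if "p \<in> D" for p
  proof -
    have "norm (m p) \<le> cmod (fst p) * norm X + cmod (snd p) * norm Y"
      unfolding m_def by (metis norm_triangle_ineq nrm)
    also have "\<dots> \<le> \<tau> * norm X + \<tau> * norm Y"
      using that by (intro add_mono mult_right_mono) (auto simp: D_def)
    also have "\<dots> < \<rho>" using tau by (simp add: distrib_left)
    finally show ?thesis .
  qed
  have D_sets: "D \<in> sets (lborel \<Otimes>\<^sub>M lborel)"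
    unfolding D_def by (intro pair_measureI) auto
  have eD: "emeasure (lborel \<Otimes>\<^sub>M lborel) D = ennreal ((pi * \<tau>\<^sup>2)\<^sup>2)"
    unfolding D_def using tau emeasure_cball[of \<tau> "0::complex"]
    by (subst lborel.emeasure_pair_measure_Times)
       (auto simp: unit_ball_vol_2 ennreal_mult power2_eq_square)
  obtain B where B: "B \<ge> 0" "emeasure lborel (ball P (2*\<rho>)) = ennreal B"
    using emeasure_bounded_finite[of "ball P (2*\<rho>)"]
    by (metis bounded_ball emeasure_lborel_ball_finite ennreal_cases infinity_ennreal_def
        less_top top.not_eq_extremum)
  define C where "C = B * (81 * pi\<^sup>2) / (pi * \<tau>\<^sup>2)\<^sup>2"
  show thesis
  proof
    show "0 \<le> C" using B tau by (auto simp: C_def)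
    fix a b :: real assume ab: "0 \<le> a" "0 \<le> b"
    define W where "W = {z \<in> ball P \<rho>. cmod (u z) \<le> a \<and> cmod (w z) \<le> b}"
    have W_borel: "W \<in> sets borel"
    proof -
      have "{z. cmod (u z) \<le> a} \<in> sets borel" "{z. cmod (w z) \<le> b} \<in> sets borel"
        using cont by (auto intro!: borel_closed closed_Collect_le continuous_intros)
      moreover have "W = ball P \<rho> \<inter> {z. cmod (u z) \<le> a} \<inter> {z. cmod (w z) \<le> b}"
        by (auto simp: W_def)
      ultimately show ?thesis by (metis borel_open open_ball sets.Int)
    qed
    define S where "S = (\<lambda>x. {p \<in> D. x + m p \<in> W})"
    have S_borel: "S x \<in> sets borel" for x
    proof -
      have "(\<lambda>p. x + m p) \<in> borel_measurable borel"
        using m_cont by (intro borel_measurable_continuous_onI continuous_intros)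
      then have "(\<lambda>p. x + m p) -` W \<inter> space borel \<in> sets borel"
        using W_borel by (rule measurable_sets)
      moreover have "D \<in> sets borel" using D_sets by (metis lborel_prod sets_lborel)
      moreover have "S x = D \<inter> ((\<lambda>p. x + m p) -` W \<inter> space borel)" by (auto simp: S_def)
      ultimately show ?thesis by simp
    qed
    have S_le: "emeasure (lborel \<Otimes>\<^sub>M lborel) (S x)
        \<le> ennreal (81 * pi\<^sup>2 * a\<^sup>2 * b\<^sup>2) * indicator (ball P (2*\<rho>)) x" for x
    proof (cases "S x = {}")
      case False
      then obtain p where p: "p \<in> D" "x + m p \<in> W" by (auto simp: S_def)
      have "dist P x < 2 * \<rho>"
      proof -
        have "dist P x \<le> dist P (x + m p) + dist (x + m p) x" by (rule dist_triangle)
        also have "\<dots> < \<rho> + \<rho>" using p(2) mD[OF p(1)] by (intro add_strict_mono) (auto simp: W_def dist_norm)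
        finally show ?thesis by simp
      qed
      moreover have "emeasure (lborel \<Otimes>\<^sub>M lborel) (S x) \<le> ennreal (81 * pi\<^sup>2 * a\<^sup>2 * b\<^sup>2)"
      proof (rule emeasure_near_identity_le[OF S_borel ab])
        fix \<xi> \<xi>' \<eta> \<eta>' assume pp: "(\<xi>, \<eta>) \<in> S x" "(\<xi>', \<eta>') \<in> S x"
        define z where "z = x + m (\<xi>', \<eta>')"
        have z: "z \<in> W" "z + (\<xi> - \<xi>') *s X + (\<eta> - \<eta>') *s Y = x + m (\<xi>, \<eta>)"
          using pp by (auto simp: z_def S_def m_def vec_eq_iff algebra_simps)
        have z': "z + (\<xi> - \<xi>') *s X + (\<eta> - \<eta>') *s Y \<in> W"
          unfolding z(2) using pp by (simp add: S_def)
        let ?z' = "z + (\<xi> - \<xi>') *s X + (\<eta> - \<eta>') *s Y"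
        have in_b: "z \<in> ball P \<rho>" "?z' \<in> ball P \<rho>" using z(1) z' by (auto simp: W_def)
        have bu: "cmod (u z) \<le> a" "cmod (u ?z') \<le> a" "cmod (w z) \<le> b" "cmod (w ?z') \<le> b"
          using z(1) z' by (auto simp: W_def)
        show "cmod (\<xi> - \<xi>') \<le> 2 * a + max (cmod (\<xi> - \<xi>')) (cmod (\<eta> - \<eta>')) / 4"
        proof -
          have "cmod (\<xi> - \<xi>') = cmod (u ?z' - u z - (u ?z' - u z - (\<xi> - \<xi>')))" by simp
          also have "\<dots> \<le> cmod (u ?z') + cmod (u z) + cmod (u ?z' - u z - (\<xi> - \<xi>'))"
            by (meson norm_triangle_ineq4 order_trans add_right_mono)
          finally show ?thesis using Hu[OF in_b] bu by linarith
        qed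
        show "cmod (\<eta> - \<eta>') \<le> 2 * b + max (cmod (\<xi> - \<xi>')) (cmod (\<eta> - \<eta>')) / 4"
        proof -
          have "cmod (\<eta> - \<eta>') = cmod (w ?z' - w z - (w ?z' - w z - (\<eta> - \<eta>')))" by simp
          also have "\<dots> \<le> cmod (w ?z') + cmod (w z) + cmod (w ?z' - w z - (\<eta> - \<eta>'))"
            by (meson norm_triangle_ineq4 order_trans add_right_mono)
          finally show ?thesis using Hw[OF in_b] bu by linarith
        qed
      qed
      ultimately show ?thesis by simp
    qed auto
    have meas: "(\<lambda>(p, x). indicator D p * indicator W (x + m p) :: ennreal)
        \<in> borel_measurable (lborel \<Otimes>\<^sub>M lborel)"
    proof -
      have "(\<lambda>q::(complex\<times>complex)\<times>(complex^3). snd q + m (fst q)) \<in> borel_measurable borel"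
        using m_cont by (intro borel_measurable_continuous_onI continuous_intros
            continuous_on_compose2[OF m_cont]) auto
      then have 1: "(\<lambda>q::(complex\<times>complex)\<times>(complex^3). indicator W (snd q + m (fst q)) :: ennreal) \<in> borel_measurable borel"
        using W_borel by (intro measurable_compose[OF _ borel_measurable_indicator]) auto
      have "D \<in> sets borel" using D_sets by (metis lborel_prod sets_lborel)
      then have 2: "(\<lambda>q::(complex\<times>complex)\<times>(complex^3). indicator D (fst q) :: ennreal) \<in> borel_measurable borel"
        by (intro measurable_compose[OF _ borel_measurable_indicator])
           (auto intro!: borel_measurable_continuous_onI continuous_intros)
      show ?thesis using 1 2 by (simp add: lborel_prod case_prod_beta)
    qed
    have transl: "(\<integral>\<^sup>+x. indicator W (x + v) \<partial>lborel) = emeasure lborel W" for v :: "complex^3"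
    proof -
      have "emeasure lborel W = (\<integral>\<^sup>+x. indicator W x \<partial>lborel)" using W_borel by simp
      also have "\<dots> = (\<integral>\<^sup>+x. indicator W x \<partial>(distr lborel borel ((+) v)))"
        by (simp add: lborel_distr_plus)
      also have "\<dots> = (\<integral>\<^sup>+x. indicator W (v + x) \<partial>lborel)"
        using W_borel by (subst nn_integral_distr) auto
      finally show ?thesis by (simp add: add.commute)
    qed
    \<comment> \<open>The volume of the pairs with \<open>p \<in> D\<close> and
      \<open>x + m p \<in> W\<close> is computed in both orders. Integrating over \<open>x\<close>
      first gives the product of the volumes of \<open>D\<close> and \<open>W\<close> by translation
      invariance; integrating over \<open>p\<close> first gives the slices \<open>S x\<close>, whose
      volumes are already bounded.\<close>
    have "ennreal ((pi * \<tau>\<^sup>2)\<^sup>2) * emeasure lborel W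
        = (\<integral>\<^sup>+p. emeasure lborel W * indicator D p \<partial>(lborel \<Otimes>\<^sub>M lborel))"
      by (subst nn_integral_cmult_indicator[OF D_sets]) (simp add: eD mult.commute)
    also have "\<dots> = (\<integral>\<^sup>+p. (\<integral>\<^sup>+x. indicator D p * indicator W (x + m p) \<partial>lborel) \<partial>lborel)"
      unfolding lborel_prod
    proof (intro nn_integral_cong)
      fix p
      have "(\<lambda>x. indicator W (x + m p) :: ennreal) \<in> borel_measurable lborel"
        using W_borel by (intro measurable_compose[OF _ borel_measurable_indicator]) auto
      then show "emeasure lborel W * indicator D p = (\<integral>\<^sup>+x. indicator D p * indicator W (x + m p) \<partial>lborel)"
        by (simp add: nn_integral_cmult transl mult.commute)
    qed
    also have "\<dots> = (\<integral>\<^sup>+x. (\<integral>\<^sup>+p. indicator D p * indicator W (x + m p) \<partial>lborel) \<partial>lborel)"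
      using lborel_pair.Fubini'[OF meas] by simp
    also have "\<dots> = (\<integral>\<^sup>+x. emeasure (lborel \<Otimes>\<^sub>M lborel) (S x) \<partial>lborel)"
      unfolding lborel_prod
    proof (intro nn_integral_cong)
      fix x
      have "(\<integral>\<^sup>+p. indicator D p * indicator W (x + m p) \<partial>lborel) = (\<integral>\<^sup>+p. indicator (S x) p \<partial>lborel)"
        by (intro nn_integral_cong) (auto simp: S_def indicator_def)
      then show "(\<integral>\<^sup>+p. indicator D p * indicator W (x + m p) \<partial>lborel) = emeasure lborel (S x)"
        using S_borel[of x] by simp
    qed
    also have "\<dots> \<le> (\<integral>\<^sup>+x. ennreal (81 * pi\<^sup>2 * a\<^sup>2 * b\<^sup>2) * indicator (ball P (2*\<rho>)) x \<partial>lborel)"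
      by (intro nn_integral_mono S_le)
    also have "\<dots> = ennreal (81 * pi\<^sup>2 * a\<^sup>2 * b\<^sup>2) * ennreal B"
      by (subst nn_integral_cmult_indicator) (auto simp: B(2))
    also have "\<dots> = ennreal ((pi * \<tau>\<^sup>2)\<^sup>2) * ennreal (C * a\<^sup>2 * b\<^sup>2)"
      using B tau by (subst ennreal_mult[symmetric] ennreal_mult[symmetric])
       (auto simp: C_def ennreal_mult[symmetric])
    finally have le: "ennreal ((pi * \<tau>\<^sup>2)\<^sup>2) * emeasure lborel W
        \<le> ennreal ((pi * \<tau>\<^sup>2)\<^sup>2) * ennreal (C * a\<^sup>2 * b\<^sup>2)" .
    have "emeasure lborel W \<le> ennreal (C * a\<^sup>2 * b\<^sup>2)"
      using le tau by (subst (asm) ennreal_mult_le_mult_iff) auto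
    then show "emeasure lborel {z \<in> ball P \<rho>. cmod (u z) \<le> a \<and> cmod (w z) \<le> b} \<le> ennreal (C * a\<^sup>2 * b\<^sup>2)"
      unfolding W_def .
  qed
qed

section \<open>Integration by parts for compactly supported functions\<close>

text \<open>Difference quotients integrate to 0 because Lebesgue measure is translation invariant.
  The mean value inequality bounds them by \<open>M\<close> on a ball enlarged by
  \<open>norm v\<close>, which accommodates all steps \<open>1 / Suc n\<close>, so dominated
  convergence passes to the derivative.\<close>

lemma integral_directional_derivative_eq_0:
  fixes F :: "'a::euclidean_space \<Rightarrow> complex"
  assumes F: "\<And>x. (F has_derivative F' x) (at x)"
    and cont: "continuous_on UNIV (\<lambda>x. F' x v)"
    and supp: "\<And>x. norm x \<ge> R \<Longrightarrow> F x = 0"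
  shows "(LINT x|lborel. F' x v) = 0" "integrable lborel (\<lambda>x. F' x v)"
proof -
  have F_cont: "continuous_on UNIV F"
    using F by (meson continuous_at_imp_continuous_on has_derivative_continuous)
  have F'0: "F' x v = 0" if "norm x > R" for x
  proof -
    have "open {x::'a. R < norm x}" by (intro open_Collect_less continuous_intros)
    then have "(F has_derivative (\<lambda>_. 0)) (at x)"
      by (rule has_derivative_transform_within_open[of "\<lambda>_. 0", rotated])
         (use that supp in \<open>auto simp: less_imp_le\<close>)
    then have "F' x = (\<lambda>_. 0)" using F has_derivative_unique by blast
    then show ?thesis by simp
  qed
  have "bounded ((\<lambda>x. F' x v) ` cball 0 R)"
    by (intro compact_imp_bounded compact_continuous_image continuous_on_subset[OF cont]) auto
  then obtain M where M: "\<And>x. norm x \<le> R \<Longrightarrow> cmod (F' x v) \<le> M" "M > 0"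
    unfolding bounded_pos by (metis image_eqI mem_cball_0)
  have M: "cmod (F' x v) \<le> M" for x
    using M F'0[of x] by (cases "norm x \<le> R") auto
  have M0: "M \<ge> 0" using M[of 0] norm_ge_zero order_trans by blast
  define D where "D = (\<lambda>n x. of_nat (Suc n) * (F (x + (1 / Suc n) *\<^sub>R v) - F x))"
  have F_int: "integrable lborel F"
  proof -
    have "integrable lborel (\<lambda>x. indicator (cball 0 R) x *\<^sub>R F x)"
      by (rule borel_integrable_compact) (auto intro: continuous_on_subset[OF F_cont])
    moreover have "(\<lambda>x. indicator (cball 0 R) x *\<^sub>R F x) = F"
      using supp by (auto simp: fun_eq_iff indicator_def)
    ultimately show ?thesis by simp
  qed
  have transl: "integrable lborel (\<lambda>x. F (x + t))" "(LINT x|lborel. F (x + t)) = (LINT x|lborel. F x)" for t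
  proof -
    have m: "F \<in> borel_measurable borel" using F_int by simp
    have e: "(\<lambda>x. F (x + t)) = (\<lambda>x. F (t + x))" by (simp add: add.commute)
    have "integrable (distr lborel borel ((+) t)) F" using F_int by (simp add: lborel_distr_plus)
    then show "integrable lborel (\<lambda>x. F (x + t))"
      unfolding e by (subst (asm) integrable_distr_eq) (auto simp: m)
    have "(LINT x|lborel. F x) = (LINT x|distr lborel borel ((+) t). F x)" by (simp add: lborel_distr_plus)
    also have "\<dots> = (LINT x|lborel. F (t + x))" by (subst integral_distr) (auto simp: m)
    finally show "(LINT x|lborel. F (x + t)) = (LINT x|lborel. F x)" unfolding e by simp
  qed
  have D0: "(LINT x|lborel. D n x) = 0" for n
    unfolding D_def using transl F_int by simp
  have at0: "filterlim (\<lambda>n. 1 / real (Suc n)) (at 0) sequentially"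
    unfolding filterlim_at
    by (intro conjI always_eventually LIMSEQ_Suc[OF lim_1_over_n[where 'a=real]]) (simp del: of_nat_Suc)
  have lim: "(\<lambda>n. D n x) \<longlonglongrightarrow> F' x v" for x
  proof -
    have "((\<lambda>t. F (x + t *\<^sub>R v)) has_vector_derivative F' x v) (at 0)"
    proof -
      have 1: "((\<lambda>t::real. x + t *\<^sub>R v) has_derivative (\<lambda>t. t *\<^sub>R v)) (at 0)"
        by (auto intro!: derivative_eq_intros)
      have "(F has_derivative F' x) (at (x + 0 *\<^sub>R v))" using F by simp
      then have "((\<lambda>t. F (x + t *\<^sub>R v)) has_derivative (\<lambda>t. F' x (t *\<^sub>R v))) (at 0)"
        by (rule has_derivative_compose[OF 1])
      moreover have "(\<lambda>t. F' x (t *\<^sub>R v)) = (\<lambda>t. t *\<^sub>R F' x v)"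
        by (simp only: linear_scale[OF has_derivative_linear[OF F]])
      ultimately show ?thesis by (simp add: has_vector_derivative_def)
    qed
    then have "((\<lambda>t. norm (F (x + t *\<^sub>R v) - F x - t *\<^sub>R F' x v) / norm t) \<longlongrightarrow> 0) (at 0)"
      unfolding has_vector_derivative_def has_derivative_at by simp
    moreover have "eventually (\<lambda>t::real. norm (F (x + t *\<^sub>R v) - F x - t *\<^sub>R F' x v) / norm t
        = norm ((F (x + t *\<^sub>R v) - F x) /\<^sub>R t - F' x v)) (at 0)"
      unfolding eventually_at_filter
    proof (intro always_eventually allI impI)
      fix t :: real assume t: "t \<noteq> 0"
      then have "F (x + t *\<^sub>R v) - F x - t *\<^sub>R F' x v = t *\<^sub>R ((F (x + t *\<^sub>R v) - F x) /\<^sub>R t - F' x v)"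
        unfolding scaleR_diff_right[of t "(F (x + t *\<^sub>R v) - F x) /\<^sub>R t"] by simp
      then have "norm (F (x + t *\<^sub>R v) - F x - t *\<^sub>R F' x v)
          = \<bar>t\<bar> * norm ((F (x + t *\<^sub>R v) - F x) /\<^sub>R t - F' x v)"
        by (simp only: norm_scaleR)
      then show "norm (F (x + t *\<^sub>R v) - F x - t *\<^sub>R F' x v) / norm t
        = norm ((F (x + t *\<^sub>R v) - F x) /\<^sub>R t - F' x v)"
        using t by (simp only: real_norm_def) (simp add: field_simps)
    qed
    ultimately have "((\<lambda>t. norm ((F (x + t *\<^sub>R v) - F x) /\<^sub>R t - F' x v)) \<longlongrightarrow> 0) (at 0)"
      by (rule Lim_transform_eventually)
    then have "((\<lambda>t. (F (x + t *\<^sub>R v) - F x) /\<^sub>R t) \<longlongrightarrow> F' x v) (at 0)"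
      by (rule LIM_zero_cancel[OF tendsto_norm_zero_cancel])
    from filterlim_compose[OF this at0]
    have "(\<lambda>n. (F (x + (1 / real (Suc n)) *\<^sub>R v) - F x) /\<^sub>R (1 / real (Suc n))) \<longlonglongrightarrow> F' x v" .
    moreover have "D n x = (F (x + (1 / real (Suc n)) *\<^sub>R v) - F x) /\<^sub>R (1 / real (Suc n))" for n
      unfolding D_def by (simp add: scaleR_conv_of_real del: of_nat_Suc)
    ultimately show ?thesis by (simp only:)
  qed
  have bound: "cmod (D n x) \<le> indicator (cball 0 (R + norm v)) x *\<^sub>R M" for n x
  proof (cases "norm x \<le> R + norm v")
    case True
    define h where "h = 1 / real (Suc n)"
    have h: "0 < h" by (simp add: h_def)
    have "norm (F (x + h *\<^sub>R v) - F (x + 0 *\<^sub>R v)) \<le> M * h - M * 0"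
    proof (rule differentiable_bound_general[where f = "\<lambda>t. F (x + t *\<^sub>R v)" and \<phi> = "\<lambda>t. M * t"
          and f' = "\<lambda>t. F' (x + t *\<^sub>R v) v" and \<phi>' = "\<lambda>_. M", OF h])
      show "continuous_on {0..h} (\<lambda>t. F (x + t *\<^sub>R v))"
        by (intro continuous_on_compose2[OF F_cont] continuous_intros) auto
      fix t :: real
      have 1: "((\<lambda>t::real. x + t *\<^sub>R v) has_derivative (\<lambda>t. t *\<^sub>R v)) (at t)"
        by (auto intro!: derivative_eq_intros)
      have "((\<lambda>t. F (x + t *\<^sub>R v)) has_derivative (\<lambda>s. F' (x + t *\<^sub>R v) (s *\<^sub>R v))) (at t)"
        by (rule has_derivative_compose[OF 1 F])
      moreover have "(\<lambda>s. F' (x + t *\<^sub>R v) (s *\<^sub>R v)) = (\<lambda>s. s *\<^sub>R F' (x + t *\<^sub>R v) v)"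
        by (simp only: linear_scale[OF has_derivative_linear[OF F]])
      ultimately show "((\<lambda>t. F (x + t *\<^sub>R v)) has_vector_derivative F' (x + t *\<^sub>R v) v) (at t)"
        by (simp add: has_vector_derivative_def)
    qed (auto intro!: continuous_intros derivative_eq_intros M simp: has_real_derivative_iff_has_vector_derivative[symmetric])
    then have "cmod (F (x + h *\<^sub>R v) - F x) \<le> M * h" by simp
    then have "real (Suc n) * cmod (F (x + h *\<^sub>R v) - F x) \<le> real (Suc n) * (M * h)"
      by (rule mult_left_mono) auto
    then show ?thesis using True by (simp add: D_def h_def norm_mult del: of_nat_Suc)
  next
    case False
    have "norm v * 1 \<le> norm v * real (Suc n)" by (intro mult_left_mono) auto
    then have "norm ((1 / real (Suc n)) *\<^sub>R v) \<le> norm v"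
      by (simp add: divide_le_eq del: of_nat_Suc)
    then have 1: "norm (x + (1 / real (Suc n)) *\<^sub>R v) \<ge> R"
      using False norm_diff_ineq[of x "(1 / real (Suc n)) *\<^sub>R v"] by linarith
    have 2: "norm x \<ge> R" using False norm_ge_zero[of v] by linarith
    have "F (x + (1 / real (Suc n)) *\<^sub>R v) = 0" "F x = 0"
      using supp[OF 1] supp[OF 2] .
    then show ?thesis using M0 by (simp add: D_def)
  qed
  have w: "integrable lborel (\<lambda>x::'a. indicator (cball 0 (R + norm v)) x *\<^sub>R M)"
    by (rule borel_integrable_compact) auto
  have meas: "(\<lambda>x. F' x v) \<in> borel_measurable lborel"
    using cont by (simp add: borel_measurable_continuous_onI)
  have measD: "D n \<in> borel_measurable lborel" for n
    unfolding D_def using transl(1)[THEN borel_measurable_integrable] F_int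
    by (intro borel_measurable_times borel_measurable_diff) auto
  have "(\<lambda>n. LINT x|lborel. D n x) \<longlonglongrightarrow> (LINT x|lborel. F' x v)"
    by (rule integral_dominated_convergence[OF meas measD w]) (use lim bound in auto)
  then show "(LINT x|lborel. F' x v) = 0" using D0 by (simp add: LIMSEQ_const_iff)
  show "integrable lborel (\<lambda>x. F' x v)"
    by (rule integrable_dominated_convergence[where s = D, OF meas measD w]) (use lim bound in auto)
qed

subsection \<open>Evaluation of polynomials\<close>

text \<open>One notion covers the three coefficient maps in use: evaluation at points, restriction
  to a parametrised curve with values in polynomials, and local equations with values in power
  series.\<close>

definition is_ring_hom :: "('a::comm_ring_1 \<Rightarrow> 'r::comm_ring_1) \<Rightarrow> bool" where
  "is_ring_hom h \<longleftrightarrow> h 0 = 0 \<and> h 1 = 1 \<and> (\<forall>x y. h (x + y) = h x + h y) \<and> (\<forall>x y. h (x * y) = h x * h y)"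

lemma is_ring_homD:
  assumes "is_ring_hom h"
  shows "h 0 = 0" "h 1 = 1" "h (x + y) = h x + h y" "h (x * y) = h x * h y"
  using assms by (auto simp: is_ring_hom_def)

lemma is_ring_hom_sum: "is_ring_hom h \<Longrightarrow> h (sum g A) = (\<Sum>x\<in>A. h (g x))"
  by (induction A rule: infinite_finite_induct) (auto simp: is_ring_homD)

lemma is_ring_hom_prod: "is_ring_hom h \<Longrightarrow> h (prod g A) = (\<Prod>x\<in>A. h (g x))"
  by (induction A rule: infinite_finite_induct) (auto simp: is_ring_homD)

lemma is_ring_hom_power: "is_ring_hom h \<Longrightarrow> h (x ^ n) = h x ^ n"
  by (induction n) (auto simp: is_ring_homD)

lemma is_ring_hom_id: "is_ring_hom (\<lambda>c. c)"
  and is_ring_hom_poly_const: "is_ring_hom (\<lambda>c::complex. [:c:])"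
  and is_ring_hom_const2: "is_ring_hom const2"
  by (auto simp: is_ring_hom_def const2_def one_pCons)

lemma prod_UNIV_3: "(\<Prod>i\<in>UNIV. g (i::3)) = g 1 * g 2 * (g 3 :: 'a::comm_monoid_mult)"
  unfolding UNIV_3 by (simp add: ac_simps)

lemma poly_mapping_eq_sum_singles:
  fixes p :: "'a \<Rightarrow>\<^sub>0 'b::comm_monoid_add"
  shows "p = (\<Sum>m\<in>Poly_Mapping.keys p. Poly_Mapping.single m (Poly_Mapping.lookup p m))"
proof (rule poly_mapping_eqI)
  fix k
  show "Poly_Mapping.lookup p k = Poly_Mapping.lookup (\<Sum>m\<in>Poly_Mapping.keys p. Poly_Mapping.single m (Poly_Mapping.lookup p m)) k"
    by (cases "k \<in> Poly_Mapping.keys p")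
       (auto simp: lookup_sum lookup_single when_def sum.delta not_in_keys_iff_lookup_eq_zero)
qed

lemma poly_mapping_single_induct [case_names single add]:
  fixes p :: "'a \<Rightarrow>\<^sub>0 'b::comm_monoid_add"
  assumes "\<And>m c. P (Poly_Mapping.single m c)" "\<And>p q. P p \<Longrightarrow> P q \<Longrightarrow> P (p + q)"
  shows "P p"
proof -
  have "P (\<Sum>m\<in>A. Poly_Mapping.single m (Poly_Mapping.lookup p m))" if "finite A" for A
    using that
  proof induction
    case empty
    show ?case using assms(1)[of undefined 0] by simp
  next
    case (insert x F)
    then show ?case using assms by simp
  qed
  then show ?thesis by (subst poly_mapping_eq_sum_singles) simp
qed

lemma eval_hom_superset:
  assumes "finite K" "Poly_Mapping.keys p \<subseteq> K" "h 0 = 0"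
  shows "eval_hom h a p = (\<Sum>m\<in>K. h (Poly_Mapping.lookup p m) * (\<Prod>i\<in>UNIV. a i ^ Poly_Mapping.lookup m i))"
  unfolding eval_hom_def
  by (rule sum.mono_neutral_left) (use assms in \<open>auto simp: not_in_keys_iff_lookup_eq_zero\<close>)

lemma eval_hom_single:
  assumes "h 0 = 0"
  shows "eval_hom h a (Poly_Mapping.single m c) = h c * (\<Prod>i\<in>UNIV. a i ^ Poly_Mapping.lookup m i)"
  by (subst eval_hom_superset[of "{m}"]) (use assms in auto)

lemma eval_hom_add:
  assumes "is_ring_hom h"
  shows "eval_hom h a (p + q) = eval_hom h a p + eval_hom h a q"
proof -
  let ?K = "Poly_Mapping.keys p \<union> Poly_Mapping.keys q"
  have "Poly_Mapping.keys (p + q) \<subseteq> ?K" by (rule Poly_Mapping.keys_add)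
  then show ?thesis
    using is_ring_homD[OF assms]
    by (subst (1 2 3) eval_hom_superset[of ?K]) (auto simp: lookup_add algebra_simps sum.distrib)
qed

lemma eval_hom_0 [simp]: "eval_hom h a 0 = 0"
  by (simp add: eval_hom_def)

lemma eval_hom_1: "is_ring_hom h \<Longrightarrow> eval_hom h a 1 = 1"
  using eval_hom_single[of h a 0 1] by (simp add: is_ring_homD)

lemma eval_hom_mult:
  assumes h: "is_ring_hom h"
  shows "eval_hom h a (p * q) = eval_hom h a p * eval_hom h a q"
proof (induction p rule: poly_mapping_single_induct)
  case (single m c)
  show ?case
  proof (induction q rule: poly_mapping_single_induct)
    case (single n d)
    show ?case
      using is_ring_homD[OF h]
      by (simp add: mult_single eval_hom_single lookup_add power_add prod.distrib algebra_simps)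
  next
    case (add p q)
    then show ?case by (simp add: distrib_left eval_hom_add[OF h])
  qed
next
  case (add p q)
  then show ?case by (simp add: distrib_right eval_hom_add[OF h])
qed

lemma is_ring_hom_eval_hom: "is_ring_hom h \<Longrightarrow> is_ring_hom (eval_hom h a)"
  unfolding is_ring_hom_def[of "eval_hom h a"] by (simp add: eval_hom_1 eval_hom_add eval_hom_mult)

lemmas eval_hom_sum = is_ring_hom_sum[OF is_ring_hom_eval_hom]
  and eval_hom_prod = is_ring_hom_prod[OF is_ring_hom_eval_hom]

lemma ring_hom_eval_hom:
  assumes g: "is_ring_hom g" and "h 0 = 0"
  shows "g (eval_hom h a p) = eval_hom (\<lambda>c. g (h c)) (\<lambda>i. g (a i)) p"
  unfolding eval_hom_def
  by (simp add: is_ring_hom_sum[OF g] is_ring_homD[OF g] is_ring_hom_prod[OF g] is_ring_hom_power[OF g])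

lemma poly_eval_hom:
  "poly (eval_hom (\<lambda>c. [:c:]) g p) s = eval_at (\<lambda>i. poly (g i) s) p"
  using ring_hom_eval_hom[of "\<lambda>p. poly p s" "\<lambda>c. [:c:]" g p] by (simp add: is_ring_hom_def)

lemma eval_at_scale:
  assumes "homogeneous (int n) p"
  shows "eval_at (\<lambda>i. c * a i) p = c ^ n * eval_at a p"
proof -
  have "monom_degree m = n" if "m \<in> Poly_Mapping.keys p" for m
    using assms that by (auto simp: homogeneous_def)
  then have "(\<Prod>i\<in>UNIV. (c * a i) ^ Poly_Mapping.lookup m i) = c ^ n * (\<Prod>i\<in>UNIV. a i ^ Poly_Mapping.lookup m i)"
    if "m \<in> Poly_Mapping.keys p" for m
    using that by (simp add: power_mult_distrib prod.distrib power_sum monom_degree_def flip: power_sum)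
  then show ?thesis
    unfolding eval_hom_def by (simp add: sum_distrib_left mult.left_commute)
qed

lemma degree_eval_hom_le:
  assumes "homogeneous (int n) p" "\<And>i. degree (g i) \<le> D"
  shows "degree (eval_hom (\<lambda>c. [:c:]) g p) \<le> n * D"
  unfolding eval_hom_def
proof (rule degree_sum_le)
  fix m assume m: "m \<in> Poly_Mapping.keys p"
  have "degree ([:Poly_Mapping.lookup p m:] * (\<Prod>i\<in>UNIV. g i ^ Poly_Mapping.lookup m i))
      \<le> degree [:Poly_Mapping.lookup p m:] + degree (\<Prod>i\<in>UNIV. g i ^ Poly_Mapping.lookup m i)"
    by (rule degree_mult_le)
  also have "\<dots> \<le> 0 + (\<Sum>i\<in>UNIV. degree (g i ^ Poly_Mapping.lookup m i))"
    using degree_prod_sum_le[of UNIV "\<lambda>i. g i ^ Poly_Mapping.lookup m i"] by (simp add: o_def)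
  also have "\<dots> \<le> (\<Sum>i\<in>UNIV. Poly_Mapping.lookup m i * D)"
    unfolding add_0
  proof (rule sum_mono)
    fix i
    show "degree (g i ^ Poly_Mapping.lookup m i) \<le> Poly_Mapping.lookup m i * D"
      using order.trans[OF degree_power_le mult_le_mono1[OF assms(2)]] by (metis mult.commute)
  qed
  also have "\<dots> = monom_degree m * D"
    by (simp add: monom_degree_def sum_distrib_right[symmetric])
  also have "monom_degree m = n"
    using assms(1) m by (auto simp: homogeneous_def)
  finally show "degree ([:Poly_Mapping.lookup p m:] * (\<Prod>i\<in>UNIV. g i ^ Poly_Mapping.lookup m i)) \<le> n * D" .
qed simp

text \<open>Kronecker's substitution of \<open>s\<close>, \<open>s ^ N\<close>,
  \<open>s ^ (N * N)\<close> for the variables. When \<open>N\<close> exceeds all exponents,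
  \<open>e m\<close> has the exponents of \<open>m\<close> as its digits in base \<open>N\<close>,
  so distinct monomials stay distinct and the resulting univariate polynomial is nonzero.\<close>

lemma exists_eval_at_nonzero:
  assumes "p \<noteq> 0"
  obtains a where "eval_at a p \<noteq> 0"
proof -
  obtain m0 where m0: "m0 \<in> Poly_Mapping.keys p" using assms by (metis keys_eq_empty all_not_in_conv)
  have "finite ((\<lambda>(m, i). Poly_Mapping.lookup m i) ` (Poly_Mapping.keys p \<times> UNIV))" by simp
  then obtain N where N: "\<And>m i. m \<in> Poly_Mapping.keys p \<Longrightarrow> Poly_Mapping.lookup m i < N"
    using finite_nat_set_iff_bounded by (metis (no_types, lifting) SigmaI UNIV_I case_prod_conv image_eqI)
  define e where "e = (\<lambda>m::3 \<Rightarrow>\<^sub>0 nat. Poly_Mapping.lookup m 1 + N * (Poly_Mapping.lookup m 2 + N * Poly_Mapping.lookup m 3))"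
  have inj: "m = m0" if "m \<in> Poly_Mapping.keys p" "e m = e m0" for m
  proof -
    note l = N[OF that(1)] N[OF m0]
    have 1: "Poly_Mapping.lookup m 1 = Poly_Mapping.lookup m0 1"
      using arg_cong[OF that(2), of "\<lambda>x. x mod N"] l by (simp add: e_def)
    have N0: "N > 0" using l(1)[of 1] by simp
    have t: "Poly_Mapping.lookup m 2 + N * Poly_Mapping.lookup m 3 = Poly_Mapping.lookup m0 2 + N * Poly_Mapping.lookup m0 3"
      using that(2) 1 N0 by (simp add: e_def)
    have 2: "Poly_Mapping.lookup m 2 = Poly_Mapping.lookup m0 2"
      using arg_cong[OF t, of "\<lambda>x. x mod N"] l by simp
    then have 3: "Poly_Mapping.lookup m 3 = Poly_Mapping.lookup m0 3" using t N0 by simp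
    show ?thesis by (rule poly_mapping_eqI) (metis 1 2 3 exhaust_3)
  qed
  define g :: "3 \<Rightarrow> complex poly" where "g = (\<lambda>i. if i = 1 then monom 1 1 else if i = 2 then monom 1 N else monom 1 (N * N))"
  have g: "[:c:] * (\<Prod>i\<in>UNIV. g i ^ Poly_Mapping.lookup m i) = monom c (e m)" for m c
    by (simp add: prod_UNIV_3 g_def monom_power mult_monom e_def algebra_simps flip: monom_0)
  have "poly.coeff (eval_hom (\<lambda>c. [:c:]) g p) (e m0)
      = (\<Sum>m\<in>Poly_Mapping.keys p. if m = m0 then Poly_Mapping.lookup p m else 0)"
    unfolding eval_hom_def g coeff_sum by (intro sum.cong) (auto dest: inj)
  also have "\<dots> = Poly_Mapping.lookup p m0" using m0 by simp
  also have "\<dots> \<noteq> 0" using m0 by (simp add: in_keys_iff)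
  finally have "eval_hom (\<lambda>c. [:c:]) g p \<noteq> 0" by auto
  then obtain s where "poly (eval_hom (\<lambda>c. [:c:]) g p) s \<noteq> 0" by (metis poly_all_0_iff_0)
  then show thesis using that by (simp add: poly_eval_hom)
qed

subsection \<open>Partial derivatives\<close>

lemma partial_superset:
  assumes "finite K" "Poly_Mapping.keys p \<subseteq> K"
  shows "partial i p = (\<Sum>m\<in>K. Poly_Mapping.single (m - Poly_Mapping.single i 1)
       (of_nat (Poly_Mapping.lookup m i) * Poly_Mapping.lookup p m))"
  unfolding partial_def
  by (rule sum.mono_neutral_left) (use assms in \<open>auto simp: not_in_keys_iff_lookup_eq_zero\<close>)

lemma partial_single:
  "partial i (Poly_Mapping.single m c)
    = Poly_Mapping.single (m - Poly_Mapping.single i 1) (of_nat (Poly_Mapping.lookup m i) * c)"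
  by (subst partial_superset[of "{m}"]) auto

lemma partial_add: "partial i (p + q) = partial i p + partial i q"
proof -
  let ?K = "Poly_Mapping.keys p \<union> Poly_Mapping.keys q"
  have "Poly_Mapping.keys (p + q) \<subseteq> ?K" by (rule Poly_Mapping.keys_add)
  then show ?thesis
    by (subst (1 2 3) partial_superset[of ?K]) (auto simp: lookup_add algebra_simps single_add sum.distrib)
qed

lemma homogeneous_partial:
  assumes "homogeneous n p"
  shows "homogeneous (n - 1) (partial i p)"
  unfolding homogeneous_def
proof
  fix m assume "m \<in> Poly_Mapping.keys (partial i p)"
  then have "Poly_Mapping.lookup (partial i p) m \<noteq> 0" by (simp add: in_keys_iff)
  then obtain m' where m': "m' \<in> Poly_Mapping.keys p" and
    ne: "Poly_Mapping.lookup (Poly_Mapping.single (m' - Poly_Mapping.single i 1)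
       (of_nat (Poly_Mapping.lookup m' i) * Poly_Mapping.lookup p m')) m \<noteq> 0"
    unfolding partial_def lookup_sum by (meson sum.not_neutral_contains_not_neutral)
  \<comment> \<open>The subtraction of exponents is truncated. The coefficient is nonzero only if
    variable \<open>i\<close> occurs in \<open>m'\<close>, and then the subtraction is
    exact.\<close>
  have m: "m = m' - Poly_Mapping.single i 1" "Poly_Mapping.lookup m' i \<noteq> 0"
    using ne by (auto simp: lookup_single when_def split: if_splits)
  have "Poly_Mapping.lookup m' j = Poly_Mapping.lookup m j + (if j = i then 1 else 0)" for j
    using m by (auto simp: lookup_minus lookup_single when_def)
  then have "monom_degree m' = monom_degree m + 1"
    by (simp add: monom_degree_def sum.distrib)
  then show "int (monom_degree m) = n - 1"
    using assms m' by (auto simp: homogeneous_def)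
qed

text \<open>Points become vectors, so that the norm, Lebesgue measure and derivatives on
  \<open>complex^3\<close> apply.\<close>

abbreviation ev :: "S \<Rightarrow> complex^3 \<Rightarrow> complex" where
  "ev p z \<equiv> eval_at (($) z) p"

lemma has_derivative_ev:
  "(ev p has_derivative (\<lambda>h. \<Sum>i\<in>UNIV. ev (partial i p) z * h $ i)) (at z)"
proof (induction p rule: poly_mapping_single_induct)
  case (single m c)
  have e: "ev (Poly_Mapping.single m c) = (\<lambda>z. c * (z$1 ^ Poly_Mapping.lookup m 1 * z$2 ^ Poly_Mapping.lookup m 2 * z$3 ^ Poly_Mapping.lookup m 3))"
    by (simp add: fun_eq_iff eval_hom_single prod_UNIV_3)
  have pw: "((\<lambda>z::complex^3. z $ i ^ n) has_derivative (\<lambda>h. h $ i * (of_nat n * z $ i ^ (n - 1)))) (at z)" for i n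
    by (rule has_derivative_eq_rhs,
        rule has_derivative_power[OF bounded_linear.has_derivative[OF bounded_linear_vec_nth has_derivative_ident]])
       (simp add: mult_ac)
  have "(ev (Poly_Mapping.single m c) has_derivative (\<lambda>h. c *
     (z$1 ^ Poly_Mapping.lookup m 1 * z$2 ^ Poly_Mapping.lookup m 2 * (h$3 * (of_nat (Poly_Mapping.lookup m 3) * z$3 ^ (Poly_Mapping.lookup m 3 - 1))) +
     (z$1 ^ Poly_Mapping.lookup m 1 * (h$2 * (of_nat (Poly_Mapping.lookup m 2) * z$2 ^ (Poly_Mapping.lookup m 2 - 1)))
     + h$1 * (of_nat (Poly_Mapping.lookup m 1) * z$1 ^ (Poly_Mapping.lookup m 1 - 1)) * z$2 ^ Poly_Mapping.lookup m 2) *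
      z$3 ^ Poly_Mapping.lookup m 3))) (at z)"
    unfolding e by (intro has_derivative_mult_right has_derivative_mult pw)
  moreover have "(\<Sum>i\<in>UNIV. ev (partial i (Poly_Mapping.single m c)) z * h $ i) = c *
     (z$1 ^ Poly_Mapping.lookup m 1 * z$2 ^ Poly_Mapping.lookup m 2 * (h$3 * (of_nat (Poly_Mapping.lookup m 3) * z$3 ^ (Poly_Mapping.lookup m 3 - 1))) +
     (z$1 ^ Poly_Mapping.lookup m 1 * (h$2 * (of_nat (Poly_Mapping.lookup m 2) * z$2 ^ (Poly_Mapping.lookup m 2 - 1)))
     + h$1 * (of_nat (Poly_Mapping.lookup m 1) * z$1 ^ (Poly_Mapping.lookup m 1 - 1)) * z$2 ^ Poly_Mapping.lookup m 2) *
      z$3 ^ Poly_Mapping.lookup m 3)" for h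
    by (simp add: sum_3 partial_single eval_hom_single prod_UNIV_3 lookup_minus lookup_single when_def)
       (simp add: algebra_simps)
  ultimately show ?case by simp
next
  case (add p q)
  have "((\<lambda>z. ev p z + ev q z) has_derivative (\<lambda>h. (\<Sum>i\<in>UNIV. ev (partial i p) z * h $ i) + (\<Sum>i\<in>UNIV. ev (partial i q) z * h $ i))) (at z)"
    by (intro has_derivative_add add)
  then show ?case
    by (simp add: eval_hom_add[OF is_ring_hom_id] partial_add sum.distrib distrib_right)
qed

lemma continuous_on_ev [continuous_intros]:
  assumes "continuous_on A g"
  shows "continuous_on A (\<lambda>x. ev p (g x))"
proof -
  have "continuous_on UNIV (ev p)"
    by (rule has_derivative_continuous_on) (rule has_derivative_ev)
  then show ?thesis using assms by (rule continuous_on_compose2) auto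
qed

lemma ev_scale: "homogeneous (int n) p \<Longrightarrow> ev p (c *s z) = c ^ n * ev p z"
proof -
  have "($) (c *s z) = (\<lambda>i. c * z $ i)" by (simp add: fun_eq_iff)
  then show "homogeneous (int n) p \<Longrightarrow> ev p (c *s z) = c ^ n * ev p z"
    by (simp add: eval_at_scale)
qed

subsection \<open>A syzygy of degree \<open>d\<^sub>1\<close>\<close>

lemma module_times: "Modules.module ((*) :: 'a::comm_ring_1 \<Rightarrow> 'a \<Rightarrow> 'a)"
  by unfold_locales (simp_all add: algebra_simps)

lemma generated_ideal_rangeE:
  fixes g :: "3 \<Rightarrow> 'a::comm_ring_1"
  assumes "x \<in> generated_ideal (range g)"
  obtains s where "x = (\<Sum>i\<in>UNIV. s i * g i)"
proof -
  let ?T = "{x. \<exists>s. x = (\<Sum>i\<in>UNIV. s i * g i)}"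
  have "Modules.module.span (*) (range g) \<subseteq> ?T"
  proof (rule Modules.module.span_minimal[OF module_times])
    show "range g \<subseteq> ?T"
    proof safe
      fix i
      have "g i = (\<Sum>j\<in>UNIV. (if j = i then 1 else 0) * g j)"
        by (simp add: if_distrib[of "\<lambda>x. x * _"] cong: if_cong)
      then show "\<exists>s. g i = (\<Sum>i\<in>UNIV. s i * g i)" by - (rule exI, assumption)
    qed
    show "Modules.module.subspace (*) ?T"
    proof (rule Modules.module.subspaceI[OF module_times])
      have "0 = (\<Sum>i\<in>UNIV. 0 * g i)" by simp
      then show "0 \<in> ?T" by - (rule CollectI, rule exI, assumption)
      fix x y assume "x \<in> ?T" "y \<in> ?T"
      then obtain s t where "x = (\<Sum>i\<in>UNIV. s i * g i)" "y = (\<Sum>i\<in>UNIV. t i * g i)" by blast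
      then have "x + y = (\<Sum>i\<in>UNIV. (s i + t i) * g i)" by (simp add: distrib_right sum.distrib)
      then show "x + y \<in> ?T" by - (rule CollectI, rule exI, assumption)
    next
      fix c x assume "x \<in> ?T"
      then obtain s where "x = (\<Sum>i\<in>UNIV. s i * g i)" by blast
      then have "c * x = (\<Sum>i\<in>UNIV. (c * s i) * g i)" by (simp add: sum_distrib_left mult.assoc)
      then show "c * x \<in> ?T" by - (rule CollectI, rule exI, assumption)
    qed
  qed
  then show thesis using assms that unfolding generated_ideal_def by blast
qed

lemma monom_degree_add: "monom_degree (m + n) = monom_degree m + monom_degree n"
  by (simp add: monom_degree_def lookup_add sum.distrib)

lemma monom_degree_eq_0_iff: "monom_degree m = 0 \<longleftrightarrow> m = 0"
  by (auto simp: monom_degree_def intro: poly_mapping_eqI)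

lemma lookup_single_0_mult:
  fixes p :: S
  shows "Poly_Mapping.lookup (Poly_Mapping.single 0 c * p) m = c * Poly_Mapping.lookup p m"
  by (induction p rule: poly_mapping_single_induct)
     (auto simp: mult_single lookup_single when_def distrib_left lookup_add)

lemma lookup_mult_0:
  fixes p q :: S
  shows "Poly_Mapping.lookup (p * q) 0 = Poly_Mapping.lookup p 0 * Poly_Mapping.lookup q 0"
proof (induction p rule: poly_mapping_single_induct)
  case (single m c)
  show ?case
  proof (induction q rule: poly_mapping_single_induct)
    case (single n d)
    have "m + n = 0 \<longleftrightarrow> m = 0 \<and> n = 0"
      by (simp add: monom_degree_add flip: monom_degree_eq_0_iff)
    then show ?case by (auto simp: mult_single lookup_single when_def)
  next
    case (add p q)
    then show ?case by (simp add: distrib_left lookup_add)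
  qed
next
  case (add p q)
  then show ?case by (simp add: distrib_right lookup_add)
qed

definition hcomponent :: "int \<Rightarrow> S \<Rightarrow> S" where
  "hcomponent n p = (\<Sum>m\<in>Poly_Mapping.keys p.
     if int (monom_degree m) = n then Poly_Mapping.single m (Poly_Mapping.lookup p m) else 0)"

lemma lookup_hcomponent:
  "Poly_Mapping.lookup (hcomponent n p) m = (if int (monom_degree m) = n then Poly_Mapping.lookup p m else 0)"
proof -
  have "Poly_Mapping.lookup (hcomponent n p) m = (\<Sum>k\<in>Poly_Mapping.keys p.
      if k = m then (if int (monom_degree m) = n then Poly_Mapping.lookup p m else 0) else 0)"
    unfolding hcomponent_def lookup_sum
    by (intro sum.cong) (auto simp: lookup_single when_def)
  then show ?thesis by (auto simp: not_in_keys_iff_lookup_eq_zero)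
qed

lemma hcomponent_add: "hcomponent n (p + q) = hcomponent n p + hcomponent n q"
  by (rule poly_mapping_eqI) (simp add: lookup_hcomponent lookup_add)

lemma hcomponent_sum: "hcomponent n (sum g A) = (\<Sum>x\<in>A. hcomponent n (g x))"
  by (rule poly_mapping_eqI) (simp add: lookup_hcomponent lookup_sum)

lemma hcomponent_homogeneous: "homogeneous n p \<Longrightarrow> hcomponent n p = p"
  by (rule poly_mapping_eqI) (auto simp: lookup_hcomponent homogeneous_def in_keys_iff)

lemma keys_mult_degree:
  fixes p q :: S
  assumes "homogeneous a p" "homogeneous b q"
  shows "homogeneous (a + b) (p * q)"
  unfolding homogeneous_def
proof
  fix m assume "m \<in> Poly_Mapping.keys (p * q)"
  then obtain k l where "m = k + l" "k \<in> Poly_Mapping.keys p" "l \<in> Poly_Mapping.keys q"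
    using keys_mult[of p q] by blast
  then show "int (monom_degree m) = a + b"
    using assms by (simp add: homogeneous_def monom_degree_add)
qed

lemma homogeneous_add: "homogeneous n p \<Longrightarrow> homogeneous n q \<Longrightarrow> homogeneous n (p + q)"
  using Poly_Mapping.keys_add[of p q] by (auto simp: homogeneous_def)

lemma homogeneous_sum: "(\<And>x. x \<in> A \<Longrightarrow> homogeneous n (g x)) \<Longrightarrow> homogeneous n (sum g A)"
  by (induction A rule: infinite_finite_induct) (auto intro: homogeneous_add simp: homogeneous_def[of _ 0])

lemma homogeneous_single_0: "homogeneous 0 (Poly_Mapping.single 0 c)"
  by (auto simp: homogeneous_def monom_degree_def)

text \<open>Multiplication by a monomial other than 1 raises the degree, so only the constant term
  of \<open>s\<close> contributes in degree \<open>n\<close>. Ideal elements of the same degree as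
  the generators are thereby constant combinations of them.\<close>

lemma hcomponent_mult_homogeneous:
  assumes q: "homogeneous n q"
  shows "hcomponent n (s * q) = Poly_Mapping.single 0 (Poly_Mapping.lookup s 0) * q"
proof (induction s rule: poly_mapping_single_induct)
  case (single m c)
  show ?case
  proof (cases "m = 0")
    case True
    have "homogeneous (0 + n) (Poly_Mapping.single 0 c * q)"
      by (rule keys_mult_degree[OF homogeneous_single_0 q])
    then show ?thesis using True by (simp add: hcomponent_homogeneous)
  next
    case False
    have h: "homogeneous (int (monom_degree m) + n) (Poly_Mapping.single m c * q)"
      by (rule keys_mult_degree[OF _ q]) (auto simp: homogeneous_def)
    have "monom_degree m > 0" using False monom_degree_eq_0_iff[of m] by simp
    then have "int (monom_degree m) + n \<noteq> n" by simp
    then have "k \<notin> Poly_Mapping.keys (Poly_Mapping.single m c * q)" if "int (monom_degree k) = n" for k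
      using bspec[OF h[unfolded homogeneous_def], of k] that by metis
    then have "hcomponent n (Poly_Mapping.single m c * q) = 0"
      by (intro poly_mapping_eqI) (simp add: lookup_hcomponent not_in_keys_iff_lookup_eq_zero)
    then show ?thesis using False by (simp add: lookup_single when_def)
  qed
next
  case (add p q)
  then show ?case by (simp add: distrib_right hcomponent_add lookup_add single_add)
qed

lemma mat_mult_vec_index:
  "A \<in> carrier_mat nr nc \<Longrightarrow> v \<in> carrier_vec nc \<Longrightarrow> i < nr \<Longrightarrow>
    vec_index (A *\<^sub>v v) i = (\<Sum>j\<in>{0..<nc}. A $$ (i, j) * vec_index v j)"
  by (auto simp: scalar_prod_def)

lemma minimal_map_mult_vec_lookup_0:
  assumes "minimal_map A" "A \<in> carrier_mat nr nc" "v \<in> carrier_vec nc" "i < nr"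
  shows "Poly_Mapping.lookup (vec_index (A *\<^sub>v v) i) 0 = 0"
  using assms by (subst mat_mult_vec_index) (auto simp: lookup_sum lookup_mult_0 minimal_map_def)

text \<open>The entries of \<open>A1\<close> generate the Jacobian ideal but need not be the partial
  derivatives. Having degree \<open>d - 1\<close>, they are combinations of these with constant
  coefficients \<open>\<mu>\<close>, and \<open>\<mu>\<close> turns the first column
  \<open>a\<close> of \<open>A2\<close> into a syzygy of the partial derivatives. If that syzygy
  were 0, the coefficients of each monomial in \<open>a\<close> would form a constant vector in the
  kernel of \<open>A1\<close>, hence in the image of \<open>A2\<close>, where minimality allows no
  constant terms; so \<open>a = 0\<close>. Then the first unit vector lies in the kernel of
  \<open>A2\<close>, that is in the image of \<open>A3\<close>, against the minimality of
  \<open>A3\<close>.\<close>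

lemma jacobian_syzygyE:
  assumes sc: "syzygy_curve d f [d1, d2, d3]"
  obtains t where "\<And>i. homogeneous (int d1) (t i)" "\<exists>i. t i \<noteq> 0"
    "(\<Sum>i\<in>UNIV. t i * partial i f) = 0"
proof -
  define I where "I = jacobian_ideal f"
  obtain es A1 A2 A3 where es: "length es = 1" and
    res: "minimal_graded_free_resolution I (replicate 3 (int d - 1))
       (map (\<lambda>e. int d - 1 + int e) [d1, d2, d3]) es A1 A2 A3" and d: "homogeneous (int d) f"
    using sc by (auto simp: syzygy_curve_def reduced_curve_def I_def)
  have g1: "graded_map (replicate 3 (int d - 1)) [0] A1"
    and g2: "graded_map (map (\<lambda>e. int d - 1 + int e) [d1, d2, d3]) (replicate 3 (int d - 1)) A2"
    and g3: "graded_map es (map (\<lambda>e. int d - 1 + int e) [d1, d2, d3]) A3"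
    and m2: "minimal_map A2" and m3: "minimal_map A3"
    and im1: "mat_image A1 = {v \<in> carrier_vec 1. vec_index v 0 \<in> I}"
    and k1: "mat_kernel A1 = mat_image A2" and k2: "mat_kernel A2 = mat_image A3"
    using res by (auto simp: minimal_graded_free_resolution_def)
  have c1: "A1 \<in> carrier_mat 1 3" and c2: "A2 \<in> carrier_mat 3 3" and c3: "A3 \<in> carrier_mat 3 1"
    using g1 g2 g3 es by (auto simp: graded_map_def eval_nat_numeral)
  define g where "g = (\<lambda>c. A1 $$ (0, c))"
  define a where "a = (\<lambda>c. A2 $$ (c, 0))"
  have g_hom: "homogeneous (int d - 1) (g c)" if "c < 3" for c
    using g1 that by (simp add: graded_map_def g_def)
  have a_hom: "homogeneous (int d1) (a c)" if "c < 3" for c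
    using conjunct2[OF g2[unfolded graded_map_def], rule_format, of c 0] that by (simp add: a_def)
  have A1_mult: "A1 *\<^sub>v v = Matrix.vec 1 (\<lambda>_. \<Sum>j\<in>{0..<3}. g j * vec_index v j)" if "v \<in> carrier_vec 3" for v
    using c1 that by (intro eq_vecI) (auto simp: g_def scalar_prod_def)
  have g_in: "g c \<in> I" if c: "c < 3" for c
  proof -
    have "A1 *\<^sub>v unit_vec 3 c \<in> mat_image A1" using c1 by (auto simp: mat_image_def)
    then have "vec_index (A1 *\<^sub>v unit_vec 3 c) 0 \<in> I" using im1 by blast
    moreover have "vec_index (A1 *\<^sub>v unit_vec 3 c) 0 = g c"
      using c by (simp add: A1_mult unit_vec_def if_distrib[of "\<lambda>x. _ * x"] cong: if_cong)
    ultimately show ?thesis by simp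
  qed
  have "\<exists>\<mu>. g c = (\<Sum>j\<in>UNIV. Poly_Mapping.single 0 (\<mu> j) * partial j f)" if c: "c < 3" for c
  proof -
    obtain s where s: "g c = (\<Sum>j\<in>UNIV. s j * partial j f)"
      using g_in[OF c] unfolding I_def jacobian_ideal_def by (rule generated_ideal_rangeE)
    have "g c = hcomponent (int d - 1) (g c)" using g_hom[OF c] by (simp add: hcomponent_homogeneous)
    also have "\<dots> = (\<Sum>j\<in>UNIV. Poly_Mapping.single 0 (Poly_Mapping.lookup (s j) 0) * partial j f)"
      unfolding s hcomponent_sum by (simp add: hcomponent_mult_homogeneous[OF homogeneous_partial[OF d]])
    finally show ?thesis by (rule exI[of _ "\<lambda>j. Poly_Mapping.lookup (s j) 0"])
  qed
  then have "\<forall>c. \<exists>\<mu>. c < 3 \<longrightarrow> g c = (\<Sum>j\<in>UNIV. Poly_Mapping.single 0 (\<mu> j) * partial j f)"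
    by simp
  from choice[OF this] obtain \<mu> where
    "\<forall>c. c < 3 \<longrightarrow> g c = (\<Sum>j\<in>UNIV. Poly_Mapping.single 0 (\<mu> c j) * partial j f)" ..
  then have mu: "g c = (\<Sum>j\<in>UNIV. Poly_Mapping.single 0 (\<mu> c j) * partial j f)" if "c < 3" for c
    using that by simp
  define t where "t = (\<lambda>j::3. \<Sum>c\<in>{0..<3}. Poly_Mapping.single 0 (\<mu> c j) * a c)"
  have col: "A2 *\<^sub>v unit_vec 3 0 = Matrix.vec 3 a"
    using c2 by (intro eq_vecI) (auto simp: a_def scalar_prod_def unit_vec_def if_distrib[of "\<lambda>x. _ * x"] cong: if_cong)
  have "Matrix.vec 3 a \<in> mat_kernel A1"
    unfolding k1 mat_image_def col[symmetric] using c2 by auto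
  then have "A1 *\<^sub>v Matrix.vec 3 a = 0\<^sub>v 1" using c1 by (simp add: mat_kernel_def)
  then have "vec_index (A1 *\<^sub>v Matrix.vec 3 a) 0 = 0" by simp
  then have ga: "(\<Sum>c\<in>{0..<3}. g c * a c) = 0" by (simp add: A1_mult)
  show thesis
  proof
    show "homogeneous (int d1) (t i)" for i
      unfolding t_def
    proof (rule homogeneous_sum)
      fix c assume "c \<in> {0..<3::nat}"
      then show "homogeneous (int d1) (Poly_Mapping.single 0 (\<mu> c i) * a c)"
        using keys_mult_degree[OF homogeneous_single_0 a_hom, of c "\<mu> c i"] by simp
    qed
    have "(\<Sum>i\<in>UNIV. t i * partial i f) = (\<Sum>c\<in>{0..<3}. \<Sum>i\<in>UNIV. Poly_Mapping.single 0 (\<mu> c i) * a c * partial i f)"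
      unfolding t_def sum_distrib_right by (rule sum.swap)
    also have "\<dots> = (\<Sum>c\<in>{0..<3}. g c * a c)"
      by (intro sum.cong refl) (simp add: mu sum_distrib_left mult_ac)
    finally show "(\<Sum>i\<in>UNIV. t i * partial i f) = 0" using ga by simp
    show "\<exists>i. t i \<noteq> 0"
    proof (rule ccontr)
      assume "\<not> ?thesis"
      then have t0: "t i = 0" for i by blast
      have a0: "a c = 0" if c: "c < 3" for c
      proof (rule poly_mapping_eqI)
        fix m
        define y where "y = (\<lambda>c. Poly_Mapping.lookup (a c) m)"
        have y: "(\<Sum>c\<in>{0..<3}. \<mu> c j * y c) = 0" for j
          using arg_cong[OF t0[of j], of "\<lambda>p. Poly_Mapping.lookup p m"]
          by (simp add: t_def lookup_sum lookup_single_0_mult y_def)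
        have sc: "Poly_Mapping.single 0 u * q * Poly_Mapping.single 0 v = Poly_Mapping.single 0 (u * v) * q" for u v and q :: S
        proof -
          have "Poly_Mapping.single 0 (u * v) = Poly_Mapping.single 0 u * (Poly_Mapping.single 0 v :: S)"
            by (simp add: mult_single)
          then show ?thesis by (simp only: ac_simps)
        qed
        let ?v = "Matrix.vec 3 (\<lambda>c. Poly_Mapping.single 0 (y c)) :: S Matrix.vec"
        have "(\<Sum>c\<in>{0..<3}. g c * Poly_Mapping.single 0 (y c))
            = (\<Sum>c\<in>{0..<3}. \<Sum>j\<in>UNIV. Poly_Mapping.single 0 (\<mu> c j * y c) * partial j f)"
          by (intro sum.cong refl) (simp add: mu sum_distrib_right sc)
        also have "\<dots> = (\<Sum>j\<in>UNIV. \<Sum>c\<in>{0..<3}. Poly_Mapping.single 0 (\<mu> c j * y c) * partial j f)"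
          by (rule sum.swap)
        also have "\<dots> = (\<Sum>j\<in>UNIV. Poly_Mapping.single 0 (\<Sum>c\<in>{0..<3}. \<mu> c j * y c) * partial j f)"
        proof (intro sum.cong refl)
          fix j
          have "(\<Sum>c\<in>A. Poly_Mapping.single 0 (\<mu> c j * y c)) = (Poly_Mapping.single 0 (\<Sum>c\<in>A. \<mu> c j * y c) :: S)" for A :: "nat set"
            by (induction A rule: infinite_finite_induct) (auto simp: single_add)
          then show "(\<Sum>c\<in>{0..<3}. Poly_Mapping.single 0 (\<mu> c j * y c) * partial j f) =
              Poly_Mapping.single 0 (\<Sum>c\<in>{0..<3}. \<mu> c j * y c) * partial j f"
            unfolding sum_distrib_right[symmetric] by (simp only:)
        qed
        also have "\<dots> = 0" by (simp add: y)
        finally have "A1 *\<^sub>v ?v = 0\<^sub>v 1" by (subst A1_mult) (auto intro!: eq_vecI)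
        then have "?v \<in> mat_kernel A1" using c1 by (simp add: mat_kernel_def)
        then have "?v \<in> (\<lambda>v. A2 *\<^sub>v v) ` carrier_vec 3"
          using c2 by (simp only: k1 mat_image_def carrier_matD)
        then obtain w where w: "?v = A2 *\<^sub>v w" "w \<in> carrier_vec 3" by (rule imageE)
        have "Poly_Mapping.lookup (vec_index ?v c) 0 = 0"
          unfolding w(1) by (rule minimal_map_mult_vec_lookup_0[OF m2 c2 w(2) c])
        then have "y c = 0" using c by simp
        then show "Poly_Mapping.lookup (a c) m = Poly_Mapping.lookup 0 m" by (simp add: y_def)
      qed
      have "A2 *\<^sub>v unit_vec 3 0 = 0\<^sub>v 3" unfolding col by (auto intro!: eq_vecI simp: a0)
      then have "unit_vec 3 0 \<in> mat_kernel A2" using c2 by (simp add: mat_kernel_def)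
      then have "unit_vec 3 0 \<in> (\<lambda>v. A3 *\<^sub>v v) ` carrier_vec 1"
        using c3 by (simp only: k2 mat_image_def carrier_matD)
      then obtain w where w: "unit_vec 3 0 = A3 *\<^sub>v w" "w \<in> carrier_vec 1" by (rule imageE)
      have "Poly_Mapping.lookup (vec_index (unit_vec 3 0 :: S Matrix.vec) 0) 0 = 0"
        unfolding w(1) by (rule minimal_map_mult_vec_lookup_0[OF m3 c3 w(2)]) simp
      then show False by simp
    qed
  qed
qed

lemma vec_nth_vec_lambda: "($) (vec_lambda P) = P"
  by (simp add: fun_eq_iff)

subsection \<open>Conics and their polar forms\<close>

definition mono3 :: "nat \<Rightarrow> nat \<Rightarrow> nat \<Rightarrow> 3 \<Rightarrow>\<^sub>0 nat" where
  "mono3 a b c = Poly_Mapping.single 1 a + Poly_Mapping.single 2 b + Poly_Mapping.single 3 c"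

lemma lookup_mono3: "Poly_Mapping.lookup (mono3 a b c) 1 = a"
  "Poly_Mapping.lookup (mono3 a b c) 2 = b" "Poly_Mapping.lookup (mono3 a b c) 3 = c"
  by (simp_all add: mono3_def lookup_add lookup_single when_def)

lemma mono3_eq_iff: "mono3 a b c = mono3 a' b' c' \<longleftrightarrow> a = a' \<and> b = b' \<and> c = c'"
  by (metis lookup_mono3)

lemma mono3_lookup: "m = mono3 (Poly_Mapping.lookup m 1) (Poly_Mapping.lookup m 2) (Poly_Mapping.lookup m 3)"
  by (rule poly_mapping_eqI) (metis lookup_mono3 exhaust_3)

definition qcoef :: "S \<Rightarrow> nat \<Rightarrow> nat \<Rightarrow> nat \<Rightarrow> complex" where
  "qcoef q a b c = Poly_Mapping.lookup q (mono3 a b c)"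

lemma eval_hom_quadratic:
  assumes q: "homogeneous 2 q" and h: "is_ring_hom h"
  shows "eval_hom h x q = h (qcoef q 2 0 0) * (x 1)\<^sup>2 + h (qcoef q 0 2 0) * (x 2)\<^sup>2 + h (qcoef q 0 0 2) * (x 3)\<^sup>2
    + h (qcoef q 1 1 0) * x 1 * x 2 + h (qcoef q 1 0 1) * x 1 * x 3 + h (qcoef q 0 1 1) * x 2 * x 3"
proof -
  define K where "K = {mono3 2 0 0, mono3 0 2 0, mono3 0 0 2, mono3 1 1 0, mono3 1 0 1, mono3 0 1 1}"
  have "Poly_Mapping.keys q \<subseteq> K"
  proof
    fix m assume "m \<in> Poly_Mapping.keys q"
    then have "int (Poly_Mapping.lookup m 1 + Poly_Mapping.lookup m 2 + Poly_Mapping.lookup m 3) = 2"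
      using q by (auto simp: homogeneous_def monom_degree_def sum_3)
    then have "(Poly_Mapping.lookup m 1, Poly_Mapping.lookup m 2, Poly_Mapping.lookup m 3)
        \<in> {(2,0,0), (0,2,0), (0,0,2), (1,1,0), (1,0,1), (0,1,1)}" by simp presburger
    then show "m \<in> K" unfolding K_def using mono3_lookup[of m] by auto
  qed
  then have "eval_hom h x q = (\<Sum>m\<in>K. h (Poly_Mapping.lookup q m) * (\<Prod>i\<in>UNIV. x i ^ Poly_Mapping.lookup m i))"
    using h by (intro eval_hom_superset) (auto simp: K_def is_ring_homD)
  then show ?thesis
    by (simp add: K_def mono3_eq_iff prod_UNIV_3 lookup_mono3 qcoef_def algebra_simps)
qed

text \<open>Polarisation without the factor 1/2: \<open>bil q z\<close> is the differential of
  \<open>q\<close> at \<open>z\<close>, and \<open>bil q x x\<close> is twice \<open>q\<close> at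
  \<open>x\<close>, which accounts for the factors 2 below.\<close>

definition bil :: "S \<Rightarrow> complex^3 \<Rightarrow> complex^3 \<Rightarrow> complex" where
  "bil q x y = 2 * qcoef q 2 0 0 * (x$1 * y$1) + 2 * qcoef q 0 2 0 * (x$2 * y$2) + 2 * qcoef q 0 0 2 * (x$3 * y$3)
    + qcoef q 1 1 0 * (x$1 * y$2 + x$2 * y$1) + qcoef q 1 0 1 * (x$1 * y$3 + x$3 * y$1)
    + qcoef q 0 1 1 * (x$2 * y$3 + x$3 * y$2)"

lemma ev_quadratic:
  assumes "homogeneous 2 q"
  shows "ev q x = qcoef q 2 0 0 * (x$1)\<^sup>2 + qcoef q 0 2 0 * (x$2)\<^sup>2 + qcoef q 0 0 2 * (x$3)\<^sup>2
    + qcoef q 1 1 0 * x$1 * x$2 + qcoef q 1 0 1 * x$1 * x$3 + qcoef q 0 1 1 * x$2 * x$3"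
  by (rule eval_hom_quadratic[OF assms is_ring_hom_id])

lemma bil_add_left: "bil q (x + x') y = bil q x y + bil q x' y"
  and bil_add_right: "bil q y (x + x') = bil q y x + bil q y x'"
  and bil_scale_left: "bil q (c *s x) y = c * bil q x y"
  and bil_scale_right: "bil q y (c *s x) = c * bil q y x"
  and bil_diff_left: "bil q (x - x') y = bil q x y - bil q x' y"
  and bil_diff_right: "bil q y (x - x') = bil q y x - bil q y x'"
  and bil_uminus_left: "bil q (- x) y = - bil q x y"
  and bil_uminus_right: "bil q y (- x) = - bil q y x"
  by (simp_all add: bil_def algebra_simps)

lemma bil_0 [simp]: "bil q 0 y = 0" "bil q y 0 = 0"
  by (simp_all add: bil_def)

lemmas bil_simps = bil_add_left bil_add_right bil_scale_left bil_scale_right bil_diff_left bil_diff_right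
  bil_uminus_left bil_uminus_right

lemma bil_commute: "bil q x y = bil q y x"
  by (simp add: bil_def algebra_simps)

lemma bil_sum_left: "bil q (sum g A) y = (\<Sum>x\<in>A. bil q (g x) y)"
  by (induction A rule: infinite_finite_induct) (auto simp: bil_add_left)

lemma ev_add:
  assumes "homogeneous 2 q"
  shows "ev q (x + y) = ev q x + ev q y + bil q x y"
  unfolding ev_quadratic[OF assms] bil_def by (simp add: power2_eq_square algebra_simps)

lemma bil_same: "homogeneous 2 q \<Longrightarrow> bil q x x = 2 * ev q x"
  unfolding ev_quadratic bil_def by (simp add: power2_eq_square algebra_simps)

lemma ev_scale2: "homogeneous 2 q \<Longrightarrow> ev q (c *s z) = c\<^sup>2 * ev q z"
  using ev_scale[of 2 q c z] by simp

lemma ev_0: "homogeneous 2 q \<Longrightarrow> ev q 0 = 0"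
  using ev_scale2[of q 0 0] by simp

lemma has_derivative_conic:
  assumes "homogeneous 2 q"
  shows "(ev q has_derivative bil q z) (at z)"
proof -
  have e: "ev q = (\<lambda>x. qcoef q 2 0 0 * (x$1 * x$1) + qcoef q 0 2 0 * (x$2*x$2) + qcoef q 0 0 2 * (x$3 * x$3)
    + qcoef q 1 1 0 * (x$1 * x$2) + qcoef q 1 0 1 * (x$1 * x$3) + qcoef q 0 1 1 * (x$2 * x$3))"
    by (rule ext) (simp add: ev_quadratic[OF assms] power2_eq_square algebra_simps)
  have c: "((\<lambda>x::complex^3. x $ i) has_derivative (\<lambda>h. h $ i)) (at z)" for i
    by (rule bounded_linear.has_derivative[OF bounded_linear_vec_nth has_derivative_ident])
  have m: "((\<lambda>x::complex^3. k * (x $ i * x $ j)) has_derivative (\<lambda>h. k * (z $ i * h $ j + h $ i * z $ j))) (at z)"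
    for i j k
    by (intro has_derivative_mult_right has_derivative_mult c)
  show ?thesis
    unfolding e
    by (rule has_derivative_eq_rhs[OF has_derivative_add[OF has_derivative_add[OF has_derivative_add[OF
          has_derivative_add[OF has_derivative_add[OF m m] m] m] m] m]])
       (simp add: bil_def fun_eq_iff algebra_simps)
qed

lemma ev_partial_conic:
  assumes "homogeneous 2 q"
  shows "(\<Sum>i\<in>UNIV. ev (partial i q) z * h $ i) = bil q z h"
  using has_derivative_unique[OF has_derivative_ev has_derivative_conic[OF assms], of z]
  by (simp add: fun_eq_iff)

text \<open>A nonzero vector in the radical of the polar form lies on the conic, and all partial
  derivatives vanish at it, so it would be a singular point.\<close>

lemma smooth_conicD:
  assumes "smooth_conic q"
  shows "homogeneous 2 q" and "(\<And>y. bil q x y = 0) \<Longrightarrow> x = 0"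
proof -
  show h: "homogeneous 2 q" using assms by (simp add: smooth_conic_def)
  assume b: "\<And>y. bil q x y = 0"
  show "x = 0"
  proof (rule ccontr)
    assume "x \<noteq> 0"
    then have "($) x \<noteq> (\<lambda>_. 0)" by (auto simp: vec_eq_iff fun_eq_iff)
    moreover have "ev q x = 0" using b[of x] bil_same[OF h, of x] by simp
    moreover have "ev (partial i q) x = 0" for i
    proof -
      have "ev (partial i q) x = (\<Sum>j\<in>UNIV. ev (partial j q) x * axis i 1 $ j)"
        by (simp add: axis_def if_distrib[of "\<lambda>y. _ * y"] cong: if_cong)
      then show ?thesis using b ev_partial_conic[OF h] by simp
    qed
    ultimately have "($) x \<in> singular_points q" by (simp add: singular_points_def zero_set_def)
    then show False using assms by (simp add: smooth_conic_def)
  qed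
qed

lemma linear_comb3: "Vector_Spaces.linear (*s) (*s) (\<lambda>v::complex^3. v $ 1 *s a + v $ 2 *s b + v $ 3 *s (c::complex^3))"
  by unfold_locales (auto simp: vec_eq_iff algebra_simps)

lemma span3:
  fixes a b c v :: "complex^3"
  assumes "\<And>x y z. x *s a + y *s b + z *s c = 0 \<Longrightarrow> x = 0 \<and> y = 0 \<and> z = 0"
  obtains x y z where "v = x *s a + y *s b + z *s c"
proof -
  let ?L = "\<lambda>v::complex^3. v $ 1 *s a + v $ 2 *s b + v $ 3 *s c"
  have "inj ?L"
    unfolding vec.linear_inj_iff_eq_0[OF linear_comb3]
  proof safe
    fix v :: "complex^3" assume "?L v = 0"
    from assms[OF this] show "v = 0" by (simp add: vec_eq_iff forall_3)
  qed
  then have "surj ?L" using vec.linear_injective_imp_surjective[OF linear_comb3] by blast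
  from surjD[OF this, of v] obtain w where "v = ?L w" ..
  then show thesis by (rule that)
qed

lemma exists_common_kernel:
  fixes n1 n2 :: "complex^3 \<Rightarrow> complex"
  assumes "\<And>x y. n1 (x + y) = n1 x + n1 y" "\<And>c x. n1 (c *s x) = c * n1 x"
    and "\<And>x y. n2 (x + y) = n2 x + n2 y" "\<And>c x. n2 (c *s x) = c * n2 x"
  obtains v where "v \<noteq> 0" "n1 v = 0" "n2 v = 0"
proof -
  let ?L = "\<lambda>v. (\<chi> i. if i = 1 then n1 v else if i = 2 then n2 v else 0) :: complex^3"
  have L: "Vector_Spaces.linear (*s) (*s) ?L"
    by unfold_locales (auto simp: vec_eq_iff assms algebra_simps)
  have "\<not> surj ?L"
  proof
    assume "surj ?L"
    from surjD[OF this, of "axis 3 1"] obtain v where "axis 3 1 = ?L v" ..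
    then have "(axis 3 1 :: complex^3) $ 3 = ?L v $ 3" by simp
    then show False by (simp add: axis_def)
  qed
  then have "\<not> inj ?L" using vec.linear_injective_imp_surjective[OF L] by blast
  then obtain v where v: "?L v = 0" "v \<noteq> 0" unfolding vec.linear_inj_iff_eq_0[OF L] by blast
  then have "n1 v = 0" "n2 v = 0" by (simp_all add: vec_eq_iff forall_3)
  then show thesis using v that by blast
qed

lemma isotropic_vectorE:
  assumes q: "homogeneous 2 q"
  obtains U where "U \<noteq> 0" "ev q U = 0"
proof (cases "ev q (axis 2 1) = 0")
  case True
  then show thesis using that[of "axis 2 1"] by (simp add: axis_eq_0_iff)
next
  case False
  define a b c where "a = ev q (axis 2 1)" and "b = bil q (axis 1 1) (axis 2 1)" and "c = ev q (axis 1 1)"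
  define t where "t = (- b + csqrt (b\<^sup>2 - 4 * a * c)) / (2 * a)"
  define U where "U = (axis 1 1 + t *s axis 2 1 :: complex^3)"
  have a0: "a \<noteq> 0" using False by (simp add: a_def)
  have "(2 * a * t + b)\<^sup>2 = b\<^sup>2 - 4 * a * c"
    using a0 by (simp add: t_def)
  then have "4 * a * (a * t\<^sup>2 + b * t + c) = 0"
    by (simp add: power2_eq_square algebra_simps)
  then have "a * t\<^sup>2 + b * t + c = 0" using a0 by simp
  then have "ev q U = 0"
    unfolding U_def ev_add[OF q] by (simp add: ev_scale2[OF q] bil_simps a_def b_def c_def algebra_simps)
  moreover have "U $ 1 = 1" by (simp add: U_def axis_def)
  then have "U \<noteq> 0" by auto
  ultimately show thesis using that by blast
qed

text \<open>\<open>s \<mapsto> s\<^sup>2 U + s V + W\<close> parametrises the conic.\<close>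

definition conic_frame :: "S \<Rightarrow> complex \<Rightarrow> complex^3 \<Rightarrow> complex^3 \<Rightarrow> complex^3 \<Rightarrow> bool" where
  "conic_frame q b U V W \<longleftrightarrow> homogeneous 2 q \<and> b \<noteq> 0 \<and>
     (\<forall>v. \<exists>x y z. v = x *s U + y *s V + z *s W) \<and>
     bil q U U = 0 \<and> bil q W W = 0 \<and> bil q U V = 0 \<and> bil q V W = 0 \<and>
     bil q U W = b \<and> bil q V V = - 2 * b"

text \<open>A hyperbolic pair \<open>U\<close>, \<open>W\<close> is split off. Its orthogonal
  complement is spanned by one vector, which is not isotropic because the form is nondegenerate, and
  rescaling that vector brings \<open>q\<close> to the shape
  \<open>b * (x * z - y\<^sup>2)\<close>.\<close>

lemma conic_frameE:
  assumes sm: "smooth_conic q" and U: "U \<noteq> 0" "ev q U = 0"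
  obtains b V W where "conic_frame q b U V W"
proof -
  note q = smooth_conicD(1)[OF sm]
  obtain y where y: "bil q U y \<noteq> 0" using smooth_conicD(2)[OF sm] U by blast
  define b where "b = bil q U y"
  have b: "b \<noteq> 0" using y by (simp add: b_def)
  \<comment> \<open>Along the isotropic direction \<open>U\<close> the value of \<open>q\<close> at
    \<open>y\<close> changes linearly, so a suitable multiple of \<open>U\<close> makes
    \<open>W\<close> isotropic, while \<open>bil q U W\<close> keeps the value
    \<open>b\<close>.\<close>
  define W where "W = y - (ev q y / b) *s U"
  have UU: "bil q U U = 0" using bil_same[OF q, of U] U by simp
  have UW: "bil q U W = b" by (simp add: W_def bil_simps UU b_def)
  have WW: "bil q W W = 0"
    using b by (simp add: W_def bil_simps U bil_same[OF q] bil_commute[of q y U] b_def[symmetric])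
  obtain V0 where V0: "V0 \<noteq> 0" "bil q U V0 = 0" "bil q W V0 = 0"
    by (rule exists_common_kernel[of "bil q U" "bil q W"]) (auto simp: bil_simps)
  have ind: "x = 0 \<and> y = 0 \<and> z = 0" if "x *s U + y *s V + z *s W = 0" and V: "V \<noteq> 0" "bil q U V = 0" "bil q W V = 0"
    for x y z V
  proof -
    have "bil q U (x *s U + y *s V + z *s W) = 0" "bil q W (x *s U + y *s V + z *s W) = 0"
      using that(1) by simp_all
    then have "x = 0" "z = 0" using UU UW WW V b by (simp_all add: bil_simps bil_commute[of q W U])
    then show ?thesis using that by (auto simp: vec_eq_iff)
  qed
  have sp: "\<exists>x y z. v = x *s U + y *s V + z *s W" if V: "V \<noteq> 0" "bil q U V = 0" "bil q W V = 0" for v V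
  proof -
    obtain x y z where "v = x *s U + y *s V + z *s W"
      by (rule span3[of U V W v]) (rule ind[OF _ V])
    then show ?thesis by blast
  qed
  have "bil q V0 V0 \<noteq> 0"
  proof
    assume "bil q V0 V0 = 0"
    have "bil q V0 v = 0" for v
    proof -
      obtain x y z where "v = x *s U + y *s V0 + z *s W"
        using sp[OF V0] by blast
      then show ?thesis using V0 \<open>bil q V0 V0 = 0\<close> by (simp add: bil_simps bil_commute[of q V0 U] bil_commute[of q V0 W])
    qed
    then show False using smooth_conicD(2)[OF sm] V0 by blast
  qed
  then obtain s where s: "s\<^sup>2 * bil q V0 V0 = - 2 * b" "s \<noteq> 0"
    using b by (intro that[of "csqrt (- 2 * b / bil q V0 V0)"]) auto
  define V where "V = s *s V0"
  have V: "V \<noteq> 0" "bil q U V = 0" "bil q W V = 0" "bil q V V = - 2 * b"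
    using V0 s by (auto simp: V_def bil_simps power2_eq_square algebra_simps)
  have "\<exists>x y z. v = x *s U + y *s V + z *s W" for v
    by (rule sp[OF V(1-3)])
  then have "conic_frame q b U V W"
    unfolding conic_frame_def using q b UU UW WW V by (simp add: bil_commute[of q V W])
  then show thesis by (rule that)
qed

lemma conic_frame_ev:
  assumes "conic_frame q b U V W"
  shows "ev q (x *s U + y *s V + z *s W) = b * (x * z - y\<^sup>2)"
proof -
  have q: "homogeneous 2 q" and r: "bil q U U = 0" "bil q W W = 0" "bil q U V = 0" "bil q V W = 0" "bil q U W = b"
      "bil q V V = - 2 * b" using assms by (auto simp: conic_frame_def)
  have "2 * ev q (x *s U + y *s V + z *s W) = 2 * (b * (x * z - y\<^sup>2))"
    unfolding bil_same[OF q, symmetric] bil_simps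
    using r by (simp add: bil_commute[of q V U] bil_commute[of q W U] bil_commute[of q W V] power2_eq_square algebra_simps)
  then show ?thesis by simp
qed

definition conic_pt :: "complex^3 \<Rightarrow> complex^3 \<Rightarrow> complex^3 \<Rightarrow> complex \<Rightarrow> complex^3" where
  "conic_pt U V W s = s\<^sup>2 *s U + s *s V + W"

lemma conic_frame_ev_pt: "conic_frame q b U V W \<Longrightarrow> ev q (conic_pt U V W s) = 0"
  using conic_frame_ev[of q b U V W "s\<^sup>2" s 1] by (simp add: conic_pt_def)

lemma conic_frame_independent:
  assumes "conic_frame q b U V W" "x *s U + y *s V + z *s W = 0"
  shows "x = 0 \<and> y = 0 \<and> z = 0"
proof -
  let ?v = "x *s U + y *s V + z *s W"
  have r: "bil q U U = 0" "bil q W W = 0" "bil q U V = 0" "bil q V W = 0" "bil q U W = b"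
      "bil q V V = - 2 * b" "b \<noteq> 0" using assms by (auto simp: conic_frame_def)
  have "bil q ?v U = 0" "bil q ?v V = 0" "bil q ?v W = 0" using assms(2) by simp_all
  then show ?thesis
    using r by (simp add: bil_simps bil_commute[of q V U] bil_commute[of q W U] bil_commute[of q W V])
qed

lemma conic_pt_nonzero: "conic_frame q b U V W \<Longrightarrow> conic_pt U V W s \<noteq> 0"
  using conic_frame_independent[of q b U V W "s\<^sup>2" s 1] by (auto simp: conic_pt_def)

definition restrict_poly :: "S \<Rightarrow> complex^3 \<Rightarrow> complex^3 \<Rightarrow> complex^3 \<Rightarrow> complex poly" where
  "restrict_poly p U V W = eval_hom (\<lambda>c. [:c:]) (\<lambda>i. [:W $ i, V $ i, U $ i:]) p"

lemma poly_restrict_poly: "poly (restrict_poly p U V W) s = ev p (conic_pt U V W s)"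
  unfolding restrict_poly_def poly_eval_hom
  by (rule arg_cong[where f = "\<lambda>a. eval_at a p"])
     (simp add: fun_eq_iff conic_pt_def power2_eq_square algebra_simps)

lemma degree_restrict_poly: "homogeneous (int n) p \<Longrightarrow> degree (restrict_poly p U V W) \<le> n * 2"
  unfolding restrict_poly_def by (rule degree_eval_hom_le) auto

lemma restrict_poly_conic:
  assumes q: "homogeneous 2 q"
  shows "restrict_poly q U V W = [:ev q W, bil q V W, ev q V + bil q U W, bil q U V, ev q U:]"
  unfolding poly_eq_poly_eq_iff[symmetric]
proof
  fix s
  show "poly (restrict_poly q U V W) s = poly [:ev q W, bil q V W, ev q V + bil q U W, bil q U V, ev q U:] s"
    by (simp add: poly_restrict_poly conic_pt_def ev_add[OF q] ev_scale2[OF q] bil_simps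
        bil_commute[of q V U] bil_commute[of q W U] bil_commute[of q W V] power2_eq_square algebra_simps)
qed

text \<open>The five coefficients of the restriction are five linear conditions on a quadratic form
  in frame coordinates and leave only the multiples of \<open>x * z - y\<^sup>2\<close>, so
  \<open>q'\<close> is proportional to \<open>q\<close>. The factor is not 0, as otherwise
  \<open>U\<close> would lie in the radical of \<open>q'\<close>.\<close>

lemma conic_vanishing_on_conic:
  assumes q: "smooth_conic q" and q': "smooth_conic q'" and fr: "conic_frame q b U V W"
    and 0: "restrict_poly q' U V W = 0"
  shows "zero_set q = zero_set q'"
proof -
  note h = smooth_conicD(1)[OF q] and h' = smooth_conicD(1)[OF q']
  define k where "k = bil q' U W"
  have r: "ev q' W = 0" "bil q' V W = 0" "ev q' V = - k" "bil q' U V = 0" "ev q' U = 0"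
    using 0 unfolding restrict_poly_conic[OF h'] k_def eq_neg_iff_add_eq_0 by simp_all
  have e: "ev q' (x *s U + y *s V + z *s W) = k * (x * z - y\<^sup>2)" for x y z
    using r by (simp add: ev_add[OF h'] ev_scale2[OF h'] bil_simps bil_commute[of q' V W] k_def[symmetric] algebra_simps)
  have b: "b \<noteq> 0" and sp: "\<And>v. \<exists>x y z. v = x *s U + y *s V + z *s W" using fr by (auto simp: conic_frame_def)
  have eq: "b * ev q' v = k * ev q v" for v
  proof -
    obtain x y z where v: "v = x *s U + y *s V + z *s W" using sp by blast
    show ?thesis unfolding v e conic_frame_ev[OF fr] by simp
  qed
  have "k \<noteq> 0"
  proof
    assume "k = 0"
    then have "ev q' v = 0" for v using eq[of v] b by simp
    then have "bil q' U y = 0" for y using ev_add[OF h', of U y] by simp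
    then have "U = 0" using smooth_conicD(2)[OF q'] by blast
    then show False using conic_frame_independent[OF fr, of 1 0 0] by simp
  qed
  then have z: "ev q' v = 0 \<longleftrightarrow> ev q v = 0" for v using eq[of v] b by auto
  have "eval_at P q' = 0 \<longleftrightarrow> eval_at P q = 0" for P :: "3 \<Rightarrow> complex"
    using z[of "vec_lambda P"] by (simp add: vec_nth_vec_lambda)
  then show ?thesis by (auto simp: zero_set_def)
qed

subsection \<open>Substituting a curve germ into a local equation\<close>

text \<open>Substitution of \<open>a\<close> for the outer variable. If \<open>a\<close> has no
  constant term, \<open>a ^ i\<close> has order at least \<open>i\<close>, so the truncation at
  \<open>n\<close> gives the exact coefficient.\<close>

definition fps_eval :: "complex fps \<Rightarrow> complex fps fps \<Rightarrow> complex fps" where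
  "fps_eval a Y = Abs_fps (\<lambda>n. fps_nth (\<Sum>i\<le>n. fps_nth Y i * a ^ i) n)"

lemma fps_power_nth_low: "fps_nth a 0 = 0 \<Longrightarrow> n < i \<Longrightarrow> fps_nth (a ^ i) n = 0" for a :: "complex fps"
  using startsby_zero_power_prefix by blast

lemma fps_mult_power_nth_low: "fps_nth a 0 = 0 \<Longrightarrow> n < i \<Longrightarrow> fps_nth (c * a ^ i) n = 0" for a :: "complex fps"
  by (simp add: fps_mult_nth fps_power_nth_low)

lemma fps_eval_nth:
  assumes "fps_nth a 0 = 0" "n \<le> N"
  shows "fps_nth (fps_eval a Y) n = fps_nth (\<Sum>i\<le>N. fps_nth Y i * a ^ i) n"
proof -
  have "(\<Sum>i\<le>N. fps_nth (fps_nth Y i * a ^ i) n) = (\<Sum>i\<le>n. fps_nth (fps_nth Y i * a ^ i) n)"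
    by (rule sum.mono_neutral_right) (use assms in \<open>auto simp: fps_mult_power_nth_low\<close>)
  then show ?thesis by (simp add: fps_eval_def fps_sum_nth)
qed

text \<open>In the product of the truncations at \<open>n\<close>, the surplus terms with
  \<open>i + j > n\<close> carry \<open>a ^ (i + j)\<close> and do not reach degree
  \<open>n\<close>.\<close>

lemma fps_eval_mult:
  assumes a: "fps_nth a 0 = 0"
  shows "fps_eval a (Y * Z) = fps_eval a Y * fps_eval a Z"
proof (rule fps_ext)
  fix n
  let ?P = "\<lambda>Y. \<Sum>i\<le>n. fps_nth Y i * a ^ i"
  define g where "g = (\<lambda>i j. fps_nth Y i * fps_nth Z j * a ^ (i + j))"
  have "?P Y * ?P Z = (\<Sum>(i,j)\<in>{..n} \<times> {..n}. g i j)"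
    by (simp add: sum_product sum.cartesian_product g_def power_add mult_ac)
  also have "\<dots> = (\<Sum>(i,j)\<in>{(i,j). i + j \<le> n}. g i j) + (\<Sum>(i,j)\<in>{..n} \<times> {..n} - {(i,j). i + j \<le> n}. g i j)"
    by (subst sum.subset_diff[of "{(i,j). i + j \<le> n}"]) (auto simp: add.commute)
  also have "(\<Sum>(i,j)\<in>{(i,j). i + j \<le> n}. g i j) = ?P (Y * Z)"
    by (simp add: sum.triangle_reindex_eq fps_mult_nth g_def sum_distrib_right atMost_atLeast0)
  finally have e: "?P Y * ?P Z = ?P (Y * Z) + (\<Sum>(i,j)\<in>{..n} \<times> {..n} - {(i,j). i + j \<le> n}. g i j)" .
  have "fps_nth (\<Sum>(i,j)\<in>{..n} \<times> {..n} - {(i,j). i + j \<le> n}. g i j) n = 0"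
    unfolding fps_sum_nth
  proof (rule sum.neutral, rule)
    fix p assume "p \<in> {..n} \<times> {..n} - {(i,j). i + j \<le> n}"
    then obtain i j where p: "p = (i, j)" "n < i + j" by fastforce
    show "fps_nth (case p of (i, j) \<Rightarrow> g i j) n = 0"
      unfolding p g_def prod.case using p(2) by (rule fps_mult_power_nth_low[OF a])
  qed
  then have "fps_nth (?P Y * ?P Z) n = fps_nth (?P (Y * Z)) n" by (simp only: e fps_add_nth add_0_right)
  moreover have "fps_nth (fps_eval a Y * fps_eval a Z) n = fps_nth (?P Y * ?P Z) n"
    unfolding fps_mult_nth by (intro sum.cong refl) (simp add: fps_eval_nth[OF a, of _ n])
  ultimately show "fps_nth (fps_eval a (Y * Z)) n = fps_nth (fps_eval a Y * fps_eval a Z) n"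
    by (simp add: fps_eval_nth[OF a, of n n])
qed

definition fps_sub :: "complex fps \<Rightarrow> complex fps \<Rightarrow> local_series \<Rightarrow> complex fps" where
  "fps_sub a b x = fps_eval a (Abs_fps (\<lambda>i. fps_nth x i oo b))"

lemma is_ring_hom_fps_sub:
  assumes a: "fps_nth a 0 = 0" and b: "fps_nth b 0 = 0"
  shows "is_ring_hom (fps_sub a b)"
proof -
  let ?m = "\<lambda>x::local_series. Abs_fps (\<lambda>i. fps_nth x i oo b)"
  have add: "fps_sub a b (x + y) = fps_sub a b x + fps_sub a b y" for x y
    by (rule fps_ext)
       (simp add: fps_sub_def fps_eval_def fps_compose_add_distrib distrib_right sum.distrib)
  have "?m (x * y) = ?m x * ?m y" for x y
    by (rule fps_ext)
       (simp add: fps_mult_nth fps_compose_sum_distrib fps_compose_mult_distrib[OF b])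
  then have mult: "fps_sub a b (x * y) = fps_sub a b x * fps_sub a b y" for x y
    by (simp add: fps_sub_def fps_eval_mult[OF a])
  have zero: "fps_sub a b 0 = 0"
    by (rule fps_ext) (simp add: fps_sub_def fps_eval_def)
  have one: "fps_sub a b 1 = 1"
  proof (rule fps_ext)
    fix n
    have "(\<Sum>i\<le>n. (fps_nth (1::local_series) i oo b) * a ^ i) = 1"
      by (subst sum.remove[of _ 0]) (auto intro!: sum.neutral)
    then show "fps_nth (fps_sub a b 1) n = fps_nth 1 n"
      by (simp add: fps_sub_def fps_eval_def)
  qed
  show ?thesis using add mult zero one by (simp add: is_ring_hom_def)
qed

lemma fps_compose_nth_low:
  fixes c b :: "complex fps"
  assumes b: "fps_nth b 0 = 0"
  shows "fps_nth (c oo b) 0 = fps_nth c 0" "fps_nth (c oo b) 1 = fps_nth c 1 * fps_nth b 1"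
    "fps_nth (c oo b) 2 = fps_nth c 1 * fps_nth b 2 + fps_nth c 2 * (fps_nth b 1)\<^sup>2"
  using b by (simp_all add: fps_compose_nth numeral_2_eq_2 fps_mult_nth)

lemma fps_sub_nth:
  assumes a: "fps_nth a 0 = 0" and b: "fps_nth b 0 = 0"
  shows "fps_nth (fps_sub a b x) 0 = coeff2 x 0 0"
    "fps_nth (fps_sub a b x) 1 = coeff2 x 1 0 * fps_nth a 1 + coeff2 x 0 1 * fps_nth b 1"
    "fps_nth (fps_sub a b x) 2 = coeff2 x 1 0 * fps_nth a 2 + coeff2 x 0 1 * fps_nth b 2
       + coeff2 x 2 0 * (fps_nth a 1)\<^sup>2 + coeff2 x 1 1 * fps_nth a 1 * fps_nth b 1 + coeff2 x 0 2 * (fps_nth b 1)\<^sup>2"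
  using a b fps_compose_nth_low[OF b]
  by (simp_all add: fps_sub_def fps_eval_def coeff2_def numeral_2_eq_2 fps_mult_nth algebra_simps)

lemma fps_sub_const2: "fps_nth a 0 = 0 \<Longrightarrow> fps_sub a b (const2 c) = fps_const c"
proof (rule fps_ext)
  fix n
  have "(\<Sum>i\<le>n. (fps_nth (const2 c) i oo b) * a ^ i) = fps_const c"
    by (subst sum.remove[of _ 0]) (auto intro!: sum.neutral simp: const2_def)
  then show "fps_nth (fps_sub a b (const2 c)) n = fps_nth (fps_const c) n"
    by (simp add: fps_sub_def fps_eval_def)
qed

lemma fps_sub_outer_X:
  assumes a: "fps_nth a 0 = 0"
  shows "fps_sub a b fps_X = a"
proof (rule fps_ext)
  fix n
  have "fps_nth (\<Sum>i\<le>Suc n. (fps_nth fps_X i oo b) * a ^ i) n = fps_nth a n"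
    by (subst sum.remove[of _ 1]) (auto intro!: sum.neutral simp: fps_sum_nth)
  then show "fps_nth (fps_sub a b fps_X) n = fps_nth a n"
    unfolding fps_sub_def by (subst fps_eval_nth[OF a, of n "Suc n"]) auto
qed

lemma fps_sub_inner_X:
  assumes b: "fps_nth b 0 = 0"
  shows "fps_sub a b (fps_const fps_X) = b"
proof (rule fps_ext)
  fix n
  have "(\<Sum>i\<le>n. (fps_nth (fps_const fps_X) i oo b) * a ^ i) = b"
    using b by (subst sum.remove[of _ 0]) (auto intro!: sum.neutral)
  then show "fps_nth (fps_sub a b (fps_const fps_X)) n = fps_nth b n"
    by (simp add: fps_sub_def fps_eval_def)
qed

lemma fps_prod_nth_low:
  fixes F :: "'i \<Rightarrow> complex fps" and r :: "'i \<Rightarrow> nat"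
  assumes "finite I" "\<And>j i. j \<in> I \<Longrightarrow> i < r j \<Longrightarrow> fps_nth (F j) i = 0"
  shows "fps_nth (\<Prod>j\<in>I. F j) (\<Sum>j\<in>I. r j) = (\<Prod>j\<in>I. fps_nth (F j) (r j))
    \<and> (\<forall>i < (\<Sum>j\<in>I. r j). fps_nth (\<Prod>j\<in>I. F j) i = 0)"
  using assms
proof (induction I rule: finite_induct)
  case (insert x I)
  let ?s = "\<Sum>j\<in>I. r j" and ?G = "\<Prod>j\<in>I. F j"
  have IH: "fps_nth ?G ?s = (\<Prod>j\<in>I. fps_nth (F j) (r j))" "\<And>i. i < ?s \<Longrightarrow> fps_nth ?G i = 0"
    and x: "\<And>i. i < r x \<Longrightarrow> fps_nth (F x) i = 0"
    using insert by auto
  have "fps_nth (F x * ?G) (r x + ?s) = (\<Sum>i\<in>{r x}. fps_nth (F x) i * fps_nth ?G (r x + ?s - i))"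
    unfolding fps_mult_nth
  proof (rule sum.mono_neutral_right)
    show "\<forall>i\<in>{0..r x + ?s} - {r x}. fps_nth (F x) i * fps_nth ?G (r x + ?s - i) = 0"
    proof
      fix i assume "i \<in> {0..r x + ?s} - {r x}"
      then have "i < r x \<or> r x + ?s - i < ?s" by auto
      then show "fps_nth (F x) i * fps_nth ?G (r x + ?s - i) = 0" using x IH(2) by auto
    qed
  qed auto
  moreover have "fps_nth (F x * ?G) i = 0" if "i < r x + ?s" for i
    unfolding fps_mult_nth
  proof (rule sum.neutral, rule)
    fix l assume "l \<in> {0..i}"
    then have "l < r x \<or> i - l < ?s" using that by auto
    then show "fps_nth (F x) l * fps_nth ?G (i - l) = 0" using x IH(2) by auto
  qed
  ultimately show ?case using insert.hyps IH(1) by simp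
qed auto

text \<open>The germ \<open>t \<mapsto> P + t T + t\<^sup>2 Z\<close>, with \<open>T = \<xi> A + \<eta> B\<close> and \<open>Z = \<zeta> A + \<omega> B\<close>.\<close>

definition germ :: "complex \<Rightarrow> complex \<Rightarrow> complex fps" where
  "germ \<xi> \<zeta> = fps_const \<xi> * fps_X + fps_const \<zeta> * fps_X ^ 2"

lemma germ_nth: "fps_nth (germ \<xi> \<zeta>) 0 = 0" "fps_nth (germ \<xi> \<zeta>) 1 = \<xi>" "fps_nth (germ \<xi> \<zeta>) 2 = \<zeta>"
  by (simp_all add: germ_def fps_X_power_nth)

text \<open>Substitution commutes with evaluation, so the series is \<open>q\<close> at the point
  \<open>P + t T + t\<^sup>2 Z\<close>, expanded by the polar form. Degree 2 is what tells simple
  contact of two conics from higher contact.\<close>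

lemma fps_sub_local_equation_conic:
  fixes P A B :: "complex^3" and \<xi> \<zeta> \<eta> \<omega> :: complex
  assumes q: "homogeneous 2 q"
  defines "F \<equiv> fps_sub (germ \<xi> \<zeta>) (germ \<eta> \<omega>) (local_equation q (($) P) (($) A) (($) B))"
  shows "fps_nth F 0 = ev q P" "fps_nth F 1 = bil q P (\<xi> *s A + \<eta> *s B)"
    "fps_nth F 2 = bil q P (\<zeta> *s A + \<omega> *s B) + ev q (\<xi> *s A + \<eta> *s B)"
proof -
  let ?g = "fps_sub (germ \<xi> \<zeta>) (germ \<eta> \<omega>)"
  have g: "is_ring_hom ?g" by (rule is_ring_hom_fps_sub) (rule germ_nth)+
  define x where "x = (\<lambda>i. fps_const (P $ i) + fps_const (A $ i) * germ \<xi> \<zeta> + fps_const (B $ i) * germ \<eta> \<omega>)"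
  have h: "is_ring_hom (fps_const :: complex \<Rightarrow> _)" by (simp add: is_ring_hom_def)
  have F: "F = eval_hom fps_const x q"
    unfolding F_def local_equation_def
    by (subst ring_hom_eval_hom[OF g])
       (simp_all add: const2_def[of 0] is_ring_homD[OF g] fps_sub_const2 fps_sub_outer_X fps_sub_inner_X germ_nth x_def)
  have x: "fps_nth (x i) 0 = P $ i" "fps_nth (x i) 1 = (\<xi> *s A + \<eta> *s B) $ i" "fps_nth (x i) 2 = (\<zeta> *s A + \<omega> *s B) $ i" for i
    by (simp_all add: x_def germ_nth germ_nth(2)[unfolded One_nat_def] mult.commute)
  let ?T = "\<xi> *s A + \<eta> *s B" and ?Z = "\<zeta> *s A + \<omega> *s B"
  have m: "fps_nth (u * v) 0 = fps_nth u 0 * fps_nth v 0"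
    "fps_nth (u * v) 1 = fps_nth u 0 * fps_nth v 1 + fps_nth u 1 * fps_nth v 0"
    "fps_nth (u * v) 2 = fps_nth u 0 * fps_nth v 2 + fps_nth u 1 * fps_nth v 1 + fps_nth u 2 * fps_nth v 0"
    for u v :: "complex fps"
    by (simp_all add: fps_mult_nth numeral_2_eq_2)
  note e = eval_hom_quadratic[OF q h, of x, folded F, unfolded power2_eq_square mult.assoc]
  show "fps_nth F 0 = ev q P"
    unfolding e ev_quadratic[OF q] fps_add_nth fps_mult_left_const_nth m x
    by (simp add: power2_eq_square algebra_simps)
  show "fps_nth F 1 = bil q P ?T"
    unfolding e bil_def fps_add_nth fps_mult_left_const_nth m x
    by (simp only: algebra_simps) (simp add: algebra_simps)
  show "fps_nth F 2 = bil q P ?Z + ev q ?T"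
    unfolding e bil_def ev_quadratic[OF q] fps_add_nth fps_mult_left_const_nth m x power2_eq_square
    by (simp only: algebra_simps) (simp add: algebra_simps)
qed

section \<open>From the branches at a singular point to the conics through it\<close>

lemma exists_common_nonzero:
  fixes a b :: "'i \<Rightarrow> complex"
  assumes "finite I" "\<And>j. j \<in> I \<Longrightarrow> a j \<noteq> 0 \<or> b j \<noteq> 0"
  obtains s where "\<And>j. j \<in> I \<Longrightarrow> a j + b j * s \<noteq> 0"
proof -
  have "finite {s. a j + b j * s = 0}" if "j \<in> I" for j
  proof (cases "b j = 0")
    case True
    then show ?thesis using assms(2)[OF that] by simp
  next
    case False
    then have "{s. a j + b j * s = 0} \<subseteq> {- a j / b j}"
      by (auto simp: field_simps add_eq_0_iff)
    then show ?thesis by (rule finite_subset) simp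
  qed
  then have "finite (\<Union>j\<in>I. {s. a j + b j * s = 0})" using assms(1) by blast
  then obtain s where "s \<notin> (\<Union>j\<in>I. {s. a j + b j * s = 0})"
    using ex_new_if_finite infinite_UNIV_char_0 by blast
  then show thesis using that by blast
qed

text \<open>Independence of the two differentials, expressed by dual vectors: \<open>X\<close> and
  \<open>Y\<close> are later the translation directions along which the two conics act as
  coordinates.\<close>

definition transv :: "S \<Rightarrow> S \<Rightarrow> complex^3 \<Rightarrow> bool" where
  "transv p q z \<longleftrightarrow> (\<exists>X Y. bil p z X = 1 \<and> bil q z X = 0 \<and> bil p z Y = 0 \<and> bil q z Y = 1)"

text \<open>Two conics through \<open>z\<close> with a common tangent line and intersection multiplicity exactly 2.\<close>

definition simply_tangent :: "S \<Rightarrow> S \<Rightarrow> complex^3 \<Rightarrow> bool" where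
  "simply_tangent p q z \<longleftrightarrow> (\<exists>\<kappa> T. (\<forall>x. bil q z x = \<kappa> * bil p z x) \<and> bil p z T = 0 \<and> ev q T \<noteq> \<kappa> * ev p T)"

definition through :: "(nat \<Rightarrow> S) \<Rightarrow> nat \<Rightarrow> complex^3 \<Rightarrow> nat set" where
  "through q k z = {j. j < k \<and> ev (q j) z = 0}"

text \<open>A condition on the conics themselves in place of abstract branches. It includes the
  points on at most one conic, so that it can be asked of every nonzero \<open>P\<close>.\<close>

definition mild_point :: "(nat \<Rightarrow> S) \<Rightarrow> nat \<Rightarrow> complex^3 \<Rightarrow> bool" where
  "mild_point q k z \<longleftrightarrow>
     card (through q k z) \<le> 3 \<and> (\<forall>i\<in>through q k z. \<forall>j\<in>through q k z. i \<noteq> j \<longrightarrow> transv (q i) (q j) z) \<or>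
     (\<exists>i j. i \<noteq> j \<and> through q k z = {i, j} \<and> simply_tangent (q i) (q j) z)"

lemma finite_through [simp]: "finite (through q k z)"
  by (simp add: through_def)

lemma orthogonal_lines_parallel:
  fixes a b :: complex
  assumes "a * g2 - b * g1 = 0" "a * h2 - b * h1 = 0" "a \<noteq> 0 \<or> b \<noteq> 0"
  shows "g1 * h2 - g2 * h1 = 0"
proof (cases "a = 0")
  case True
  then show ?thesis using assms by simp
next
  case False
  have "a * (g1 * h2 - g2 * h1) = g1 * (a * h2 - b * h1) - h1 * (a * g2 - b * g1)"
    by (simp add: algebra_simps)
  then show ?thesis using assms False by simp
qed

locale conic_germs =
  fixes q :: "nat \<Rightarrow> S" and k :: nat and P A B :: "complex^3"
  assumes sm: "\<And>j. j < k \<Longrightarrow> smooth_conic (q j)" and P: "P \<noteq> 0"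
    and frame: "frame_at (($) P) (($) A) (($) B)"
begin

abbreviation "J \<equiv> through q k P"
abbreviation "al j \<equiv> bil (q j) P A"
abbreviation "be j \<equiv> bil (q j) P B"
abbreviation "loc p \<equiv> local_equation p (($) P) (($) A) (($) B)"

lemma hom: "j < k \<Longrightarrow> homogeneous 2 (q j)"
  using sm smooth_conicD(1) by blast

lemma span: "\<exists>x y z. v = x *s P + y *s A + z *s B"
proof -
  obtain x y z where "v = x *s P + y *s A + z *s B"
  proof (rule span3[of P A B v])
    fix x y z assume "x *s P + y *s A + z *s B = 0"
    then have "\<forall>i. x * P $ i + y * A $ i + z * B $ i = 0" by (simp add: vec_eq_iff)
    then show "x = 0 \<and> y = 0 \<and> z = 0" using frame unfolding frame_at_def by blast
  qed
  then show ?thesis by blast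
qed

lemma JD: "j \<in> J \<Longrightarrow> j < k" "j \<in> J \<Longrightarrow> ev (q j) P = 0"
  by (auto simp: through_def)

lemma bil_P: "j \<in> J \<Longrightarrow> bil (q j) P (x *s P + y *s A + z *s B) = al j * y + be j * z"
  using JD[of j] bil_same[OF hom, of j P] by (simp add: bil_simps)

lemma nonzero: "j \<in> J \<Longrightarrow> al j \<noteq> 0 \<or> be j \<noteq> 0"
proof (rule ccontr)
  assume j: "j \<in> J" and "\<not> (al j \<noteq> 0 \<or> be j \<noteq> 0)"
  have "bil (q j) P v = 0" for v
  proof -
    obtain x y z where v: "v = x *s P + y *s A + z *s B" using span by blast
    show ?thesis unfolding v bil_P[OF j] using \<open>\<not> (al j \<noteq> 0 \<or> be j \<noteq> 0)\<close> by simp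
  qed
  then show False using smooth_conicD(2)[OF sm[OF JD(1)[OF j]]] P by blast
qed

definition "c0 = (\<Prod>j\<in>{..<k} - J. ev (q j) P)"

lemma c0: "c0 \<noteq> 0"
  by (auto simp: c0_def through_def)

lemma fps_sub_product:
  fixes \<xi> \<zeta> \<eta> \<omega> r
  defines "F \<equiv> \<lambda>p. fps_sub (germ \<xi> \<zeta>) (germ \<eta> \<omega>) (loc p)"
  assumes low: "\<And>j i. j \<in> J \<Longrightarrow> i < r \<Longrightarrow> fps_nth (F (q j)) i = 0"
  shows "fps_nth (F (\<Prod>j<k. q j)) (r * card J) = c0 * (\<Prod>j\<in>J. fps_nth (F (q j)) r)"
    "i < r * card J \<Longrightarrow> fps_nth (F (\<Prod>j<k. q j)) i = 0"
proof -
  have g: "is_ring_hom (fps_sub (germ \<xi> \<zeta>) (germ \<eta> \<omega>))"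
    by (rule is_ring_hom_fps_sub) (rule germ_nth)+
  have F: "F (\<Prod>j<k. q j) = (\<Prod>j<k. F (q j))"
    unfolding F_def local_equation_def eval_hom_prod[OF is_ring_hom_const2] is_ring_hom_prod[OF g] ..
  define s where "s = (\<lambda>j. if j \<in> J then r else 0)"
  have sub: "J \<subseteq> {..<k}" by (auto simp: through_def)
  have s: "(\<Sum>j<k. s j) = r * card J"
    unfolding s_def using sub by (simp add: sum.If_cases Int_absorb1 mult.commute)
  have "fps_nth (F (q j)) i = 0" if "i < s j" for i j
    using that low by (auto simp: s_def split: if_splits)
  then have *: "fps_nth (\<Prod>j<k. F (q j)) (\<Sum>j<k. s j) = (\<Prod>j<k. fps_nth (F (q j)) (s j))"
      "\<And>i. i < (\<Sum>j<k. s j) \<Longrightarrow> fps_nth (\<Prod>j<k. F (q j)) i = 0"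
    using fps_prod_nth_low[of "{..<k}" s "\<lambda>j. F (q j)"] by auto
  have "(\<Prod>j<k. fps_nth (F (q j)) (s j)) = (\<Prod>j\<in>{..<k} - J. fps_nth (F (q j)) (s j)) * (\<Prod>j\<in>J. fps_nth (F (q j)) (s j))"
    by (rule prod.subset_diff[OF sub]) simp
  also have "(\<Prod>j\<in>{..<k} - J. fps_nth (F (q j)) (s j)) = c0"
    unfolding c0_def F_def s_def by (intro prod.cong refl) (simp add: fps_sub_local_equation_conic hom)
  also have "(\<Prod>j\<in>J. fps_nth (F (q j)) (s j)) = (\<Prod>j\<in>J. fps_nth (F (q j)) r)"
    by (intro prod.cong refl) (simp add: s_def)
  finally show "fps_nth (F (\<Prod>j<k. q j)) (r * card J) = c0 * (\<Prod>j\<in>J. fps_nth (F (q j)) r)"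
    using *(1) unfolding F s by simp
  show "fps_nth (F (\<Prod>j<k. q j)) i = 0" if "i < r * card J"
    using *(2)[of i] that unfolding F s by simp
qed

abbreviation lin :: "local_series \<Rightarrow> complex \<Rightarrow> complex \<Rightarrow> complex" where
  "lin g \<xi> \<eta> \<equiv> coeff2 g 1 0 * \<xi> + coeff2 g 0 1 * \<eta>"

lemma fps_sub_branch:
  "smooth_branch g \<Longrightarrow> fps_nth (fps_sub (germ \<xi> \<zeta>) (germ \<eta> \<omega>) g) 0 = 0"
  "fps_nth (fps_sub (germ \<xi> \<zeta>) (germ \<eta> \<omega>) g) 1 = lin g \<xi> \<eta>"
  unfolding fps_sub_nth[OF germ_nth(1) germ_nth(1)] germ_nth by (simp_all add: smooth_branch_def)

lemma order_one:
  shows "fps_nth (fps_sub (germ \<xi> 0) (germ \<eta> 0) (loc (\<Prod>j<k. q j))) (card J) = c0 * (\<Prod>j\<in>J. al j * \<xi> + be j * \<eta>)"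
    "i < card J \<Longrightarrow> fps_nth (fps_sub (germ \<xi> 0) (germ \<eta> 0) (loc (\<Prod>j<k. q j))) i = 0"
proof -
  have low: "fps_nth (fps_sub (germ \<xi> 0) (germ \<eta> 0) (loc (q j))) i = 0" if "j \<in> J" "i < 1" for i j
    using that JD[of j] by (simp add: fps_sub_local_equation_conic hom)
  have "fps_nth (fps_sub (germ \<xi> 0) (germ \<eta> 0) (loc (q j))) 1 = al j * \<xi> + be j * \<eta>" if "j \<in> J" for j
    using that JD[of j] by (subst fps_sub_local_equation_conic(2)) (auto simp: hom bil_simps)
  then show "fps_nth (fps_sub (germ \<xi> 0) (germ \<eta> 0) (loc (\<Prod>j<k. q j))) (card J) = c0 * (\<Prod>j\<in>J. al j * \<xi> + be j * \<eta>)"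
    using fps_sub_product(1)[where r = 1, OF low] by simp
  show "i < card J \<Longrightarrow> fps_nth (fps_sub (germ \<xi> 0) (germ \<eta> 0) (loc (\<Prod>j<k. q j))) i = 0"
    using fps_sub_product(2)[where r = 1, OF low] by simp
qed

text \<open>The branches are arbitrary series, not given as the conics, so the two factorisations of
  the local equation are compared through their lowest homogeneous parts. Along a direction tangent
  to no conic and to no branch, the order of vanishing is the number of factors on either
  side.\<close>

lemma branches:
  assumes eq: "loc (\<Prod>j<k. q j) = (\<Prod>b\<in>I. g b)" and fin: "finite I"
    and br: "\<And>b. b \<in> I \<Longrightarrow> smooth_branch (g b)"
  shows "card J = card I" "c0 * (\<Prod>j\<in>J. al j * \<xi> + be j * \<eta>) = (\<Prod>b\<in>I. lin (g b) \<xi> \<eta>)"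
proof -
  have nth: "fps_nth (fps_sub (germ \<xi> 0) (germ \<eta> 0) (loc (\<Prod>j<k. q j))) (card I) = (\<Prod>b\<in>I. lin (g b) \<xi> \<eta>)"
    "\<And>i. i < card I \<Longrightarrow> fps_nth (fps_sub (germ \<xi> 0) (germ \<eta> 0) (loc (\<Prod>j<k. q j))) i = 0" for \<xi> \<eta>
  proof -
    have g: "is_ring_hom (fps_sub (germ \<xi> 0) (germ \<eta> 0))"
      by (rule is_ring_hom_fps_sub) (rule germ_nth)+
    have "fps_nth (\<Prod>b\<in>I. fps_sub (germ \<xi> 0) (germ \<eta> 0) (g b)) (\<Sum>b\<in>I. 1) = (\<Prod>b\<in>I. fps_nth (fps_sub (germ \<xi> 0) (germ \<eta> 0) (g b)) 1)
      \<and> (\<forall>i < (\<Sum>b\<in>I. 1). fps_nth (\<Prod>b\<in>I. fps_sub (germ \<xi> 0) (germ \<eta> 0) (g b)) i = 0)"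
      using br by (intro fps_prod_nth_low fin) (auto simp: fps_sub_branch)
    then show "fps_nth (fps_sub (germ \<xi> 0) (germ \<eta> 0) (loc (\<Prod>j<k. q j))) (card I) = (\<Prod>b\<in>I. lin (g b) \<xi> \<eta>)"
      "\<And>i. i < card I \<Longrightarrow> fps_nth (fps_sub (germ \<xi> 0) (germ \<eta> 0) (loc (\<Prod>j<k. q j))) i = 0"
      unfolding eq is_ring_hom_prod[OF g] fps_sub_branch(2) by simp_all
  qed
  \<comment> \<open>On the disjoint sum of both index sets, a single \<open>s\<close> makes the
    direction \<open>(1, s)\<close> avoid the zeros of both families of linear forms.\<close>
  define a where "a = (\<lambda>x. case x of Inl j \<Rightarrow> al j | Inr b \<Rightarrow> coeff2 (g b) 1 0)"
  define b where "b = (\<lambda>x. case x of Inl j \<Rightarrow> be j | Inr b \<Rightarrow> coeff2 (g b) 0 1)"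
  obtain s where s: "\<And>x. x \<in> J <+> I \<Longrightarrow> a x + b x * s \<noteq> 0"
  proof (rule exists_common_nonzero[of "J <+> I" a b])
    show "finite (J <+> I)" using fin by simp
    fix x assume "x \<in> J <+> I"
    then show "a x \<noteq> 0 \<or> b x \<noteq> 0"
      using nonzero br by (auto simp: a_def b_def smooth_branch_def)
  qed blast
  have 1: "(\<Prod>j\<in>J. al j * 1 + be j * s) \<noteq> 0"
    using s by (force simp: a_def b_def)
  have 2: "(\<Prod>b\<in>I. lin (g b) 1 s) \<noteq> 0"
    using s fin by (force simp: a_def b_def)
  show card: "card J = card I"
  proof (rule ccontr)
    assume "card J \<noteq> card I"
    then consider "card J < card I" | "card I < card J" by linarith
    then show False
    proof cases
      case 1
      then show ?thesis using nth(2)[of "card J" 1 s] order_one(1)[of 1 s] \<open>(\<Prod>j\<in>J. al j * 1 + be j * s) \<noteq> 0\<close> c0 by simp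
    next
      case 2
      then show ?thesis using nth(1)[of 1 s] order_one(2)[of "card I" 1 s] \<open>(\<Prod>b\<in>I. lin (g b) 1 s) \<noteq> 0\<close> by simp
    qed
  qed
  show "c0 * (\<Prod>j\<in>J. al j * \<xi> + be j * \<eta>) = (\<Prod>b\<in>I. lin (g b) \<xi> \<eta>)"
    using nth(1)[of \<xi> \<eta>] order_one(1)[of \<xi> \<eta>] card by simp
qed

lemma transvI:
  assumes i: "i \<in> J" and j: "j \<in> J" and d: "al i * be j - be i * al j \<noteq> 0"
  shows "transv (q i) (q j) P"
proof -
  define D where "D = al i * be j - be i * al j"
  have b: "bil (q l) P (y *s A + z *s B) = al l * y + be l * z" if "l \<in> J" for l y z
    by (simp add: bil_simps)
  have D1: "(al i * be j - be i * al j) / D = 1" using d by (simp add: D_def)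
  have "al i * (be j / D) + be i * (- al j / D) = 1" "al j * (- be i / D) + be j * (al i / D) = 1"
    unfolding D1[symmetric] by (simp_all add: diff_divide_distrib mult.commute)
  then have "bil (q i) P ((be j / D) *s A + (- al j / D) *s B) = 1" "bil (q j) P ((- be i / D) *s A + (al i / D) *s B) = 1"
    unfolding b[OF i] b[OF j] .
  moreover have "bil (q j) P ((be j / D) *s A + (- al j / D) *s B) = 0" "bil (q i) P ((- be i / D) *s A + (al i / D) *s B) = 0"
    unfolding b[OF i] b[OF j] by simp_all
  ultimately show ?thesis unfolding transv_def by blast
qed

lemma parallelD:
  assumes j: "j \<in> J" and d: "al i * be j - be i * al j = 0" and 0: "al j * x + be j * y = 0"
  shows "al i * x + be i * y = 0"
proof (cases "al j = 0")
  case True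
  then have "be j \<noteq> 0" using nonzero[OF j] by simp
  have "be j * (al i * x + be i * y) = al i * be j * x + be i * (be j * y)" by (simp add: algebra_simps)
  also have "\<dots> = be i * (al j * x + be j * y)" using d by (simp add: algebra_simps)
  finally show ?thesis using 0 \<open>be j \<noteq> 0\<close> by simp
next
  case False
  have "al j * (al i * x + be i * y) = al i * (al j * x) + be i * al j * y" by (simp add: algebra_simps)
  also have "\<dots> = al i * (al j * x + be j * y)" using d by (simp add: algebra_simps)
  finally show ?thesis using 0 False by simp
qed

text \<open>The zero lines of the branches are distinct, whereas two tangent conics share theirs.\<close>

lemma transv_of_branches:
  assumes eq: "loc (\<Prod>j<k. q j) = (\<Prod>b\<in>I. g b)" and fin: "finite I"
    and br: "\<And>b. b \<in> I \<Longrightarrow> smooth_branch (g b)"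
    and tr: "\<And>b c. b \<in> I \<Longrightarrow> c \<in> I \<Longrightarrow> b \<noteq> c \<Longrightarrow> transversal (g b) (g c)"
    and ij: "i \<in> J" "j \<in> J" "i \<noteq> j"
  shows "transv (q i) (q j) P"
proof (rule transvI[OF ij(1,2)], rule notI)
  assume d: "al i * be j - be i * al j = 0"
  note B = branches[OF eq fin br]
  have "\<exists>l\<in>J - {i}. al l * coeff2 (g b) 0 1 - be l * coeff2 (g b) 1 0 = 0" if b: "b \<in> I" for b
  proof -
    have "(\<Prod>c\<in>I. lin (g c) (coeff2 (g b) 0 1) (- coeff2 (g b) 1 0)) = 0"
      by (rule prod_zero[OF fin]) (rule bexI[OF _ b], simp)
    then have "(\<Prod>l\<in>J. al l * coeff2 (g b) 0 1 + be l * (- coeff2 (g b) 1 0)) = 0"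
      using B(2)[of "coeff2 (g b) 0 1" "- coeff2 (g b) 1 0"] c0 by simp
    then obtain l where l: "l \<in> J" "al l * coeff2 (g b) 0 1 + be l * (- coeff2 (g b) 1 0) = 0" by auto
    show ?thesis
    proof (cases "l = i")
      case True
      have "al j * coeff2 (g b) 0 1 + be j * (- coeff2 (g b) 1 0) = 0"
        by (rule parallelD[OF ij(1) _ l(2)[unfolded True]]) (use d in \<open>simp add: algebra_simps\<close>)
      then show ?thesis using ij by (intro bexI[of _ j]) auto
    next
      case False
      then show ?thesis using l by (intro bexI[of _ l]) auto
    qed
  qed
  then obtain L where L: "\<And>b. b \<in> I \<Longrightarrow> L b \<in> J - {i}"
    "\<And>b. b \<in> I \<Longrightarrow> al (L b) * coeff2 (g b) 0 1 - be (L b) * coeff2 (g b) 1 0 = 0" by metis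
  \<comment> \<open>Every branch shares its tangent line with some conic other than
    \<open>i\<close>, and there are fewer such conics than branches; two branches with the same
    conic are parallel.\<close>
  have "card (J - {i}) < card I" using B(1) ij(1) by (metis card_Diff1_less finite_through)
  moreover have "L ` I \<subseteq> J - {i}" using L(1) by blast
  ultimately have "\<not> inj_on L I" using card_inj_on_le[of L I "J - {i}"] by fastforce
  then obtain b c where bc: "b \<in> I" "c \<in> I" "b \<noteq> c" "L b = L c" by (auto simp: inj_on_def)
  have "coeff2 (g b) 1 0 * coeff2 (g c) 0 1 - coeff2 (g b) 0 1 * coeff2 (g c) 1 0 = 0"
    using orthogonal_lines_parallel[of "al (L b)" "coeff2 (g b) 0 1" "be (L b)" "coeff2 (g b) 1 0" "coeff2 (g c) 0 1" "coeff2 (g c) 1 0"]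
      L(2)[OF bc(1)] L(2)[OF bc(2)] bc nonzero[of "L b"] L(1)[OF bc(1)] by simp
  then show False using tr[OF bc(1-3)] by (simp add: transversal_def)
qed

lemma mild_of_branches:
  assumes eq: "loc (\<Prod>j<k. q j) = (\<Prod>b\<in>I. g b)" and fin: "finite I"
    and br: "\<And>b. b \<in> I \<Longrightarrow> smooth_branch (g b)"
    and tr: "\<And>b c. b \<in> I \<Longrightarrow> c \<in> I \<Longrightarrow> b \<noteq> c \<Longrightarrow> transversal (g b) (g c)"
    and 3: "card I \<le> 3"
  shows "mild_point q k P"
  unfolding mild_point_def
  using branches(1)[OF eq fin br] 3 transv_of_branches[OF eq fin br tr] by simp

end

text \<open>On a germ with nonzero velocity along which \<open>g\<close> and \<open>h\<close> vanish
  modulo \<open>t\<^sup>3\<close>, the whole ideal does, so the quotient by the ideal maps onto the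
  series modulo \<open>t\<^sup>3\<close>, of dimension 3. Concretely, \<open>1\<close>,
  \<open>z\<close> and \<open>z * z\<close> restrict to series starting with \<open>1\<close>,
  \<open>t\<close> and \<open>t\<^sup>2\<close>, while their coordinates with respect to the two
  elements \<open>b 0\<close>, \<open>b 1\<close> are linearly dependent.\<close>

lemma intersection_multiplicity_two_jet:
  assumes mult: "has_intersection_multiplicity g h 2"
    and g: "\<And>n. n < 3 \<Longrightarrow> fps_nth (fps_sub (germ \<xi> \<zeta>) (germ \<eta> \<omega>) g) n = 0"
    and h: "\<And>n. n < 3 \<Longrightarrow> fps_nth (fps_sub (germ \<xi> \<zeta>) (germ \<eta> \<omega>) h) n = 0"
    and ne: "\<xi> \<noteq> 0 \<or> \<eta> \<noteq> 0"
  shows False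
proof -
  let ?s = "fps_sub (germ \<xi> \<zeta>) (germ \<eta> \<omega>)"
  have s: "is_ring_hom ?s" by (rule is_ring_hom_fps_sub) (rule germ_nth)+
  have ideal: "\<forall>n<3. fps_nth (?s x) n = 0" if "x \<in> generated_ideal {g, h}" for x
  proof -
    let ?T = "{x. \<forall>n<3. fps_nth (?s x) n = 0}"
    have "Modules.module.span (*) {g, h} \<subseteq> ?T"
    proof (rule Modules.module.span_minimal[OF module_times])
      show "{g, h} \<subseteq> ?T" using g h by simp
      show "Modules.module.subspace (*) ?T"
        by (rule Modules.module.subspaceI[OF module_times])
           (auto simp: is_ring_homD[OF s] fps_mult_nth intro!: sum.neutral)
    qed
    then show ?thesis using that by (auto simp: generated_ideal_def)
  qed
  obtain \<alpha> \<beta> where ab: "\<alpha> * \<xi> + \<beta> * \<eta> = 1"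
  proof (cases "\<xi> = 0")
    case True
    then show thesis using ne by (intro that[of 0 "1 / \<eta>"]) auto
  next
    case False
    then show thesis by (intro that[of "1 / \<xi>" 0]) auto
  qed
  define z where "z = const2 \<alpha> * fps_X + const2 \<beta> * fps_const fps_X"
  have sz: "?s z = fps_const \<alpha> * germ \<xi> \<zeta> + fps_const \<beta> * germ \<eta> \<omega>"
    by (simp add: z_def is_ring_homD[OF s] fps_sub_const2 fps_sub_outer_X fps_sub_inner_X germ_nth)
  have z: "fps_nth (?s z) 0 = 0" "fps_nth (?s z) 1 = 1"
    using ab by (simp_all add: sz germ_nth germ_nth(2)[unfolded One_nat_def])
  have z2: "fps_nth (?s (z * z)) 0 = 0" "fps_nth (?s (z * z)) 1 = 0" "fps_nth (?s (z * z)) 2 = 1"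
    using z unfolding is_ring_homD(4)[OF s] fps_mult_nth by (simp_all add: numeral_2_eq_2)
  obtain b where "\<forall>x. \<exists>!c :: nat \<Rightarrow> complex.
        (\<forall>i\<ge>2. c i = 0) \<and> x - (\<Sum>i<2. const2 (c i) * b i) \<in> generated_ideal {g, h}"
    using mult unfolding has_intersection_multiplicity_def by blast
  then have "\<exists>c :: nat \<Rightarrow> complex. x - (\<Sum>i<2. const2 (c i) * b i) \<in> generated_ideal {g, h}" for x
    by (meson ex1_implies_ex)
  then obtain c :: "local_series \<Rightarrow> nat \<Rightarrow> complex" where
    c: "\<And>x. x - (\<Sum>i<2. const2 (c x i) * b i) \<in> generated_ideal {g, h}" by metis
  have nth: "fps_nth (?s x) n = c x 0 * fps_nth (?s (b 0)) n + c x 1 * fps_nth (?s (b 1)) n" if "n < 3" for x n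
  proof -
    have "?s x = ?s (x - (\<Sum>i<2. const2 (c x i) * b i)) + ?s (\<Sum>i<2. const2 (c x i) * b i)"
      unfolding is_ring_homD(3)[OF s, symmetric] by simp
    also have "?s (\<Sum>i<2. const2 (c x i) * b i) = fps_const (c x 0) * ?s (b 0) + fps_const (c x 1) * ?s (b 1)"
      by (simp add: numeral_2_eq_2 is_ring_homD[OF s] fps_sub_const2 germ_nth)
    finally have "?s x = ?s (x - (\<Sum>i<2. const2 (c x i) * b i)) + (fps_const (c x 0) * ?s (b 0) + fps_const (c x 1) * ?s (b 1))" .
    then show ?thesis using ideal[OF c] that by simp
  qed
  obtain v :: "complex^3" where v: "v \<noteq> 0"
    "v $ 1 * c 1 0 + v $ 2 * c z 0 + v $ 3 * c (z * z) 0 = 0"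
    "v $ 1 * c 1 1 + v $ 2 * c z 1 + v $ 3 * c (z * z) 1 = 0"
    by (rule exists_common_kernel[of "\<lambda>v. v $ 1 * c 1 0 + v $ 2 * c z 0 + v $ 3 * c (z * z) 0"
          "\<lambda>v. v $ 1 * c 1 1 + v $ 2 * c z 1 + v $ 3 * c (z * z) 1"]) (auto simp: algebra_simps)
  have comb: "v $ 1 * fps_nth (?s 1) n + v $ 2 * fps_nth (?s z) n + v $ 3 * fps_nth (?s (z * z)) n = 0" if "n < 3" for n
  proof -
    have "v $ 1 * fps_nth (?s 1) n + v $ 2 * fps_nth (?s z) n + v $ 3 * fps_nth (?s (z * z)) n
      = (v $ 1 * c 1 0 + v $ 2 * c z 0 + v $ 3 * c (z * z) 0) * fps_nth (?s (b 0)) n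
      + (v $ 1 * c 1 1 + v $ 2 * c z 1 + v $ 3 * c (z * z) 1) * fps_nth (?s (b 1)) n"
      unfolding nth[OF that, of 1] nth[OF that, of z] nth[OF that, of "z * z"] by (simp add: algebra_simps)
    then show ?thesis using v by simp
  qed
  have "v $ 1 = 0" using comb[of 0] z z2 by (simp add: is_ring_homD[OF s])
  moreover from this have "v $ 2 = 0" using comb[of 1] z(2) z2(2) by simp
  moreover from calculation have "v $ 3 = 0" using comb[of 2] z2(3) by simp
  ultimately show False using v(1) by (simp add: vec_eq_iff forall_3)
qed

context conic_germs
begin

text \<open>If the two conics are not transversal, their differentials are proportional with factor
  \<open>\<kappa>\<close>, and equal second-order parts along the common tangent \<open>T\<close>
  have to be excluded. In that case, germs in direction \<open>T\<close> with an acceleration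
  depending on \<open>s\<close> give the conics the leading coefficients \<open>s\<close> and
  \<open>\<kappa> * s\<close>, so \<open>f\<close> has the coefficient
  \<open>c0 * \<kappa> * s\<^sup>2\<close> in degree 4. The branches give a product of two affine
  functions of \<open>s\<close> there, whose constant terms must vanish. At \<open>s = 0\<close>
  both branches then vanish modulo \<open>t\<^sup>3\<close> along the germ, against intersection
  multiplicity 2.\<close>

lemma mild_of_tacnode:
  assumes eq: "loc (\<Prod>j<k. q j) = g * h" and br: "smooth_branch g" "smooth_branch h"
    and mult: "has_intersection_multiplicity g h 2"
  shows "mild_point q k P"
proof -
  define G where "G = (\<lambda>b. if b then g else h)"
  have eq': "loc (\<Prod>j<k. q j) = (\<Prod>b\<in>UNIV. G b)"
    by (simp add: eq G_def UNIV_bool mult.commute)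
  have br': "smooth_branch (G b)" for b using br by (simp add: G_def)
  note B = branches[OF eq' _ br', simplified]
  have cardJ: "card J = 2" using B(1) by (simp add: card_UNIV_bool)
  then obtain i j where ij: "J = {i, j}" "i \<noteq> j" by (auto simp: card_2_iff)
  have iJ: "i \<in> J" and jJ: "j \<in> J" using ij by auto
  have prod: "c0 * ((al i * x + be i * y) * (al j * x + be j * y)) = lin g x y * lin h x y" for x y
    using B(2)[of x y] ij by (simp add: G_def UNIV_bool mult.commute)
  show ?thesis
  proof (cases "al i * be j - be i * al j = 0")
    case False
    then have "transv (q i) (q j) P" "transv (q j) (q i) P"
      using transvI[OF iJ jJ] transvI[OF jJ iJ] by (auto simp: algebra_simps)
    then show ?thesis unfolding mild_point_def using ij cardJ by auto
  next
    case d: True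
    obtain \<kappa> where k: "al j = \<kappa> * al i" "be j = \<kappa> * be i"
    proof (cases "al i = 0")
      case True
      then have "be i \<noteq> 0" "al j = 0" using nonzero[OF iJ] d by auto
      then show thesis using True by (intro that[of "be j / be i"]) auto
    next
      case False
      then show thesis using d by (intro that[of "al j / al i"]) (auto simp: field_simps)
    qed
    have k0: "\<kappa> \<noteq> 0" using k nonzero[OF jJ] by auto
    define x0 y0 where "x0 = be i" and "y0 = - al i"
    have e0: "x0 \<noteq> 0 \<or> y0 \<noteq> 0" using nonzero[OF iJ] by (auto simp: x0_def y0_def)
    define T where "T = x0 *s A + y0 *s B"
    have T: "bil (q i) P T = 0" by (simp add: T_def bil_simps x0_def y0_def)
    have kk: "bil (q j) P v = \<kappa> * bil (q i) P v" for v
    proof -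
      obtain x y z where v: "v = x *s P + y *s A + z *s B" using span by blast
      show ?thesis unfolding v bil_P[OF iJ] bil_P[OF jJ] k by (simp add: algebra_simps)
    qed
    have "ev (q j) T \<noteq> \<kappa> * ev (q i) T"
    proof
      assume c: "ev (q j) T = \<kappa> * ev (q i) T"
      have lin0: "lin G' x0 y0 = 0" if G': "G' = g \<or> G' = h" for G'
      proof -
        let ?x = "coeff2 G' 0 1" and ?y = "- coeff2 G' 1 0"
        have "lin g ?x ?y * lin h ?x ?y = 0" using G' by auto
        then have "c0 * \<kappa> * (al i * ?x + be i * ?y)\<^sup>2 = 0"
          unfolding prod[symmetric] k by (simp add: power2_eq_square algebra_simps)
        then show ?thesis using c0 k0 by (simp add: x0_def y0_def algebra_simps)
      qed
      obtain w1 w2 where w: "al i * w1 + be i * w2 = 1"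
      proof (cases "al i = 0")
        case True
        then show thesis using nonzero[OF iJ] by (intro that[of 0 "1 / be i"]) auto
      next
        case False
        then show thesis by (intro that[of "1 / al i" 0]) auto
      qed
      \<comment> \<open>The vector \<open>w1 *s A + w2 *s B\<close> has value 1 under the
        differential of \<open>q i\<close>, so the acceleration \<open>y + s\<close> times it makes
        the coefficient of \<open>q i\<close> in degree 2 equal to \<open>s\<close>.\<close>
      define y where "y = - ev (q i) T"
      let ?s = "\<lambda>s. fps_sub (germ x0 ((y + s) * w1)) (germ y0 ((y + s) * w2))"
      have W: "bil (q i) P (((y + s) * w1) *s A + ((y + s) * w2) *s B) = y + s" for s
        using arg_cong[OF w, of "\<lambda>u. (y + s) * u"] by (simp add: bil_simps algebra_simps)
      have Fi: "fps_nth (?s s (loc (q i))) 0 = 0" "fps_nth (?s s (loc (q i))) 1 = 0"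
        "fps_nth (?s s (loc (q i))) 2 = s" for s
        unfolding fps_sub_local_equation_conic[OF hom[OF JD(1)[OF iJ]]] W
        using T JD(2)[OF iJ] by (simp_all add: T_def[symmetric] y_def)
      have Fj: "fps_nth (?s s (loc (q j))) 0 = 0" "fps_nth (?s s (loc (q j))) 1 = 0"
        "fps_nth (?s s (loc (q j))) 2 = \<kappa> * s" for s
        unfolding fps_sub_local_equation_conic[OF hom[OF JD(1)[OF jJ]]] kk W
        using T JD(2)[OF jJ] c by (simp_all add: T_def[symmetric] y_def algebra_simps)
      have low: "fps_nth (?s s (loc (q l))) n = 0" if "l \<in> J" "n < 2" for s l n
        using that Fi[of s] Fj[of s] ij by (auto simp: less_2_cases_iff)
      have f4: "fps_nth (?s s (loc (\<Prod>j<k. q j))) 4 = c0 * \<kappa> * s\<^sup>2" for s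
        using fps_sub_product(1)[where r = 2, OF low, of s] Fi(3)[of s] Fj(3)[of s] ij cardJ
        by (simp add: power2_eq_square)
      have g01: "fps_nth (?s s G') 0 = 0" "fps_nth (?s s G') 1 = 0" if G': "G' = g \<or> G' = h" for s G'
        using fps_sub_branch(1)[where g = G'] fps_sub_branch(2)[where g = G'] lin0[OF G'] br G' by auto
      have g2: "fps_nth (?s s G') 2 = fps_nth (?s 0 G') 2 + s * lin G' w1 w2" for s G'
        unfolding fps_sub_nth[OF germ_nth(1) germ_nth(1)] germ_nth by (simp add: algebra_simps)
      have gh: "(fps_nth (?s 0 g) 2 + s * lin g w1 w2) * (fps_nth (?s 0 h) 2 + s * lin h w1 w2) = c0 * \<kappa> * s\<^sup>2" for s
      proof -
        have s: "is_ring_hom (?s s)" by (rule is_ring_hom_fps_sub) (rule germ_nth)+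
        have "fps_nth (\<Prod>b\<in>UNIV. ?s s (G b)) (\<Sum>b\<in>(UNIV::bool set). 2) = (\<Prod>b\<in>UNIV. fps_nth (?s s (G b)) 2)"
          by (intro conjunct1[OF fps_prod_nth_low]) (auto simp: less_2_cases_iff G_def g01 g01(2)[unfolded One_nat_def])
        then have "fps_nth (?s s (g * h)) 4 = fps_nth (?s s g) 2 * fps_nth (?s s h) 2"
          unfolding is_ring_homD(4)[OF s] by (simp add: UNIV_bool G_def mult.commute)
        then show ?thesis using f4[of s] unfolding eq g2[of s] by simp
      qed
      define g2' h2' gw hw where "g2' = fps_nth (?s 0 g) 2" and "h2' = fps_nth (?s 0 h) 2"
        and "gw = lin g w1 w2" and "hw = lin h w1 w2"
      have id: "(g2' + s * gw) * (h2' + s * hw) = c0 * \<kappa> * s\<^sup>2" for s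
        using gh[of s] unfolding g2'_def h2'_def gw_def hw_def .
      have 0: "g2' * h2' = 0" using id[of 0] by simp
      have 1: "g2' * hw + gw * h2' = 0" "gw * hw = c0 * \<kappa>"
      proof -
        have a: "g2' * hw + gw * h2' + gw * hw = c0 * \<kappa>" "- g2' * hw - gw * h2' + gw * hw = c0 * \<kappa>"
          using id[of 1] id[of "-1"] 0 by (simp_all add: algebra_simps)
        have "2 * (gw * hw) = 2 * (c0 * \<kappa>)" using arg_cong2[OF a, of "(+)"] by simp
        then show "gw * hw = c0 * \<kappa>" by simp
        then show "g2' * hw + gw * h2' = 0" using a(1) by simp
      qed
      have "gw \<noteq> 0" "hw \<noteq> 0" using 1(2) c0 k0 by auto
      then have "g2' = 0" "h2' = 0" using 0 1(1) by auto
      then have jet: "fps_nth (?s 0 G') n = 0" if "G' = g \<or> G' = h" "n < 3" for G' n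
        using that g01[of G' 0] by (auto simp: less_Suc_eq numeral_3_eq_3 g2'_def h2'_def numeral_2_eq_2)
      show False
        by (rule intersection_multiplicity_two_jet[OF mult jet jet e0]) auto
    qed
    then have "simply_tangent (q i) (q j) P"
      unfolding simply_tangent_def using T kk by blast
    then show ?thesis unfolding mild_point_def using ij by blast
  qed
qed

end

text \<open>Where two of the conics meet, the gradient of the product vanishes, so \<open>P\<close>
  is singular and has one of the three types; at the other points the condition holds
  trivially.\<close>

lemma mild_point_conic_arrangement:
  assumes sm: "\<And>j. j < k \<Longrightarrow> smooth_conic (q j)" and P: "P \<noteq> (0::complex^3)"
    and sing: "\<forall>P \<in> singular_points (\<Prod>j<k. q j). node (\<Prod>j<k. q j) P \<or> tacnode (\<Prod>j<k. q j) P \<or> ordinary_triple_point (\<Prod>j<k. q j) P"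
  shows "mild_point q k P"
proof (cases "\<exists>i\<in>through q k P. \<exists>j\<in>through q k P. i \<noteq> j")
  case False
  then have "\<exists>i. through q k P \<subseteq> {i}" by blast
  then have "card (through q k P) \<le> 1" by (metis card_mono card_1_singleton_iff One_nat_def finite.intros)
  then show ?thesis using False unfolding mild_point_def by auto
next
  case True
  then obtain i j where ij: "i < k" "j < k" "i \<noteq> j" "ev (q i) P = 0" "ev (q j) P = 0"
    by (auto simp: through_def)
  let ?f = "\<Prod>j<k. q j"
  define R where "R = (\<Prod>l\<in>{..<k} - {i} - {j}. q l)"
  have f: "?f = q i * q j * R"
    unfolding R_def using ij by (subst prod.remove[of _ i], simp, simp, subst prod.remove[of _ j]) (auto simp: mult_ac)
  have evf: "ev ?f = (\<lambda>z. ev (q i) z * ev (q j) z * ev R z)"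
    unfolding f by (simp add: fun_eq_iff eval_hom_mult[OF is_ring_hom_id])
  have "(ev ?f has_derivative (\<lambda>h. 0)) (at P)"
    unfolding evf
    by (rule has_derivative_eq_rhs[OF has_derivative_mult[OF has_derivative_mult[OF has_derivative_ev has_derivative_ev] has_derivative_ev]])
       (use ij in simp)
  then have d0: "(\<Sum>l\<in>UNIV. ev (partial l ?f) P * h $ l) = 0" for h
    by (rule fun_cong[OF has_derivative_unique[OF has_derivative_ev]])
  have "ev (partial l ?f) P = 0" for l
    using d0[of "axis l 1"] by (simp add: axis_def if_distrib[of "\<lambda>y. _ * y"] cong: if_cong)
  moreover have "ev ?f P = 0" unfolding fun_cong[OF evf, of P] using ij by simp
  moreover have "($) P \<noteq> (\<lambda>_. 0)" using P by (auto simp: vec_eq_iff fun_eq_iff)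
  ultimately have "($) P \<in> singular_points ?f" by (simp add: singular_points_def zero_set_def)
  with sing consider "node ?f (($) P)" | "tacnode ?f (($) P)" | "ordinary_triple_point ?f (($) P)" by blast
  then show ?thesis
  proof cases
    case 1
    then obtain A B g h where *: "frame_at (($) P) A B" "local_equation ?f (($) P) A B = g * h"
      "smooth_branch g" "smooth_branch h" "transversal g h" unfolding node_def by blast
    interpret conic_germs q k P "vec_lambda A" "vec_lambda B"
      using sm P *(1) by unfold_locales (simp_all add: vec_nth_vec_lambda)
    show ?thesis
      by (rule mild_of_branches[where I = UNIV and g = "\<lambda>b::bool. if b then g else h"])
         (use * in \<open>auto simp: UNIV_bool vec_nth_vec_lambda transversal_def algebra_simps\<close>)
  next
    case 2
    then obtain A B g h where *: "frame_at (($) P) A B" "local_equation ?f (($) P) A B = g * h"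
      "smooth_branch g" "smooth_branch h" "has_intersection_multiplicity g h 2" unfolding tacnode_def by blast
    interpret conic_germs q k P "vec_lambda A" "vec_lambda B"
      using sm P *(1) by unfold_locales (simp_all add: vec_nth_vec_lambda)
    show ?thesis
      by (rule mild_of_tacnode[of g h]) (use * in \<open>auto simp: vec_nth_vec_lambda\<close>)
  next
    case 3
    then obtain A B g h l where *: "frame_at (($) P) A B" "local_equation ?f (($) P) A B = g * h * l"
      "smooth_branch g" "smooth_branch h" "smooth_branch l" "transversal g h" "transversal g l" "transversal h l"
      unfolding ordinary_triple_point_def by blast
    interpret conic_germs q k P "vec_lambda A" "vec_lambda B"
      using sm P *(1) by unfold_locales (simp_all add: vec_nth_vec_lambda)
    show ?thesis
      by (rule mild_of_branches[where I = "{0,1,2::nat}" and g = "\<lambda>b. if b = 0 then g else if b = 1 then h else l"])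
         (use * in \<open>auto simp: vec_nth_vec_lambda transversal_def algebra_simps\<close>)
  qed
qed

subsection \<open>Volume of sublevel sets\<close>

lemma norm_vector_scalar_mult: "norm (c *s v) = cmod c * norm v" for c :: complex and v :: "complex^3"
  by (simp add: norm_vec_def L2_set_def norm_mult power_mult_distrib
      sum_distrib_left[symmetric] real_sqrt_mult)

text \<open>\<open>F t\<close> has volume \<open>O(t\<^sup>e)\<close> near \<open>P\<close>; measurable supersets avoid measurability side conditions.\<close>

definition vsmall :: "complex^3 \<Rightarrow> real \<Rightarrow> (real \<Rightarrow> complex^3 \<Rightarrow> bool) \<Rightarrow> bool" where
  "vsmall P e F \<longleftrightarrow> (\<exists>\<rho>>0. \<exists>C\<ge>0. \<forall>t. 0 < t \<and> t \<le> 1 \<longrightarrow>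
     (\<exists>M\<in>sets lborel. {x \<in> ball P \<rho>. F t x} \<subseteq> M \<and> emeasure lborel M \<le> ennreal (C * t powr e)))"

lemma vsmallE:
  assumes "vsmall P e F"
  obtains \<rho> C where "0 < \<rho>" "0 \<le> C" "\<And>t. 0 < t \<Longrightarrow> t \<le> 1 \<Longrightarrow>
     \<exists>M\<in>sets lborel. {x \<in> ball P \<rho>. F t x} \<subseteq> M \<and> emeasure lborel M \<le> ennreal (C * t powr e)"
  using assms unfolding vsmall_def by blast

lemma vsmall_mono:
  assumes F: "vsmall P e F" and e: "e' \<le> e"
    and ev: "eventually (\<lambda>x. \<forall>t. 0 < t \<longrightarrow> t \<le> 1 \<longrightarrow> G t x \<longrightarrow> F t x) (nhds P)"
  shows "vsmall P e' G"
proof -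
  obtain \<rho> C where 1: "0 < \<rho>" "0 \<le> C" "\<And>t. 0 < t \<Longrightarrow> t \<le> 1 \<Longrightarrow>
     \<exists>M\<in>sets lborel. {x \<in> ball P \<rho>. F t x} \<subseteq> M \<and> emeasure lborel M \<le> ennreal (C * t powr e)"
    by (rule vsmallE[OF F]) (rule that)
  obtain d where d: "d > 0" "\<And>x t. dist x P < d \<Longrightarrow> 0 < t \<Longrightarrow> t \<le> 1 \<Longrightarrow> G t x \<Longrightarrow> F t x"
    using ev unfolding eventually_nhds_metric by blast
  show ?thesis
    unfolding vsmall_def
  proof (rule exI[of _ "min d \<rho>"], intro conjI exI[of _ C] allI impI)
    fix t :: real assume t: "0 < t \<and> t \<le> 1"
    obtain M where M: "M \<in> sets lborel" "{x \<in> ball P \<rho>. F t x} \<subseteq> M" "emeasure lborel M \<le> ennreal (C * t powr e)"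
      using 1(3)[of t] t by auto
    have "{x \<in> ball P (min d \<rho>). G t x} \<subseteq> M"
      using M(2) d(2) t by (auto simp: dist_commute)
    moreover have "C * t powr e \<le> C * t powr e'"
      using t e 1(2) by (intro mult_left_mono powr_mono') auto
    ultimately show "\<exists>M\<in>sets lborel. {x \<in> ball P (min d \<rho>). G t x} \<subseteq> M \<and> emeasure lborel M \<le> ennreal (C * t powr e')"
      using M by (meson ennreal_leI order_trans)
  qed (use 1 d in auto)
qed

lemma vsmall_or:
  assumes "vsmall P e F" "vsmall P e G"
  shows "vsmall P e (\<lambda>t x. F t x \<or> G t x)"
proof -
  obtain \<rho> C where 1: "0 < \<rho>" "0 \<le> C" "\<And>t. 0 < t \<Longrightarrow> t \<le> 1 \<Longrightarrow>
     \<exists>M\<in>sets lborel. {x \<in> ball P \<rho>. F t x} \<subseteq> M \<and> emeasure lborel M \<le> ennreal (C * t powr e)"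
    by (rule vsmallE[OF assms(1)]) (rule that)
  obtain \<rho>' C' where 2: "0 < \<rho>'" "0 \<le> C'" "\<And>t. 0 < t \<Longrightarrow> t \<le> 1 \<Longrightarrow>
     \<exists>M\<in>sets lborel. {x \<in> ball P \<rho>'. G t x} \<subseteq> M \<and> emeasure lborel M \<le> ennreal (C' * t powr e)"
    by (rule vsmallE[OF assms(2)]) (rule that)
  show ?thesis
    unfolding vsmall_def
  proof (rule exI[of _ "min \<rho> \<rho>'"], intro conjI exI[of _ "C + C'"] allI impI)
    fix t :: real assume t: "0 < t \<and> t \<le> 1"
    obtain M where M: "M \<in> sets lborel" "{x \<in> ball P \<rho>. F t x} \<subseteq> M" "emeasure lborel M \<le> ennreal (C * t powr e)"
      using 1(3)[of t] t by auto
    obtain M' where M': "M' \<in> sets lborel" "{x \<in> ball P \<rho>'. G t x} \<subseteq> M'" "emeasure lborel M' \<le> ennreal (C' * t powr e)"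
      using 2(3)[of t] t by auto
    have "emeasure lborel (M \<union> M') \<le> emeasure lborel M + emeasure lborel M'"
      by (rule emeasure_subadditive) (use M M' in auto)
    also have "\<dots> \<le> ennreal (C * t powr e) + ennreal (C' * t powr e)" by (intro add_mono M M')
    also have "\<dots> = ennreal ((C + C') * t powr e)"
      using 1 2 by (simp add: ennreal_plus[symmetric] distrib_right del: ennreal_plus)
    finally show "\<exists>M\<in>sets lborel. {x \<in> ball P (min \<rho> \<rho>'). F t x \<or> G t x} \<subseteq> M \<and> emeasure lborel M \<le> ennreal ((C + C') * t powr e)"
      using M M' by (intro bexI[of _ "M \<union> M'"]) auto
  qed (use 1 2 in auto)
qed

lemma vsmall_False: "vsmall P e (\<lambda>t x. False)"
  unfolding vsmall_def by (rule exI[of _ 1], intro conjI exI[of _ 0]) (auto intro: bexI[of _ "{}"])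

lemma vsmall_Ex:
  assumes "\<And>j. j < (N::nat) \<Longrightarrow> vsmall P e (F j)"
  shows "vsmall P e (\<lambda>t x. \<exists>j<N. F j t x)"
  using assms
proof (induction N)
  case 0
  then show ?case using vsmall_False by simp
next
  case (Suc N)
  have "vsmall P e (\<lambda>t x. (\<exists>j<N. F j t x) \<or> F N t x)"
    by (intro vsmall_or Suc) auto
  then show ?case by (simp add: less_Suc_eq ex_disj_distrib conj_disj_distribR disj_commute)
qed

lemma vsmall_rescale:
  assumes "vsmall P e F" "0 < \<alpha>"
  shows "vsmall P (\<alpha> * e) (\<lambda>t. F (t powr \<alpha>))"
proof -
  obtain \<rho> C where 1: "0 < \<rho>" "0 \<le> C" "\<And>t. 0 < t \<Longrightarrow> t \<le> 1 \<Longrightarrow>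
     \<exists>M\<in>sets lborel. {x \<in> ball P \<rho>. F t x} \<subseteq> M \<and> emeasure lborel M \<le> ennreal (C * t powr e)"
    by (rule vsmallE[OF assms(1)]) (rule that)
  have "\<exists>M\<in>sets lborel. {x \<in> ball P \<rho>. F (t powr \<alpha>) x} \<subseteq> M \<and> emeasure lborel M \<le> ennreal (C * t powr (\<alpha> * e))"
    if t: "0 < t" "t \<le> 1" for t
  proof -
    have "t powr \<alpha> \<le> 1" using t assms(2) by (simp add: powr_le1)
    then show ?thesis using 1(3)[of "t powr \<alpha>"] t by (simp add: powr_powr)
  qed
  then show ?thesis unfolding vsmall_def using 1 by blast
qed

text \<open>The volume bound satisfied by bidiscs in two independent complex coordinates.\<close>

definition pair_bound :: "complex^3 \<Rightarrow> (complex^3 \<Rightarrow> complex) \<Rightarrow> (complex^3 \<Rightarrow> complex) \<Rightarrow> bool" where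
  "pair_bound P u w \<longleftrightarrow> continuous_on UNIV u \<and> continuous_on UNIV w \<and>
     (\<exists>\<rho>>0. \<exists>C\<ge>0. \<forall>a\<ge>0. \<forall>b\<ge>0.
       emeasure lborel {z \<in> ball P \<rho>. cmod (u z) \<le> a \<and> cmod (w z) \<le> b} \<le> ennreal (C * a\<^sup>2 * b\<^sup>2))"

lemma pair_boundI:
  assumes "continuous_on UNIV u" "continuous_on UNIV w"
    and "\<exists>\<rho>>0. \<forall>z \<xi> \<eta>. z \<in> ball P \<rho> \<longrightarrow> z + \<xi> *s X + \<eta> *s Y \<in> ball P \<rho> \<longrightarrow>
        cmod (u (z + \<xi> *s X + \<eta> *s Y) - u z - \<xi>) \<le> max (cmod \<xi>) (cmod \<eta>) / 4"
    and "\<exists>\<rho>>0. \<forall>z \<xi> \<eta>. z \<in> ball P \<rho> \<longrightarrow> z + \<xi> *s X + \<eta> *s Y \<in> ball P \<rho> \<longrightarrow>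
        cmod (w (z + \<xi> *s X + \<eta> *s Y) - w z - \<eta>) \<le> max (cmod \<xi>) (cmod \<eta>) / 4"
  shows "pair_bound P u w"
proof -
  from assms(3) obtain \<rho>1 where r1: "\<rho>1 > 0" "\<And>z \<xi> \<eta>. z \<in> ball P \<rho>1 \<Longrightarrow> z + \<xi> *s X + \<eta> *s Y \<in> ball P \<rho>1 \<Longrightarrow>
        cmod (u (z + \<xi> *s X + \<eta> *s Y) - u z - \<xi>) \<le> max (cmod \<xi>) (cmod \<eta>) / 4" by blast
  from assms(4) obtain \<rho>2 where r2: "\<rho>2 > 0" "\<And>z \<xi> \<eta>. z \<in> ball P \<rho>2 \<Longrightarrow> z + \<xi> *s X + \<eta> *s Y \<in> ball P \<rho>2 \<Longrightarrow>
        cmod (w (z + \<xi> *s X + \<eta> *s Y) - w z - \<eta>) \<le> max (cmod \<xi>) (cmod \<eta>) / 4" by blast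
  let ?r = "min \<rho>1 \<rho>2"
  obtain C where C: "0 \<le> C" "\<And>a b. 0 \<le> a \<Longrightarrow> 0 \<le> b \<Longrightarrow>
      emeasure lborel {z \<in> ball P ?r. cmod (u z) \<le> a \<and> cmod (w z) \<le> b} \<le> ennreal (C * a\<^sup>2 * b\<^sup>2)"
  proof (rule emeasure_two_functions_le[OF assms(1,2), of ?r P X Y])
    show "0 < ?r" using r1 r2 by simp
    show "\<And>z \<xi> \<eta>. z \<in> ball P ?r \<Longrightarrow> z + \<xi> *s X + \<eta> *s Y \<in> ball P ?r \<Longrightarrow>
        cmod (u (z + \<xi> *s X + \<eta> *s Y) - u z - \<xi>) \<le> max (cmod \<xi>) (cmod \<eta>) / 4"
      by (rule r1(2)) auto
    show "\<And>z \<xi> \<eta>. z \<in> ball P ?r \<Longrightarrow> z + \<xi> *s X + \<eta> *s Y \<in> ball P ?r \<Longrightarrow>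
        cmod (w (z + \<xi> *s X + \<eta> *s Y) - w z - \<eta>) \<le> max (cmod \<xi>) (cmod \<eta>) / 4"
      by (rule r2(2)) auto
  qed blast
  have "?r > 0" using r1(1) r2(1) by simp
  then show ?thesis unfolding pair_bound_def using assms(1,2) C by blast
qed

text \<open>With \<open>D\<close> the increment, the error is
  \<open>bil q (z - P) D + bil q D D / 2\<close> by polarisation, and both \<open>z - P\<close> and
  \<open>D\<close> have length of order \<open>\<rho>\<close>.\<close>

lemma conic_increment:
  assumes q: "homogeneous 2 q"
  shows "\<exists>\<rho>>0. \<forall>z \<xi> \<eta>. z \<in> ball P \<rho> \<longrightarrow> z + \<xi> *s X + \<eta> *s Y \<in> ball P \<rho> \<longrightarrow>
    cmod (ev q (z + \<xi> *s X + \<eta> *s Y) - ev q z - (bil q P X * \<xi> + bil q P Y * \<eta>)) \<le> max (cmod \<xi>) (cmod \<eta>) / 4"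
proof -
  define c where "c = cmod (qcoef q 2 0 0) + cmod (qcoef q 0 2 0) + cmod (qcoef q 0 0 2)
     + cmod (qcoef q 1 1 0) + cmod (qcoef q 1 0 1) + cmod (qcoef q 0 1 1)"
  have c0: "c \<ge> 0" by (simp add: c_def)
  have t: "cmod (x $ i * y $ j) \<le> norm x * norm y" for x y :: "complex^3" and i j
    unfolding norm_mult by (intro mult_mono Finite_Cartesian_Product.norm_nth_le) auto
  have B: "cmod (bil q x y) \<le> 2 * c * (norm x * norm y)" for x y
  proof -
    let ?m = "norm x * norm y"
    have a: "cmod (2 * k * w) \<le> 2 * cmod k * ?m" if "cmod w \<le> ?m" for k w
      using mult_left_mono[OF that, of "2 * cmod k"] by (simp add: norm_mult)
    have b: "cmod (k * (w + w')) \<le> 2 * cmod k * ?m" if "cmod w \<le> ?m" "cmod w' \<le> ?m" for k w w'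
    proof -
      have "cmod (w + w') \<le> 2 * ?m" using norm_triangle_ineq[of w w'] that by linarith
      from mult_left_mono[OF this, of "cmod k"] show ?thesis by (simp add: norm_mult mult_ac)
    qed
    have "cmod (bil q x y) \<le> 2 * cmod (qcoef q 2 0 0) * ?m + 2 * cmod (qcoef q 0 2 0) * ?m + 2 * cmod (qcoef q 0 0 2) * ?m
        + 2 * cmod (qcoef q 1 1 0) * ?m + 2 * cmod (qcoef q 1 0 1) * ?m + 2 * cmod (qcoef q 0 1 1) * ?m"
      unfolding bil_def by (intro norm_triangle_mono a b t)
    also have "\<dots> = 2 * c * ?m" by (simp add: c_def algebra_simps)
    finally show ?thesis .
  qed
  define M where "M = norm X + norm Y"
  have M0: "M \<ge> 0" by (simp add: M_def)
  \<comment> \<open>By \<open>norm D \<le> m * M\<close> and \<open>norm D \<le> 2 * \<rho>\<close>,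
    twice the error is at most \<open>8 * c * \<rho> * m * M\<close>, which this choice makes at
    most \<open>m / 2\<close>. The summand 1 keeps the denominator positive.\<close>
  define \<rho> where "\<rho> = 1 / (16 * c * M + 1)"
  have den: "16 * c * M + 1 > 0" using c0 M0 by (simp add: add_nonneg_pos)
  have rho: "\<rho> > 0" "16 * c * M * \<rho> \<le> 1"
    using den by (simp_all add: \<rho>_def divide_le_eq)
  show ?thesis
  proof (intro exI[of _ \<rho>] conjI rho(1) allI impI)
    fix z \<xi> \<eta> assume z: "z \<in> ball P \<rho>" "z + \<xi> *s X + \<eta> *s Y \<in> ball P \<rho>"
    define D where "D = \<xi> *s X + \<eta> *s Y"
    define m where "m = max (cmod \<xi>) (cmod \<eta>)"
    have m0: "m \<ge> 0" by (simp add: m_def le_max_iff_disj)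
    have zD: "z + \<xi> *s X + \<eta> *s Y = z + D" by (simp add: D_def)
    have D1: "norm D \<le> m * M"
    proof -
      have "norm D \<le> cmod \<xi> * norm X + cmod \<eta> * norm Y"
        unfolding D_def norm_vector_scalar_mult[symmetric] by (rule norm_triangle_ineq)
      also have "\<dots> \<le> m * norm X + m * norm Y" by (intro add_mono mult_right_mono) (auto simp: m_def)
      finally show ?thesis by (simp add: M_def distrib_left)
    qed
    have D2: "norm D \<le> 2 * \<rho>"
    proof -
      have "norm D = dist (z + D) z" by (simp add: dist_norm)
      also have "\<dots> \<le> dist P (z + D) + dist P z" by (metis dist_triangle3 dist_commute)
      finally show ?thesis using z unfolding zD by simp
    qed
    have zP: "norm (z - P) \<le> \<rho>" using z(1) by (simp add: dist_norm norm_minus_commute)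
    have "2 * (ev q (z + D) - ev q z - (bil q P X * \<xi> + bil q P Y * \<eta>)) = 2 * bil q (z - P) D + bil q D D"
      unfolding ev_add[OF q] bil_same[OF q] by (simp add: bil_simps D_def algebra_simps)
    then have "2 * cmod (ev q (z + D) - ev q z - (bil q P X * \<xi> + bil q P Y * \<eta>)) = cmod (2 * bil q (z - P) D + bil q D D)"
      by (metis norm_mult norm_numeral)
    also have "\<dots> \<le> 2 * cmod (bil q (z - P) D) + cmod (bil q D D)"
      using norm_triangle_ineq[of "2 * bil q (z - P) D" "bil q D D"] by (simp add: norm_mult)
    also have "\<dots> \<le> 2 * (2 * c * (norm (z - P) * norm D)) + 2 * c * (norm D * norm D)"
      using B[of "z - P" D] B[of D D] by linarith
    also have "\<dots> \<le> 2 * (2 * c * (\<rho> * norm D)) + 2 * c * (2 * \<rho> * norm D)"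
      using zP D2 c0 by (intro add_mono mult_left_mono mult_right_mono) auto
    also have "\<dots> = 8 * c * \<rho> * norm D" by simp
    also have "\<dots> \<le> 8 * c * \<rho> * (m * M)" using D1 c0 rho by (intro mult_left_mono) auto
    also have "\<dots> = (16 * c * M * \<rho>) * m / 2" by simp
    also have "\<dots> \<le> 1 * m / 2" using rho(2) m0 by (intro divide_right_mono mult_right_mono) auto
    finally show "cmod (ev q (z + \<xi> *s X + \<eta> *s Y) - ev q z - (bil q P X * \<xi> + bil q P Y * \<eta>)) \<le> max (cmod \<xi>) (cmod \<eta>) / 4"
      unfolding zD m_def by simp
  qed
qed

lemma continuous_on_ev_UNIV: "continuous_on UNIV (ev q)"
  using continuous_on_ev[of UNIV "\<lambda>x. x" q] by simp

lemma pair_bound_transv: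
  assumes "homogeneous 2 p" "homogeneous 2 q" "transv p q P"
  shows "pair_bound P (ev p) (ev q)"
proof -
  obtain X Y where XY: "bil p P X = 1" "bil q P X = 0" "bil p P Y = 0" "bil q P Y = 1"
    using assms(3) unfolding transv_def by blast
  show ?thesis
    by (rule pair_boundI[of _ _ _ X Y])
       (use conic_increment[OF assms(1), of P X Y] conic_increment[OF assms(2), of P X Y] XY continuous_on_ev_UNIV in auto)
qed

text \<open>A multiple of \<open>T\<close> moves only \<open>l\<close>, to first order; a vector on
  which the differential of \<open>q\<close> is nonzero, corrected by a multiple of
  \<open>T\<close>, moves only \<open>q\<close>.\<close>

lemma pair_bound_linear:
  assumes q: "homogeneous 2 q" and l: "continuous_on UNIV l" "\<And>x y. l (x + y) = l x + l y" "\<And>c x. l (c *s x) = c * l x"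
    and T: "bil q P T = 0" "l T \<noteq> 0" and N: "bil q P N \<noteq> 0"
  shows "pair_bound P (ev q) l"
proof -
  define Y where "Y = (1 / l T) *s T"
  define X where "X = (1 / bil q P N) *s (N + (- l N / l T) *s T)"
  have Y: "bil q P Y = 0" "l Y = 1" using T by (simp_all add: Y_def bil_simps l)
  have X: "bil q P X = 1" "l X = 0" unfolding X_def l bil_simps using T N by simp_all
  have "l (z + \<xi> *s X + \<eta> *s Y) - l z - \<eta> = 0" for z \<xi> \<eta> by (simp add: l X Y)
  then have 2: "\<exists>\<rho>>0. \<forall>z \<xi> \<eta>. z \<in> ball P \<rho> \<longrightarrow> z + \<xi> *s X + \<eta> *s Y \<in> ball P \<rho> \<longrightarrow>
        cmod (l (z + \<xi> *s X + \<eta> *s Y) - l z - \<eta>) \<le> max (cmod \<xi>) (cmod \<eta>) / 4"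
    by (intro exI[of _ 1]) (auto simp: le_max_iff_disj)
  have 1: "\<exists>\<rho>>0. \<forall>z \<xi> \<eta>. z \<in> ball P \<rho> \<longrightarrow> z + \<xi> *s X + \<eta> *s Y \<in> ball P \<rho> \<longrightarrow>
        cmod (ev q (z + \<xi> *s X + \<eta> *s Y) - ev q z - \<xi>) \<le> max (cmod \<xi>) (cmod \<eta>) / 4"
    using conic_increment[OF q, of P X Y] X Y by simp
  show ?thesis by (rule pair_boundI[OF continuous_on_ev_UNIV l(1) 1 2])
qed

lemma vsmall_pair:
  assumes pb: "pair_bound P u w" and AB: "0 \<le> A" "0 \<le> B"
  shows "vsmall P (2 * \<alpha> + 2 * \<beta>) (\<lambda>t x. cmod (u x) \<le> A * t powr \<alpha> \<and> cmod (w x) \<le> B * t powr \<beta>)"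
proof -
  obtain \<rho> C where 1: "\<rho> > 0" "C \<ge> 0" "\<And>a b. a \<ge> 0 \<Longrightarrow> b \<ge> 0 \<Longrightarrow>
       emeasure lborel {z \<in> ball P \<rho>. cmod (u z) \<le> a \<and> cmod (w z) \<le> b} \<le> ennreal (C * a\<^sup>2 * b\<^sup>2)"
    and cont: "continuous_on UNIV u" "continuous_on UNIV w"
    using pb unfolding pair_bound_def by blast
  have meas: "{z \<in> ball P \<rho>. cmod (u z) \<le> a \<and> cmod (w z) \<le> b} \<in> sets lborel" for a b
  proof -
    have "{z. cmod (u z) \<le> a} \<in> sets borel" "{z. cmod (w z) \<le> b} \<in> sets borel"
      using cont by (auto intro!: borel_closed closed_Collect_le continuous_intros)
    moreover have "{z \<in> ball P \<rho>. cmod (u z) \<le> a \<and> cmod (w z) \<le> b} = ball P \<rho> \<inter> {z. cmod (u z) \<le> a} \<inter> {z. cmod (w z) \<le> b}"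
      by auto
    ultimately show ?thesis by (simp only: sets_lborel) (intro sets.Int borel_open[OF open_ball])
  qed
  show ?thesis
    unfolding vsmall_def
  proof (rule exI[of _ \<rho>], intro conjI exI[of _ "C * A\<^sup>2 * B\<^sup>2"] allI impI)
    fix t :: real assume t: "0 < t \<and> t \<le> 1"
    have eq: "C * (A * t powr \<alpha>)\<^sup>2 * (B * t powr \<beta>)\<^sup>2 = C * A\<^sup>2 * B\<^sup>2 * t powr (2 * \<alpha> + 2 * \<beta>)"
    proof -
      have sq: "(t powr x)\<^sup>2 = t powr (2 * x)" for x
        unfolding power2_eq_square mult_2 powr_add by (rule refl)
      show ?thesis unfolding power_mult_distrib sq powr_add by (simp only: mult_ac)
    qed
    have "0 \<le> A * t powr \<alpha>" "0 \<le> B * t powr \<beta>" using AB by simp_all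
    from 1(3)[OF this, unfolded eq] meas[of "A * t powr \<alpha>" "B * t powr \<beta>"]
    show "\<exists>M\<in>sets lborel. {x \<in> ball P \<rho>. cmod (u x) \<le> A * t powr \<alpha> \<and> cmod (w x) \<le> B * t powr \<beta>} \<subseteq> M
        \<and> emeasure lborel M \<le> ennreal (C * A\<^sup>2 * B\<^sup>2 * t powr (2 * \<alpha> + 2 * \<beta>))"
      by blast
  qed (use 1 in auto)
qed

lemma eventually_norm_le:
  assumes "continuous_on UNIV u" "cmod (u P) < c"
  shows "eventually (\<lambda>x. cmod (u x) \<le> c) (nhds P)"
proof -
  have "open {x. cmod (u x) < c}"
    using assms(1) by (intro open_Collect_less continuous_intros) auto
  then show ?thesis
    by (rule eventually_mono[OF eventually_nhds_in_open]) (use assms(2) in auto)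
qed

text \<open>For true coordinates a logarithm accompanies the exponent 2, hence \<open>e < 2\<close>.
  The region is covered by finitely many boxes: if \<open>j < N\<close> is maximal with
  \<open>cmod (u x) \<le> t powr (j / N)\<close>, then
  \<open>cmod (w x) \<le> A * t powr (1 - (j + 1) / N)\<close>, and such a box has exponent
  \<open>2 - 2 / N\<close>, at least \<open>e\<close> for large \<open>N\<close>. The box
  \<open>G\<close> takes the case \<open>j = N\<close>.\<close>

lemma vsmall_product:
  assumes pb: "pair_bound P u w" and 0: "u P = 0" "w P = 0" and A: "0 \<le> A" and e: "e < 2"
  shows "vsmall P e (\<lambda>t x. cmod (u x) * cmod (w x) \<le> A * t)"
proof -
  have cont: "continuous_on UNIV u" "continuous_on UNIV w" using pb by (auto simp: pair_bound_def)
  obtain N where N: "real N > 2 / (2 - e)" using reals_Archimedean2 by blast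
  have "2 / (2 - e) > 0" using e by simp
  then have N0: "real N > 0" using N by linarith
  have eN: "e \<le> 2 - 2 / real N"
    using N N0 e by (simp add: field_simps)
  define F where "F = (\<lambda>(j::nat) t x. cmod (u x) \<le> 1 * t powr (real j / N) \<and> cmod (w x) \<le> A * t powr (1 - (real j + 1) / N))"
  have F: "vsmall P e (F j)" for j
    unfolding F_def
    by (rule vsmall_mono[OF vsmall_pair[OF pb _ A, of 1 "real j / N" "1 - (real j + 1) / N"]])
       (use eN N0 in \<open>auto simp: field_simps intro: always_eventually\<close>)
  define G where "G = (\<lambda>t x. cmod (u x) \<le> 1 * t powr 1 \<and> cmod (w x) \<le> 1 * t powr 0)"
  have G: "vsmall P e G"
    unfolding G_def
    by (rule vsmall_mono[OF vsmall_pair[OF pb, of 1 1 1 0]]) (use e in \<open>auto intro: always_eventually\<close>)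
  have all: "vsmall P e (\<lambda>t x. (\<exists>j<N. F j t x) \<or> G t x)"
    by (intro vsmall_or vsmall_Ex F G)
  show ?thesis
  proof (rule vsmall_mono[OF all order.refl])
    have "eventually (\<lambda>x. cmod (u x) \<le> 1 \<and> cmod (w x) \<le> 1) (nhds P)"
      using eventually_norm_le[OF cont(1), of P 1] eventually_norm_le[OF cont(2), of P 1] 0
      by (simp add: eventually_conj)
    then show "\<forall>\<^sub>F x in nhds P. \<forall>t>0. t \<le> 1 \<longrightarrow> cmod (u x) * cmod (w x) \<le> A * t \<longrightarrow> (\<exists>j<N. F j t x) \<or> G t x"
    proof (rule eventually_mono, intro allI impI)
      fix x and t :: real
      assume b: "cmod (u x) \<le> 1 \<and> cmod (w x) \<le> 1" and t: "0 < t" "t \<le> 1"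
        and uw: "cmod (u x) * cmod (w x) \<le> A * t"
      define S where "S = {j. j \<le> N \<and> cmod (u x) \<le> t powr (real j / N)}"
      have S: "finite S" "0 \<in> S" using b t by (auto simp: S_def)
      define j where "j = Max S"
      have j: "j \<in> S" unfolding j_def using S by (intro Max_in) auto
      show "(\<exists>j<N. F j t x) \<or> G t x"
      proof (cases "j = N")
        case True
        then have "cmod (u x) \<le> t" using j N0 t by (simp add: S_def)
        then show ?thesis using b t by (simp add: G_def)
      next
        case False
        then have jN: "j < N" using j by (simp add: S_def)
        have "Suc j \<notin> S"
        proof
          assume "Suc j \<in> S"
          then have "Suc j \<le> j" unfolding j_def using S by (metis Max_ge)
          then show False by simp
        qed
        then have gt: "cmod (u x) > t powr ((real j + 1) / N)" using jN by (auto simp: S_def add.commute)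
        have "t powr ((real j + 1) / N) * cmod (w x) \<le> A * t"
          using order.trans[OF mult_right_mono[OF less_imp_le[OF gt]] uw] by simp
        then have "cmod (w x) \<le> A * t / t powr ((real j + 1) / N)"
          using t by (simp add: pos_le_divide_eq mult.commute)
        also have "\<dots> = A * t powr (1 - (real j + 1) / N)"
          using t by (simp add: powr_diff)
        finally have "F j t x" using j by (simp add: F_def S_def)
        then show ?thesis using jN by blast
      qed
    qed
  qed
qed

text \<open>\<open>P\<close> lies in the radical of \<open>q - \<kappa> p\<close>, which is
  therefore a binary quadratic form in the coordinates along \<open>T\<close> and \<open>N\<close>.
  Its value at \<open>T\<close> is nonzero, and completing the square with a root \<open>s\<close>
  of the discriminant splits it into two linear forms, both nonzero at \<open>T\<close>.\<close>

lemma tangent_difference_factorsE: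
  assumes p: "smooth_conic p" and q: "smooth_conic q" and P: "P \<noteq> 0" "ev p P = 0" "ev q P = 0"
    and \<kappa>: "\<And>x. bil q P x = \<kappa> * bil p P x" and T: "bil p P T = 0" "ev q T \<noteq> \<kappa> * ev p T"
  obtains l1 l2 :: "complex^3 \<Rightarrow> complex" and c where
    "\<And>l x y. l = l1 \<or> l = l2 \<Longrightarrow> l (x + y) = l x + l y" "\<And>l c x. l = l1 \<or> l = l2 \<Longrightarrow> l (c *s x) = c * l x"
    "\<And>l. l = l1 \<or> l = l2 \<Longrightarrow> continuous_on UNIV l" "\<And>l. l = l1 \<or> l = l2 \<Longrightarrow> l T \<noteq> 0"
    "\<And>x. l1 x * l2 x = c * (ev q x - \<kappa> * ev p x)"
proof -
  note hp = smooth_conicD(1)[OF p] and hq = smooth_conicD(1)[OF q]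
  define h where "h = (\<lambda>x. ev q x - \<kappa> * ev p x)"
  define b where "b = (\<lambda>x y. bil q x y - \<kappa> * bil p x y)"
  have b_simps: "b (x + x') y = b x y + b x' y" "b y (x + x') = b y x + b y x'"
    "b (c *s x) y = c * b x y" "b y (c *s x) = c * b y x" for x x' y c
    by (simp_all add: b_def bil_simps algebra_simps)
  have h_add: "h (x + y) = h x + h y + b x y" and h_scale: "h (c *s x) = c\<^sup>2 * h x" for x y c
    by (simp_all add: h_def b_def ev_add[OF hp] ev_add[OF hq] ev_scale2[OF hp] ev_scale2[OF hq] algebra_simps)
  have b_comm: "b x y = b y x" for x y by (simp add: b_def bil_commute)
  have b_same: "b x x = 2 * h x" for x
    by (simp add: b_def h_def bil_same[OF hp] bil_same[OF hq] algebra_simps)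
  have bP: "b P x = 0" for x by (simp add: b_def \<kappa>)
  have hP: "h P = 0" using P by (simp add: h_def)
  have hT: "h T \<noteq> 0" using T by (simp add: h_def)
  obtain N0 where N0: "bil p P N0 \<noteq> 0" using smooth_conicD(2)[OF p, of P] P by blast
  define N where "N = (1 / bil p P N0) *s N0"
  have N: "bil p P N = 1" using N0 by (simp add: N_def bil_simps)
  have pP: "bil p P P = 0" using bil_same[OF hp, of P] P by simp
  have n: "bil p P (a *s P + y *s T + v *s N) = v" for a y v
    by (simp add: bil_simps pP T N)
  have hx: "h (a *s P + y *s T + v *s N) = y\<^sup>2 * h T + y * v * b T N + v\<^sup>2 * h N" for a y v
    by (simp add: h_add h_scale b_simps bP hP b_comm[of N T] algebra_simps)
  have ind: "a = 0 \<and> y = 0 \<and> v = 0" if "a *s P + y *s T + v *s N = 0" for a y v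
  proof -
    have v: "v = 0" using n[of a y v] that by simp
    have "h (0::complex^3) = 0" using h_scale[of 0 P] by simp
    then have y: "y = 0" using hx[of a y v] that v hT by simp
    have "a *s P = 0" using that v y by simp
    then show ?thesis using v y P by simp
  qed
  define s where "s = csqrt ((b T N)\<^sup>2 - 4 * h T * h N)"
  have s: "s\<^sup>2 = (b T N)\<^sup>2 - 4 * h T * h N" by (simp add: s_def)
  define l1 where "l1 = (\<lambda>x. b x T - s * bil p P x)"
  define l2 where "l2 = (\<lambda>x. b x T + s * bil p P x)"
  have prod: "l1 x * l2 x = (4 * h T) * h x" for x
  proof -
    obtain a y v where x: "x = a *s P + y *s T + v *s N"
      by (rule span3[of P T N x]) (rule ind)
    have bx: "b x T = 2 * y * h T + v * b T N"
      unfolding x by (simp add: b_simps bP b_same b_comm[of N T])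
    have "l1 x * l2 x = (b x T)\<^sup>2 - s\<^sup>2 * (bil p P x)\<^sup>2"
      by (simp add: l1_def l2_def power2_eq_square algebra_simps)
    also have "bil p P x = v" unfolding x n ..
    finally show ?thesis
      unfolding bx s unfolding x hx by (simp add: power2_eq_square algebra_simps)
  qed
  show thesis
  proof (rule that[of l1 l2 "4 * h T"])
    show "l (x + y) = l x + l y" if "l = l1 \<or> l = l2" for l x y
      using that by (auto simp: l1_def l2_def b_simps bil_simps algebra_simps)
    show "l (c *s x) = c * l x" if "l = l1 \<or> l = l2" for l c x
      using that by (auto simp: l1_def l2_def b_simps bil_simps algebra_simps)
    show "continuous_on UNIV l" if "l = l1 \<or> l = l2" for l
      using that unfolding l1_def l2_def b_def bil_def by (auto intro!: continuous_intros)
    show "l T \<noteq> 0" if "l = l1 \<or> l = l2" for l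
      using that hT by (auto simp: l1_def l2_def b_same T)
    show "l1 x * l2 x = 4 * h T * (ev q x - \<kappa> * ev p x)" for x
      using prod[of x] by (simp add: h_def)
  qed
qed

text \<open>Let \<open>a \<le> b\<close> be the two absolute values.  Since \<open>b\<close> dominates \<open>\<bar>q - \<kappa> p\<bar>\<close>, a product of two
  linear forms, \<open>a b \<le> A t\<close> forces \<open>a \<lesssim> t\<^bsup>1/2\<^esup>\<close>, and \<open>a \<le> t\<^bsup>2/3\<^esup>\<close> or one linear form is \<open>\<lesssim> t\<^bsup>1/6\<^esup>\<close>.\<close>

lemma vsmall_tangent:
  assumes p: "smooth_conic p" and q: "smooth_conic q" and P: "P \<noteq> 0" "ev p P = 0" "ev q P = 0"
    and tang: "simply_tangent p q P" and A: "0 \<le> A"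
  shows "vsmall P (4/3) (\<lambda>t x. cmod (ev p x) * cmod (ev q x) \<le> A * t)"
proof -
  obtain \<kappa> T where kT: "\<And>x. bil q P x = \<kappa> * bil p P x" "bil p P T = 0" "ev q T \<noteq> \<kappa> * ev p T"
    using tang unfolding simply_tangent_def by blast
  obtain l1 l2 :: "complex^3 \<Rightarrow> complex" and c where
    lin: "\<And>l x y. l = l1 \<or> l = l2 \<Longrightarrow> l (x + y) = l x + l y" "\<And>l c x. l = l1 \<or> l = l2 \<Longrightarrow> l (c *s x) = c * l x"
    and cont: "\<And>l. l = l1 \<or> l = l2 \<Longrightarrow> continuous_on UNIV l" and lT: "\<And>l. l = l1 \<or> l = l2 \<Longrightarrow> l T \<noteq> 0"
    and prod: "\<And>x. l1 x * l2 x = c * (ev q x - \<kappa> * ev p x)"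
    by (rule tangent_difference_factorsE[OF p q P kT]) (rule that)
  obtain N where N: "bil p P N \<noteq> 0" using smooth_conicD(2)[OF p, of P] P by blast
  obtain N' where N': "bil q P N' \<noteq> 0" using smooth_conicD(2)[OF q, of P] P by blast
  have qT: "bil q P T = 0" using kT by simp
  have "pair_bound P (ev p) l" "pair_bound P (ev q) l" if l: "l = l1 \<or> l = l2" for l
    by (rule pair_bound_linear[OF smooth_conicD(1)[OF p] cont[OF l] lin(1)[OF l] lin(2)[OF l] kT(2) lT[OF l] N])
       (rule pair_bound_linear[OF smooth_conicD(1)[OF q] cont[OF l] lin(1)[OF l] lin(2)[OF l] qT lT[OF l] N'])
  then have pb: "pair_bound P (ev r) l" if "r = p \<or> r = q" "l = l1 \<or> l = l2" for r l
    using that by auto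
  \<comment> \<open>This is \<open>E * A\<close> for the factor \<open>E\<close> below. If both
    linear forms exceed \<open>sqrt K * t powr (1/6)\<close>, then \<open>E * b\<close> exceeds
    \<open>E * A * t powr (1/3)\<close>, which together with \<open>a > t powr (2/3)\<close>
    contradicts \<open>a * b \<le> A * t\<close>.\<close>
  define K where "K = cmod c * (1 + cmod \<kappa>) * A"
  have K: "K \<ge> 0" using A by (simp add: K_def)
  define L where "L = cmod (l1 P) + 1"
  \<comment> \<open>Both shapes of box have exponent 4/3: \<open>2 * (2/3)\<close> for
    \<open>F\<close>, where the linear form is merely bounded, and
    \<open>2 * (1/2) + 2 * (1/6)\<close> for \<open>G\<close>.\<close>
  define F where "F = (\<lambda>r t x. cmod (ev r x) \<le> 1 * t powr (2/3) \<and> cmod (l1 x) \<le> L * t powr 0)"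
  define G where "G = (\<lambda>r l t x. cmod (ev r x) \<le> sqrt A * t powr (1/2) \<and> cmod (l x) \<le> sqrt K * t powr (1/6))"
  have F: "vsmall P (4/3) (F r)" if "r = p \<or> r = q" for r
    using vsmall_pair[OF pb[OF that, of l1], of 1 L "2/3" 0] unfolding F_def L_def by simp
  have G: "vsmall P (4/3) (G r l)" if "r = p \<or> r = q" "l = l1 \<or> l = l2" for r l
    using vsmall_pair[OF pb[OF that], of "sqrt A" "sqrt K" "1/2" "1/6"] A K unfolding G_def by simp
  have all: "vsmall P (4/3) (\<lambda>t x. (F p t x \<or> F q t x) \<or> (G p l1 t x \<or> G p l2 t x) \<or> (G q l1 t x \<or> G q l2 t x))"
    by (intro vsmall_or F G) auto
  have key: "(cmod (ev r x) \<le> t powr (2/3)) \<or> G r l1 t x \<or> G r l2 t x"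
    if le: "cmod (ev r x) \<le> cmod (ev r' x)" and rr: "(r, r') = (p, q) \<or> (r, r') = (q, p)"
      and t: "0 < t" and ab: "cmod (ev p x) * cmod (ev q x) \<le> A * t" for r r' t x
  proof (rule ccontr)
    assume neg: "\<not> ?thesis"
    define a b where "a = cmod (ev r x)" and "b = cmod (ev r' x)"
    have ab': "a * b \<le> A * t" "a \<le> b" "a \<ge> 0" using ab le rr by (auto simp: a_def b_def mult.commute)
    have a23: "a > t powr (2/3)" using neg by (auto simp: a_def)
    have "a\<^sup>2 \<le> A * t" using ab' mult_left_mono[of a b a] by (simp add: power2_eq_square)
    then have "sqrt (a\<^sup>2) \<le> sqrt (A * t)" by (rule real_sqrt_le_mono)
    then have a12: "a \<le> sqrt A * t powr (1/2)"
      using ab' t by (simp add: real_sqrt_mult powr_half_sqrt)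
    then have l: "cmod (l x) > sqrt K * t powr (1/6)" if "l = l1 \<or> l = l2" for l
      using neg that by (auto simp: G_def a_def)
    define E where "E = cmod c * (1 + cmod \<kappa>)"
    have E0: "E \<ge> 0" by (simp add: E_def)
    have strict: "sqrt K * t powr (1/6) * (sqrt K * t powr (1/6)) < cmod (l1 x) * cmod (l2 x)"
      using l[of l1] l[of l2] K by (intro mult_strict_mono') auto
    have Klt: "K * t powr (1/3) < E * b"
    proof -
      have "K * t powr (1/3) = (sqrt K * t powr (1/6)) * (sqrt K * t powr (1/6))"
      proof -
        have "t powr (1/6) * t powr (1/6) = t powr (1/3)" unfolding powr_add[symmetric] by simp
        moreover have "(sqrt K * t powr (1/6)) * (sqrt K * t powr (1/6)) = (sqrt K * sqrt K) * (t powr (1/6) * t powr (1/6))"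
          by (simp only: mult_ac)
        ultimately show ?thesis using K by simp
      qed
      also have "\<dots> < cmod (l1 x) * cmod (l2 x)" by (rule strict)
      also have "\<dots> = cmod c * cmod (ev q x - \<kappa> * ev p x)" by (metis norm_mult prod)
      also have "\<dots> \<le> cmod c * ((1 + cmod \<kappa>) * b)"
      proof (intro mult_left_mono norm_ge_zero)
        have "cmod (ev q x) \<le> b" "cmod (ev p x) \<le> b" using ab'(2) rr by (auto simp: a_def b_def)
        then have "cmod (ev q x) + cmod \<kappa> * cmod (ev p x) \<le> b + cmod \<kappa> * b" by (intro add_mono mult_left_mono) auto
        then show "cmod (ev q x - \<kappa> * ev p x) \<le> (1 + cmod \<kappa>) * b"
          using norm_triangle_ineq4[of "ev q x" "\<kappa> * ev p x"] by (simp add: norm_mult distrib_right)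
      qed
      finally show ?thesis by (simp add: E_def mult.assoc)
    qed
    have "E * (A * t) = (K * t powr (1/3)) * t powr (2/3)"
    proof -
      have "t powr (1/3) * t powr (2/3) = t" unfolding powr_add[symmetric] using t by simp
      then show ?thesis by (simp add: K_def E_def mult.assoc)
    qed
    also have "\<dots> \<le> (K * t powr (1/3)) * a"
      using a23 K by (intro mult_left_mono) auto
    also have "\<dots> < (E * b) * a"
      using Klt a23 t by (intro mult_strict_right_mono) (auto intro: less_trans[OF _ a23])
    also have "\<dots> = E * (a * b)" by simp
    also have "\<dots> \<le> E * (A * t)" using ab' E0 by (intro mult_left_mono) auto
    finally show False by simp
  qed
  show ?thesis
  proof (rule vsmall_mono[OF all order.refl])
    have "eventually (\<lambda>x. cmod (l1 x) \<le> L) (nhds P)"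
      by (rule eventually_norm_le) (auto simp: L_def cont)
    then show "\<forall>\<^sub>F x in nhds P. \<forall>t>0. t \<le> 1 \<longrightarrow> cmod (ev p x) * cmod (ev q x) \<le> A * t \<longrightarrow>
       (F p t x \<or> F q t x) \<or> (G p l1 t x \<or> G p l2 t x) \<or> (G q l1 t x \<or> G q l2 t x)"
    proof (rule eventually_mono, intro allI impI)
      fix x and t :: real
      assume L: "cmod (l1 x) \<le> L" and t: "0 < t" "t \<le> 1" and ab: "cmod (ev p x) * cmod (ev q x) \<le> A * t"
      have "F r t x \<or> G r l1 t x \<or> G r l2 t x"
        if "cmod (ev r x) \<le> cmod (ev r' x)" "(r, r') = (p, q) \<or> (r, r') = (q, p)" for r r'
        using key[OF that t(1) ab] L t by (auto simp: F_def)
      from this[of p q] this[of q p]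
      show "(F p t x \<or> F q t x) \<or> (G p l1 t x \<or> G p l2 t x) \<or> (G q l1 t x \<or> G q l2 t x)"
        using linear[of "cmod (ev p x)" "cmod (ev q x)"] by blast
    qed
  qed
qed

text \<open>The case of a point off the curve: the set is empty while \<open>A * t < 1\<close>, and
  afterwards the volume of a fixed ball is at most that volume times
  \<open>(A * t)\<^sup>2\<close>.\<close>

lemma vsmall_constant:
  assumes A: "0 \<le> A" and e: "e \<le> 2"
  shows "vsmall P e (\<lambda>t x. 1 \<le> A * t)"
proof -
  have "emeasure lborel (ball P 1) < \<infinity>" by (rule emeasure_lborel_ball_finite)
  then obtain V where V: "V \<ge> 0" "emeasure lborel (ball P 1) = ennreal V"
    by (cases "emeasure lborel (ball P 1)") auto
  have "vsmall P 2 (\<lambda>t x. 1 \<le> A * t)"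
    unfolding vsmall_def
  proof (rule exI[of _ 1], intro conjI exI[of _ "V * A\<^sup>2"] allI impI)
    fix t :: real assume t: "0 < t \<and> t \<le> 1"
    show "\<exists>M\<in>sets lborel. {x \<in> ball P 1. 1 \<le> A * t} \<subseteq> M \<and> emeasure lborel M \<le> ennreal (V * A\<^sup>2 * t powr 2)"
    proof (cases "1 \<le> A * t")
      case True
      then have "1 \<le> (A * t)\<^sup>2" by (rule one_le_power)
      then have "V * 1 \<le> V * (A * t)\<^sup>2" using V by (intro mult_left_mono) auto
      also have "\<dots> = V * A\<^sup>2 * t powr 2" using t by (simp add: power_mult_distrib powr_numeral)
      finally have "emeasure lborel (ball P 1) \<le> ennreal (V * A\<^sup>2 * t powr 2)"
        unfolding V(2) by (intro ennreal_leI) simp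
      then show ?thesis by (intro bexI[of _ "ball P 1"]) auto
    next
      case False
      then show ?thesis by (intro bexI[of _ "{}"]) auto
    qed
  qed (use V in auto)
  then show ?thesis by (rule vsmall_mono) (use e in auto)
qed

text \<open>At a point on a single conic a second function has to be supplied. \<open>P\<close>
  itself is tangent to the cone \<open>q = 0\<close>, so a coordinate that does not vanish at
  \<open>P\<close> completes \<open>q\<close> to a pair.\<close>

lemma vsmall_single:
  assumes q: "smooth_conic q" and P: "P \<noteq> 0" "ev q P = 0" and A: "0 \<le> A" and e: "e \<le> 2"
  shows "vsmall P e (\<lambda>t x. cmod (ev q x) \<le> A * t)"
proof -
  obtain m where m: "P $ m \<noteq> 0" using P(1) by (auto simp: vec_eq_iff)
  obtain N where N: "bil q P N \<noteq> 0" using smooth_conicD(2)[OF q, of P] P by blast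
  note h = smooth_conicD(1)[OF q]
  have PP: "bil q P P = 0" using bil_same[OF h, of P] P by simp
  let ?l = "\<lambda>x::complex^3. x $ m"
  have pb: "pair_bound P (ev q) ?l"
    by (rule pair_bound_linear[OF h _ _ _ PP _ N]) (use m in \<open>auto intro!: continuous_intros\<close>)
  have s: "vsmall P (2 * 1 + 2 * 0) (\<lambda>t x. cmod (ev q x) \<le> A * t powr 1 \<and> cmod (?l x) \<le> (cmod (P $ m) + 1) * t powr 0)"
    by (rule vsmall_pair[OF pb A]) simp
  show ?thesis
  proof (rule vsmall_mono[OF s])
    have "eventually (\<lambda>x. cmod (?l x) \<le> cmod (P $ m) + 1) (nhds P)"
      by (rule eventually_norm_le) (auto intro!: continuous_intros)
    then show "\<forall>\<^sub>F x in nhds P. \<forall>t>0. t \<le> 1 \<longrightarrow> cmod (ev q x) \<le> A * t \<longrightarrow>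
        cmod (ev q x) \<le> A * t powr 1 \<and> cmod (?l x) \<le> (cmod (P $ m) + 1) * t powr 0"
      by (rule eventually_mono) auto
  qed (use e in simp)
qed

text \<open>Since \<open>(a b c)\<^sup>2 = (a b)(b c)(c a)\<close>, one of three pairwise products is at most \<open>(a b c)\<^bsup>2/3\<^esup>\<close>.\<close>

lemma vsmall_triple:
  assumes pb: "pair_bound P u v" "pair_bound P v w" "pair_bound P w u"
    and 0: "u P = 0" "v P = 0" "w P = 0" and A: "0 \<le> A" and e: "e < 4/3"
  shows "vsmall P e (\<lambda>t x. cmod (u x) * cmod (v x) * cmod (w x) \<le> A * t)"
proof -
  define B where "B = A powr (2/3)"
  have B: "0 \<le> B" by (simp add: B_def)
  have r: "vsmall P e (\<lambda>t x. cmod (u x) * cmod (v x) \<le> B * t powr (2/3))"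
    if "pair_bound P u v" "u P = 0" "v P = 0" for u v
    using vsmall_rescale[OF vsmall_product[OF that B, of "3/2 * e"], of "2/3"] e by simp
  have all: "vsmall P e (\<lambda>t x. cmod (u x) * cmod (v x) \<le> B * t powr (2/3) \<or>
      cmod (v x) * cmod (w x) \<le> B * t powr (2/3) \<or> cmod (w x) * cmod (u x) \<le> B * t powr (2/3))"
    by (intro vsmall_or r pb 0)
  show ?thesis
  proof (rule vsmall_mono[OF all order.refl], intro always_eventually allI impI, rule ccontr)
    fix x and t :: real
    assume t: "0 < t" and le: "cmod (u x) * cmod (v x) * cmod (w x) \<le> A * t"
      and neg: "\<not> (cmod (u x) * cmod (v x) \<le> B * t powr (2/3) \<or>
      cmod (v x) * cmod (w x) \<le> B * t powr (2/3) \<or> cmod (w x) * cmod (u x) \<le> B * t powr (2/3))"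
    let ?M = "B * t powr (2/3)"
    have M0: "?M \<ge> 0" using B by simp
    have sq: "?M * ?M * ?M = (A * t)\<^sup>2"
    proof -
      have "?M = (A * t) powr (2/3)" using A t by (simp add: B_def powr_mult)
      then have "?M * ?M * ?M = (A * t) powr (2/3 + 2/3 + 2/3)" by (simp only: powr_add)
      also have "\<dots> = (A * t)\<^sup>2" using A t by (cases "A = 0") (auto simp: powr_numeral)
      finally show ?thesis .
    qed
    have "?M * ?M * ?M < (cmod (u x) * cmod (v x)) * (cmod (v x) * cmod (w x)) * (cmod (w x) * cmod (u x))"
    proof -
      have n: "?M < cmod (u x) * cmod (v x)" "?M < cmod (v x) * cmod (w x)" "?M < cmod (w x) * cmod (u x)"
        using neg by auto
      show ?thesis
        by (rule mult_strict_mono'[OF mult_strict_mono'[OF n(1,2) M0 M0] n(3) mult_nonneg_nonneg[OF M0 M0] M0])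
    qed
    also have "\<dots> = (cmod (u x) * cmod (v x) * cmod (w x))\<^sup>2" by (simp add: power2_eq_square)
    also have "\<dots> \<le> (A * t)\<^sup>2" using le by (intro power_mono) auto
    finally show False unfolding sq by simp
  qed
qed

text \<open>Near \<open>P\<close> the conics that miss it are bounded below, which costs the
  constant \<open>A\<close>; the others are treated by their number and contact. The strict
  inequality \<open>e < 4/3\<close> comes from the triple points.\<close>

lemma vsmall_arrangement:
  assumes sm: "\<And>j. j < k \<Longrightarrow> smooth_conic (q j)" and mild: "mild_point q k P" and P: "P \<noteq> 0" and e: "e < 4/3"
  shows "vsmall P e (\<lambda>t x. cmod (ev (\<Prod>j<k. q j) x) \<le> t)"
proof -
  define J where "J = through q k P"
  have J: "J \<subseteq> {..<k}" "finite J" "\<And>j. j \<in> J \<Longrightarrow> smooth_conic (q j)" "\<And>j. j \<in> J \<Longrightarrow> ev (q j) P = 0"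
    using sm by (auto simp: J_def through_def)
  define R where "R = (\<lambda>x. \<Prod>j\<in>{..<k} - J. ev (q j) x)"
  have f: "ev (\<Prod>j<k. q j) x = R x * (\<Prod>j\<in>J. ev (q j) x)" for x
    unfolding eval_hom_prod[OF is_ring_hom_id] R_def by (rule prod.subset_diff[OF J(1)]) simp
  define c where "c = cmod (R P) / 2"
  have "R P \<noteq> 0" by (auto simp: R_def J_def through_def)
  then have c: "c > 0" by (simp add: c_def)
  have "continuous_on UNIV R" unfolding R_def by (intro continuous_intros)
  then have "open {x. c < cmod (R x)}" by (intro open_Collect_less continuous_intros)
  then have evR: "eventually (\<lambda>x. c < cmod (R x)) (nhds P)"
    by (rule eventually_mono[OF eventually_nhds_in_open]) (use c in \<open>auto simp: c_def\<close>)
  define A where "A = 1 / c"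
  have A: "A \<ge> 0" using c by (simp add: A_def)
  have main: "vsmall P e (\<lambda>t x. cmod (\<Prod>j\<in>J. ev (q j) x) \<le> A * t)"
  proof (cases "\<exists>i j. i \<noteq> j \<and> J = {i, j} \<and> simply_tangent (q i) (q j) P")
    case True
    then obtain i j where ij: "i \<noteq> j" "J = {i, j}" "simply_tangent (q i) (q j) P" by blast
    have "vsmall P (4/3) (\<lambda>t x. cmod (ev (q i) x) * cmod (ev (q j) x) \<le> A * t)"
      using ij J by (intro vsmall_tangent P A) auto
    then have "vsmall P (4/3) (\<lambda>t x. cmod (\<Prod>j\<in>J. ev (q j) x) \<le> A * t)"
      using ij by (simp add: norm_mult)
    then show ?thesis by (rule vsmall_mono) (use e in auto)
  next
    case False
    then have card: "card J \<le> 3" and tr: "\<And>i j. i \<in> J \<Longrightarrow> j \<in> J \<Longrightarrow> i \<noteq> j \<Longrightarrow> transv (q i) (q j) P"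
      using mild unfolding mild_point_def J_def[symmetric] by blast+
    have pb: "pair_bound P (ev (q i)) (ev (q j))" if "i \<in> J" "j \<in> J" "i \<noteq> j" for i j
      using pair_bound_transv[OF smooth_conicD(1) smooth_conicD(1) tr[OF that]] J(3) that by blast
    from card consider "card J = 0" | "card J = 1" | "card J = 2" | "card J = 3" by linarith
    then show ?thesis
    proof cases
      case 1
      then have "J = {}" using J by simp
      then show ?thesis using vsmall_constant[OF A, of e P] e by simp
    next
      case 2
      then obtain i where i: "J = {i}" by (auto simp: card_1_singleton_iff)
      then show ?thesis using vsmall_single[OF J(3)[of i] P J(4)[of i] A, of e] e by simp
    next
      case 3
      then obtain i j where ij: "J = {i, j}" "i \<noteq> j" by (auto simp: card_2_iff)
      then show ?thesis using vsmall_product[OF pb[of i j] J(4)[of i] J(4)[of j] A, of e] e by (simp add: norm_mult)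
    next
      case 4
      then obtain i j l where ijl: "J = {i, j, l}" "i \<noteq> j" "j \<noteq> l" "i \<noteq> l" by (auto simp: card_3_iff)
      have "vsmall P e (\<lambda>t x. cmod (ev (q i) x) * cmod (ev (q j) x) * cmod (ev (q l) x) \<le> A * t)"
        by (rule vsmall_triple[OF pb[of i j] pb[of j l] pb[of l i] J(4)[of i] J(4)[of j] J(4)[of l] A e])
           (use ijl in auto)
      then show ?thesis using ijl by (simp add: norm_mult mult.assoc)
    qed
  qed
  show ?thesis
  proof (rule vsmall_mono[OF main order.refl], rule eventually_mono[OF evR], intro allI impI)
    fix x and t :: real assume "c < cmod (R x)" and t: "cmod (ev (\<Prod>j<k. q j) x) \<le> t"
    then have "c * cmod (\<Prod>j\<in>J. ev (q j) x) \<le> cmod (R x) * cmod (\<Prod>j\<in>J. ev (q j) x)"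
      by (intro mult_right_mono) auto
    also have "\<dots> \<le> t" using t by (simp add: f norm_mult)
    finally show "cmod (\<Prod>j\<in>J. ev (q j) x) \<le> A * t"
      using c by (simp add: A_def field_simps)
  qed
qed

lemma volume_annulus:
  assumes K: "compact K" and F: "\<And>P. P \<in> K \<Longrightarrow> vsmall P e F"
  obtains C where "0 \<le> C" "\<And>t. 0 < t \<Longrightarrow> t \<le> 1 \<Longrightarrow> {x \<in> K. F t x} \<in> sets lborel \<Longrightarrow>
    emeasure lborel {x \<in> K. F t x} \<le> ennreal (C * t powr e)"
proof -
  let ?Q = "\<lambda>P \<rho> C. 0 < \<rho> \<and> 0 \<le> C \<and> (\<forall>t. 0 < t \<and> t \<le> 1 \<longrightarrow>
     (\<exists>M\<in>sets lborel. {x \<in> ball P \<rho>. F t x} \<subseteq> M \<and> emeasure lborel M \<le> ennreal (C * t powr e)))"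
  have "\<forall>P\<in>K. \<exists>\<rho>. \<exists>C. ?Q P \<rho> C"
    using F unfolding vsmall_def by blast
  from bchoice[OF this] obtain \<rho> where "\<forall>P\<in>K. \<exists>C. ?Q P (\<rho> P) C" ..
  from bchoice[OF this] obtain C where Q: "\<forall>P\<in>K. ?Q P (\<rho> P) (C P)" ..
  have rC: "0 < \<rho> P" "0 \<le> C P" if "P \<in> K" for P
    using Q that by blast+
  have rC3: "\<exists>M\<in>sets lborel. {x \<in> ball P (\<rho> P). F t x} \<subseteq> M \<and> emeasure lborel M \<le> ennreal (C P * t powr e)"
    if "P \<in> K" "0 < t" "t \<le> 1" for P t
    using Q that by blast
  have cover: "K \<subseteq> (\<Union>P\<in>K. ball P (\<rho> P))" using rC(1) by force
  obtain D where D: "D \<subseteq> K" "finite D" "K \<subseteq> (\<Union>P\<in>D. ball P (\<rho> P))"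
    by (rule compactE_image[OF K, of K "\<lambda>P. ball P (\<rho> P)"]) (use cover in auto)
  show thesis
  proof (rule that[of "\<Sum>P\<in>D. C P"])
    show "0 \<le> (\<Sum>P\<in>D. C P)" using D rC(2) by (intro sum_nonneg) auto
    fix t :: real assume t: "0 < t" "t \<le> 1" and meas: "{x \<in> K. F t x} \<in> sets lborel"
    have "\<exists>M. \<forall>P\<in>D. M P \<in> sets lborel \<and> {x \<in> ball P (\<rho> P). F t x} \<subseteq> M P \<and> emeasure lborel (M P) \<le> ennreal (C P * t powr e)"
      using rC3[OF _ t] D(1) by (intro bchoice) blast
    then obtain M where M: "\<And>P. P \<in> D \<Longrightarrow> M P \<in> sets lborel" "\<And>P. P \<in> D \<Longrightarrow> {x \<in> ball P (\<rho> P). F t x} \<subseteq> M P"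
      "\<And>P. P \<in> D \<Longrightarrow> emeasure lborel (M P) \<le> ennreal (C P * t powr e)" by blast
    have "{x \<in> K. F t x} \<subseteq> (\<Union>P\<in>D. M P)" using D(3) M(2) by blast
    then have "emeasure lborel {x \<in> K. F t x} \<le> emeasure lborel (\<Union>P\<in>D. M P)"
      using M(1) D(2) by (intro emeasure_mono) auto
    also have "\<dots> \<le> (\<Sum>P\<in>D. emeasure lborel (M P))"
      using M(1) D(2) by (intro emeasure_subadditive_finite) auto
    also have "\<dots> \<le> (\<Sum>P\<in>D. ennreal (C P * t powr e))" by (intro sum_mono M)
    also have "\<dots> = ennreal (\<Sum>P\<in>D. C P * t powr e)"
      using D rC(2) by (intro sum_ennreal) auto
    finally show "emeasure lborel {x \<in> K. F t x} \<le> ennreal ((\<Sum>P\<in>D. C P) * t powr e)"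
      by (simp add: sum_distrib_right)
  qed
qed

subsection \<open>Wirtinger calculus\<close>

text \<open>\<open>L i\<close> is the derivative \<open>\<partial>F/\<partial>z\<^sub>i\<close>; the conjugate derivatives are only required to be continuous.\<close>

definition wirtinger :: "(complex^3 \<Rightarrow> complex) \<Rightarrow> (3 \<Rightarrow> complex^3 \<Rightarrow> complex) \<Rightarrow> bool" where
  "wirtinger F L \<longleftrightarrow> (\<exists>M. (\<forall>z. (F has_derivative (\<lambda>h. \<Sum>i\<in>UNIV. L i z * h $ i + M i z * cnj (h $ i))) (at z)) \<and>
     (\<forall>i. continuous_on UNIV (L i)) \<and> (\<forall>i. continuous_on UNIV (M i)))"

lemma wirtingerI:
  assumes "\<And>z. (F has_derivative (\<lambda>h. \<Sum>i\<in>UNIV. L i z * h $ i + M i z * cnj (h $ i))) (at z)"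
    "\<And>i. continuous_on UNIV (L i)" "\<And>i. continuous_on UNIV (M i)"
  shows "wirtinger F L"
  using assms unfolding wirtinger_def by blast

lemma wirtinger_continuous: "wirtinger F L \<Longrightarrow> continuous_on UNIV F"
  unfolding wirtinger_def by (meson has_derivative_continuous continuous_at_imp_continuous_on)

lemma wirtinger_ev: "wirtinger (ev p) (\<lambda>i z. ev (partial i p) z)"
  by (rule wirtingerI[where M = "\<lambda>_ _. 0"]) (simp_all add: has_derivative_ev continuous_on_ev_UNIV)

lemma wirtinger_cnj_ev: "wirtinger (\<lambda>z. cnj (ev p z)) (\<lambda>i z. 0)"
proof (rule wirtingerI[where M = "\<lambda>i z. cnj (ev (partial i p) z)"])
  fix z
  show "((\<lambda>z. cnj (ev p z)) has_derivative (\<lambda>h. \<Sum>i\<in>UNIV. 0 * h $ i + cnj (ev (partial i p) z) * cnj (h $ i))) (at z)"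
    using bounded_linear.has_derivative[OF bounded_linear_cnj has_derivative_ev[of p z]] by simp
qed (auto intro!: continuous_intros simp: continuous_on_ev_UNIV)

lemma wirtinger_coord: "wirtinger (\<lambda>z. z $ j) (\<lambda>i z. if i = j then 1 else 0)"
proof (rule wirtingerI[where M = "\<lambda>_ _. 0"])
  fix z :: "complex^3"
  have "((\<lambda>z::complex^3. z $ j) has_derivative (\<lambda>h. h $ j)) (at z)"
    by (rule bounded_linear.has_derivative[OF bounded_linear_vec_nth has_derivative_ident])
  then show "((\<lambda>z. z $ j) has_derivative (\<lambda>h. \<Sum>i\<in>UNIV. (if i = j then 1 else 0) * h $ i + 0 * cnj (h $ i))) (at z)"
    by (simp add: if_distrib[of "\<lambda>x. x * _"] cong: if_cong)
qed auto

lemma wirtinger_cnj_coord: "wirtinger (\<lambda>z. cnj (z $ j)) (\<lambda>i z. 0)"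
proof (rule wirtingerI[where M = "\<lambda>i z. if i = j then 1 else 0"])
  fix z :: "complex^3"
  have "((\<lambda>z::complex^3. cnj (z $ j)) has_derivative (\<lambda>h. cnj (h $ j))) (at z)"
    by (rule bounded_linear.has_derivative[OF bounded_linear_cnj
        bounded_linear.has_derivative[OF bounded_linear_vec_nth has_derivative_ident]])
  then show "((\<lambda>z. cnj (z $ j)) has_derivative (\<lambda>h. \<Sum>i\<in>UNIV. 0 * h $ i + (if i = j then 1 else 0) * cnj (h $ i))) (at z)"
    by (simp add: if_distrib[of "\<lambda>x. x * _"] cong: if_cong)
qed auto

lemma wirtinger_add:
  assumes "wirtinger F L" "wirtinger G L'"
  shows "wirtinger (\<lambda>z. F z + G z) (\<lambda>i z. L i z + L' i z)"
proof -
  obtain M where M: "\<And>z. (F has_derivative (\<lambda>h. \<Sum>i\<in>UNIV. L i z * h $ i + M i z * cnj (h $ i))) (at z)"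
     "\<And>i. continuous_on UNIV (L i)" "\<And>i. continuous_on UNIV (M i)" using assms(1) unfolding wirtinger_def by blast
  obtain M' where M': "\<And>z. (G has_derivative (\<lambda>h. \<Sum>i\<in>UNIV. L' i z * h $ i + M' i z * cnj (h $ i))) (at z)"
     "\<And>i. continuous_on UNIV (L' i)" "\<And>i. continuous_on UNIV (M' i)" using assms(2) unfolding wirtinger_def by blast
  show ?thesis
  proof (rule wirtingerI[where M = "\<lambda>i z. M i z + M' i z"])
    fix z
    show "((\<lambda>z. F z + G z) has_derivative (\<lambda>h. \<Sum>i\<in>UNIV. (L i z + L' i z) * h $ i + (M i z + M' i z) * cnj (h $ i))) (at z)"
      by (rule has_derivative_eq_rhs[OF has_derivative_add[OF M(1) M'(1)]])
         (simp add: fun_eq_iff sum.distrib algebra_simps)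
  qed (intro continuous_intros M M')+
qed

lemma wirtinger_mult:
  assumes F: "wirtinger F L" and G: "wirtinger G L'"
  shows "wirtinger (\<lambda>z. F z * G z) (\<lambda>i z. L i z * G z + F z * L' i z)"
proof -
  obtain M where M: "\<And>z. (F has_derivative (\<lambda>h. \<Sum>i\<in>UNIV. L i z * h $ i + M i z * cnj (h $ i))) (at z)"
     "\<And>i. continuous_on UNIV (L i)" "\<And>i. continuous_on UNIV (M i)" using F unfolding wirtinger_def by blast
  obtain M' where M': "\<And>z. (G has_derivative (\<lambda>h. \<Sum>i\<in>UNIV. L' i z * h $ i + M' i z * cnj (h $ i))) (at z)"
     "\<And>i. continuous_on UNIV (L' i)" "\<And>i. continuous_on UNIV (M' i)" using G unfolding wirtinger_def by blast
  note c = wirtinger_continuous[OF F] wirtinger_continuous[OF G]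
  show ?thesis
  proof (rule wirtingerI[where M = "\<lambda>i z. M i z * G z + F z * M' i z"])
    fix z
    show "((\<lambda>z. F z * G z) has_derivative (\<lambda>h. \<Sum>i\<in>UNIV. (L i z * G z + F z * L' i z) * h $ i + (M i z * G z + F z * M' i z) * cnj (h $ i))) (at z)"
      by (rule has_derivative_eq_rhs[OF has_derivative_mult[OF M(1) M'(1)]])
         (simp add: fun_eq_iff sum.distrib sum_distrib_left sum_distrib_right algebra_simps)
  qed (intro continuous_intros c M M')+
qed

lemma wirtinger_const: "wirtinger (\<lambda>z. c) (\<lambda>i z. 0)"
  by (rule wirtingerI[where M = "\<lambda>_ _. 0"]) auto

lemma wirtinger_minus:
  assumes "wirtinger F L" "wirtinger G L'"
  shows "wirtinger (\<lambda>z. F z - G z) (\<lambda>i z. L i z - L' i z)"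
  using wirtinger_add[OF assms(1) wirtinger_mult[OF wirtinger_const[of "-1"] assms(2)]] by simp

lemma wirtinger_sum:
  assumes "finite I" "\<And>j. j \<in> I \<Longrightarrow> wirtinger (F j) (L j)"
  shows "wirtinger (\<lambda>z. \<Sum>j\<in>I. F j z) (\<lambda>i z. \<Sum>j\<in>I. L j i z)"
  using assms by (induction I rule: finite_induct) (auto intro: wirtinger_const wirtinger_add)

lemma wirtinger_real_compose:
  fixes \<phi> :: "complex^3 \<Rightarrow> real"
  assumes F: "wirtinger (\<lambda>z. of_real (\<phi> z)) L"
    and \<psi>: "\<And>z. (\<psi> has_real_derivative \<psi>' (\<phi> z)) (at (\<phi> z))" and c: "continuous_on UNIV (\<lambda>z. \<psi>' (\<phi> z))"
  shows "wirtinger (\<lambda>z. of_real (\<psi> (\<phi> z))) (\<lambda>i z. of_real (\<psi>' (\<phi> z)) * L i z)"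
proof -
  obtain M where M: "\<And>z. ((\<lambda>z. complex_of_real (\<phi> z)) has_derivative (\<lambda>h. \<Sum>i\<in>UNIV. L i z * h $ i + M i z * cnj (h $ i))) (at z)"
     "\<And>i. continuous_on UNIV (L i)" "\<And>i. continuous_on UNIV (M i)" using F unfolding wirtinger_def by blast
  show ?thesis
  proof (rule wirtingerI[where M = "\<lambda>i z. of_real (\<psi>' (\<phi> z)) * M i z"])
    fix z
    let ?A = "\<lambda>h. \<Sum>i\<in>UNIV. L i z * h $ i + M i z * cnj (h $ i)"
    have re: "(\<phi> has_derivative (\<lambda>h. Re (?A h))) (at z)"
      using bounded_linear.has_derivative[OF bounded_linear_Re M(1)[of z]] by simp
    have im: "((\<lambda>z. 0) has_derivative (\<lambda>h. Im (?A h))) (at z)"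
      using bounded_linear.has_derivative[OF bounded_linear_Im M(1)[of z]] by simp
    \<comment> \<open>A real-valued function has a real differential, so \<open>?A h\<close> equals
      its real part and may be multiplied by the real derivative of \<open>\<psi>\<close>.\<close>
    have im0: "Im (?A h) = 0" for h
      by (rule fun_cong[OF has_derivative_unique[OF im has_derivative_const]])
    have "((\<lambda>z. \<psi> (\<phi> z)) has_derivative (\<lambda>h. \<psi>' (\<phi> z) * Re (?A h))) (at z)"
      by (rule has_derivative_compose[OF re]) (use \<psi>[of z] in \<open>simp add: has_field_derivative_def\<close>)
    then have "((\<lambda>z. complex_of_real (\<psi> (\<phi> z))) has_derivative (\<lambda>h. complex_of_real (\<psi>' (\<phi> z) * Re (?A h)))) (at z)"
      by (rule bounded_linear.has_derivative[OF bounded_linear_of_real])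
    moreover have "complex_of_real (\<psi>' (\<phi> z) * Re (?A h)) = of_real (\<psi>' (\<phi> z)) * ?A h" for h
      using im0[of h] by (simp add: complex_eq_iff)
    ultimately show "((\<lambda>z. complex_of_real (\<psi> (\<phi> z))) has_derivative
        (\<lambda>h. \<Sum>i\<in>UNIV. of_real (\<psi>' (\<phi> z)) * L i z * h $ i + of_real (\<psi>' (\<phi> z)) * M i z * cnj (h $ i))) (at z)"
      by (simp add: sum_distrib_left distrib_left mult.assoc)
  qed (intro continuous_intros c M)+
qed

text \<open>With \<open>R1\<close> and \<open>R2\<close> the real directional derivatives along
  \<open>axis i 1\<close> and \<open>axis i \<i>\<close>, the derivative \<open>L i\<close> is
  \<open>(R1 - \<i> * R2) / 2\<close>, and each of the two integrates to 0.\<close>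

lemma integral_wirtinger_eq_0:
  assumes F: "wirtinger F L" and supp: "\<And>z. norm z \<ge> R \<Longrightarrow> F z = 0"
  shows "(LINT z|lborel. L i z) = 0" "integrable lborel (L i)"
proof -
  obtain M where M: "\<And>z. (F has_derivative (\<lambda>h. \<Sum>i\<in>UNIV. L i z * h $ i + M i z * cnj (h $ i))) (at z)"
     "\<And>i. continuous_on UNIV (L i)" "\<And>i. continuous_on UNIV (M i)" using F unfolding wirtinger_def by blast
  let ?F' = "\<lambda>z h. \<Sum>i\<in>UNIV. L i z * h $ i + M i z * cnj (h $ i)"
  have ax: "?F' z (axis i c) = L i z * c + M i z * cnj c" for z c
  proof -
    have "?F' z (axis i c) = (\<Sum>j\<in>UNIV. if j = i then L i z * c + M i z * cnj c else 0)"
      by (intro sum.cong) (auto simp: axis_def)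
    then show ?thesis by simp
  qed
  have c: "continuous_on UNIV (\<lambda>z. ?F' z (axis i c))" for c
    unfolding ax by (intro continuous_intros M)
  have d: "(LINT z|lborel. L i z * c + M i z * cnj c) = 0" "integrable lborel (\<lambda>z. L i z * c + M i z * cnj c)" for c
    using integral_directional_derivative_eq_0[OF M(1) c supp] unfolding ax by auto
  have e: "L i z = (1/2) * ((L i z * 1 + M i z * cnj 1) - \<i> * (L i z * \<i> + M i z * cnj \<i>))" for z
    by (simp add: algebra_simps)
  have "integrable lborel (\<lambda>z. (1/2) * ((L i z * 1 + M i z * cnj 1) - \<i> * (L i z * \<i> + M i z * cnj \<i>)))"
    by (intro integrable_mult_right Bochner_Integration.integrable_diff d)
  then show "integrable lborel (L i)" unfolding e[symmetric] .
  have "(LINT z|lborel. (1/2) * ((L i z * 1 + M i z * cnj 1) - \<i> * (L i z * \<i> + M i z * cnj \<i>))) = 0"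
    using d[of 1] d[of \<i>] by (simp only: integral_mult_right_zero Bochner_Integration.integral_diff[OF d(2) integrable_mult_right[OF d(2)]]) simp
  then show "(LINT z|lborel. L i z) = 0" unfolding e[symmetric] .
qed

lemma euler_identity:
  assumes "homogeneous (int n) p"
  shows "(\<Sum>i\<in>UNIV. ev (partial i p) z * z $ i) = of_nat n * ev p z"
proof -
  have "((\<lambda>c. ev p (c *s z)) has_derivative (\<lambda>h. \<Sum>i\<in>UNIV. ev (partial i p) (1 *s z) * (h *s z) $ i)) (at 1)"
  proof (rule has_derivative_compose[where f = "\<lambda>c. c *s z"])
    show "((\<lambda>c. c *s z) has_derivative (\<lambda>h. h *s z)) (at 1)"
      by (intro bounded_linear_imp_has_derivative bounded_linear_intro[where K = "norm z"])
         (auto simp: vec_eq_iff norm_vector_scalar_mult algebra_simps)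
  qed (use has_derivative_ev in auto)
  moreover have "((\<lambda>c. ev p (c *s z)) has_derivative (\<lambda>h. of_nat n * h * ev p z)) (at 1)"
    unfolding ev_scale[OF assms] by (auto intro!: derivative_eq_intros)
  ultimately have "(\<lambda>h. \<Sum>i\<in>UNIV. ev (partial i p) (1 *s z) * (h *s z) $ i) = (\<lambda>h. of_nat n * h * ev p z)"
    by (rule has_derivative_unique)
  from fun_cong[OF this, of 1] show ?thesis by simp
qed

subsection \<open>Cut-off functions\<close>

lemma has_real_derivative_pos_part_square:
  "((\<lambda>x::real. (max 0 x)\<^sup>2) has_real_derivative 2 * max 0 x) (at x)"
proof -
  consider "x < 0" | "x > 0" | "x = 0" by linarith
  then show ?thesis
  proof cases
    case 1
    have "((\<lambda>_. 0) has_real_derivative 0) (at x)" by simp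
    moreover have "eventually (\<lambda>y. (max 0 y)\<^sup>2 = (0::real)) (nhds x)"
      using eventually_nhds_in_open[of "{..<0}" x] 1 by (auto elim!: eventually_mono)
    ultimately show ?thesis using 1 by (subst DERIV_cong_ev[OF refl _ refl, where g = "\<lambda>_. 0"]) auto
  next
    case 2
    have "((\<lambda>y. y\<^sup>2) has_real_derivative 2 * x) (at x)" by (auto intro!: derivative_eq_intros)
    moreover have "eventually (\<lambda>y. (max 0 y)\<^sup>2 = y\<^sup>2) (nhds x)"
      using eventually_nhds_in_open[of "{0<..}" x] 2 by (auto elim!: eventually_mono)
    ultimately show ?thesis using 2 by (subst DERIV_cong_ev[OF refl _ refl, where g = "\<lambda>y. y\<^sup>2"]) auto
  next
    case 3
    have "((\<lambda>h. ((max 0 (0 + h))\<^sup>2 - (max 0 0)\<^sup>2) / h) \<longlongrightarrow> (0::real)) (at 0)"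
    proof (rule Lim_null_comparison)
      show "\<forall>\<^sub>F h in at (0::real). norm (((max 0 (0 + h))\<^sup>2 - (max 0 0)\<^sup>2) / h) \<le> \<bar>h\<bar>"
        by (intro always_eventually allI) (auto simp: max_def power2_eq_square)
      show "((\<lambda>h::real. \<bar>h\<bar>) \<longlongrightarrow> 0) (at 0)" by (rule tendsto_eq_intros | simp)+
    qed
    then show ?thesis unfolding 3 DERIV_def by simp
  qed
qed

text \<open>Applied to the square of \<open>norm z\<close>, hence supported on the annulus
  \<open>1 \<le> norm z \<le> 2\<close>. Squaring the positive part makes it continuously
  differentiable.\<close>

definition bump :: "real \<Rightarrow> real" where
  "bump s = (max 0 ((s - 1) * (4 - s)))\<^sup>2"

definition bump' :: "real \<Rightarrow> real" where
  "bump' s = 2 * max 0 ((s - 1) * (4 - s)) * (5 - 2 * s)"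

lemma bump_deriv: "(bump has_real_derivative bump' s) (at s)"
proof -
  have "((\<lambda>s. (s - 1) * (4 - s)) has_real_derivative 5 - 2 * s) (at s)"
    by (auto intro!: derivative_eq_intros)
  from DERIV_chain2[OF has_real_derivative_pos_part_square this]
  show ?thesis by (simp add: bump_def[abs_def] bump'_def)
qed

lemma bump_nonneg: "bump s \<ge> 0" by (simp add: bump_def)

lemma bump_pos: "1 < s \<Longrightarrow> s < 4 \<Longrightarrow> bump s > 0" by (simp add: bump_def max_def)

lemma bump_zero: "s \<le> 1 \<or> s \<ge> 4 \<Longrightarrow> bump s = 0"
  using mult_nonpos_nonneg[of "s - 1" "4 - s"] mult_nonneg_nonpos[of "s - 1" "4 - s"]
  by (auto simp: bump_def max_def)

text \<open>A regularisation of \<open>u\<^bsup>-\<alpha>\<^esup>\<close>, for which \<open>u \<Phi>' + \<alpha> \<Phi>\<close> is concentrated on \<open>u \<lesssim> \<epsilon>\<close> when \<open>m\<close> is large.\<close>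

definition Phi :: "nat \<Rightarrow> real \<Rightarrow> real \<Rightarrow> real \<Rightarrow> real" where
  "Phi m \<alpha> \<epsilon> u = (u ^ m + \<epsilon> ^ m) powr (- \<alpha> / m)"

definition Phi' :: "nat \<Rightarrow> real \<Rightarrow> real \<Rightarrow> real \<Rightarrow> real" where
  "Phi' m \<alpha> \<epsilon> u = - \<alpha> * u ^ (m - 1) * (u ^ m + \<epsilon> ^ m) powr (- \<alpha> / m - 1)"

definition Phi_err :: "nat \<Rightarrow> real \<Rightarrow> real \<Rightarrow> real \<Rightarrow> real" where
  "Phi_err m \<alpha> \<epsilon> u = \<alpha> * \<epsilon> ^ m * (u ^ m + \<epsilon> ^ m) powr (- \<alpha> / m - 1)"

lemma Phi_base_pos: "u \<ge> 0 \<Longrightarrow> \<epsilon> > 0 \<Longrightarrow> u ^ m + \<epsilon> ^ m > (0::real)"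
  by (simp add: add_nonneg_pos)

lemma Phi_deriv:
  assumes "u \<ge> 0" "\<epsilon> > 0" "m > 0"
  shows "(Phi m \<alpha> \<epsilon> has_real_derivative Phi' m \<alpha> \<epsilon> u) (at u)"
proof -
  have "((\<lambda>u. u ^ m + \<epsilon> ^ m) has_real_derivative m * u ^ (m - 1)) (at u)"
    by (auto intro!: derivative_eq_intros)
  from DERIV_fun_powr[OF this Phi_base_pos[OF assms(1,2)], of "- \<alpha> / m"]
  show ?thesis using assms by (simp add: Phi_def[abs_def] Phi'_def mult_ac)
qed

lemma Phi_identity:
  assumes "u \<ge> 0" "\<epsilon> > 0" "m > 0"
  shows "u * Phi' m \<alpha> \<epsilon> u + \<alpha> * Phi m \<alpha> \<epsilon> u = Phi_err m \<alpha> \<epsilon> u"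
proof -
  let ?b = "u ^ m + \<epsilon> ^ m"
  have b: "?b > 0" using Phi_base_pos assms by simp
  have p: "Phi m \<alpha> \<epsilon> u = ?b * ?b powr (- \<alpha> / m - 1)"
    using b by (simp add: Phi_def powr_mult_base)
  have "u * u ^ (m - 1) = u ^ m" using assms(3) by (metis power_eq_if less_numeral_extra(3))
  then have "u * Phi' m \<alpha> \<epsilon> u = - \<alpha> * u ^ m * ?b powr (- \<alpha> / m - 1)"
    by (simp add: Phi'_def mult_ac)
  then show ?thesis unfolding p Phi_err_def by (simp add: algebra_simps)
qed

lemma Phi_err_nonneg: "\<alpha> \<ge> 0 \<Longrightarrow> \<epsilon> > 0 \<Longrightarrow> Phi_err m \<alpha> \<epsilon> u \<ge> 0"
  by (simp add: Phi_err_def)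

lemma Phi_err_le1:
  assumes "u \<ge> 0" "\<epsilon> > 0" "m > 0" "\<alpha> \<ge> 0"
  shows "Phi_err m \<alpha> \<epsilon> u \<le> \<alpha> * \<epsilon> powr (- \<alpha>)"
proof -
  have am: "- \<alpha> / m - 1 \<le> 0" proof -
    have "0 \<le> \<alpha> / m" using assms by simp
    then show ?thesis unfolding minus_divide_left[symmetric] by linarith
  qed
  have "(u ^ m + \<epsilon> ^ m) powr (- \<alpha> / m - 1) \<le> (\<epsilon> ^ m) powr (- \<alpha> / m - 1)"
    using assms am by (intro powr_mono2') auto
  then have "Phi_err m \<alpha> \<epsilon> u \<le> \<alpha> * \<epsilon> ^ m * (\<epsilon> ^ m) powr (- \<alpha> / m - 1)"
    unfolding Phi_err_def using assms by (intro mult_left_mono) auto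
  also have "\<epsilon> ^ m = \<epsilon> powr m" using assms by (simp add: powr_realpow)
  also have "\<alpha> * \<epsilon> powr m * (\<epsilon> powr m) powr (- \<alpha> / m - 1) = \<alpha> * \<epsilon> powr (m + m * (- \<alpha> / m - 1))"
    by (simp only: powr_powr powr_add mult.assoc)
  also have "real m + m * (- \<alpha> / m - 1) = - \<alpha>" using assms by (simp add: field_simps)
  finally show ?thesis .
qed

text \<open>Above \<open>\<epsilon> powr \<kappa>\<close> the term \<open>u ^ m\<close> dominates,
  and for \<open>\<kappa> < 1\<close> the exponent is positive as soon as
  \<open>m > \<kappa> * \<alpha> / (1 - \<kappa>)\<close>, so the error tends to 0 there. Closer to
  the curve only the bound of order \<open>\<epsilon> powr (- \<alpha>)\<close> remains, to be
  compensated by small volume.\<close>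

lemma Phi_err_le2:
  assumes "\<epsilon> powr \<kappa> \<le> u" "\<epsilon> > 0" "m > 0" "\<alpha> \<ge> 0"
  shows "Phi_err m \<alpha> \<epsilon> u \<le> \<alpha> * \<epsilon> powr (m * (1 - \<kappa>) - \<kappa> * \<alpha>)"
proof -
  have am: "- \<alpha> / m - 1 \<le> 0" proof -
    have "0 \<le> \<alpha> / m" using assms by simp
    then show ?thesis unfolding minus_divide_left[symmetric] by linarith
  qed
  have "(\<epsilon> powr \<kappa>) ^ m \<le> u ^ m" using assms(1) by (rule power_mono) simp
  then have "(u ^ m + \<epsilon> ^ m) powr (- \<alpha> / m - 1) \<le> ((\<epsilon> powr \<kappa>) ^ m) powr (- \<alpha> / m - 1)"
    using assms am by (intro powr_mono2') (auto intro: add_increasing2)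
  then have "Phi_err m \<alpha> \<epsilon> u \<le> \<alpha> * \<epsilon> ^ m * ((\<epsilon> powr \<kappa>) ^ m) powr (- \<alpha> / m - 1)"
    unfolding Phi_err_def using assms by (intro mult_left_mono) auto
  also have "(\<epsilon> powr \<kappa>) ^ m = \<epsilon> powr (\<kappa> * m)" using assms by (simp add: powr_realpow[symmetric] powr_powr)
  also have "\<epsilon> ^ m = \<epsilon> powr m" using assms by (simp add: powr_realpow)
  also have "\<alpha> * \<epsilon> powr m * (\<epsilon> powr (\<kappa> * m)) powr (- \<alpha> / m - 1) = \<alpha> * \<epsilon> powr (m + \<kappa> * m * (- \<alpha> / m - 1))"
    by (simp only: powr_powr powr_add mult.assoc)
  also have "real m + \<kappa> * m * (- \<alpha> / m - 1) = m * (1 - \<kappa>) - \<kappa> * \<alpha>" using assms by (simp add: field_simps)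
  finally show ?thesis .
qed

text \<open>The bound is independent of \<open>\<epsilon>\<close>, so it survives on the left of the
  integral inequality as \<open>\<epsilon>\<close> tends to 0.\<close>

lemma Phi_lower:
  assumes "0 \<le> u" "u \<le> U" "0 < \<epsilon>" "\<epsilon> \<le> 1" "\<alpha> \<ge> 0"
  shows "(U ^ m + 1) powr (- \<alpha> / m) \<le> Phi m \<alpha> \<epsilon> u"
  unfolding Phi_def using assms Phi_base_pos[of u \<epsilon> m]
  by (intro powr_mono2') (auto intro!: add_mono power_mono power_le_one)

subsection \<open>Vanishing of the divergence\<close>

lemma norm_square_sum: "(\<Sum>j\<in>UNIV. z $ j * cnj (z $ j)) = complex_of_real ((norm z)\<^sup>2)" for z :: "complex^3"
  by (simp add: norm_vec_def L2_set_def sum_nonneg complex_norm_square[symmetric])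

lemma integrable_compact_support:
  fixes h :: "complex^3 \<Rightarrow> 'b::{banach, second_countable_topology}"
  assumes "continuous_on UNIV h" "\<And>x. norm x \<ge> R \<Longrightarrow> h x = 0"
  shows "integrable lborel h"
proof -
  have "integrable lborel (\<lambda>x. indicator (cball 0 R) x *\<^sub>R h x)"
    by (rule borel_integrable_compact) (auto intro: continuous_on_subset[OF assms(1)])
  moreover have "(\<lambda>x. indicator (cball 0 R) x *\<^sub>R h x) = h"
    using assms(2) by (auto simp: fun_eq_iff indicator_def)
  ultimately show ?thesis by simp
qed

lemma continuous_integral_zero_imp_zero:
  fixes h :: "complex^3 \<Rightarrow> real"
  assumes c: "continuous_on UNIV h" and nn: "\<And>x. h x \<ge> 0" and i: "integrable lborel h" and 0: "(LINT x|lborel. h x) \<le> 0"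
  shows "h x = 0"
proof (rule ccontr)
  assume "h x \<noteq> 0"
  have "(LINT x|lborel. h x) = 0" by (intro antisym 0 Bochner_Integration.integral_nonneg nn)
  then have "AE x in lborel. h x = 0"
    using integral_nonneg_eq_0_iff_AE[OF i] nn by auto
  then have "{x. h x \<noteq> 0} \<in> null_sets lborel"
    using c by (subst (asm) AE_iff_null) (auto intro!: borel_open open_Collect_neq continuous_intros)
  then have "negligible {x. h x \<noteq> 0}"
    by (simp add: negligible_iff_null_sets null_sets_completionI)
  moreover have "open {x. h x \<noteq> 0}" using c by (intro open_Collect_neq continuous_intros)
  ultimately show False using open_not_negligible[of "{x. h x \<noteq> 0}"] \<open>h x \<noteq> 0\<close> by blast
qed

text \<open>The vector field \<open>s \<theta> - \<langle>\<theta>, z\<rangle> E\<close>, with \<open>s = \<bar>z\<bar>\<^sup>2\<close> and \<open>E\<close> the Euler field, is tangent to the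
  spheres around \<open>0\<close>, so that a radial cut-off is not differentiated.\<close>

lemma divergence_computation:
  fixes a z zc fi :: "3 \<Rightarrow> complex" and pa :: "3 \<Rightarrow> 3 \<Rightarrow> complex" and f fc \<Phi> \<Phi>' \<rho> \<rho>' Dc r n :: complex
  assumes tang: "(\<Sum>l\<in>UNIV. a l * fi l) = 0" and euler_f: "(\<Sum>l\<in>UNIV. fi l * z l) = n * f"
    and euler_a: "\<And>j. (\<Sum>l\<in>UNIV. pa l j * z l) = r * a j"
  defines "D \<equiv> \<Sum>l\<in>UNIV. pa l l" and "s \<equiv> \<Sum>l\<in>UNIV. z l * zc l" and "g \<equiv> \<Sum>l\<in>UNIV. a l * zc l"
  defines "w \<equiv> \<lambda>l. s * a l - g * z l"
    and "dw \<equiv> \<lambda>l. zc l * a l + s * pa l l - ((\<Sum>j\<in>UNIV. pa l j * zc j) * z l + g)"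
  shows "(\<Sum>l\<in>UNIV. (Dc * dw l * \<Phi> + Dc * w l * (\<Phi>' * (fi l * fc))) * \<rho> + Dc * w l * \<Phi> * (\<rho>' * zc l))
     = Dc * \<rho> * (s * D * \<Phi> - g * ((r + 2) * \<Phi> + n * (f * fc) * \<Phi>'))"
proof -
  have "(\<Sum>l\<in>UNIV. (\<Sum>j\<in>UNIV. pa l j * zc j) * z l) = (\<Sum>l\<in>UNIV. \<Sum>j\<in>UNIV. zc j * (pa l j * z l))"
    by (simp add: sum_distrib_left mult_ac)
  also have "\<dots> = (\<Sum>j\<in>UNIV. \<Sum>l\<in>UNIV. zc j * (pa l j * z l))" by (rule sum.swap)
  also have "\<dots> = r * g"
    by (simp add: sum_distrib_left[symmetric] euler_a g_def) (simp add: sum_distrib_left mult_ac)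
  finally have 0: "(\<Sum>l\<in>UNIV. (\<Sum>j\<in>UNIV. pa l j * zc j) * z l) = r * g" .
  have e1: "(\<Sum>l\<in>UNIV. zc l * a l) = g" by (simp add: g_def mult.commute)
  \<comment> \<open>The origin of \<open>r + 2\<close>: Euler's relation for \<open>a\<close> gives
    \<open>r\<close>, the divergence of the Euler field gives 3, and differentiating
    \<open>s\<close> takes away 1.\<close>
  have 1: "(\<Sum>l\<in>UNIV. dw l) = s * D - (r + 2) * g"
    unfolding dw_def
    by (simp add: sum.distrib sum_subtractf 0 e1 sum_distrib_left[symmetric] D_def[symmetric])
       (simp add: algebra_simps)
  have 2: "(\<Sum>l\<in>UNIV. w l * fi l) = - (n * f * g)"
  proof -
    have "(\<Sum>l\<in>UNIV. w l * fi l) = s * (\<Sum>l\<in>UNIV. a l * fi l) - g * (\<Sum>l\<in>UNIV. fi l * z l)"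
      by (simp add: w_def algebra_simps sum_subtractf sum_distrib_left)
    then show ?thesis by (simp add: tang euler_f)
  qed
  have 3: "(\<Sum>l\<in>UNIV. w l * zc l) = 0"
  proof -
    have "(\<Sum>l\<in>UNIV. w l * zc l) = s * (\<Sum>l\<in>UNIV. a l * zc l) - g * (\<Sum>l\<in>UNIV. z l * zc l)"
      by (simp add: w_def algebra_simps sum_subtractf sum_distrib_left)
    then show ?thesis by (simp add: s_def[symmetric] g_def[symmetric])
  qed
  have "(\<Sum>l\<in>UNIV. (Dc * dw l * \<Phi> + Dc * w l * (\<Phi>' * (fi l * fc))) * \<rho> + Dc * w l * \<Phi> * (\<rho>' * zc l))
    = Dc * \<Phi> * \<rho> * (\<Sum>l\<in>UNIV. dw l) + Dc * \<Phi>' * fc * \<rho> * (\<Sum>l\<in>UNIV. w l * fi l) + Dc * \<Phi> * \<rho>' * (\<Sum>l\<in>UNIV. w l * zc l)"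
    by (simp add: sum.distrib sum_distrib_left algebra_simps)
  then show ?thesis unfolding 1 2 3 by (simp add: algebra_simps)
qed

lemma wirtinger_cong: "wirtinger F L \<Longrightarrow> (\<And>z. F z = G z) \<Longrightarrow> (\<And>i z. L i z = L' i z) \<Longrightarrow> wirtinger G L'"
proof -
  assume a: "wirtinger F L" "\<And>z. F z = G z" "\<And>i z. L i z = L' i z"
  have "F = G" "L = L'" using a(2,3) by (simp_all add: fun_eq_iff)
  with a(1) show "wirtinger G L'" by simp
qed

text \<open>The field \<open>w\<close>, multiplied by \<open>cnj (D z)\<close>, \<open>Phi\<close>
  and \<open>bump\<close>, has compact support, so its divergence integrates to 0. The factor
  \<open>cnj (D z)\<close> is antiholomorphic; it is not differentiated and turns \<open>D z\<close>
  into the square of its modulus. With \<open>\<alpha> = (r + 2) / n\<close> the terms containing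
  \<open>g\<close> combine to \<open>Phi_err\<close>, which leaves the two integrals compared
  here.\<close>

lemma integral_identity:
  fixes t :: "3 \<Rightarrow> S" and f :: S
  assumes f: "homogeneous (int n) f" and t: "\<And>i. homogeneous (int r) (t i)"
    and syz: "(\<Sum>i\<in>UNIV. t i * partial i f) = 0" and eps: "\<epsilon> > 0" "m > 0" and n: "n > 0"
    and al: "\<alpha> = (real r + 2) / n"
  defines "D \<equiv> ev (\<Sum>i\<in>UNIV. partial i (t i))" and "g \<equiv> \<lambda>z::complex^3. \<Sum>j\<in>UNIV. ev (t j) z * cnj (z $ j)"
    and "u \<equiv> \<lambda>z. (cmod (ev f z))\<^sup>2" and "N \<equiv> \<lambda>z::complex^3. (norm z)\<^sup>2"
  shows "(LINT z|lborel. (cmod (D z))\<^sup>2 * (bump (N z) * N z * Phi m \<alpha> \<epsilon> (u z)))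
    \<le> (LINT z|lborel. cmod (D z * g z) * (bump (N z) * n * Phi_err m \<alpha> \<epsilon> (u z)))"
    "integrable lborel (\<lambda>z. (cmod (D z))\<^sup>2 * (bump (N z) * N z * Phi m \<alpha> \<epsilon> (u z)))"
    "integrable lborel (\<lambda>z. cmod (D z * g z) * (bump (N z) * n * Phi_err m \<alpha> \<epsilon> (u z)))"
proof -
  note h = is_ring_hom_id
  have DE: "D z = (\<Sum>i\<in>UNIV. ev (partial i (t i)) z)" for z
    unfolding D_def by (rule eval_hom_sum[OF h])
  have syz': "(\<Sum>i\<in>UNIV. ev (t i) z * ev (partial i f) z) = 0" for z
    using arg_cong[OF syz, of "\<lambda>p. ev p z"] by (simp add: eval_hom_sum[OF h] eval_hom_mult[OF h])
  have Nw: "wirtinger (\<lambda>z. of_real (N z)) (\<lambda>i z. cnj (z $ i))"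
    by (rule wirtinger_cong[OF wirtinger_sum[OF finite_class.finite_UNIV, of "\<lambda>j z. z $ j * cnj (z $ j)"]], rule wirtinger_mult[OF wirtinger_coord wirtinger_cnj_coord])
       (simp_all add: N_def norm_square_sum if_distrib[of "\<lambda>x. x * _"] cong: if_cong)
  have uw: "wirtinger (\<lambda>z. of_real (u z)) (\<lambda>i z. ev (partial i f) z * cnj (ev f z))"
    by (rule wirtinger_cong[OF wirtinger_mult[OF wirtinger_ev wirtinger_cnj_ev]])
       (simp_all add: u_def complex_norm_square del: of_real_power)
  have gw: "wirtinger g (\<lambda>i z. \<Sum>j\<in>UNIV. ev (partial i (t j)) z * cnj (z $ j))"
    unfolding g_def
    by (rule wirtinger_cong[OF wirtinger_sum[OF finite_class.finite_UNIV, of "\<lambda>j z. ev (t j) z * cnj (z $ j)"]], rule wirtinger_mult[OF wirtinger_ev wirtinger_cnj_coord])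
       simp_all
  define w where "w = (\<lambda>l z. of_real (N z) * ev (t l) z - g z * z $ l)"
  have ww: "wirtinger (w l) (\<lambda>i z. (cnj (z $ i) * ev (t l) z + of_real (N z) * ev (partial i (t l)) z)
      - ((\<Sum>j\<in>UNIV. ev (partial i (t j)) z * cnj (z $ j)) * z $ l + g z * (if i = l then 1 else 0)))" for l
    unfolding w_def by (intro wirtinger_minus wirtinger_mult Nw wirtinger_ev gw wirtinger_coord)
  have u0: "u z \<ge> 0" for z by (simp add: u_def)
  have cN: "continuous_on UNIV N" unfolding N_def by (intro continuous_intros)
  have cu: "continuous_on UNIV u" unfolding u_def by (intro continuous_intros continuous_on_ev_UNIV)
  have b: "u z ^ m + \<epsilon> ^ m > 0" for z by (rule Phi_base_pos[OF u0 eps(1)])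
  have b': "\<forall>z\<in>UNIV. u z ^ m + \<epsilon> ^ m \<noteq> 0" using b by (metis less_irrefl)
  have cPhi: "continuous_on UNIV (\<lambda>z. Phi m \<alpha> \<epsilon> (u z))" "continuous_on UNIV (\<lambda>z. Phi' m \<alpha> \<epsilon> (u z))"
    "continuous_on UNIV (\<lambda>z. Phi_err m \<alpha> \<epsilon> (u z))"
    unfolding Phi_def Phi'_def Phi_err_def using b'
    by (intro continuous_intros cu | blast)+
  have cb: "continuous_on UNIV (\<lambda>z. bump (N z))" "continuous_on UNIV (\<lambda>z. bump' (N z))"
    unfolding bump_def bump'_def by (intro continuous_intros cN)+
  have Pw: "wirtinger (\<lambda>z. of_real (Phi m \<alpha> \<epsilon> (u z))) (\<lambda>i z. of_real (Phi' m \<alpha> \<epsilon> (u z)) * (ev (partial i f) z * cnj (ev f z)))"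
    by (rule wirtinger_real_compose[OF uw Phi_deriv cPhi(2)]) (use u0 eps in auto)
  have bw: "wirtinger (\<lambda>z. of_real (bump (N z))) (\<lambda>i z. of_real (bump' (N z)) * cnj (z $ i))"
    by (rule wirtinger_real_compose[OF Nw bump_deriv cb(2)])
  define F where "F = (\<lambda>l z. cnj (D z) * w l z * of_real (Phi m \<alpha> \<epsilon> (u z)) * of_real (bump (N z)))"
  define dw where "dw = (\<lambda>l z. cnj (z $ l) * ev (t l) z + of_real (N z) * ev (partial l (t l)) z
      - ((\<Sum>j\<in>UNIV. ev (partial l (t j)) z * cnj (z $ j)) * z $ l + g z))"
  define LL where "LL = (\<lambda>l z. (cnj (D z) * dw l z * of_real (Phi m \<alpha> \<epsilon> (u z))
       + cnj (D z) * w l z * (of_real (Phi' m \<alpha> \<epsilon> (u z)) * (ev (partial l f) z * cnj (ev f z)))) * of_real (bump (N z))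
       + cnj (D z) * w l z * of_real (Phi m \<alpha> \<epsilon> (u z)) * (of_real (bump' (N z)) * cnj (z $ l)))"
  have supp: "bump (N z) = 0" if "norm z \<ge> 2" for z
    using power_mono[OF that, of 2] by (intro bump_zero) (simp add: N_def)
  have LL: "(LINT z|lborel. LL l z) = 0" "integrable lborel (LL l)" for l
  proof -
    have Fw: "wirtinger (F l) (\<lambda>i z. ((0 * w l z + cnj (D z) * ((cnj (z $ i) * ev (t l) z + of_real (N z) * ev (partial i (t l)) z)
      - ((\<Sum>j\<in>UNIV. ev (partial i (t j)) z * cnj (z $ j)) * z $ l + g z * (if i = l then 1 else 0)))) * of_real (Phi m \<alpha> \<epsilon> (u z))
       + cnj (D z) * w l z * (of_real (Phi' m \<alpha> \<epsilon> (u z)) * (ev (partial i f) z * cnj (ev f z)))) * of_real (bump (N z))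
       + cnj (D z) * w l z * of_real (Phi m \<alpha> \<epsilon> (u z)) * (of_real (bump' (N z)) * cnj (z $ i)))"
      unfolding F_def D_def by (intro wirtinger_mult wirtinger_cnj_ev ww Pw bw)
    have "F l z = 0" if "norm z \<ge> 2" for z using supp[OF that] by (simp add: F_def)
    from integral_wirtinger_eq_0[where i = l, OF Fw this]
    show "(LINT z|lborel. LL l z) = 0" "integrable lborel (LL l)"
      unfolding LL_def dw_def by simp_all
  qed
  define Y where "Y = (\<lambda>z. cnj (D z) * of_real (bump (N z)) * (g z * (of_nat n * of_real (Phi_err m \<alpha> \<epsilon> (u z)))))"
  define X where "X = (\<lambda>z. (cmod (D z))\<^sup>2 * (bump (N z) * N z * Phi m \<alpha> \<epsilon> (u z)))"
  have sum_LL: "(\<Sum>l\<in>UNIV. LL l z) = of_real (X z) - Y z" for z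
  proof -
    have "(\<Sum>l\<in>UNIV. LL l z) = cnj (D z) * of_real (bump (N z)) * (of_real (N z) * D z * of_real (Phi m \<alpha> \<epsilon> (u z))
        - g z * ((of_nat r + 2) * of_real (Phi m \<alpha> \<epsilon> (u z)) + of_nat n * (ev f z * cnj (ev f z)) * of_real (Phi' m \<alpha> \<epsilon> (u z))))"
      using divergence_computation[of "\<lambda>l. ev (t l) z" "\<lambda>l. ev (partial l f) z" "\<lambda>l. z $ l" "of_nat n" "ev f z"
          "\<lambda>l j. ev (partial l (t j)) z" "of_nat r" "cnj (D z)" "\<lambda>l. cnj (z $ l)" "of_real (Phi m \<alpha> \<epsilon> (u z))"
          "of_real (Phi' m \<alpha> \<epsilon> (u z))" "cnj (ev f z)" "of_real (bump (N z))" "of_real (bump' (N z))",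
          OF syz' euler_identity[OF f] euler_identity[OF t]]
      unfolding norm_square_sum DE[symmetric] LL_def dw_def w_def N_def g_def by simp
    also have "ev f z * cnj (ev f z) = of_real (u z)" unfolding u_def complex_norm_square ..
    also have "(of_nat r + 2) * of_real (Phi m \<alpha> \<epsilon> (u z)) + of_nat n * of_real (u z) * of_real (Phi' m \<alpha> \<epsilon> (u z))
        = complex_of_real (n * (u z * Phi' m \<alpha> \<epsilon> (u z) + \<alpha> * Phi m \<alpha> \<epsilon> (u z)))"
    proof -
      have "real r + 2 = n * \<alpha>" using n by (simp add: al)
      then have "(of_nat r + 2 :: complex) = of_nat n * of_real \<alpha>"
        by (metis of_real_add of_real_mult of_real_numeral of_real_of_nat_eq)
      then show ?thesis by (simp add: algebra_simps)
    qed
    also have "u z * Phi' m \<alpha> \<epsilon> (u z) + \<alpha> * Phi m \<alpha> \<epsilon> (u z) = Phi_err m \<alpha> \<epsilon> (u z)"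
      by (rule Phi_identity[OF u0 eps])
    also have "cnj (D z) * of_real (bump (N z)) * (of_real (N z) * D z * of_real (Phi m \<alpha> \<epsilon> (u z))
        - g z * complex_of_real (n * Phi_err m \<alpha> \<epsilon> (u z))) = of_real (X z) - Y z"
    proof -
      have "cnj (D z) * D z = of_real ((cmod (D z))\<^sup>2)" unfolding complex_norm_square by (rule mult.commute)
      then have "of_real (X z) = cnj (D z) * D z * (of_real (bump (N z)) * of_real (N z) * of_real (Phi m \<alpha> \<epsilon> (u z)))"
        by (simp add: X_def)
      then show ?thesis by (simp add: Y_def algebra_simps)
    qed
    finally show ?thesis .
  qed
  have cD: "continuous_on UNIV D" unfolding D_def by (rule continuous_on_ev_UNIV)
  have cg: "continuous_on UNIV g" by (rule wirtinger_continuous[OF gw])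
  have X_int: "integrable lborel X"
    by (rule integrable_compact_support[where R = 2])
       (auto simp: X_def supp intro!: continuous_intros cD cb cN cPhi)
  have Xc_int: "integrable lborel (\<lambda>z. complex_of_real (X z))" using X_int by simp
  have Y_int: "integrable lborel Y"
    by (rule integrable_compact_support[where R = 2])
       (auto simp: Y_def supp intro!: continuous_intros cD cb cg cPhi)
  have nY: "cmod (Y z) = cmod (D z * g z) * (bump (N z) * n * Phi_err m \<alpha> \<epsilon> (u z))" for z
  proof -
    have "\<alpha> \<ge> 0" by (simp add: al)
    then have "\<bar>Phi_err m \<alpha> \<epsilon> (u z)\<bar> = Phi_err m \<alpha> \<epsilon> (u z)" using Phi_err_nonneg eps by simp
    then show ?thesis using bump_nonneg[of "N z"] by (simp add: Y_def norm_mult)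
  qed
  have "0 = (LINT z|lborel. (\<Sum>l\<in>UNIV. LL l z))"
    using LL by (simp add: Bochner_Integration.integral_sum)
  also have "\<dots> = (LINT z|lborel. of_real (X z) - Y z)" by (simp only: sum_LL)
  also have "\<dots> = of_real (LINT z|lborel. X z) - (LINT z|lborel. Y z)"
    by (subst Bochner_Integration.integral_diff[OF Xc_int Y_int]) simp
  finally have "of_real (LINT z|lborel. X z) = (LINT z|lborel. Y z)" by simp
  then have "(LINT z|lborel. X z) \<le> cmod (LINT z|lborel. Y z)"
    by (metis norm_of_real abs_ge_self)
  also have "\<dots> \<le> (LINT z|lborel. cmod (Y z))" by (rule integral_norm_bound)
  finally show "(LINT z|lborel. (cmod (D z))\<^sup>2 * (bump (N z) * N z * Phi m \<alpha> \<epsilon> (u z)))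
    \<le> (LINT z|lborel. cmod (D z * g z) * (bump (N z) * n * Phi_err m \<alpha> \<epsilon> (u z)))"
    unfolding X_def nY .
  show "integrable lborel (\<lambda>z. (cmod (D z))\<^sup>2 * (bump (N z) * N z * Phi m \<alpha> \<epsilon> (u z)))"
    using X_int unfolding X_def .
  show "integrable lborel (\<lambda>z. cmod (D z * g z) * (bump (N z) * n * Phi_err m \<alpha> \<epsilon> (u z)))"
    using integrable_norm[OF Y_int] unfolding nY .
qed

lemma tendsto_inverse_Suc_powr:
  assumes "p > 0"
  shows "(\<lambda>n. (1 / real (Suc n)) powr p) \<longlonglongrightarrow> 0"
proof -
  have "(\<lambda>n. real (Suc n) powr (- p)) \<longlonglongrightarrow> 0"
    by (rule tendsto_neg_powr)
       (use assms filterlim_compose[OF filterlim_real_sequentially filterlim_Suc] in auto)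
  moreover have "(1 / real (Suc n)) powr p = real (Suc n) powr (- p)" for n
    by (simp add: powr_divide powr_minus_divide del: of_nat_Suc)
  ultimately show ?thesis by simp
qed

text \<open>Taking \<open>\<kappa>\<close> strictly between \<open>2 * \<alpha> / e\<close> and 1
  balances two regions. Where \<open>u \<le> \<epsilon> powr \<kappa>\<close>, an error of order
  \<open>\<epsilon> powr (- \<alpha>)\<close> meets a volume of order
  \<open>\<epsilon> powr (\<kappa> * e / 2)\<close>; elsewhere the error is small for large
  \<open>m\<close>. Both resulting exponents \<open>p1\<close> and \<open>p2\<close> are positive,
  so the limit shows that \<open>D\<close> vanishes inside the annulus, and by homogeneity at every
  nonzero point.\<close>

lemma divergence_vanishes:
  fixes t :: "3 \<Rightarrow> S" and f :: S
  assumes f: "homogeneous (int n) f" and t: "\<And>i. homogeneous (int r) (t i)"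
    and syz: "(\<Sum>i\<in>UNIV. t i * partial i f) = 0" and n: "n > 0" and r: "r \<ge> 1"
    and e: "e > 2 * ((real r + 2) / n)" and C: "0 \<le> C"
    and vol: "\<And>\<eta>. 0 < \<eta> \<Longrightarrow> \<eta> \<le> 1 \<Longrightarrow>
      emeasure lborel {z. 1 \<le> norm z \<and> norm z \<le> 2 \<and> cmod (ev f z) \<le> \<eta>} \<le> ennreal (C * \<eta> powr e)"
    and z0: "z0 \<noteq> 0"
  shows "(\<Sum>i\<in>UNIV. ev (partial i (t i)) z0) = 0"
proof -
  define \<alpha> where "\<alpha> = (real r + 2) / n"
  have al: "\<alpha> > 0" using n by (simp add: \<alpha>_def)
  have e2: "e > 2 * \<alpha>" using e by (simp add: \<alpha>_def)
  then have e0: "e > 0" using al by linarith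
  define \<kappa> where "\<kappa> = (2 * \<alpha> / e + 1) / 2"
  have q: "2 * \<alpha> / e < 1" using e2 e0 by (simp add: divide_less_eq)
  have k1: "\<kappa> < 1" "2 * \<alpha> / e < \<kappa>" using q by (simp_all add: \<kappa>_def)
  have k0: "\<kappa> > 0" using k1(2) divide_pos_pos[of "2 * \<alpha>" e] al e0 by linarith
  define p1 where "p1 = \<kappa> * e / 2 - \<alpha>"
  have p1: "p1 > 0" using k1(2) e0 by (simp add: p1_def divide_less_eq)
  obtain m0 where m0: "real m0 > \<kappa> * \<alpha> / (1 - \<kappa>)" using reals_Archimedean2 by blast
  define m where "m = Suc m0"
  have m: "m > 0" by (simp add: m_def)
  define p2 where "p2 = m * (1 - \<kappa>) - \<kappa> * \<alpha>"
  have "\<kappa> * \<alpha> < real m0 * (1 - \<kappa>)" using m0 k1(1) by (simp add: divide_less_eq)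
  also have "\<dots> \<le> real m * (1 - \<kappa>)" using k1(1) by (intro mult_right_mono) (auto simp: m_def)
  finally have p2: "p2 > 0" by (simp add: p2_def)
  define D where "D = ev (\<Sum>i\<in>UNIV. partial i (t i))"
  define g where "g = (\<lambda>z::complex^3. \<Sum>j\<in>UNIV. ev (t j) z * cnj (z $ j))"
  define u where "u = (\<lambda>z. (cmod (ev f z))\<^sup>2)"
  define N where "N = (\<lambda>z::complex^3. (norm z)\<^sup>2)"
  define K where "K = {z::complex^3. 1 \<le> norm z \<and> norm z \<le> 2}"
  have cD: "continuous_on UNIV D" unfolding D_def by (rule continuous_on_ev_UNIV)
  have cg: "continuous_on UNIV g" unfolding g_def by (intro continuous_intros continuous_on_ev_UNIV)
  have cN: "continuous_on UNIV N" unfolding N_def by (intro continuous_intros)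
  have cu: "continuous_on UNIV u" unfolding u_def by (intro continuous_intros continuous_on_ev_UNIV)
  have cb: "continuous_on UNIV (\<lambda>z. bump (N z))" unfolding bump_def by (intro continuous_intros cN)
  have bumpK: "bump (N z) = 0" if "z \<notin> K" for z
  proof -
    have "norm z < 1 \<or> norm z > 2" using that by (auto simp: K_def)
    then have "N z \<le> 1 \<or> N z \<ge> 4"
      using power_mono[of "norm z" 1 2] power_mono[of 2 "norm z" 2] by (auto simp: N_def)
    then show ?thesis by (rule bump_zero)
  qed
  have Kc: "closed K"
    unfolding K_def by (intro closed_Collect_conj closed_Collect_le continuous_intros)
  have Kb: "bounded K" unfolding K_def bounded_iff by blast
  have K: "compact K" using Kc Kb by (simp add: compact_eq_bounded_closed)
  obtain B where B: "B > 0" "\<And>z. z \<in> K \<Longrightarrow> cmod (D z * g z) * (bump (N z) * n) \<le> B"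
  proof -
    have "bounded ((\<lambda>z. cmod (D z * g z) * (bump (N z) * n)) ` K)"
      by (intro compact_imp_bounded compact_continuous_image K continuous_intros
          continuous_on_subset[OF cD] continuous_on_subset[OF cg] continuous_on_subset[OF cb]) auto
    then obtain B where "B > 0" "\<And>x. x \<in> (\<lambda>z. cmod (D z * g z) * (bump (N z) * n)) ` K \<Longrightarrow> norm x \<le> B"
      unfolding bounded_pos by blast
    then show thesis by (intro that[of B]) force+
  qed
  obtain U where U: "U > 0" "\<And>z. z \<in> K \<Longrightarrow> u z \<le> U"
  proof -
    have "bounded (u ` K)"
      by (intro compact_imp_bounded compact_continuous_image K continuous_on_subset[OF cu]) auto
    then obtain B where "B > 0" "\<And>x. x \<in> u ` K \<Longrightarrow> norm x \<le> B" unfolding bounded_pos by blast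
    then show thesis by (intro that[of B]) force+
  qed
  have Kfin: "emeasure lborel K < \<infinity>" using emeasure_bounded_finite[OF Kb] by simp
  have Ks: "K \<in> sets lborel" using Kc by (simp add: borel_closed)
  define h where "h = (\<lambda>z. (cmod (D z))\<^sup>2 * (bump (N z) * N z))"
  have ch: "continuous_on UNIV h" unfolding h_def by (intro continuous_intros cD cb cN)
  have h0: "h z \<ge> 0" for z using bump_nonneg[of "N z"] by (simp add: h_def N_def)
  have hi: "integrable lborel h"
  proof (rule integrable_compact_support[OF ch, of 3])
    fix x :: "complex^3" assume "norm x \<ge> 3"
    then have "x \<notin> K" by (simp add: K_def)
    then show "h x = 0" using bumpK by (simp add: h_def)
  qed
  define \<phi> where "\<phi> = (U ^ m + 1) powr (- \<alpha> / m)"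
  have "U ^ m + 1 > 0" using U(1) by (intro add_pos_pos) auto
  then have phi: "\<phi> > 0" by (simp add: \<phi>_def)
  define V where "V = measure lborel K"
  have V0: "V \<ge> 0" by (simp add: V_def)
  have main: "\<phi> * (LINT z|lborel. h z) \<le> B * \<alpha> * (C * \<epsilon> powr p1 + V * \<epsilon> powr p2)"
    if eps: "0 < \<epsilon>" "\<epsilon> \<le> 1" for \<epsilon>
  proof -
    have I: "(LINT z|lborel. (cmod (D z))\<^sup>2 * (bump (N z) * N z * Phi m \<alpha> \<epsilon> (u z)))
        \<le> (LINT z|lborel. cmod (D z * g z) * (bump (N z) * n * Phi_err m \<alpha> \<epsilon> (u z)))"
      "integrable lborel (\<lambda>z. (cmod (D z))\<^sup>2 * (bump (N z) * N z * Phi m \<alpha> \<epsilon> (u z)))"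
      "integrable lborel (\<lambda>z. cmod (D z * g z) * (bump (N z) * n * Phi_err m \<alpha> \<epsilon> (u z)))"
      unfolding D_def g_def u_def N_def by (rule integral_identity[OF f t syz eps(1) m n \<alpha>_def])+
    have u0: "u z \<ge> 0" for z by (simp add: u_def)
    \<comment> \<open>The exponent is halved because \<open>u\<close> is the square of
      \<open>cmod (ev f z)\<close>.\<close>
    define K1 where "K1 = {z. 1 \<le> norm z \<and> norm z \<le> 2 \<and> cmod (ev f z) \<le> \<epsilon> powr (\<kappa>/2)}"
    have e1: "0 < \<epsilon> powr (\<kappa>/2)" "\<epsilon> powr (\<kappa>/2) \<le> 1" using eps k0 by (auto intro: powr_le1)
    have "K1 = K \<inter> {z. cmod (ev f z) \<le> \<epsilon> powr (\<kappa>/2)}" by (auto simp: K1_def K_def)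
    moreover have "closed {z. cmod (ev f z) \<le> \<epsilon> powr (\<kappa>/2)}"
      by (intro closed_Collect_le continuous_intros continuous_on_ev_UNIV)
    ultimately have K1s: "K1 \<in> sets lborel" using Kc by (simp add: borel_closed closed_Int)
    have volK1: "emeasure lborel K1 \<le> ennreal (C * \<epsilon> powr (\<kappa> * e / 2))"
      using vol[OF e1] by (simp add: K1_def powr_powr)
    then have K1fin: "emeasure lborel K1 < \<infinity>" by (rule le_less_trans) simp
    have mK1: "measure lborel K1 \<le> C * \<epsilon> powr (\<kappa> * e / 2)"
      unfolding measure_def using enn2real_mono[OF volK1] C by simp
    let ?Z = "\<lambda>z. cmod (D z * g z) * (bump (N z) * n * Phi_err m \<alpha> \<epsilon> (u z))"
    let ?W = "\<lambda>z. B * \<alpha> * \<epsilon> powr (- \<alpha>) * indicator K1 z + B * \<alpha> * \<epsilon> powr p2 * indicator K z :: real"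
    have ZW: "?Z z \<le> ?W z" for z
    proof (cases "z \<in> K")
      case False
      then have "z \<notin> K1" by (auto simp: K1_def K_def)
      then show ?thesis using False bumpK by simp
    next
      case True
      have Zb: "?Z z \<le> B * x" if "Phi_err m \<alpha> \<epsilon> (u z) \<le> x" for x
      proof -
        have "?Z z = (cmod (D z * g z) * (bump (N z) * n)) * Phi_err m \<alpha> \<epsilon> (u z)" by simp
        also have "\<dots> \<le> B * x"
          using B True that Phi_err_nonneg[of \<alpha> \<epsilon> m "u z"] al eps by (intro mult_mono) auto
        finally show ?thesis .
      qed
      show ?thesis
      proof (cases "z \<in> K1")
        case z1: True
        have "?Z z \<le> B * (\<alpha> * \<epsilon> powr (- \<alpha>))"
          by (rule Zb[OF Phi_err_le1[OF u0 eps(1) m]]) (use al in simp)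
        moreover have "0 \<le> B * \<alpha> * \<epsilon> powr p2" using B(1) al by simp
        ultimately show ?thesis using z1 True by (simp add: mult.assoc)
      next
        case z1: False
        then have "\<epsilon> powr (\<kappa>/2) \<le> cmod (ev f z)" using True by (auto simp: K1_def K_def)
        then have "(\<epsilon> powr (\<kappa>/2))\<^sup>2 \<le> u z" unfolding u_def by (intro power_mono) auto
        also have "(\<epsilon> powr (\<kappa>/2))\<^sup>2 = \<epsilon> powr \<kappa>" by (simp add: power2_eq_square powr_add[symmetric])
        finally have "?Z z \<le> B * (\<alpha> * \<epsilon> powr (m * (1 - \<kappa>) - \<kappa> * \<alpha>))"
          by (intro Zb Phi_err_le2 eps m) (use al in auto)
        then show ?thesis using z1 True by (simp add: p2_def mult.assoc)
      qed
    qed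
    have W_int: "integrable lborel ?W"
      using K1s Ks K1fin Kfin by (intro Bochner_Integration.integrable_add integrable_mult_right integrable_real_indicator) auto
    have "\<phi> * (LINT z|lborel. h z) = (LINT z|lborel. \<phi> * h z)" by simp
    also have "\<dots> \<le> (LINT z|lborel. (cmod (D z))\<^sup>2 * (bump (N z) * N z * Phi m \<alpha> \<epsilon> (u z)))"
    proof (rule Bochner_Integration.integral_mono[OF integrable_mult_right[OF hi] I(2)])
      fix z
      show "\<phi> * h z \<le> (cmod (D z))\<^sup>2 * (bump (N z) * N z * Phi m \<alpha> \<epsilon> (u z))"
      proof (cases "z \<in> K")
        case True
        have "\<phi> \<le> Phi m \<alpha> \<epsilon> (u z)"
          unfolding \<phi>_def by (rule Phi_lower[OF u0 U(2)[OF True] eps]) (use al in simp)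
        then have "\<phi> * h z \<le> Phi m \<alpha> \<epsilon> (u z) * h z" using h0 by (rule mult_right_mono)
        then show ?thesis by (simp add: h_def mult_ac)
      qed (simp add: h_def bumpK)
    qed
    also have "\<dots> \<le> (LINT z|lborel. ?Z z)" by (rule I(1))
    also have "\<dots> \<le> (LINT z|lborel. ?W z)" by (rule Bochner_Integration.integral_mono[OF I(3) W_int ZW])
    also have "\<dots> = B * \<alpha> * \<epsilon> powr (- \<alpha>) * measure lborel K1 + B * \<alpha> * \<epsilon> powr p2 * V"
      using K1s Ks K1fin Kfin
      by (subst Bochner_Integration.integral_add) (auto simp: V_def intro!: integrable_mult_right integrable_real_indicator)
    also have "\<dots> \<le> B * \<alpha> * \<epsilon> powr (- \<alpha>) * (C * \<epsilon> powr (\<kappa> * e / 2)) + B * \<alpha> * \<epsilon> powr p2 * V"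
      using mK1 B(1) al by (intro add_right_mono mult_left_mono) auto
    also have "\<epsilon> powr p1 = \<epsilon> powr (- \<alpha>) * \<epsilon> powr (\<kappa> * e / 2)"
      unfolding p1_def powr_add[symmetric] by simp
    then have "B * \<alpha> * \<epsilon> powr (- \<alpha>) * (C * \<epsilon> powr (\<kappa> * e / 2)) + B * \<alpha> * \<epsilon> powr p2 * V
      = B * \<alpha> * (C * \<epsilon> powr p1 + V * \<epsilon> powr p2)" by (simp add: algebra_simps)
    finally show ?thesis .
  qed
  have "\<phi> * (LINT z|lborel. h z) \<le> 0"
  proof (rule LIMSEQ_le_const)
    show "(\<lambda>n. B * \<alpha> * (C * (1 / real (Suc n)) powr p1 + V * (1 / real (Suc n)) powr p2)) \<longlonglongrightarrow> 0"
      by (rule tendsto_eq_intros tendsto_inverse_Suc_powr p1 p2 refl | simp del: of_nat_Suc)+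
    show "\<exists>N. \<forall>n\<ge>N. \<phi> * (LINT z|lborel. h z) \<le> B * \<alpha> * (C * (1 / real (Suc n)) powr p1 + V * (1 / real (Suc n)) powr p2)"
      by (intro exI[of _ 0] allI impI main) auto
  qed
  then have "(LINT z|lborel. h z) \<le> 0" using phi by (simp add: mult_le_0_iff)
  then have hz: "h z = 0" for z by (rule continuous_integral_zero_imp_zero[OF ch h0 hi])
  define c where "c = complex_of_real (3 / 2 / norm z0)"
  have nz: "norm (c *s z0) = 3/2" using z0 by (simp add: norm_vector_scalar_mult c_def norm_divide)
  then have N94: "N (c *s z0) = 9/4" unfolding N_def nz by (simp add: power2_eq_square)
  have "bump (N (c *s z0)) * N (c *s z0) > 0" unfolding N94 using bump_pos[of "9/4"] by simp
  then have "D (c *s z0) = 0" using hz[of "c *s z0"] by (auto simp: h_def)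
  moreover have "D (c *s z0) = c ^ (r - 1) * D z0"
  proof -
    have "homogeneous (int r - 1) (\<Sum>i\<in>UNIV. partial i (t i))"
      by (intro homogeneous_sum homogeneous_partial t)
    then show ?thesis unfolding D_def using r by (intro ev_scale) (simp add: of_nat_diff)
  qed
  moreover have "c \<noteq> 0" using z0 by (simp add: c_def)
  ultimately have "D z0 = 0" by simp
  then show ?thesis unfolding D_def eval_hom_sum[OF is_ring_hom_id] .
qed

subsection \<open>Difference quotients of polynomial maps\<close>

text \<open>\<open>G\<close> extends the quotient of the increment by \<open>w\<close> continuously
  to \<open>w = 0\<close>. Identities along a curve can thus be divided by the parameter and then
  read at 0, in the manner of leading coefficients.\<close>

definition has_difference_quotient :: "(complex^3 \<Rightarrow> complex) \<Rightarrow> ((complex^3) \<times> complex \<times> (complex^3) \<Rightarrow> complex) \<Rightarrow> bool" where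
  "has_difference_quotient F G \<longleftrightarrow> continuous_on UNIV F \<and> continuous_on UNIV G \<and>
     (\<forall>z w X. F (z + w *s X) = F z + w * G (z, w, X))"

lemma has_difference_quotient_const: "has_difference_quotient (\<lambda>z. c) (\<lambda>x. 0)"
  by (simp add: has_difference_quotient_def)

lemma has_difference_quotient_coord: "has_difference_quotient (\<lambda>z. z $ i) (\<lambda>x. snd (snd x) $ i)"
  by (auto simp: has_difference_quotient_def intro!: continuous_intros)

lemma has_difference_quotient_add:
  "has_difference_quotient F G \<Longrightarrow> has_difference_quotient F' G' \<Longrightarrow>
    has_difference_quotient (\<lambda>z. F z + F' z) (\<lambda>x. G x + G' x)"
  unfolding has_difference_quotient_def by (auto intro!: continuous_intros simp: algebra_simps)

lemma has_difference_quotient_mult: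
  assumes "has_difference_quotient F G" "has_difference_quotient F' G'"
  shows "has_difference_quotient (\<lambda>z. F z * F' z) (\<lambda>x. F (fst x) * G' x + G x * F' (fst x) + fst (snd x) * (G x * G' x))"
proof -
  have c: "continuous_on UNIV F" "continuous_on UNIV F'" "continuous_on UNIV G" "continuous_on UNIV G'"
    and e: "\<And>z w X. F (z + w *s X) = F z + w * G (z, w, X)" "\<And>z w X. F' (z + w *s X) = F' z + w * G' (z, w, X)"
    using assms by (auto simp: has_difference_quotient_def)
  have f: "continuous_on UNIV (\<lambda>x. F (fst x))" "continuous_on UNIV (\<lambda>x. F' (fst x))"
    by (rule continuous_on_compose2[OF c(1)] continuous_on_compose2[OF c(2)], auto intro!: continuous_intros)+
  show ?thesis
    unfolding has_difference_quotient_def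
    by (intro conjI allI continuous_intros c f) (simp add: e algebra_simps)
qed

lemma has_difference_quotient_power:
  assumes "has_difference_quotient F G"
  shows "\<exists>G'. has_difference_quotient (\<lambda>z. F z ^ n) G'"
proof (induction n)
  case 0
  show ?case using has_difference_quotient_const[of 1] by auto
next
  case (Suc n)
  then obtain G' where "has_difference_quotient (\<lambda>z. F z ^ n) G'" ..
  from has_difference_quotient_mult[OF assms this] show ?case unfolding power_Suc by - (rule exI, assumption)
qed

lemma ex_difference_quotient_ev: "\<exists>G. has_difference_quotient (ev p) G"
proof (induction p rule: poly_mapping_single_induct)
  case (single m c)
  obtain G1 where G1: "has_difference_quotient (\<lambda>z. z $ 1 ^ Poly_Mapping.lookup m 1) G1"
    using has_difference_quotient_power[OF has_difference_quotient_coord] by blast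
  obtain G2 where G2: "has_difference_quotient (\<lambda>z. z $ 2 ^ Poly_Mapping.lookup m 2) G2"
    using has_difference_quotient_power[OF has_difference_quotient_coord] by blast
  obtain G3 where G3: "has_difference_quotient (\<lambda>z. z $ 3 ^ Poly_Mapping.lookup m 3) G3"
    using has_difference_quotient_power[OF has_difference_quotient_coord] by blast
  have e: "ev (Poly_Mapping.single m c) = (\<lambda>z. c * (z$1 ^ Poly_Mapping.lookup m 1 * z$2 ^ Poly_Mapping.lookup m 2 * z$3 ^ Poly_Mapping.lookup m 3))"
    by (simp add: fun_eq_iff eval_hom_single prod_UNIV_3)
  from has_difference_quotient_mult[OF has_difference_quotient_const[of c]
        has_difference_quotient_mult[OF has_difference_quotient_mult[OF G1 G2] G3]]
  show ?case unfolding e by - (rule exI, assumption)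
next
  case (add p q)
  then obtain G G' where "has_difference_quotient (ev p) G" "has_difference_quotient (ev q) G'" by blast
  from has_difference_quotient_add[OF this] show ?case
    unfolding eval_hom_add[OF is_ring_hom_id] by - (rule exI, assumption)
qed

lemma continuous_eq_at_0:
  fixes F G :: "complex \<Rightarrow> 'a::t2_space"
  assumes "continuous_on UNIV F" "continuous_on UNIV G" "\<And>x. x \<noteq> 0 \<Longrightarrow> F x = G x"
  shows "F 0 = G 0"
proof -
  have F: "(F \<longlongrightarrow> F 0) (at 0)" and G: "(G \<longlongrightarrow> G 0) (at 0)"
    using assms(1,2) by (auto simp: continuous_on_eq_continuous_at continuous_at)
  have "(F \<longlongrightarrow> G 0) (at 0)"
    by (rule Lim_transform_eventually[OF G]) (simp add: eventually_at_filter assms(3))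
  then show ?thesis by (rule tendsto_unique[OF at_neq_bot F])
qed

lemma difference_quotient_at_0:
  assumes "has_difference_quotient (ev p) G"
  shows "G (z, 0, X) = (\<Sum>i\<in>UNIV. ev (partial i p) z * X $ i)"
proof -
  have e: "ev p (z + w *s X) = ev p z + w * G (z, w, X)" and c: "continuous_on UNIV G" for w
    using assms by (auto simp: has_difference_quotient_def)
  have "((\<lambda>w. z + w *s X) has_derivative (\<lambda>w. w *s X)) (at 0)"
  proof -
    have "((\<lambda>w. w *s X) has_derivative (\<lambda>w. w *s X)) (at 0)"
      by (intro bounded_linear_imp_has_derivative bounded_linear_intro[where K = "norm X"])
         (auto simp: vec_eq_iff norm_vector_scalar_mult algebra_simps)
    then show ?thesis using has_derivative_add[OF has_derivative_const] by fastforce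
  qed
  then have "((\<lambda>w. ev p (z + w *s X)) has_derivative (\<lambda>w. \<Sum>i\<in>UNIV. ev (partial i p) (z + 0 *s X) * (w *s X) $ i)) (at 0)"
    by (rule has_derivative_compose[OF _ has_derivative_ev])
  then have "((\<lambda>w. ev p (z + w *s X)) has_field_derivative (\<Sum>i\<in>UNIV. ev (partial i p) z * X $ i)) (at 0)"
    unfolding has_field_derivative_def
    by (rule has_derivative_eq_rhs) (simp add: fun_eq_iff sum_distrib_left sum_distrib_right mult_ac)
  then have lim: "((\<lambda>w. (ev p (z + w *s X) - ev p z) / w) \<longlongrightarrow> (\<Sum>i\<in>UNIV. ev (partial i p) z * X $ i)) (at 0)"
    by (simp add: DERIV_def)
  have "continuous_on UNIV (\<lambda>w. G (z, w, X))"
    by (rule continuous_on_compose2[OF c]) (auto intro!: continuous_intros)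
  then have "((\<lambda>w. G (z, w, X)) \<longlongrightarrow> G (z, 0, X)) (at 0)"
    by (auto simp: continuous_on_eq_continuous_at continuous_at)
  moreover have "((\<lambda>w. G (z, w, X)) \<longlongrightarrow> (\<Sum>i\<in>UNIV. ev (partial i p) z * X $ i)) (at 0)"
    by (rule Lim_transform_eventually[OF lim]) (simp add: eventually_at_filter e)
  ultimately show ?thesis by (rule tendsto_unique[OF at_neq_bot])
qed

text \<open>Formally the sum is the product of all \<open>\<psi> a\<close> times the sum of the
  quotients \<open>\<phi> a / \<psi> a\<close>, and the hypotheses multiply every quotient by the
  same \<open>D\<close>.\<close>

lemma rescale_log_sum:
  fixes \<phi> \<psi> \<phi>' \<psi>' s :: "'i \<Rightarrow> complex"
  assumes 0: "(\<Sum>a\<in>I. \<phi> a * (\<Prod>l\<in>I - {a}. \<psi> l)) = 0" and fin: "finite I"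
    and s: "\<And>a. a \<in> I \<Longrightarrow> s a \<noteq> 0" "D \<noteq> 0"
    and p: "\<And>a. a \<in> I \<Longrightarrow> \<phi> a * D = s a * \<phi>' a" "\<And>a. a \<in> I \<Longrightarrow> \<psi> a = s a * \<psi>' a"
  shows "(\<Sum>a\<in>I. \<phi>' a * (\<Prod>l\<in>I - {a}. \<psi>' l)) = 0"
proof -
  have "D * (\<Sum>a\<in>I. \<phi> a * (\<Prod>l\<in>I - {a}. \<psi> l)) = (\<Sum>a\<in>I. (\<Prod>l\<in>I. s l) * (\<phi>' a * (\<Prod>l\<in>I - {a}. \<psi>' l)))"
    unfolding sum_distrib_left
  proof (rule sum.cong[OF refl])
    fix a assume a: "a \<in> I"
    have "(\<Prod>l\<in>I - {a}. \<psi> l) = (\<Prod>l\<in>I - {a}. s l) * (\<Prod>l\<in>I - {a}. \<psi>' l)"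
      unfolding prod.distrib[symmetric] by (intro prod.cong refl p) auto
    moreover have "(\<Prod>l\<in>I. s l) = s a * (\<Prod>l\<in>I - {a}. s l)" by (rule prod.remove[OF fin a])
    ultimately show "D * (\<phi> a * (\<Prod>l\<in>I - {a}. \<psi> l)) = (\<Prod>l\<in>I. s l) * (\<phi>' a * (\<Prod>l\<in>I - {a}. \<psi>' l))"
      using p(1)[OF a] by (simp add: mult_ac)
  qed
  also have "\<dots> = (\<Prod>l\<in>I. s l) * (\<Sum>a\<in>I. \<phi>' a * (\<Prod>l\<in>I - {a}. \<psi>' l))" by (simp add: sum_distrib_left)
  finally show ?thesis using 0 s fin by simp
qed

text \<open>An index outside \<open>J\<close> has the quotient \<open>E a / N a = c\<close>, so it
  adds \<open>c\<close> to the sum of quotients; the product of the nonzero \<open>N a\<close>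
  outside \<open>J\<close> is cancelled.\<close>

lemma separate_log_sum:
  fixes E N :: "'i \<Rightarrow> complex"
  assumes 0: "(\<Sum>a\<in>I. E a * (\<Prod>l\<in>I - {a}. N l)) = 0" and I: "finite I" "J \<subseteq> I"
    and N: "\<And>a. a \<in> I - J \<Longrightarrow> N a \<noteq> 0" "\<And>a. a \<in> I - J \<Longrightarrow> E a = c * N a"
  shows "(\<Sum>a\<in>J. E a * (\<Prod>l\<in>J - {a}. N l)) + of_nat (card I - card J) * c * (\<Prod>l\<in>J. N l) = 0"
proof -
  define Q where "Q = (\<Prod>l\<in>I - J. N l)"
  have Q: "Q \<noteq> 0" using N(1) I by (auto simp: Q_def)
  have finJ: "finite J" using I finite_subset by blast
  have PI: "(\<Prod>l\<in>I. N l) = Q * (\<Prod>l\<in>J. N l)" unfolding Q_def by (rule prod.subset_diff[OF I(2,1)])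
  have a: "E a * (\<Prod>l\<in>I - {a}. N l) = Q * (E a * (\<Prod>l\<in>J - {a}. N l))" if "a \<in> J" for a
  proof -
    have "(\<Prod>l\<in>I - {a}. N l) = (\<Prod>l\<in>I - {a} - (J - {a}). N l) * (\<Prod>l\<in>J - {a}. N l)"
      by (rule prod.subset_diff) (use I in auto)
    moreover have "I - {a} - (J - {a}) = I - J" using that by auto
    ultimately show ?thesis by (simp add: Q_def mult_ac)
  qed
  have b: "E a * (\<Prod>l\<in>I - {a}. N l) = Q * (c * (\<Prod>l\<in>J. N l))" if a: "a \<in> I - J" for a
  proof -
    have "E a * (\<Prod>l\<in>I - {a}. N l) = c * (N a * (\<Prod>l\<in>I - {a}. N l))" using N(2)[OF a] by simp
    also have "N a * (\<Prod>l\<in>I - {a}. N l) = (\<Prod>l\<in>I. N l)" using a by (subst prod.remove[OF I(1), of a]) auto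
    finally show ?thesis by (simp add: PI mult_ac)
  qed
  have "0 = (\<Sum>a\<in>I - J. E a * (\<Prod>l\<in>I - {a}. N l)) + (\<Sum>a\<in>J. E a * (\<Prod>l\<in>I - {a}. N l))"
    using 0 sum.subset_diff[OF I(2,1), of "\<lambda>a. E a * (\<Prod>l\<in>I - {a}. N l)"] by simp
  also have "(\<Sum>a\<in>J. E a * (\<Prod>l\<in>I - {a}. N l)) = Q * (\<Sum>a\<in>J. E a * (\<Prod>l\<in>J - {a}. N l))"
    unfolding sum_distrib_left by (intro sum.cong refl a)
  also have "(\<Sum>a\<in>I - J. E a * (\<Prod>l\<in>I - {a}. N l)) = (\<Sum>a\<in>I - J. Q * (c * (\<Prod>l\<in>J. N l)))"
    by (intro sum.cong refl b)
  also have "\<dots> = of_nat (card I - card J) * (Q * (c * (\<Prod>l\<in>J. N l)))"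
    using I finJ by (simp add: card_Diff_subset)
  finally have "Q * ((\<Sum>a\<in>J. E a * (\<Prod>l\<in>J - {a}. N l)) + of_nat (card I - card J) * c * (\<Prod>l\<in>J. N l)) = 0"
    by (simp add: algebra_simps)
  then show ?thesis using Q by simp
qed

lemma bil_expand: "bil q v w = (\<Sum>l\<in>UNIV. v $ l * bil q (axis l 1) w)"
proof -
  have "v = (\<Sum>l\<in>UNIV. v $ l *s axis l 1)"
    by (simp add: vec_eq_iff axis_def if_distrib[of "\<lambda>x. _ * x"] cong: if_cong)
  then have "bil q v w = bil q (\<Sum>l\<in>UNIV. v $ l *s axis l 1) w" by simp
  then show ?thesis by (simp only: bil_sum_left bil_scale_left)
qed

lemma poly_linear_quotientE:
  fixes p :: "complex poly"
  obtains Q where "\<And>h. poly p (a + h) = poly p a + h * poly Q (a + h)" "poly Q a = poly (pderiv p) a"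
proof -
  have "poly (p - [:poly p a:]) a = 0" by simp
  then have "[:- a, 1:] dvd p - [:poly p a:]" by (simp only: poly_eq_0_iff_dvd)
  then obtain Q where Q: "p - [:poly p a:] = [:- a, 1:] * Q" by (rule dvdE)
  then have p: "p = [:poly p a:] + [:- a, 1:] * Q" using Q unfolding diff_eq_eq by (simp only: add.commute)
  show thesis
  proof
    show "poly p (a + h) = poly p a + h * poly Q (a + h)" for h
      by (subst p) (simp add: algebra_simps)
    have "pderiv p = pderiv ([:poly p a:] + [:- a, 1:] * Q)" using p by simp
    then show "poly Q a = poly (pderiv p) a"
      by (simp add: pderiv_add pderiv_diff pderiv_mult pderiv_pCons pderiv_smult)
  qed
qed

lemma trace_in_basis:
  fixes A :: "complex^3^3" and p g u :: "complex^3"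
  assumes ind: "\<And>x y z. x *s p + y *s g + z *s u = 0 \<Longrightarrow> x = 0 \<and> y = 0 \<and> z = 0"
    and Ap: "A *v p = \<alpha> *s p" and Ag: "A *v g = x *s p + \<sigma> *s g" and Au: "A *v u = y *s p + y' *s g + \<omega> *s u"
  shows "(\<Sum>i\<in>UNIV. A $ i $ i) = \<alpha> + \<sigma> + \<omega>"
proof -
  define B :: "complex^3^3" where "B = (\<chi> i j. if j = 1 then p $ i else if j = 2 then g $ i else u $ i)"
  define T :: "complex^3^3" where "T = (\<chi> i j. if j = 1 then (if i = 1 then \<alpha> else 0)
      else if j = 2 then (if i = 1 then x else if i = 2 then \<sigma> else 0)
      else (if i = 1 then y else if i = 2 then y' else \<omega>))"
  have Bv: "B *v v = v $ 1 *s p + v $ 2 *s g + v $ 3 *s u" for v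
    by (simp add: B_def vec_eq_iff matrix_vector_mult_def sum_3 mult.commute)
  have "inj ((*v) B)"
    unfolding vec.linear_inj_iff_eq_0[OF matrix_vector_mul_linear_gen]
  proof (intro allI impI)
    fix v :: "complex^3" assume "B *v v = 0"
    then show "v = 0" using ind[of "v $ 1" "v $ 2" "v $ 3"] by (simp add: Bv vec_eq_iff forall_3)
  qed
  then obtain C where C: "C ** B = mat 1" using matrix_left_invertible_injective by blast
  then have C': "B ** C = mat 1" using matrix_left_right_inverse by blast
  have AB: "A ** B = B ** T"
  proof -
    have comp: "(A *v w) $ i = (\<Sum>l\<in>UNIV. A $ i $ l * w $ l)" for w i
      by (simp add: matrix_vector_mult_def)
    have 1: "(\<Sum>l\<in>UNIV. A $ i $ l * p $ l) = \<alpha> * p $ i" for i using Ap comp[of p i] by simp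
    have 2: "(\<Sum>l\<in>UNIV. A $ i $ l * g $ l) = x * p $ i + \<sigma> * g $ i" for i using Ag comp[of g i] by simp
    have 3: "(\<Sum>l\<in>UNIV. A $ i $ l * u $ l) = y * p $ i + y' * g $ i + \<omega> * u $ i" for i using Au comp[of u i] by simp
    have "(A ** B) $ i $ j = (B ** T) $ i $ j" for i j
      using 1[of i] 2[of i] 3[of i] exhaust_3[of j]
      by (auto simp: matrix_matrix_mult_def B_def T_def sum_3 mult.commute)
    then show ?thesis by (simp add: vec_eq_iff)
  qed
  have "A = A ** (B ** C)" by (simp add: C')
  also have "\<dots> = B ** (T ** C)" by (simp add: matrix_mul_assoc AB)
  finally have "trace A = trace (B ** (T ** C))" by simp
  also have "\<dots> = trace ((T ** C) ** B)" by (rule trace_mul_sym)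
  also have "(T ** C) ** B = T" by (simp add: matrix_mul_assoc[symmetric] C)
  finally have "trace A = trace T" .
  then show ?thesis by (simp add: trace_def T_def sum_3)
qed

subsection \<open>The vector field along one conic\<close>

lemma continuous_on_bil [continuous_intros]:
  assumes "continuous_on A f" "continuous_on A g"
  shows "continuous_on A (\<lambda>x. bil q (f x) (g x))"
  unfolding bil_def by (intro continuous_intros assms)

lemma continuous_on_vector_scalar_mult [continuous_intros]:
  fixes f :: "'b::topological_space \<Rightarrow> complex" and g :: "'b \<Rightarrow> complex^'n"
  assumes "continuous_on A f" "continuous_on A g"
  shows "continuous_on A (\<lambda>x. f x *s g x)"
  unfolding vector_scalar_mult_def by (intro continuous_intros assms)

lemma continuous_on_ev_compose [continuous_intros]:
  "continuous_on A f \<Longrightarrow> continuous_on A (\<lambda>x. ev p (f x))"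
  by (rule continuous_on_compose2[OF continuous_on_ev_UNIV]) auto

lemma has_difference_quotientD:
  assumes "has_difference_quotient F G"
  shows "continuous_on UNIV G" and "F (z + w *s X) = F z + w * G (z, w, X)"
  using assms by (auto simp: has_difference_quotient_def)

locale conic_syzygy =
  fixes q :: "nat \<Rightarrow> S" and k :: nat and t :: "3 \<Rightarrow> S" and r :: nat
  assumes sm: "\<And>j. j < k \<Longrightarrow> smooth_conic (q j)"
    and distinct: "\<And>i j. i < k \<Longrightarrow> j < k \<Longrightarrow> i \<noteq> j \<Longrightarrow> zero_set (q i) \<noteq> zero_set (q j)"
    and t_hom: "\<And>i. homogeneous (int r) (t i)"
    and syz: "(\<Sum>i\<in>UNIV. t i * partial i (\<Prod>j<k. q j)) = 0"
begin

definition \<theta> :: "complex^3 \<Rightarrow> complex^3" where "\<theta> z = (\<chi> i. ev (t i) z)"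

text \<open>The derivation \<open>\<theta>\<close> applied to \<open>q j\<close>.\<close>

definition \<Phi> :: "nat \<Rightarrow> complex^3 \<Rightarrow> complex" where "\<Phi> j z = bil (q j) z (\<theta> z)"

definition \<Gamma> :: "(complex^3) \<times> complex \<times> (complex^3) \<Rightarrow> complex^3" where
  "\<Gamma> x = (\<chi> i. (SOME G. has_difference_quotient (ev (t i)) G) x)"

definition Jac :: "complex^3 \<Rightarrow> complex^3^3" where "Jac z = (\<chi> i l. ev (partial l (t i)) z)"

lemma hom: "j < k \<Longrightarrow> homogeneous 2 (q j)"
  using sm smooth_conicD(1) by blast

lemma dq: "has_difference_quotient (ev (t i)) (SOME G. has_difference_quotient (ev (t i)) G)"
  by (rule someI_ex[OF ex_difference_quotient_ev])

lemma \<Gamma>_continuous: "continuous_on UNIV \<Gamma>"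
  unfolding \<Gamma>_def[abs_def] by (intro continuous_on_vec_lambda has_difference_quotientD(1)[OF dq])

lemma \<theta>_increment: "\<theta> (z + w *s X) = \<theta> z + w *s \<Gamma> (z, w, X)"
  by (simp add: vec_eq_iff \<theta>_def \<Gamma>_def has_difference_quotientD(2)[OF dq])

lemma \<Gamma>_0: "\<Gamma> (z, 0, X) = Jac z *v X"
  by (simp add: vec_eq_iff \<Gamma>_def difference_quotient_at_0[OF dq] Jac_def matrix_vector_mult_def)

lemma \<theta>_continuous: "continuous_on UNIV \<theta>"
  unfolding \<theta>_def by (intro continuous_on_vec_lambda continuous_on_ev_UNIV)

lemma \<theta>_scale: "\<theta> (c *s z) = c ^ r *s \<theta> z"
  by (simp add: vec_eq_iff \<theta>_def ev_scale[OF t_hom])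

lemma Jac_euler: "Jac z *v z = of_nat r *s \<theta> z"
  using euler_identity[OF t_hom] by (simp add: vec_eq_iff Jac_def matrix_vector_mult_def \<theta>_def)

lemma log_sum: "(\<Sum>a<k. \<Phi> a z * (\<Prod>l\<in>{..<k} - {a}. ev (q l) z)) = 0"
proof -
  have f: "ev (\<Prod>j<k. q j) = (\<lambda>z. \<Prod>j<k. ev (q j) z)"
    by (simp add: fun_eq_iff eval_hom_prod[OF is_ring_hom_id])
  have "(ev (\<Prod>j<k. q j) has_derivative (\<lambda>h. \<Sum>a<k. bil (q a) z h * (\<Prod>l\<in>{..<k} - {a}. ev (q l) z))) (at z)"
    unfolding f by (rule has_derivative_prod) (simp add: has_derivative_conic hom)
  from fun_cong[OF has_derivative_unique[OF has_derivative_ev this], of "\<theta> z"]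
  have "(\<Sum>a<k. \<Phi> a z * (\<Prod>l\<in>{..<k} - {a}. ev (q l) z)) = (\<Sum>i\<in>UNIV. ev (t i * partial i (\<Prod>j<k. q j)) z)"
    by (simp add: \<Phi>_def \<theta>_def eval_hom_mult[OF is_ring_hom_id] mult.commute)
  also have "\<dots> = ev (\<Sum>i\<in>UNIV. t i * partial i (\<Prod>j<k. q j)) z"
    by (rule eval_hom_sum[OF is_ring_hom_id, symmetric])
  finally show ?thesis by (simp add: syz)
qed

text \<open>On the conic \<open>j\<close> only the summand \<open>j\<close> of
  \<open>log_sum\<close> survives. Along a parametrisation both of its factors are polynomials, and
  the product of the other conics is not the zero polynomial because the conics are
  distinct.\<close>

lemma \<Phi>_on_conic:
  assumes j: "j < k" and P: "P \<noteq> 0" "ev (q j) P = 0"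
  shows "\<Phi> j P = 0"
proof -
  obtain b V W where "conic_frame (q j) b P V W" by (rule conic_frameE[OF sm[OF j] P])
  then have fr0: "conic_frame (q j) b P V W" .
  have "\<exists>x y z. v = x *s W + y *s V + z *s P" for v
  proof -
    obtain x y z where "v = x *s P + y *s V + z *s W" using fr0 unfolding conic_frame_def by blast
    then have "v = z *s W + y *s V + x *s P" by (simp add: add_ac)
    then show ?thesis by blast
  qed
  \<comment> \<open>Exchanging the outer frame vectors gives \<open>P\<close> the parameter 0; in
    the first frame it is the point that the parametrisation misses.\<close>
  then have fr: "conic_frame (q j) b W V P"
    using fr0 unfolding conic_frame_def
    by (simp add: bil_commute[of "q j" W P] bil_commute[of "q j" W V] bil_commute[of "q j" V P])
  let ?R = "\<lambda>p. restrict_poly p W V P"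
  define Lp where "Lp = (\<Sum>l\<in>UNIV. ?R (partial l (q j)) * ?R (t l))"
  define Gp where "Gp = (\<Prod>l\<in>{..<k} - {j}. ?R (q l))"
  have L: "poly Lp s = \<Phi> j (conic_pt W V P s)" for s
    unfolding \<Phi>_def ev_partial_conic[OF hom[OF j], symmetric] by (simp add: Lp_def poly_sum poly_restrict_poly \<theta>_def)
  have "?R (q l) \<noteq> 0" if "l \<in> {..<k} - {j}" for l
    using conic_vanishing_on_conic[OF sm[OF j] sm fr, of l] distinct[OF j, of l] that by auto
  then have G: "Gp \<noteq> 0" by (auto simp: Gp_def)
  have "poly (Lp * Gp) s = 0" for s
  proof -
    let ?z = "conic_pt W V P s"
    have 0: "ev (q j) ?z = 0" by (rule conic_frame_ev_pt[OF fr])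
    have "(\<Sum>a<k. \<Phi> a ?z * (\<Prod>l\<in>{..<k} - {a}. ev (q l) ?z)) = (\<Sum>a\<in>{j}. \<Phi> a ?z * (\<Prod>l\<in>{..<k} - {a}. ev (q l) ?z))"
    proof (rule sum.mono_neutral_right)
      show "\<forall>a\<in>{..<k} - {j}. \<Phi> a ?z * (\<Prod>l\<in>{..<k} - {a}. ev (q l) ?z) = 0"
      proof
        fix a assume "a \<in> {..<k} - {j}"
        then have "(\<Prod>l\<in>{..<k} - {a}. ev (q l) ?z) = 0" using j 0 by (intro prod_zero) auto
        then show "\<Phi> a ?z * (\<Prod>l\<in>{..<k} - {a}. ev (q l) ?z) = 0" by simp
      qed
    qed (use j in auto)
    then show ?thesis using log_sum[of ?z] by (simp add: L Gp_def poly_prod poly_restrict_poly)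
  qed
  then have "Lp * Gp = 0" using poly_all_0_iff_0 by blast
  then have "Lp = 0" using G by simp
  then have "\<Phi> j (conic_pt W V P 0) = 0" using L[of 0] by simp
  then show ?thesis by (simp add: conic_pt_def)
qed

end

locale conic_syzygy_frame = conic_syzygy +
  fixes i :: nat and b :: complex and U V W :: "complex^3"
  assumes i: "i < k" and fr: "conic_frame (q i) b U V W"
begin

abbreviation "\<gamma> \<equiv> conic_pt U V W"

text \<open>Together with \<open>\<gamma>\<close> and with \<open>U\<close>, half of the second
  derivative, a moving frame along the conic: \<open>\<gamma>\<close> and \<open>\<gamma>'\<close>
  span the tangent plane of the cone.\<close>

definition \<gamma>' :: "complex \<Rightarrow> complex^3" where "\<gamma>' s = (2 * s) *s U + V"

lemma b0: "b \<noteq> 0" using fr by (simp add: conic_frame_def)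

lemma frame_bil: "bil (q i) U U = 0" "bil (q i) W W = 0" "bil (q i) U V = 0" "bil (q i) V U = 0"
  "bil (q i) V W = 0" "bil (q i) W V = 0" "bil (q i) U W = b" "bil (q i) W U = b" "bil (q i) V V = - 2 * b"
  using fr by (auto simp: conic_frame_def bil_commute[of "q i" V U] bil_commute[of "q i" W V] bil_commute[of "q i" W U])

lemma \<gamma>_add: "\<gamma> (s + \<tau>) = \<gamma> s + \<tau> *s (\<gamma>' s + \<tau> *s U)"
  by (simp add: conic_pt_def \<gamma>'_def vec_eq_iff power2_eq_square algebra_simps)

lemma \<gamma>_bil: "bil (q i) (\<gamma> s) (\<gamma> s) = 0" "bil (q i) (\<gamma> s) (\<gamma>' s) = 0" "bil (q i) (\<gamma> s) U = b"
  "bil (q i) (\<gamma>' s) U = 0" "ev (q i) (\<gamma>' s) = - b" "ev (q i) U = 0" "bil (q i) (\<gamma>' s) (\<gamma>' s) = - 2 * b"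
proof -
  show 1: "bil (q i) (\<gamma>' s) (\<gamma>' s) = - 2 * b"
    by (simp add: \<gamma>'_def bil_simps frame_bil algebra_simps)
  show "ev (q i) (\<gamma>' s) = - b" using bil_same[OF hom[OF i], of "\<gamma>' s"] 1 by simp
  show "ev (q i) U = 0" using bil_same[OF hom[OF i], of U] frame_bil by simp
qed (simp_all add: conic_pt_def \<gamma>'_def bil_simps frame_bil power2_eq_square algebra_simps)

lemma \<gamma>_ev: "ev (q i) (\<gamma> s) = 0"
  by (rule conic_frame_ev_pt[OF fr])

lemma \<gamma>_nonzero: "\<gamma> s \<noteq> 0"
  by (rule conic_pt_nonzero[OF fr])

lemma \<gamma>_independent:
  assumes "x *s \<gamma> s + y *s \<gamma>' s + z *s U = 0"
  shows "x = 0 \<and> y = 0 \<and> z = 0"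
proof -
  have e: "x *s \<gamma> s + y *s \<gamma>' s + z *s U = (x * s\<^sup>2 + 2 * s * y + z) *s U + (x * s + y) *s V + x *s W"
    by (simp add: conic_pt_def \<gamma>'_def vec_eq_iff algebra_simps)
  have "x * s\<^sup>2 + 2 * s * y + z = 0 \<and> x * s + y = 0 \<and> x = 0"
    by (rule conic_frame_independent[OF fr]) (simp only: e[symmetric] assms)
  then show ?thesis by auto
qed

definition coord_poly :: "(3 \<Rightarrow> complex) \<Rightarrow> complex poly" where
  "coord_poly c = (\<Sum>l\<in>UNIV. Polynomial.smult (c l) (restrict_poly (t l) U V W))"

text \<open>\<open>Xp\<close>, \<open>Yp\<close>, \<open>Zp\<close> are the coordinates of
  \<open>\<theta>\<close> on the conic in the frame \<open>U\<close>, \<open>V\<close>,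
  \<open>W\<close>, read off by the polar form; \<open>Vp\<close> is the tangential component, the
  coefficient of \<open>\<gamma>'\<close>.\<close>

definition "Xp = coord_poly (\<lambda>l. bil (q i) (axis l 1) W / b)"
definition "Yp = coord_poly (\<lambda>l. - bil (q i) (axis l 1) V / (2 * b))"
definition "Zp = coord_poly (\<lambda>l. bil (q i) (axis l 1) U / b)"
definition "Vp = Yp - pCons 0 Zp"

lemma degree_coord_poly: "degree (coord_poly c) \<le> r * 2"
  unfolding coord_poly_def
  by (intro degree_sum_le) (auto intro: degree_restrict_poly[OF t_hom])

lemma poly_coord_poly: "poly (coord_poly c) s = (\<Sum>l\<in>UNIV. \<theta> (\<gamma> s) $ l * c l)"
  by (simp add: coord_poly_def poly_sum poly_restrict_poly \<theta>_def mult.commute)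

lemma poly_coords: "poly Xp s = bil (q i) (\<theta> (\<gamma> s)) W / b" "poly Yp s = - bil (q i) (\<theta> (\<gamma> s)) V / (2 * b)"
  "poly Zp s = bil (q i) (\<theta> (\<gamma> s)) U / b"
  unfolding Xp_def Yp_def Zp_def poly_coord_poly bil_expand[of "q i" "\<theta> (\<gamma> s)"]
  by (simp_all add: sum_divide_distrib sum_negf)

lemma coordinates:
  "\<theta> (\<gamma> s) = poly Xp s *s U + poly Yp s *s V + poly Zp s *s W"
  "poly Xp s = 2 * s * poly Yp s - s\<^sup>2 * poly Zp s"
proof -
  obtain x y z where e: "\<theta> (\<gamma> s) = x *s U + y *s V + z *s W"
    using fr unfolding conic_frame_def by blast
  have c: "poly Xp s = x" "poly Yp s = y" "poly Zp s = z"
    using b0 unfolding poly_coords e by (simp_all add: bil_simps frame_bil)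
  show "\<theta> (\<gamma> s) = poly Xp s *s U + poly Yp s *s V + poly Zp s *s W" unfolding c by (rule e)
  have "\<Phi> i (\<gamma> s) = 0" by (rule \<Phi>_on_conic[OF i \<gamma>_nonzero \<gamma>_ev])
  then have "b * (x + s\<^sup>2 * z - 2 * s * y) = 0"
    unfolding \<Phi>_def e unfolding conic_pt_def by (simp add: bil_simps frame_bil algebra_simps)
  then have "x + s\<^sup>2 * z - 2 * s * y = 0" using b0 by simp
  then show "poly Xp s = 2 * s * poly Yp s - s\<^sup>2 * poly Zp s" unfolding c by (simp add: algebra_simps)
qed

lemma \<theta>_\<gamma>: "\<theta> (\<gamma> s) = poly Zp s *s \<gamma> s + poly Vp s *s \<gamma>' s"
  unfolding coordinates(1) coordinates(2)
  by (simp add: Vp_def conic_pt_def \<gamma>'_def vec_eq_iff power2_eq_square algebra_simps)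

text \<open>By its definition alone \<open>Vp\<close> could have degree \<open>2 * r + 1\<close>.
  Tangency to the conic gives \<open>s * Vp = Xp - s * Yp\<close>, whose right-hand side has degree
  at most \<open>2 * r + 1\<close>, and this saves one.\<close>

lemma degree_Vp: "degree Vp \<le> 2 * r"
proof (cases "Vp = 0")
  case False
  have "pCons 0 Vp = Xp - pCons 0 Yp"
    unfolding poly_eq_poly_eq_iff[symmetric]
    by (rule ext) (simp add: Vp_def coordinates(2) power2_eq_square algebra_simps)
  then have "degree (pCons 0 Vp) = degree (Xp - pCons 0 Yp)" by simp
  also have "\<dots> \<le> max (degree Xp) (degree (pCons 0 Yp))" by (rule degree_diff_le_max)
  also have "\<dots> \<le> r * 2 + 1"
  proof (rule max.boundedI)
    show "degree Xp \<le> r * 2 + 1" unfolding Xp_def by (rule order.trans[OF degree_coord_poly]) simp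
    have "degree (pCons 0 Yp) \<le> Suc (degree Yp)" by (rule degree_pCons_le)
    also have "\<dots> \<le> r * 2 + 1" using degree_coord_poly unfolding Yp_def by simp
    finally show "degree (pCons 0 Yp) \<le> r * 2 + 1" .
  qed
  finally show ?thesis using False by simp
qed simp

text \<open>The derivative of \<open>\<theta>_\<gamma>\<close> along the conic, obtained by dividing
  increments by \<open>\<tau>\<close>; the last term comes from the derivative \<open>2 *s U\<close>
  of \<open>\<gamma>'\<close>.\<close>

lemma Jac_\<gamma>':
  "Jac (\<gamma> s) *v \<gamma>' s = poly (pderiv Zp) s *s \<gamma> s + (poly Zp s + poly (pderiv Vp) s) *s \<gamma>' s + (2 * poly Vp s) *s U"
proof -
  obtain Z1 where Z1: "\<And>h. poly Zp (s + h) = poly Zp s + h * poly Z1 (s + h)" "poly Z1 s = poly (pderiv Zp) s"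
    by (rule poly_linear_quotientE[of Zp s]) (rule that)
  obtain V1 where V1: "\<And>h. poly Vp (s + h) = poly Vp s + h * poly V1 (s + h)" "poly V1 s = poly (pderiv Vp) s"
    by (rule poly_linear_quotientE[of Vp s]) (rule that)
  let ?F = "\<lambda>\<tau>. \<Gamma> (\<gamma> s, \<tau>, \<gamma>' s + \<tau> *s U)"
  let ?G = "\<lambda>\<tau>. poly Z1 (s + \<tau>) *s \<gamma> (s + \<tau>) + poly Zp s *s (\<gamma>' s + \<tau> *s U) + poly V1 (s + \<tau>) *s \<gamma>' (s + \<tau>) + (2 * poly Vp s) *s U"
  have "?F 0 = ?G 0"
  proof (rule continuous_eq_at_0)
    show "continuous_on UNIV ?F"
      by (rule continuous_on_compose2[OF \<Gamma>_continuous]) (intro continuous_intros, simp)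
    show "continuous_on UNIV ?G"
      unfolding conic_pt_def \<gamma>'_def by (intro continuous_intros)
    fix \<tau> :: complex assume \<tau>: "\<tau> \<noteq> 0"
    have "\<tau> *s ?F \<tau> = \<theta> (\<gamma> (s + \<tau>)) - \<theta> (\<gamma> s)"
      unfolding \<gamma>_add \<theta>_increment by simp
    also have "\<dots> = (\<tau> * poly Z1 (s + \<tau>)) *s \<gamma> (s + \<tau>) + poly Zp s *s (\<gamma> (s + \<tau>) - \<gamma> s)
        + (\<tau> * poly V1 (s + \<tau>)) *s \<gamma>' (s + \<tau>) + poly Vp s *s (\<gamma>' (s + \<tau>) - \<gamma>' s)"
      unfolding \<theta>_\<gamma> Z1(1) V1(1) by (simp add: vec_eq_iff ring_distribs)
    also have "\<gamma> (s + \<tau>) - \<gamma> s = \<tau> *s (\<gamma>' s + \<tau> *s U)" by (simp add: \<gamma>_add)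
    also have "\<gamma>' (s + \<tau>) - \<gamma>' s = (2 * \<tau>) *s U" by (simp add: \<gamma>'_def vec_eq_iff ring_distribs)
    also have "(\<tau> * poly Z1 (s + \<tau>)) *s \<gamma> (s + \<tau>) + poly Zp s *s (\<tau> *s (\<gamma>' s + \<tau> *s U))
        + (\<tau> * poly V1 (s + \<tau>)) *s \<gamma>' (s + \<tau>) + poly Vp s *s ((2 * \<tau>) *s U) = \<tau> *s ?G \<tau>"
      by (simp add: vec_eq_iff ring_distribs mult_ac)
    finally have "\<tau> = 0 \<or> ?F \<tau> = ?G \<tau>" by (simp only: vector_mul_lcancel)
    then show "?F \<tau> = ?G \<tau>" using \<tau> by blast
  qed
  then show ?thesis by (simp add: \<Gamma>_0 Z1(2) V1(2) vec_eq_iff ring_distribs)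
qed

end

section \<open>Multiplicities of roots\<close>

lemma order_prod:
  fixes f :: "'i \<Rightarrow> complex poly"
  assumes "finite A" "\<And>x. x \<in> A \<Longrightarrow> f x \<noteq> 0"
  shows "Polynomial.order s (\<Prod>x\<in>A. f x) = (\<Sum>x\<in>A. Polynomial.order s (f x))"
  using assms
proof (induction A)
  case (insert x A)
  then have "f x * (\<Prod>x\<in>A. f x) \<noteq> 0" by auto
  with insert show ?case by (simp add: order_mult)
qed simp

lemma order_le_Suc_order_pderiv:
  fixes p :: "complex poly"
  assumes "pderiv p \<noteq> 0"
  shows "Polynomial.order s p \<le> Suc (Polynomial.order s (pderiv p))"
proof (cases "Polynomial.order s p = 0")
  case False
  then have "p \<noteq> 0" "poly p s = 0" using order_root[of p s] assms by auto
  then show ?thesis using order_pderiv[of p s] by simp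
qed simp

lemma order_le_1:
  fixes p :: "complex poly"
  assumes "poly (pderiv p) s \<noteq> 0"
  shows "Polynomial.order s p \<le> 1"
proof -
  have "pderiv p \<noteq> 0" using assms by auto
  then show ?thesis using order_le_Suc_order_pderiv[of p s] order_0I[OF assms] by simp
qed

lemma order_le_2:
  fixes p :: "complex poly"
  assumes "poly (pderiv (pderiv p)) s \<noteq> 0"
  shows "Polynomial.order s p \<le> 2"
proof -
  have "pderiv p \<noteq> 0" using assms by auto
  then show ?thesis using order_le_Suc_order_pderiv[of p s] order_le_1[OF assms] by simp
qed

lemma order_ge_1:
  fixes p :: "complex poly"
  assumes "p \<noteq> 0" "poly p s = 0"
  shows "1 \<le> Polynomial.order s p"
  using assms order_root[of p s] by simp

lemma order_ge_2:
  fixes p :: "complex poly"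
  assumes "p \<noteq> 0" "poly p s = 0" "poly (pderiv p) s = 0"
  shows "2 \<le> Polynomial.order s p"
proof -
  have "pderiv p \<noteq> 0"
  proof
    assume "pderiv p = 0"
    then obtain c where "p = [:c:]" using pderiv_eq_0_iff[of p] degree_eq_zeroE by blast
    then show False using assms by simp
  qed
  moreover have "Polynomial.order s p = Suc (Polynomial.order s (pderiv p))" by (rule order_pderiv[OF assms(1,2)])
  ultimately show ?thesis using order_ge_1[of "pderiv p" s] assms(3) by simp
qed

lemma degree_le_if_order_le:
  fixes p g :: "complex poly"
  assumes "p \<noteq> 0" "g \<noteq> 0" "\<And>s. Polynomial.order s g \<le> Polynomial.order s p"
  shows "degree g \<le> degree p"
proof -
  have "proots g \<subseteq># proots p" by (rule mset_subset_eqI) (simp add: assms)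
  from size_mset_mono[OF this] show ?thesis by (simp add: size_proots_complex)
qed

lemma simply_tangent_sym:
  assumes "simply_tangent p q z" "bil p z X \<noteq> 0" "bil q z Y \<noteq> 0"
  shows "simply_tangent q p z"
proof -
  obtain \<kappa> T where T: "\<And>x. bil q z x = \<kappa> * bil p z x" "bil p z T = 0" "ev q T \<noteq> \<kappa> * ev p T"
    using assms(1) unfolding simply_tangent_def by blast
  have "\<kappa> \<noteq> 0" using T(1)[of Y] assms(3) by auto
  then show ?thesis
    unfolding simply_tangent_def using T by (intro exI[of _ "1 / \<kappa>"] exI[of _ T]) (auto simp: field_simps)
qed

context conic_syzygy
begin

lemma \<Gamma>_continuous_compose [continuous_intros]:
  "continuous_on A f \<Longrightarrow> continuous_on A (\<lambda>x. \<Gamma> (f x))"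
  by (rule continuous_on_compose2[OF \<Gamma>_continuous]) auto

lemma \<theta>_continuous_compose [continuous_intros]:
  "continuous_on A f \<Longrightarrow> continuous_on A (\<lambda>x. \<theta> (f x))"
  by (rule continuous_on_compose2[OF \<theta>_continuous]) auto

lemma \<Phi>_continuous_compose [continuous_intros]:
  "continuous_on A f \<Longrightarrow> continuous_on A (\<lambda>x. \<Phi> a (f x))"
  unfolding \<Phi>_def by (intro continuous_intros)

text \<open>Leading coefficients of \<open>\<Sum>\<^sub>a \<Phi>\<^sub>a \<Prod>\<^sub>l q\<^sub>l = 0\<close> along a curve \<open>\<tau> \<mapsto> z \<tau>\<close>: \<open>s \<tau>\<close> is a factor
  common to all \<open>q\<^sub>a (z \<tau>)\<close> with \<open>a \<in> J\<close>.\<close>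

lemma limit_log_sum:
  fixes z :: "complex \<Rightarrow> complex^3" and s D :: "complex \<Rightarrow> complex" and \<phi> \<psi> :: "nat \<Rightarrow> complex \<Rightarrow> complex"
  assumes J: "J \<subseteq> {..<k}"
    and nz: "\<And>\<tau>. \<tau> \<noteq> 0 \<Longrightarrow> s \<tau> \<noteq> 0" "\<And>\<tau>. \<tau> \<noteq> 0 \<Longrightarrow> D \<tau> \<noteq> 0"
    and cont: "continuous_on UNIV z" "continuous_on UNIV D"
      "\<And>a. a \<in> J \<Longrightarrow> continuous_on UNIV (\<phi> a)" "\<And>a. a \<in> J \<Longrightarrow> continuous_on UNIV (\<psi> a)"
    and \<phi>: "\<And>a \<tau>. a \<in> J \<Longrightarrow> \<Phi> a (z \<tau>) * D \<tau> = s \<tau> * \<phi> a \<tau>"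
    and \<psi>: "\<And>a \<tau>. a \<in> J \<Longrightarrow> ev (q a) (z \<tau>) = s \<tau> * \<psi> a \<tau>"
    and out: "\<And>a. a \<in> {..<k} - J \<Longrightarrow> ev (q a) (z 0) \<noteq> 0"
      "\<And>a. a \<in> {..<k} - J \<Longrightarrow> \<Phi> a (z 0) * D 0 = c * ev (q a) (z 0)"
  shows "(\<Sum>a\<in>J. \<phi> a 0 * (\<Prod>l\<in>J - {a}. \<psi> l 0)) + of_nat (k - card J) * c * (\<Prod>l\<in>J. \<psi> l 0) = 0"
proof -
  define \<phi>' where "\<phi>' a \<tau> = (if a \<in> J then \<phi> a \<tau> else \<Phi> a (z \<tau>) * D \<tau>)" for a \<tau>
  define \<psi>' where "\<psi>' a \<tau> = (if a \<in> J then \<psi> a \<tau> else ev (q a) (z \<tau>))" for a \<tau>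
  have c1: "continuous_on UNIV (\<phi>' a)" for a
  proof (cases "a \<in> J")
    case False
    then have "\<phi>' a = (\<lambda>\<tau>. \<Phi> a (z \<tau>) * D \<tau>)" by (simp add: \<phi>'_def fun_eq_iff)
    then show ?thesis by (simp add: continuous_intros cont)
  qed (use cont(3) in \<open>simp add: \<phi>'_def[abs_def]\<close>)
  have c2: "continuous_on UNIV (\<psi>' a)" for a
  proof (cases "a \<in> J")
    case False
    then have "\<psi>' a = (\<lambda>\<tau>. ev (q a) (z \<tau>))" by (simp add: \<psi>'_def fun_eq_iff)
    then show ?thesis by (simp add: continuous_intros cont)
  qed (use cont(4) in \<open>simp add: \<psi>'_def[abs_def]\<close>)
  have "(\<Sum>a<k. \<phi>' a 0 * (\<Prod>l\<in>{..<k} - {a}. \<psi>' l 0)) = 0"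
  proof (rule continuous_eq_at_0[where F = "\<lambda>\<tau>. \<Sum>a<k. \<phi>' a \<tau> * (\<Prod>l\<in>{..<k} - {a}. \<psi>' l \<tau>)" and G = "\<lambda>_. 0"])
    show "continuous_on UNIV (\<lambda>\<tau>. \<Sum>a<k. \<phi>' a \<tau> * (\<Prod>l\<in>{..<k} - {a}. \<psi>' l \<tau>))"
      by (intro continuous_on_sum continuous_on_mult continuous_on_prod c1 c2)
    fix \<tau> :: complex assume \<tau>: "\<tau> \<noteq> 0"
    show "(\<Sum>a<k. \<phi>' a \<tau> * (\<Prod>l\<in>{..<k} - {a}. \<psi>' l \<tau>)) = 0"
      by (rule rescale_log_sum[OF log_sum[of "z \<tau>"], where s = "\<lambda>a. if a \<in> J then s \<tau> else 1" and D = "D \<tau>"])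
         (use nz \<tau> \<phi> \<psi> in \<open>auto simp: \<phi>'_def \<psi>'_def\<close>)
  qed simp
  from separate_log_sum[OF this finite_lessThan J, of c]
  have "(\<Sum>a\<in>J. \<phi>' a 0 * (\<Prod>l\<in>J - {a}. \<psi>' l 0)) + of_nat (k - card J) * c * (\<Prod>l\<in>J. \<psi>' l 0) = 0"
    using out by (simp add: \<phi>'_def \<psi>'_def)
  moreover have "(\<Sum>a\<in>J. \<phi>' a 0 * (\<Prod>l\<in>J - {a}. \<psi>' l 0)) = (\<Sum>a\<in>J. \<phi> a 0 * (\<Prod>l\<in>J - {a}. \<psi> l 0))"
  proof (rule sum.cong[OF refl])
    fix a assume a: "a \<in> J"
    have "(\<Prod>l\<in>J - {a}. \<psi>' l 0) = (\<Prod>l\<in>J - {a}. \<psi> l 0)"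
      by (rule prod.cong) (auto simp: \<psi>'_def)
    then show "\<phi>' a 0 * (\<Prod>l\<in>J - {a}. \<psi>' l 0) = \<phi> a 0 * (\<Prod>l\<in>J - {a}. \<psi> l 0)"
      using a by (simp add: \<phi>'_def)
  qed
  moreover have "(\<Prod>l\<in>J. \<psi>' l 0) = (\<Prod>l\<in>J. \<psi> l 0)"
    by (rule prod.cong) (auto simp: \<psi>'_def)
  ultimately show ?thesis by simp
qed

lemma \<Phi>_eigen: "a < k \<Longrightarrow> \<theta> P = c *s P \<Longrightarrow> \<Phi> a P = 2 * c * ev (q a) P"
  by (simp add: \<Phi>_def bil_simps bil_same[OF hom])

text \<open>Along the line \<open>\<tau> \<mapsto> P + \<tau> *s X\<close> every conic through
  \<open>P\<close> loses one factor \<open>\<tau>\<close>, and by Euler's relation every other conic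
  contributes the quotient \<open>2 * c\<close>. The limit ties the action of the Jacobian matrix on
  the tangent lines to the scalar \<open>c\<close>.\<close>

lemma first_order:
  assumes \<theta>P: "\<theta> P = c *s P"
  shows "(\<Sum>a\<in>through q k P. (c * bil (q a) P X + bil (q a) P (Jac P *v X)) * (\<Prod>l\<in>through q k P - {a}. bil (q l) P X))
    + of_nat (k - card (through q k P)) * (2 * c) * (\<Prod>l\<in>through q k P. bil (q l) P X) = 0"
proof -
  let ?J = "through q k P"
  let ?z = "\<lambda>\<tau>. P + \<tau> *s X"
  let ?\<phi> = "\<lambda>a \<tau>. c * bil (q a) P X + bil (q a) P (\<Gamma> (P, \<tau>, X)) + \<tau> * bil (q a) X (\<Gamma> (P, \<tau>, X))"
  let ?\<psi> = "\<lambda>a \<tau>. bil (q a) P X + \<tau> * ev (q a) X"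
  have "(\<Sum>a\<in>?J. ?\<phi> a 0 * (\<Prod>l\<in>?J - {a}. ?\<psi> l 0)) + of_nat (k - card ?J) * (2 * c) * (\<Prod>l\<in>?J. ?\<psi> l 0) = 0"
  proof (rule limit_log_sum[where z = ?z and D = "\<lambda>_. 1" and s = "\<lambda>\<tau>. \<tau>"])
    show "?J \<subseteq> {..<k}" by (auto simp: through_def)
    fix a assume a: "a \<in> ?J"
    then have ak: "a < k" "ev (q a) P = 0" by (auto simp: through_def)
    show "\<Phi> a (P + \<tau> *s X) * 1 = \<tau> * ?\<phi> a \<tau>" for \<tau>
      unfolding \<Phi>_def \<theta>_increment \<theta>P
      using ak bil_same[OF hom[OF ak(1)], of P]
      by (simp add: bil_simps bil_commute[of "q a" X P] algebra_simps)
    show "ev (q a) (P + \<tau> *s X) = \<tau> * ?\<psi> a \<tau>" for \<tau>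
      using ak by (simp add: ev_add[OF hom] ev_scale2[OF hom] bil_simps power2_eq_square algebra_simps)
  next
    fix a assume "a \<in> {..<k} - ?J"
    then have ak: "a < k" "ev (q a) P \<noteq> 0" by (auto simp: through_def)
    show "ev (q a) (P + 0 *s X) \<noteq> 0" using ak by simp
    show "\<Phi> a (P + 0 *s X) * 1 = 2 * c * ev (q a) (P + 0 *s X)" using \<Phi>_eigen[OF ak(1) \<theta>P] by simp
  qed (auto intro!: continuous_intros)
  then show ?thesis by (simp add: \<Gamma>_0)
qed

end

section \<open>Zeros of the tangential component at nodes, tacnodes and triple points\<close>

context conic_syzygy_frame
begin

text \<open>Its roots are the parameters of the intersection points with conic \<open>i\<close>,
  with their multiplicities.\<close>

definition G :: "nat \<Rightarrow> complex poly" where "G a = restrict_poly (q a) U V W"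

lemma poly_G: "poly (G a) s = ev (q a) (\<gamma> s)"
  by (simp add: G_def poly_restrict_poly)

lemma poly_pderiv_G:
  assumes "a < k"
  shows "poly (pderiv (G a)) s = bil (q a) (\<gamma> s) (\<gamma>' s)"
    and "poly (pderiv (pderiv (G a))) s = 2 * (ev (q a) (\<gamma>' s) + bil (q a) (\<gamma> s) U)"
  unfolding G_def restrict_poly_conic[OF hom[OF assms]]
  by (simp_all add: pderiv_pCons conic_pt_def \<gamma>'_def bil_simps bil_same[OF hom[OF assms]] ev_add[OF hom[OF assms]]
      ev_scale2[OF hom[OF assms]] bil_commute[of "q a" V U] bil_commute[of "q a" W U] bil_commute[of "q a" W V]
      power2_eq_square algebra_simps)

lemma G_nonzero: "a < k \<Longrightarrow> a \<noteq> i \<Longrightarrow> G a \<noteq> 0"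
  unfolding G_def using conic_vanishing_on_conic[OF sm[OF i] sm fr, of a] distinct[OF i, of a] by auto

lemma frame_expandE:
  obtains x y z where "v = x *s \<gamma> s + y *s \<gamma>' s + z *s U"
proof (rule span3[of "\<gamma> s" "\<gamma>' s" U v])
  fix x y z assume "x *s \<gamma> s + y *s \<gamma>' s + z *s U = 0"
  then show "x = 0 \<and> y = 0 \<and> z = 0" by (rule \<gamma>_independent)
next
  fix x y z assume "v = x *s \<gamma> s + y *s \<gamma>' s + z *s U"
  then show thesis by (rule that)
qed

lemma tangent_vectorE:
  assumes "bil (q i) (\<gamma> s) v = 0"
  obtains x y where "v = x *s \<gamma> s + y *s \<gamma>' s"
proof -
  obtain x y z where v: "v = x *s \<gamma> s + y *s \<gamma>' s + z *s U" by (rule frame_expandE)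
  have "z = 0" using assms b0 unfolding v by (simp add: bil_simps \<gamma>_bil)
  then show thesis using v that[of x y] by simp
qed

lemma transv_\<gamma>':
  assumes a: "a \<in> through q k (\<gamma> s)" and t: "transv (q i) (q a) (\<gamma> s)"
  shows "bil (q a) (\<gamma> s) (\<gamma>' s) \<noteq> 0"
proof
  assume 0: "bil (q a) (\<gamma> s) (\<gamma>' s) = 0"
  obtain Y where Y: "bil (q i) (\<gamma> s) Y = 0" "bil (q a) (\<gamma> s) Y = 1" using t unfolding transv_def by blast
  obtain x y where "Y = x *s \<gamma> s + y *s \<gamma>' s" by (rule tangent_vectorE[OF Y(1)])
  then show False using Y(2) 0 a bil_same[OF hom, of a "\<gamma> s"] by (simp add: bil_simps through_def)
qed

text \<open>\<open>\<theta>\<close> is tangent to both conics at the point, while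
  \<open>\<gamma>'\<close> is not tangent to conic \<open>a\<close>, so its coefficient has to
  vanish.\<close>

lemma Vp_root_transv:
  assumes a: "a \<in> through q k (\<gamma> s)" and t: "transv (q i) (q a) (\<gamma> s)"
  shows "poly Vp s = 0"
proof -
  have ak: "a < k" "ev (q a) (\<gamma> s) = 0" using a by (auto simp: through_def)
  have "\<Phi> a (\<gamma> s) = 0" by (rule \<Phi>_on_conic[OF ak(1) \<gamma>_nonzero ak(2)])
  then have "poly Vp s * bil (q a) (\<gamma> s) (\<gamma>' s) = 0"
    using ak by (simp add: \<Phi>_def \<theta>_\<gamma> bil_simps bil_same[OF hom])
  then show ?thesis using transv_\<gamma>'[OF assms] by simp
qed

lemma i_through: "i \<in> through q k (\<gamma> s)"
  using i \<gamma>_ev by (simp add: through_def)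

text \<open>Along \<open>\<gamma> (s + \<tau>) + (\<tau>\<^sup>2 * Y) *s U\<close> both conics
  vanish to second order, so \<open>\<tau>\<^sup>2\<close> is divided out. \<open>H\<close> measures
  how far the contact is from higher order, and \<open>Y\<close> is a free parameter whose powers
  separate relations. The factor \<open>D\<close> allows two uses: \<open>D \<tau> = \<tau>\<close>
  while nothing is known about the value of \<open>Vp\<close> at \<open>s\<close>, and
  \<open>D \<tau> = 1\<close> once this value is 0, with \<open>\<nu>\<close> the quotient of
  \<open>Vp\<close> by \<open>\<tau>\<close>.\<close>

lemma tangent_log_sum:
  fixes D \<nu> :: "complex \<Rightarrow> complex" and Y s :: complex
  assumes J: "through q k (\<gamma> s) = {i, j}" "j \<noteq> i"
    and \<kappa>: "\<And>x. bil (q j) (\<gamma> s) x = \<kappa> * bil (q i) (\<gamma> s) x"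
    and c: "continuous_on UNIV D" "continuous_on UNIV \<nu>"
    and D: "\<And>\<tau>. \<tau> \<noteq> 0 \<Longrightarrow> D \<tau> \<noteq> 0" "\<And>\<tau>. D \<tau> * poly Vp (s + \<tau>) = \<tau> * \<nu> \<tau>"
    and out: "D 0 = 0 \<or> poly Vp s = 0"
  defines "e \<equiv> poly Zp s * b + bil (q i) (\<gamma> s) (Jac (\<gamma> s) *v U)" and "H \<equiv> ev (q j) (\<gamma>' s) + \<kappa> * b"
  shows "D 0 * Y * e * (\<kappa> * Y * b + H) + (D 0 * (\<kappa> * Y * e + 2 * poly Zp s * H) + 2 * \<nu> 0 * H) * (Y * b)
    + of_nat (k - 2) * (2 * poly Zp s * D 0) * (Y * b * (\<kappa> * Y * b + H)) = 0"
proof -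
  have j: "j < k" "ev (q j) (\<gamma> s) = 0" using J by (auto simp: through_def)
  define g where "g \<tau> = \<gamma> (s + \<tau>)" for \<tau>
  define g' where "g' \<tau> = \<gamma>' (s + \<tau>)" for \<tau>
  define Ga where "Ga \<tau> = \<Gamma> (g \<tau>, \<tau>\<^sup>2 * Y, U)" for \<tau>
  define z where "z \<tau> = g \<tau> + (\<tau>\<^sup>2 * Y) *s U" for \<tau>
  define Z where "Z \<tau> = poly Zp (s + \<tau>)" for \<tau>
  define h1 where "h1 \<tau> = ev (q j) (\<gamma>' s + \<tau> *s U) + \<kappa> * b" for \<tau>
  define h2 where "h2 \<tau> = 2 * \<kappa> * b + bil (q j) (\<gamma>' s + \<tau> *s U) (\<gamma>' s + (2 * \<tau>) *s U)" for \<tau>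
  define \<phi> where "\<phi> a \<tau> = (if a = i then D \<tau> * Y * (bil (q i) (g \<tau>) (Ga \<tau>) + Z \<tau> * b + \<tau>\<^sup>2 * Y * bil (q i) U (Ga \<tau>))
    else D \<tau> * 2 * Z \<tau> * h1 \<tau> + \<nu> \<tau> * h2 \<tau> + D \<tau> * Y * bil (q j) (g \<tau>) (Ga \<tau>)
      + Y * (D \<tau> * Z \<tau> * bil (q j) (g \<tau>) U + \<tau> * \<nu> \<tau> * bil (q j) U (g' \<tau>) + D \<tau> * \<tau>\<^sup>2 * Y * bil (q j) U (Ga \<tau>)))" for a \<tau>
  define \<psi> where "\<psi> a \<tau> = (if a = i then Y * b else h1 \<tau> + Y * bil (q j) (g \<tau>) U + \<tau>\<^sup>2 * Y\<^sup>2 * ev (q j) U)" for a \<tau>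
  have ig: "bil (q i) (g \<tau>) (g \<tau>) = 0" "bil (q i) (g \<tau>) (g' \<tau>) = 0" "bil (q i) (g \<tau>) U = b" "bil (q i) U (g' \<tau>) = 0"
    "bil (q i) U (g \<tau>) = b" "bil (q i) U U = 0" for \<tau>
    using \<gamma>_bil(1-4)[of "s + \<tau>"] bil_same[OF hom[OF i], of U] \<gamma>_bil(6)
    by (simp_all add: g_def g'_def bil_commute[of "q i" U "\<gamma>' (s + \<tau>)"] bil_commute[of "q i" U "\<gamma> (s + \<tau>)"])
  have ge: "g \<tau> = \<gamma> s + \<tau> *s (\<gamma>' s + \<tau> *s U)" "g' \<tau> = \<gamma>' s + (2 * \<tau>) *s U" for \<tau>
    unfolding g_def g'_def by (simp_all add: \<gamma>_add) (simp add: \<gamma>'_def vec_eq_iff algebra_simps)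
  have jn: "bil (q j) (\<gamma> s) (\<gamma>' s) = 0" "bil (q j) (\<gamma> s) U = \<kappa> * b" "bil (q j) (\<gamma> s) (\<gamma> s) = 0"
    by (simp_all add: \<kappa> \<gamma>_bil)
  have eg: "ev (q j) (g \<tau>) = \<tau>\<^sup>2 * h1 \<tau>" for \<tau>
    unfolding ge h1_def ev_add[OF hom[OF j(1)], of "\<gamma> s"] ev_scale2[OF hom[OF j(1)]] bil_scale_right
    by (simp add: j(2) bil_add_right bil_scale_right jn power2_eq_square ring_distribs mult_ac)
  have jg: "bil (q j) (g \<tau>) (g \<tau>) = 2 * \<tau>\<^sup>2 * h1 \<tau>" for \<tau>
    by (simp add: bil_same[OF hom[OF j(1)]] eg)
  have jg': "bil (q j) (g \<tau>) (g' \<tau>) = \<tau> * h2 \<tau>" for \<tau>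
  proof -
    have "bil (q j) (g \<tau>) (g' \<tau>) = bil (q j) (\<gamma> s) (\<gamma>' s + (2 * \<tau>) *s U)
        + \<tau> * bil (q j) (\<gamma>' s + \<tau> *s U) (\<gamma>' s + (2 * \<tau>) *s U)"
      unfolding ge by (simp only: bil_add_left[of "q j" "\<gamma> s"] bil_scale_left)
    also have "bil (q j) (\<gamma> s) (\<gamma>' s + (2 * \<tau>) *s U) = 2 * \<tau> * (\<kappa> * b)"
      by (simp only: bil_add_right bil_scale_right jn add_0)
    finally show ?thesis by (simp add: h2_def ring_distribs mult_ac)
  qed
  have eg_i: "ev (q i) (g \<tau>) = 0" for \<tau> by (simp add: g_def \<gamma>_ev)
  have \<theta>z: "D \<tau> *s \<theta> (z \<tau>) = (D \<tau> * Z \<tau>) *s g \<tau> + (\<tau> * \<nu> \<tau>) *s g' \<tau> + (D \<tau> * (\<tau>\<^sup>2 * Y)) *s Ga \<tau>" for \<tau>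
    unfolding z_def \<theta>_increment Ga_def D(2)[symmetric] unfolding g_def g'_def Z_def \<theta>_\<gamma>
    by (simp add: vec_eq_iff algebra_simps)
  have \<Phi>z: "\<Phi> a (z \<tau>) * D \<tau> = bil (q a) (g \<tau> + (\<tau>\<^sup>2 * Y) *s U) ((D \<tau> * Z \<tau>) *s g \<tau> + (\<tau> * \<nu> \<tau>) *s g' \<tau> + (D \<tau> * (\<tau>\<^sup>2 * Y)) *s Ga \<tau>)" for a \<tau>
    unfolding \<Phi>_def \<theta>z[symmetric] by (simp add: bil_scale_right z_def mult.commute)
  have cg: "continuous_on UNIV g" "continuous_on UNIV g'" "continuous_on UNIV Z"
    unfolding g_def[abs_def] g'_def[abs_def] Z_def[abs_def] conic_pt_def \<gamma>'_def by (intro continuous_intros)+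
  have cGa: "continuous_on UNIV Ga" unfolding Ga_def[abs_def] by (intro continuous_intros cg)
  have ch: "continuous_on UNIV h1" "continuous_on UNIV h2" unfolding h1_def[abs_def] h2_def[abs_def] by (intro continuous_intros)+
  have z0: "z 0 = \<gamma> s" by (simp add: z_def g_def)
  have main: "(\<Sum>a\<in>{i, j}. \<phi> a 0 * (\<Prod>l\<in>{i, j} - {a}. \<psi> l 0))
      + of_nat (k - card {i, j}) * (2 * poly Zp s * D 0) * (\<Prod>l\<in>{i, j}. \<psi> l 0) = 0"
  proof (rule limit_log_sum[where z = z and D = D and s = "\<lambda>\<tau>. \<tau>\<^sup>2"])
    show "{i, j} \<subseteq> {..<k}" using i j by auto
    show "continuous_on UNIV z" unfolding z_def[abs_def] by (intro continuous_intros cg)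
    show "continuous_on UNIV D" by (rule c)
    show "continuous_on UNIV (\<phi> a)" for a
      unfolding \<phi>_def[abs_def] by (cases "a = i") (simp_all, (intro continuous_intros cg cGa ch c)+)
    show "continuous_on UNIV (\<psi> a)" for a
      unfolding \<psi>_def[abs_def] by (cases "a = i") (simp_all, (intro continuous_intros cg ch))
  next
    fix a \<tau> assume a: "a \<in> {i, j}"
    show "\<Phi> a (z \<tau>) * D \<tau> = \<tau>\<^sup>2 * \<phi> a \<tau>"
    proof (cases "a = i")
      case True
      then show ?thesis unfolding \<Phi>z \<phi>_def by (simp add: bil_simps ig power2_eq_square algebra_simps)
    next
      case False
      then have "a = j" using a by simp
      then show ?thesis using False unfolding \<Phi>z \<phi>_def
        by (simp add: bil_simps jg jg' bil_commute[of "q j" U "g \<tau>"] power2_eq_square algebra_simps)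
    qed
    show "ev (q a) (z \<tau>) = \<tau>\<^sup>2 * \<psi> a \<tau>"
    proof (cases "a = i")
      case True
      then show ?thesis unfolding z_def \<psi>_def
        by (simp add: ev_add[OF hom[OF i]] ev_scale2[OF hom[OF i]] bil_simps ig \<gamma>_bil(6) eg_i algebra_simps)
    next
      case False
      then have "a = j" using a by simp
      then show ?thesis using False unfolding z_def \<psi>_def
        by (simp add: ev_add[OF hom[OF j(1)]] ev_scale2[OF hom[OF j(1)]] bil_simps eg power2_eq_square algebra_simps)
    qed
  next
    fix a assume "a \<in> {..<k} - {i, j}"
    then have a: "a < k" "a \<notin> through q k (\<gamma> s)" using J by auto
    then show "ev (q a) (z 0) \<noteq> 0" unfolding z0 by (simp add: through_def)
    show "\<Phi> a (z 0) * D 0 = 2 * poly Zp s * D 0 * ev (q a) (z 0)"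
      unfolding z0 using out \<Phi>_eigen[OF a(1), of "\<gamma> s" "poly Zp s"] by (auto simp: \<theta>_\<gamma> mult_ac)
  qed (use D in auto)
  have v1: "\<phi> i 0 = D 0 * Y * e"
    by (simp add: \<phi>_def e_def g_def Ga_def Z_def \<Gamma>_0 algebra_simps)
  have v2: "\<phi> j 0 = D 0 * (\<kappa> * Y * e + 2 * poly Zp s * H) + 2 * \<nu> 0 * H"
    using J(2) by (simp add: \<phi>_def e_def g_def Ga_def Z_def \<Gamma>_0 h1_def h2_def H_def \<kappa> \<gamma>_bil bil_same[OF hom[OF j(1)]] algebra_simps)
  have v3: "\<psi> i 0 = Y * b" "\<psi> j 0 = \<kappa> * Y * b + H"
    using J(2) by (simp_all add: \<psi>_def g_def h1_def H_def jn algebra_simps)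
  have "{i, j} - {i} = {j}" "{i, j} - {j} = {i}" "card {i, j} = 2" using J(2) by auto
  then have "\<phi> i 0 * \<psi> j 0 + \<phi> j 0 * \<psi> i 0 + of_nat (k - 2) * (2 * poly Zp s * D 0) * (\<psi> i 0 * \<psi> j 0) = 0"
    using main J(2) by (simp add: numeral_2_eq_2)
  then show ?thesis unfolding v1 v2 v3 .
qed

end

locale mild_conic_syzygy = conic_syzygy +
  assumes mild: "\<And>P. P \<noteq> 0 \<Longrightarrow> mild_point q k P"
    and div: "\<And>P. P \<noteq> 0 \<Longrightarrow> (\<Sum>l\<in>UNIV. ev (partial l (t l)) P) = 0"
    and small: "3 * (r + 2) < 4 * k"

locale mild_conic_syzygy_frame = mild_conic_syzygy + conic_syzygy_frame
begin

text \<open>These integers multiply the unknown scalar \<open>c\<close> at triple points and at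
  tacnodes. The first is negative by \<open>3 * (r + 2) < 4 * k\<close>, and the second because
  \<open>2 * (r + 2) < 8 * k / 3 < 3 * k\<close>.\<close>

lemma of_nat_small:
  "3 * of_nat r - 4 * of_nat k + 6 \<noteq> (0::complex)" "2 * of_nat r - 3 * of_nat k + 4 \<noteq> (0::complex)"
proof
  assume "3 * of_nat r - 4 * of_nat k + 6 = (0::complex)"
  then have "of_nat (3 * r + 6) = (of_nat (4 * k) :: complex)" by (simp add: algebra_simps)
  then have "3 * r + 6 = 4 * k" by (simp only: of_nat_eq_iff)
  then show False using small by simp
next
  show "2 * of_nat r - 3 * of_nat k + 4 \<noteq> (0::complex)"
  proof
    assume "2 * of_nat r - 3 * of_nat k + 4 = (0::complex)"
    then have "of_nat (2 * r + 4) = (of_nat (3 * k) :: complex)" by (simp add: algebra_simps)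
    then have "2 * r + 4 = 3 * k" by (simp only: of_nat_eq_iff)
    then show False using small by simp
  qed
qed

text \<open>In the moving frame the Jacobian matrix is triangular: Euler's relation gives the first
  diagonal entry, differentiation along the conic the second, and \<open>\<omega>\<close> is the
  third. Its trace is the divergence.\<close>

lemma trace_Jac_\<gamma>:
  assumes "poly Vp s = 0" and "Jac (\<gamma> s) *v U = x *s \<gamma> s + y *s \<gamma>' s + \<omega> *s U"
  shows "of_nat r * poly Zp s + (poly Zp s + poly (pderiv Vp) s) + \<omega> = 0"
proof -
  have "(\<Sum>l\<in>UNIV. Jac (\<gamma> s) $ l $ l) = of_nat r * poly Zp s + (poly Zp s + poly (pderiv Vp) s) + \<omega>"
  proof (rule trace_in_basis[where p = "\<gamma> s" and g = "\<gamma>' s" and u = U])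
    fix x y z assume "x *s \<gamma> s + y *s \<gamma>' s + z *s U = 0"
    then show "x = 0 \<and> y = 0 \<and> z = 0" by (rule \<gamma>_independent)
  next
    show "Jac (\<gamma> s) *v \<gamma> s = (of_nat r * poly Zp s) *s \<gamma> s"
      by (simp add: Jac_euler \<theta>_\<gamma> assms(1))
    show "Jac (\<gamma> s) *v \<gamma>' s = poly (pderiv Zp) s *s \<gamma> s + (poly Zp s + poly (pderiv Vp) s) *s \<gamma>' s"
      by (simp add: Jac_\<gamma>' assms(1))
  qed (rule assms(2))
  moreover have "(\<Sum>l\<in>UNIV. Jac (\<gamma> s) $ l $ l) = 0"
    using div[OF \<gamma>_nonzero[of s]] by (simp add: Jac_def)
  ultimately show ?thesis by simp
qed

text \<open>Once \<open>Vp\<close> is seen to vanish at \<open>s\<close>, the relation along the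
  test curves is an identity in \<open>Y\<close> that yields two linear relations between
  \<open>c\<close>, \<open>v\<close> and \<open>\<omega>\<close>; the vanishing trace is a third.
  Eliminating \<open>v\<close> and \<open>\<omega>\<close> leaves
  \<open>c * (2 * r - 3 * k + 4) = 0\<close>, so \<open>c = 0\<close>, and then the derivative
  \<open>v\<close> of \<open>Vp\<close> is 0 as well.\<close>

lemma simply_tangent_order:
  assumes J: "through q k (\<gamma> s) = {i, j}" "j \<noteq> i" and tg: "simply_tangent (q i) (q j) (\<gamma> s)"
  shows "Polynomial.order s (G j) \<le> 2" and "poly Vp s = 0" and "poly (pderiv Vp) s = 0"
proof -
  have j: "j < k" "ev (q j) (\<gamma> s) = 0" using J by (auto simp: through_def)
  obtain \<kappa> T where \<kappa>: "\<And>x. bil (q j) (\<gamma> s) x = \<kappa> * bil (q i) (\<gamma> s) x"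
    and T: "bil (q i) (\<gamma> s) T = 0" "ev (q j) T \<noteq> \<kappa> * ev (q i) T"
    using tg unfolding simply_tangent_def by blast
  have "\<kappa> \<noteq> 0" using smooth_conicD(2)[OF sm[OF j(1)], of "\<gamma> s"] \<gamma>_nonzero \<kappa> by auto
  define H where "H = ev (q j) (\<gamma>' s) + \<kappa> * b"
  obtain x y where Te: "T = x *s \<gamma> s + y *s \<gamma>' s" by (rule tangent_vectorE[OF T(1)])
  have "ev (q j) T - \<kappa> * ev (q i) T = y\<^sup>2 * H"
    unfolding Te H_def using j
    by (simp add: ev_add[OF hom] ev_scale2[OF hom] i bil_simps bil_commute[of "q j" "\<gamma>' s" "\<gamma> s"]
        bil_commute[of "q i" "\<gamma>' s" "\<gamma> s"] \<kappa> \<gamma>_bil \<gamma>_ev algebra_simps)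
  then have H: "H \<noteq> 0" using T(2) by auto
  have "poly (pderiv (pderiv (G j))) s = 2 * H"
    using poly_pderiv_G(2)[OF j(1), of s] by (simp add: H_def \<kappa> \<gamma>_bil)
  then show "Polynomial.order s (G j) \<le> 2" using H by (intro order_le_2) simp
  define c where "c = poly Zp s"
  define e where "e = c * b + bil (q i) (\<gamma> s) (Jac (\<gamma> s) *v U)"
  note tls = tangent_log_sum[OF J \<kappa>, folded H_def c_def, folded e_def]
  have "0 * 1 * e * (\<kappa> * 1 * b + H) + (0 * (\<kappa> * 1 * e + 2 * c * H) + 2 * poly Vp (s + 0) * H) * (1 * b)
    + of_nat (k - 2) * (2 * c * 0) * (1 * b * (\<kappa> * 1 * b + H)) = 0"
    by (rule tls[of "\<lambda>\<tau>. \<tau>" "\<lambda>\<tau>. poly Vp (s + \<tau>)" 1]) (auto intro!: continuous_intros)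
  then show V: "poly Vp s = 0" using H b0 by simp
  obtain V1 where V1: "\<And>h. poly Vp (s + h) = poly Vp s + h * poly V1 (s + h)" "poly V1 s = poly (pderiv Vp) s"
    by (rule poly_linear_quotientE[of Vp s]) (rule that)
  define v where "v = poly (pderiv Vp) s"
  define R where "R = of_nat (k - 2) * (2 * c)"
  have main: "Y * e * (\<kappa> * Y * b + H) + (\<kappa> * Y * e + 2 * c * H + 2 * v * H) * (Y * b) + R * (Y * b * (\<kappa> * Y * b + H)) = 0" for Y
  proof -
    have "1 * Y * e * (\<kappa> * Y * b + H) + (1 * (\<kappa> * Y * e + 2 * c * H) + 2 * poly V1 (s + 0) * H) * (Y * b)
      + of_nat (k - 2) * (2 * c * 1) * (Y * b * (\<kappa> * Y * b + H)) = 0"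
      by (rule tls[of "\<lambda>\<tau>. 1" "\<lambda>\<tau>. poly V1 (s + \<tau>)" Y]) (auto intro!: continuous_intros simp: V1(1) V)
    then show ?thesis by (simp add: V1(2) R_def v_def)
  qed
  define L where "L Y = Y * e * (\<kappa> * Y * b + H) + (\<kappa> * Y * e + 2 * c * H + 2 * v * H) * (Y * b) + R * (Y * b * (\<kappa> * Y * b + H))" for Y
  have L0: "L Y = 0" for Y unfolding L_def by (rule main)
  \<comment> \<open>The coefficients of \<open>Y\<^sup>2\<close> and of \<open>Y\<close>, extracted
    from the values at \<open>Y = 1\<close> and \<open>Y = - 1\<close>.\<close>
  have "2 * (\<kappa> * b * (2 * e + R * b)) = L 1 + L (- 1)" "2 * (H * (e + 2 * (c + v) * b + R * b)) = L 1 - L (- 1)"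
    by (simp_all add: L_def algebra_simps)
  then have r1: "2 * e + R * b = 0" and r2: "e + 2 * (c + v) * b + R * b = 0"
    using H b0 \<open>\<kappa> \<noteq> 0\<close> by (simp_all add: L0)
  obtain x y \<omega> where JU: "Jac (\<gamma> s) *v U = x *s \<gamma> s + y *s \<gamma>' s + \<omega> *s U" by (rule frame_expandE)
  have e: "e = (c + \<omega>) * b" unfolding e_def JU by (simp add: bil_simps \<gamma>_bil algebra_simps)
  have tr: "of_nat r * c + (c + v) + \<omega> = 0"
    using trace_Jac_\<gamma>[OF V JU] by (simp add: c_def v_def)
  have r4: "b * (2 * (c + \<omega>) + R) = 2 * e + R * b"
    "b * (4 * (c + v) + R) = 2 * (e + 2 * (c + v) * b + R * b) - (2 * e + R * b)"
    unfolding e by (simp_all add: algebra_simps)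
  have "b * (2 * (c + \<omega>) + R) = 0" "b * (4 * (c + v) + R) = 0" unfolding r4 r1 r2 by simp_all
  then have r3: "2 * (c + \<omega>) + R = 0" "4 * (c + v) + R = 0" using b0 unfolding mult_eq_0_iff by blast+
  have "2 \<le> k" using card_mono[of "{..<k}" "{i, j}"] i j J(2) by auto
  then have R: "R = 2 * c * (of_nat k - 2)" by (simp add: R_def of_nat_diff)
  have "2 * (c * (2 * of_nat r - 3 * of_nat k + 4))
      = 4 * (of_nat r * c + (c + v) + \<omega>) - (4 * (c + v) + R) - 2 * (2 * (c + \<omega>) + R)"
    by (simp add: R algebra_simps)
  then have "c * (2 * of_nat r - 3 * of_nat k + 4) = 0" unfolding tr r3 by simp
  then have "c = 0" using of_nat_small by simp
  then show "poly (pderiv Vp) s = 0" using r3(2) by (simp add: R_def v_def)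
qed

text \<open>Modulo \<open>\<gamma> s\<close>, the Jacobian matrix plus \<open>c\<close> acts on a
  plane, and \<open>e a\<close> is the pullback of the linear form \<open>n a\<close> under it. The
  first-order relation at \<open>X\<close>, \<open>Y\<close>, \<open>X + Y\<close> and
  \<open>X - Y\<close> shows that this action is a scalar \<open>\<rho>\<close> with
  \<open>3 * \<rho> + R = 0\<close>, as befits an endomorphism of a plane with three distinct
  eigenlines. Reading it on \<open>\<gamma>'\<close> and on \<open>U\<close> expresses
  \<open>v\<close> and \<open>\<omega>\<close> by \<open>c\<close>, and zero trace becomes
  \<open>c * (3 * r - 4 * k + 6) = 0\<close>.\<close>

lemma triple_point_order:
  assumes J: "through q k (\<gamma> s) = {i, j, l}" "j \<noteq> i" "l \<noteq> i" "j \<noteq> l"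
    and tij: "transv (q i) (q j) (\<gamma> s)" and til: "transv (q i) (q l) (\<gamma> s)" and tjl: "transv (q j) (q l) (\<gamma> s)"
  shows "poly (pderiv Vp) s = 0"
proof -
  define c where "c = poly Zp s"
  define n where "n a v = bil (q a) (\<gamma> s) v" for a v
  define A where "A v = Jac (\<gamma> s) *v v" for v
  define e where "e a v = c * n a v + n a (A v)" for a v
  define R where "R = of_nat (k - 3) * (2 * c)"
  have jl: "j \<in> through q k (\<gamma> s)" "l \<in> through q k (\<gamma> s)" using J by auto
  have V: "poly Vp s = 0" by (rule Vp_root_transv[OF jl(1) tij])
  have \<theta>P: "\<theta> (\<gamma> s) = c *s \<gamma> s" by (simp add: \<theta>_\<gamma> V c_def)
  have nP: "n a (\<gamma> s) = 0" if "a \<in> {i, j, l}" for a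
  proof -
    have "a \<in> through q k (\<gamma> s)" using that by (simp only: J(1))
    then show ?thesis using bil_same[OF hom, of a "\<gamma> s"] by (simp add: n_def through_def)
  qed
  have nlin: "n a (x *s v + y *s w) = x * n a v + y * n a w" "n a (v + w) = n a v + n a w" "n a (x *s v) = x * n a v"
    "n a (v - w) = n a v - n a w" for a x y v w
    by (simp_all add: n_def bil_simps)
  have Alin: "A (v + w) = A v + A w" "A (x *s v) = x *s A v" "A (v - w) = A v - A w" for v w x
    by (simp_all add: A_def matrix_vector_right_distrib matrix_vector_mult_diff_distrib vector_scalar_commute)
  have AP: "A (\<gamma> s) = (of_nat r * c) *s \<gamma> s" by (simp add: A_def Jac_euler \<theta>P)
  have card: "card {i, j, l} = 3" "{i, j, l} - {i} = {j, l}" "{i, j, l} - {j} = {i, l}" "{i, j, l} - {l} = {i, j}"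
    using J(2-4) by auto
  have sum3: "(\<Sum>a\<in>{i, j, l}. F a) = F i + F j + F l" for F :: "nat \<Rightarrow> complex"
    using J(2-4) by (simp add: add.assoc)
  have S: "e i v * (n j v * n l v) + e j v * (n i v * n l v) + e l v * (n i v * n j v) + R * (n i v * (n j v * n l v)) = 0" for v
  proof -
    have "(\<Sum>a\<in>{i, j, l}. e a v * (\<Prod>m\<in>{i, j, l} - {a}. n m v)) + R * (\<Prod>m\<in>{i, j, l}. n m v) = 0"
      using first_order[OF \<theta>P, of v] by (simp only: J(1) e_def n_def A_def R_def card(1))
    then show ?thesis using J(2-4) unfolding sum3 card(2-4) by simp
  qed
  obtain X Y where X: "n i X = 1" "n j X = 0" and Y: "n i Y = 0" "n j Y = 1"
    using tij unfolding transv_def n_def by blast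
  define \<alpha> \<beta> where "\<alpha> = n l X" and "\<beta> = n l Y"
  have exp: "\<exists>x. v = n i v *s X + n j v *s Y + x *s \<gamma> s" for v
  proof -
    let ?w = "v - n i v *s X - n j v *s Y"
    have "bil (q i) (\<gamma> s) ?w = 0" "bil (q j) (\<gamma> s) ?w = 0"
      using X Y unfolding n_def[symmetric] by (simp_all add: nlin)
    then obtain x y where w: "?w = x *s \<gamma> s + y *s \<gamma>' s" by (elim tangent_vectorE)
    have "y * bil (q j) (\<gamma> s) (\<gamma>' s) = 0"
      using \<open>bil (q j) (\<gamma> s) ?w = 0\<close> nP[of j] unfolding w by (simp add: bil_simps n_def)
    then have "y = 0" using transv_\<gamma>'[OF jl(1) tij] by simp
    then have "v = n i v *s X + n j v *s Y + x *s \<gamma> s" using w by (simp add: algebra_simps)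
    then show ?thesis ..
  qed
  have nl: "n l v = \<alpha> * n i v + \<beta> * n j v" for v
  proof -
    obtain x where "v = n i v *s X + n j v *s Y + x *s \<gamma> s" using exp by blast
    then have "n l v = n l (n i v *s X + n j v *s Y + x *s \<gamma> s)" by simp
    then show ?thesis using nP[of l] by (simp add: nlin \<alpha>_def \<beta>_def)
  qed
  obtain X' where X': "n j X' = 0" "n l X' = 1" using tjl unfolding transv_def n_def by blast
  have \<alpha>: "\<alpha> \<noteq> 0" using nl[of X'] X' by auto
  obtain Y' where Y': "n i Y' = 0" "n l Y' = 1" using til unfolding transv_def n_def by blast
  have \<beta>: "\<beta> \<noteq> 0" using nl[of Y'] Y' by auto
  have elin: "e a (v + w) = e a v + e a w" "e a (x *s v) = x * e a v" "e a (v - w) = e a v - e a w" for a v w x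
    by (simp_all add: e_def nlin Alin algebra_simps)
  have eP: "e a (\<gamma> s) = 0" if "a \<in> {i, j, l}" for a
    using nP[OF that] by (simp add: e_def AP nlin)
  have ev: "e a v = n i v * e a X + n j v * e a Y" if "a \<in> {i, j, l}" for a v
  proof -
    obtain x where "v = n i v *s X + n j v *s Y + x *s \<gamma> s" using exp by blast
    then have "e a v = e a (n i v *s X + n j v *s Y + x *s \<gamma> s)" by simp
    then show ?thesis using eP[OF that] by (simp add: elin)
  qed
  have el: "e l v = \<alpha> * e i v + \<beta> * e j v" for v
    unfolding e_def nl by (simp add: algebra_simps)
  have "e j X * \<alpha> = 0" using S[of X] X by (simp add: \<alpha>_def)
  then have ejX: "e j X = 0" using \<alpha> by simp
  have "e i Y * \<beta> = 0" using S[of Y] Y by (simp add: \<beta>_def)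
  then have eiY: "e i Y = 0" using \<beta> by simp
  define \<rho> \<mu> where "\<rho> = e i X" and "\<mu> = e j Y"
  have vals: "n i (X + Y) = 1" "n j (X + Y) = 1" "n l (X + Y) = \<alpha> + \<beta>" "n i (X - Y) = 1" "n j (X - Y) = - 1" "n l (X - Y) = \<alpha> - \<beta>"
    "e i (X + Y) = \<rho>" "e j (X + Y) = \<mu>" "e l (X + Y) = \<alpha> * \<rho> + \<beta> * \<mu>" "e i (X - Y) = \<rho>" "e j (X - Y) = - \<mu>"
    "e l (X - Y) = \<alpha> * \<rho> - \<beta> * \<mu>"
    by (simp_all add: nlin elin el X Y \<alpha>_def[symmetric] \<beta>_def[symmetric] ejX eiY \<rho>_def[symmetric] \<mu>_def[symmetric])
  define T where "T v = e i v * (n j v * n l v) + e j v * (n i v * n l v) + e l v * (n i v * n j v) + R * (n i v * (n j v * n l v))" for v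
  have T0: "T v = 0" for v unfolding T_def by (rule S)
  have "2 * (\<alpha> * (2 * \<rho> + \<mu> + R)) = T (X + Y) - T (X - Y)" "2 * (\<beta> * (\<rho> + 2 * \<mu> + R)) = T (X + Y) + T (X - Y)"
    unfolding T_def vals by (simp_all add: algebra_simps)
  then have r: "2 * \<rho> + \<mu> + R = 0" "\<rho> + 2 * \<mu> + R = 0" using \<alpha> \<beta> by (simp_all add: T0)
  have "\<rho> - \<mu> = (2 * \<rho> + \<mu> + R) - (\<rho> + 2 * \<mu> + R)" by simp
  then have \<mu>: "\<mu> = \<rho>" unfolding r by simp
  have "3 * \<rho> + R = 2 * \<rho> + \<mu> + R" by (simp add: \<mu>)
  then have R0: "3 * \<rho> + R = 0" unfolding r .
  define v where "v = poly (pderiv Vp) s"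
  have Ag: "A (\<gamma>' s) = poly (pderiv Zp) s *s \<gamma> s + (c + v) *s \<gamma>' s"
    by (simp add: A_def Jac_\<gamma>' V c_def v_def)
  have "e j (\<gamma>' s) = \<rho> * n j (\<gamma>' s)" using ev[of j "\<gamma>' s"] ejX \<mu> by (simp add: \<mu>_def)
  moreover have "e j (\<gamma>' s) = (2 * c + v) * n j (\<gamma>' s)"
    unfolding e_def Ag using nP[of j] by (simp add: nlin algebra_simps)
  ultimately have \<sigma>: "2 * c + v = \<rho>" using transv_\<gamma>'[OF jl(1) tij] by (simp add: n_def)
  obtain x y \<omega> where JU: "Jac (\<gamma> s) *v U = x *s \<gamma> s + y *s \<gamma>' s + \<omega> *s U" by (rule frame_expandE)
  have "e i U = \<rho> * n i U" using ev[of i U] eiY by (simp add: \<rho>_def)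
  moreover have "e i U = (c + \<omega>) * n i U"
    unfolding e_def A_def JU by (simp add: n_def bil_simps \<gamma>_bil algebra_simps)
  ultimately have \<omega>: "c + \<omega> = \<rho>" using b0 by (simp add: n_def \<gamma>_bil)
  have tr: "of_nat r * c + (c + v) + \<omega> = 0"
    using trace_Jac_\<gamma>[OF V JU] by (simp add: c_def v_def)
  have "3 \<le> k" using card_mono[of "{..<k}" "{i, j, l}"] card i jl by (auto simp: through_def)
  then have R: "R = 2 * c * (of_nat k - 3)" by (simp add: R_def of_nat_diff)
  have "c * (3 * of_nat r - 4 * of_nat k + 6) = 3 * (of_nat r * c + (c + v) + \<omega>)
      - 3 * (2 * c + v - \<rho>) - 3 * (c + \<omega> - \<rho>) - 2 * (3 * \<rho> + R)"
    by (simp add: R algebra_simps)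
  then have "c * (3 * of_nat r - 4 * of_nat k + 6) = 0" unfolding tr \<sigma> \<omega> R0 by simp
  then have "c = 0" using of_nat_small by simp
  then show ?thesis using R0 \<sigma> by (simp add: R_def v_def)
qed

text \<open>At one parameter the product has a root of multiplicity one for each transversal conic
  and at most two for a tangent one. A total of two can occur only at a triple point or a tacnode,
  where \<open>Vp\<close> has a double zero.\<close>

lemma order_Vp:
  assumes nz: "Vp \<noteq> 0"
  shows "Polynomial.order s (\<Prod>a\<in>{..<k} - {i}. G a) \<le> Polynomial.order s Vp"
proof -
  let ?J = "through q k (\<gamma> s)"
  have "Polynomial.order s (\<Prod>a\<in>{..<k} - {i}. G a) = (\<Sum>a\<in>{..<k} - {i}. Polynomial.order s (G a))"
    by (rule order_prod) (use G_nonzero in auto)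
  also have "\<dots> = (\<Sum>a\<in>?J - {i}. Polynomial.order s (G a))"
  proof (rule sum.mono_neutral_right)
    show "\<forall>a\<in>{..<k} - {i} - (?J - {i}). Polynomial.order s (G a) = 0"
      by (auto intro!: order_0I simp: poly_G through_def)
  qed (auto simp: through_def)
  also have "\<dots> \<le> Polynomial.order s Vp"
  proof -
    consider (m) "card ?J \<le> 3" "\<And>a a'. a \<in> ?J \<Longrightarrow> a' \<in> ?J \<Longrightarrow> a \<noteq> a' \<Longrightarrow> transv (q a) (q a') (\<gamma> s)"
      | (t) i' j' where "i' \<noteq> j'" "?J = {i', j'}" "simply_tangent (q i') (q j') (\<gamma> s)"
      using mild[OF \<gamma>_nonzero[of s]] unfolding mild_point_def by blast
    then show ?thesis
    proof cases
      case t
      obtain j where j: "?J = {i, j}" "j \<noteq> i" "simply_tangent (q i) (q j) (\<gamma> s)"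
      proof (cases "i = i'")
        case True
        then show thesis using t that[of j'] by auto
      next
        case False
        then have ij: "i = j'" using i_through[of s] t by auto
        have lt: "i' < k" using t(2) by (auto simp: through_def)
        obtain X where X: "bil (q i') (\<gamma> s) X \<noteq> 0" using smooth_conicD(2)[OF sm[OF lt]] \<gamma>_nonzero by blast
        have "simply_tangent (q j') (q i') (\<gamma> s)"
          by (rule simply_tangent_sym[OF t(3) X, of U]) (use b0 in \<open>simp add: ij[symmetric] \<gamma>_bil\<close>)
        then show thesis using t ij that[of i'] by auto
      qed
      have "?J - {i} = {j}" using j by auto
      then have "(\<Sum>a\<in>?J - {i}. Polynomial.order s (G a)) = Polynomial.order s (G j)" by simp
      also have "\<dots> \<le> 2" by (rule simply_tangent_order(1)[OF j])
      also have "2 \<le> Polynomial.order s Vp" by (rule order_ge_2[OF nz simply_tangent_order(2,3)[OF j]])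
      finally show ?thesis .
    next
      case m
      have tr: "transv (q i) (q a) (\<gamma> s)" if "a \<in> ?J - {i}" for a using m(2)[OF i_through[of s], of a] that by auto
      have "(\<Sum>a\<in>?J - {i}. Polynomial.order s (G a)) \<le> (\<Sum>a\<in>?J - {i}. 1)"
      proof (rule sum_mono)
        fix a assume a: "a \<in> ?J - {i}"
        then have aJ: "a \<in> ?J" by blast
        then have "a < k" by (simp add: through_def)
        then have "poly (pderiv (G a)) s \<noteq> 0"
          using transv_\<gamma>'[OF aJ tr[OF a]] by (simp add: poly_pderiv_G(1))
        then show "Polynomial.order s (G a) \<le> 1" by (rule order_le_1)
      qed
      also have "\<dots> = card (?J - {i})" by simp
      also have "\<dots> \<le> Polynomial.order s Vp"
      proof -
        have "card (?J - {i}) \<le> 2" using m(1) i_through[of s] by simp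
        then consider "card (?J - {i}) = 0" | "card (?J - {i}) = 1" | "card (?J - {i}) = 2" by linarith
        then show ?thesis
        proof cases
          case 2
          then obtain a where a: "?J - {i} = {a}" by (auto simp: card_1_singleton_iff)
          then have aJ: "a \<in> ?J - {i}" by blast
          then have "poly Vp s = 0" by (intro Vp_root_transv[OF _ tr[OF aJ]]) blast
          then show ?thesis using order_ge_1[OF nz] 2 by simp
        next
          case 3
          then obtain j l where jl: "?J - {i} = {j, l}" "j \<noteq> l" by (auto simp: card_2_iff)
          then have J: "?J = {i, j, l}" "j \<noteq> i" "l \<noteq> i" using i_through[of s] by auto
          have "poly Vp s = 0" by (rule Vp_root_transv[of j]) (use J tr[of j] in auto)
          moreover have "poly (pderiv Vp) s = 0"
            by (rule triple_point_order[OF J jl(2)]) (use J jl tr m(2)[of j l] in auto)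
          ultimately show ?thesis using order_ge_2[OF nz] 3 by simp
        qed linarith
      qed
      finally show ?thesis .
    qed
  qed
  finally show ?thesis .
qed

text \<open>\<open>U\<close> is the point of the conic that the parametrisation misses. No other
  conic passes through it, so every \<open>G a\<close> has full degree 4, and comparison of degrees
  gives \<open>4 * (k - 1) \<le> 2 * r\<close>, against \<open>small\<close>.\<close>

lemma Vp_eq_0:
  assumes U: "\<And>a. a < k \<Longrightarrow> a \<noteq> i \<Longrightarrow> ev (q a) U \<noteq> 0"
  shows "Vp = 0"
proof (rule ccontr)
  assume nz: "Vp \<noteq> 0"
  have "degree (G a) = 4" if "a \<in> {..<k} - {i}" for a
    using U[of a] that unfolding G_def by (simp add: restrict_poly_conic[OF hom])
  then have "4 * (k - 1) = (\<Sum>a\<in>{..<k} - {i}. degree (G a))" using i by simp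
  also have "\<dots> = degree (\<Prod>a\<in>{..<k} - {i}. G a)"
    by (rule degree_prod_eq_sum_degree[symmetric]) (use G_nonzero in auto)
  also have "\<dots> \<le> degree Vp"
    by (rule degree_le_if_order_le[OF nz _ order_Vp[OF nz]]) (use G_nonzero in auto)
  also have "\<dots> \<le> 2 * r" by (rule degree_Vp)
  finally show False using small by simp
qed

end

section \<open>From the conics to the whole plane\<close>

definition line_poly :: "S \<Rightarrow> complex^3 \<Rightarrow> complex^3 \<Rightarrow> complex poly" where
  "line_poly p X Y = eval_hom (\<lambda>c. [:c:]) (\<lambda>l. [:Y $ l, X $ l:]) p"

lemma poly_line_poly: "poly (line_poly p X Y) s = ev p (s *s X + Y)"
proof -
  have "(\<lambda>l. poly [:Y $ l, X $ l:] s) = ($) (s *s X + Y)" by (simp add: fun_eq_iff)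
  then show ?thesis unfolding line_poly_def poly_eval_hom by simp
qed

lemma degree_line_poly: "homogeneous (int n) p \<Longrightarrow> degree (line_poly p X Y) \<le> n * 1"
  unfolding line_poly_def by (rule degree_eval_hom_le) auto

lemma line_poly_conic:
  assumes q: "homogeneous 2 q"
  shows "line_poly q X Y = [:ev q Y, bil q X Y, ev q X:]"
  unfolding poly_eq_poly_eq_iff[symmetric]
proof
  fix s
  show "poly (line_poly q X Y) s = poly [:ev q Y, bil q X Y, ev q X:] s"
    unfolding poly_line_poly by (simp add: ev_add[OF q] ev_scale2[OF q] bil_simps bil_commute[of q Y X] power2_eq_square algebra_simps)
qed

context mild_conic_syzygy
begin

lemma k_pos: "0 < k"
  using small by simp

text \<open>The first frame serves to find a point of conic \<open>i\<close> that lies on no other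
  conic; the second frame puts this point at infinity.\<close>

lemma radial_on_conicE:
  assumes i: "i < k"
  obtains b U V W where "conic_frame (q i) b U V W" "\<And>a. a < k \<Longrightarrow> a \<noteq> i \<Longrightarrow> ev (q a) U \<noteq> 0"
    "\<And>s. \<exists>\<mu>. \<theta> (conic_pt U V W s) = \<mu> *s conic_pt U V W s"
proof -
  obtain U0 where U0: "U0 \<noteq> 0" "ev (q i) U0 = 0" by (rule isotropic_vectorE[OF hom[OF i]])
  obtain b0 V0 W0 where fr0: "conic_frame (q i) b0 U0 V0 W0" by (rule conic_frameE[OF sm[OF i] U0])
  interpret F: conic_syzygy_frame q k t r i b0 U0 V0 W0 by unfold_locales (rule i fr0)+
  have "(\<Prod>a\<in>{..<k} - {i}. F.G a) \<noteq> 0" using F.G_nonzero by auto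
  then obtain s where s: "poly (\<Prod>a\<in>{..<k} - {i}. F.G a) s \<noteq> 0" using poly_all_0_iff_0 by blast
  define U where "U = conic_pt U0 V0 W0 s"
  have U: "U \<noteq> 0" "ev (q i) U = 0" using F.\<gamma>_nonzero F.\<gamma>_ev by (simp_all add: U_def)
  have Ua: "ev (q a) U \<noteq> 0" if "a < k" "a \<noteq> i" for a
    using s that by (auto simp: poly_prod F.poly_G U_def)
  obtain b V W where fr: "conic_frame (q i) b U V W" by (rule conic_frameE[OF sm[OF i] U])
  interpret E: mild_conic_syzygy_frame q k t r i b U V W by unfold_locales (rule i fr)+
  have "E.Vp = 0" by (rule E.Vp_eq_0[OF Ua])
  then have "\<theta> (conic_pt U V W s) = poly E.Zp s *s conic_pt U V W s" for s using E.\<theta>_\<gamma>[of s] by simp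
  then show thesis using that[OF fr Ua] by blast
qed

text \<open>\<open>B\<close> represents, up to scalars, the points of conic \<open>i\<close> that a
  line through \<open>X\<close> should avoid: intersections with other conics, points whose tangent
  passes through \<open>X\<close>, and points where \<open>\<theta>\<close> is not yet known to be
  radial.\<close>

definition exceptional :: "nat \<Rightarrow> complex^3 \<Rightarrow> (complex^3) set \<Rightarrow> bool" where
  "exceptional i X B \<longleftrightarrow> finite B \<and> (\<forall>v\<in>B. ev (q i) v = 0 \<and> v \<noteq> 0) \<and>
    (\<forall>z. z \<noteq> 0 \<longrightarrow> ev (q i) z = 0 \<longrightarrow> (\<forall>v\<in>B. \<forall>c. z \<noteq> c *s v) \<longrightarrow>
      (\<forall>a<k. a \<noteq> i \<longrightarrow> ev (q a) z \<noteq> 0) \<and> bil (q i) X z \<noteq> 0 \<and> (\<exists>\<mu>. \<theta> z = \<mu> *s z))"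

lemma ex_exceptional:
  assumes i: "i < k" and X: "X \<noteq> 0"
  shows "\<exists>B. exceptional i X B"
proof -
  obtain b U V W where fr: "conic_frame (q i) b U V W" and U: "\<And>a. a < k \<Longrightarrow> a \<noteq> i \<Longrightarrow> ev (q a) U \<noteq> 0"
    and rad: "\<And>s. \<exists>\<mu>. \<theta> (conic_pt U V W s) = \<mu> *s conic_pt U V W s"
    by (rule radial_on_conicE[OF i]) (rule that)
  interpret E: conic_syzygy_frame q k t r i b U V W by unfold_locales (rule i fr)+
  have sp: "\<exists>x y z. v = x *s U + y *s V + z *s W" for v using fr by (simp add: conic_frame_def)
  define P where "P = (\<Prod>a\<in>{..<k} - {i}. E.G a) * [:bil (q i) X W, bil (q i) X V, bil (q i) X U:]"
  have "[:bil (q i) X W, bil (q i) X V, bil (q i) X U:] \<noteq> 0"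
  proof
    assume "[:bil (q i) X W, bil (q i) X V, bil (q i) X U:] = 0"
    then have 0: "bil (q i) X W = 0" "bil (q i) X V = 0" "bil (q i) X U = 0" by simp_all
    have "bil (q i) X v = 0" for v
    proof -
      obtain x y z where "v = x *s U + y *s V + z *s W" using sp by blast
      then show ?thesis by (simp add: bil_simps 0)
    qed
    then show False using smooth_conicD(2)[OF sm[OF i]] X by blast
  qed
  moreover have "(\<Prod>a\<in>{..<k} - {i}. E.G a) \<noteq> 0" using E.G_nonzero by auto
  ultimately have P: "P \<noteq> 0" unfolding P_def by (simp only: mult_eq_0_iff) simp
  define B where "B = insert U (conic_pt U V W ` {s. poly P s = 0})"
  have "exceptional i X B"
    unfolding exceptional_def
  proof (intro conjI ballI allI impI)
    show "finite B" unfolding B_def using poly_roots_finite[OF P] by simp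
  next
    fix v assume v: "v \<in> B"
    show "ev (q i) v = 0" using v E.\<gamma>_ev E.\<gamma>_bil(6) by (auto simp: B_def)
    have "U \<noteq> 0" using conic_frame_independent[OF fr, of 1 0 0] by auto
    then show "v \<noteq> 0" using v E.\<gamma>_nonzero by (auto simp: B_def)
  next
    fix z assume z: "z \<noteq> 0" "ev (q i) z = 0" "\<forall>v\<in>B. \<forall>c. z \<noteq> c *s v"
    obtain x y w where ze: "z = x *s U + y *s V + w *s W" using sp by blast
    have "b * (x * w - y\<^sup>2) = 0" using z(2) unfolding ze conic_frame_ev[OF fr] .
    then have xw: "x * w = y\<^sup>2" using E.b0 by simp
    have w: "w \<noteq> 0"
    proof
      assume "w = 0"
      then have "z = x *s U" using xw ze by simp
      then show False using z(3) by (auto simp: B_def)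
    qed
    define s where "s = y / w"
    have x: "x = w * s\<^sup>2" using xw w by (simp add: s_def power2_eq_square field_simps)
    have zs: "z = w *s conic_pt U V W s"
      unfolding ze x using w by (simp add: conic_pt_def s_def vec_eq_iff algebra_simps)
    then have Ps: "poly P s \<noteq> 0" using z(3) by (auto simp: B_def)
    have "poly (\<Prod>a\<in>{..<k} - {i}. E.G a) s \<noteq> 0" and P2: "poly [:bil (q i) X W, bil (q i) X V, bil (q i) X U:] s \<noteq> 0"
      using Ps unfolding P_def poly_mult mult_eq_0_iff by blast+
    then have P1: "ev (q a) (conic_pt U V W s) \<noteq> 0" if "a < k" "a \<noteq> i" for a
      using that by (auto simp: poly_prod E.poly_G)
    show "ev (q a) z \<noteq> 0" if "a < k" "a \<noteq> i" for a
      using P1[OF that] w by (simp add: zs ev_scale2[OF hom[OF that(1)]])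
    have "poly [:bil (q i) X W, bil (q i) X V, bil (q i) X U:] s = bil (q i) X (conic_pt U V W s)"
      by (simp add: conic_pt_def bil_simps power2_eq_square algebra_simps)
    then have "bil (q i) X (conic_pt U V W s) \<noteq> 0" using P2 by metis
    then show "bil (q i) X z \<noteq> 0" using w by (simp add: zs bil_scale_right)
    obtain \<mu> where "\<theta> (conic_pt U V W s) = \<mu> *s conic_pt U V W s" using rad by blast
    then have "\<theta> z = (w ^ r * \<mu> / w) *s z" unfolding zs \<theta>_scale using w by (simp add: vec_eq_iff)
    then show "\<exists>\<mu>. \<theta> z = \<mu> *s z" ..
  qed
  then show ?thesis ..
qed

text \<open>A line through \<open>X\<close> that is tangent to no conic and misses their common points meets the arrangement in \<open>2k\<close>
  points; the minors of \<open>(\<theta> z, z)\<close>, of degree \<open>r + 1 < 2k\<close>, vanish there and hence on the whole line.\<close>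

lemma \<theta>_radial:
  assumes X: "\<And>a. a < k \<Longrightarrow> ev (q a) X \<noteq> 0"
  shows "\<theta> X $ l * X $ l' = \<theta> X $ l' * X $ l"
proof -
  have X0: "X \<noteq> 0" using X[OF k_pos] ev_0[OF hom[OF k_pos]] by auto
  have "\<forall>i\<in>{..<k}. \<exists>B. exceptional i X B" using ex_exceptional X0 by simp
  from bchoice[OF this] obtain B where B: "\<And>i. i < k \<Longrightarrow> exceptional i X (B i)" by auto
  define BB where "BB = (\<Union>i<k. B i)"
  have fin: "finite BB" using B by (auto simp: BB_def exceptional_def)
  obtain m where m: "X $ m \<noteq> 0" using X0 by (auto simp: vec_eq_iff)
  obtain m1 m2 where mm: "\<And>l. l = m \<or> l = m1 \<or> l = m2"
  proof -
    consider "m = 1" | "m = 2" | "m = 3" using exhaust_3 by blast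
    then show thesis
    proof cases
      case 1 then show thesis using that[of 2 3] exhaust_3 by auto
    next
      case 2 then show thesis using that[of 1 3] exhaust_3 by blast
    next
      case 3 then show thesis using that[of 1 2] exhaust_3 by blast
    qed
  qed
  \<comment> \<open>Minors of \<open>v\<close> against \<open>X\<close> that involve the nonzero
    coordinate \<open>X $ m\<close>. They vanish simultaneously only on multiples of
    \<open>X\<close>, and no nonzero multiple of \<open>X\<close> lies on a conic.\<close>
  define n where "n l v = v $ l * X $ m - v $ m * X $ l" for l and v :: "complex^3"
  have n_lin: "n l (v + w) = n l v + n l w" "n l (c *s v) = c * n l v" for l v w c
    by (simp_all add: n_def algebra_simps)
  have nn: "n m1 v \<noteq> 0 \<or> n m2 v \<noteq> 0" if v: "v \<in> BB" for v
  proof (rule ccontr)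
    assume "\<not> (n m1 v \<noteq> 0 \<or> n m2 v \<noteq> 0)"
    then have nl: "n l v = 0" for l using mm[of l] by (auto simp: n_def)
    define c where "c = v $ m / X $ m"
    have "v $ l = c * X $ l" for l using m nl[of l] by (simp add: n_def c_def field_simps)
    then have ve: "v = c *s X" by (simp add: vec_eq_iff)
    obtain a where a: "a < k" "v \<in> B a" using v by (auto simp: BB_def)
    then have "ev (q a) v = 0" "v \<noteq> 0" using B[OF a(1)] by (auto simp: exceptional_def)
    moreover have "ev (q a) v = c\<^sup>2 * ev (q a) X" unfolding ve by (rule ev_scale2[OF hom[OF a(1)]])
    ultimately have "c = 0" using X[OF a(1)] by simp
    then show False using ve \<open>v \<noteq> 0\<close> by simp
  qed
  \<comment> \<open>A generic combination: its kernel will be a line through \<open>X\<close> that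
    contains none of the finitely many exceptional points.\<close>
  obtain \<mu> where \<mu>: "\<And>v. v \<in> BB \<Longrightarrow> n m1 v + n m2 v * \<mu> \<noteq> 0"
    by (rule exists_common_nonzero[OF fin, of "n m1" "n m2"]) (use nn that in blast)+
  define L where "L v = n m1 v + n m2 v * \<mu>" for v
  have L_lin: "L (v + w) = L v + L w" "L (c *s v) = c * L v" for v w c
    by (simp_all add: L_def n_lin algebra_simps)
  have LX: "L X = 0" by (simp add: L_def n_def)
  \<comment> \<open>The condition \<open>Y $ m = 0\<close> makes \<open>Y\<close> independent of
    \<open>X\<close>.\<close>
  obtain Y where Y: "Y \<noteq> 0" "L Y = 0" "Y $ m = 0"
    by (rule exists_common_kernel[of L "\<lambda>v. v $ m"]) (auto simp: L_lin intro: that)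
  define z where "z s = s *s X + Y" for s
  have z0: "z s \<noteq> 0" for s
  proof
    assume 0: "z s = 0"
    then have "z s $ m = 0" by simp
    then have "s = 0" using m Y by (simp add: z_def)
    then show False using 0 Y by (simp add: z_def)
  qed
  have zB: "z s \<noteq> c *s v" if "v \<in> BB" for s c v
  proof
    assume e: "z s = c *s v"
    have "c * L v = 0" using LX Y(2) unfolding L_lin(2)[symmetric] e[symmetric] z_def by (simp add: L_lin)
    then have "c = 0" using \<mu>[OF that] by (simp add: L_def)
    then show False using e z0[of s] by simp
  qed
  have ex: "(\<forall>a'<k. a' \<noteq> a \<longrightarrow> ev (q a') (z s) \<noteq> 0) \<and> bil (q a) X (z s) \<noteq> 0 \<and> (\<exists>\<mu>. \<theta> (z s) = \<mu> *s z s)"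
    if "a < k" "ev (q a) (z s) = 0" for a s
  proof -
    have "\<forall>v\<in>B a. \<forall>c. z s \<noteq> c *s v" using zB that(1) by (auto simp: BB_def)
    then show ?thesis using B[OF that(1)] z0[of s] that(2) unfolding exceptional_def by blast
  qed
  define p where "p a = line_poly (q a) X Y" for a
  have pe: "p a = [:ev (q a) Y, bil (q a) X Y, ev (q a) X:]" if "a < k" for a
    unfolding p_def by (rule line_poly_conic[OF hom[OF that]])
  have p0: "p a \<noteq> 0" if "a < k" for a using X[OF that] by (simp add: pe[OF that])
  have dp: "degree (p a) = 2" if "a < k" for a using X[OF that] by (simp add: pe[OF that])
  have pz: "poly (p a) s = ev (q a) (z s)" for a s by (simp add: p_def poly_line_poly z_def)
  have pdp: "poly (pderiv (p a)) s = bil (q a) X (z s)" if "a < k" for a s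
    unfolding pe[OF that] z_def
    by (simp add: pderiv_pCons bil_simps bil_same[OF hom[OF that]] algebra_simps)
  define M where "M = line_poly (t l) X Y * [:Y $ l', X $ l':] - line_poly (t l') X Y * [:Y $ l, X $ l:]"
  have Mz: "poly M s = \<theta> (z s) $ l * z s $ l' - \<theta> (z s) $ l' * z s $ l" for s
    by (simp add: M_def poly_line_poly z_def \<theta>_def algebra_simps)
  have "M = 0"
  proof (rule ccontr)
    assume M: "M \<noteq> 0"
    have "2 * k = (\<Sum>a<k. degree (p a))" using dp by simp
    also have "\<dots> = degree (\<Prod>a<k. p a)" by (rule degree_prod_eq_sum_degree[symmetric]) (use p0 in auto)
    also have "\<dots> \<le> degree M"
    proof (rule degree_le_if_order_le[OF M])
      show "(\<Prod>a<k. p a) \<noteq> 0" using p0 by auto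
      fix s
      have o: "Polynomial.order s (\<Prod>a<k. p a) = (\<Sum>a<k. Polynomial.order s (p a))" by (rule order_prod) (use p0 in auto)
      show "Polynomial.order s (\<Prod>a<k. p a) \<le> Polynomial.order s M"
      proof (cases "\<exists>a<k. ev (q a) (z s) = 0")
        case False
        then have "(\<Sum>a<k. Polynomial.order s (p a)) = 0" by (intro sum.neutral ballI order_0I) (simp add: pz)
        then show ?thesis using o by simp
      next
        case True
        then obtain a where a: "a < k" "ev (q a) (z s) = 0" by blast
        note ex = ex[OF a]
        have "(\<Sum>a<k. Polynomial.order s (p a)) = (\<Sum>a\<in>{a}. Polynomial.order s (p a))"
          by (rule sum.mono_neutral_right) (use a ex in \<open>auto intro!: order_0I simp: pz\<close>)
        also have "\<dots> = Polynomial.order s (p a)" by simp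
        also have "\<dots> \<le> 1" by (rule order_le_1) (simp add: pdp[OF a(1)] ex)
        also have "1 \<le> Polynomial.order s M"
        proof (rule order_ge_1[OF M])
          obtain \<nu> where "\<theta> (z s) = \<nu> *s z s" using ex by blast
          then show "poly M s = 0" unfolding Mz by simp
        qed
        finally show ?thesis using o by simp
      qed
    qed
    also have "\<dots> \<le> r + 1"
    proof -
      have d: "degree (line_poly (t l) X Y * [:Y $ l', X $ l':]) \<le> r + 1" for l l'
      proof -
        have "degree (line_poly (t l) X Y * [:Y $ l', X $ l':]) \<le> degree (line_poly (t l) X Y) + degree [:Y $ l', X $ l':]"
          by (rule degree_mult_le)
        also have "\<dots> \<le> r * 1 + 1" by (intro add_mono degree_line_poly t_hom) simp
        finally show ?thesis by simp
      qed
      show ?thesis unfolding M_def by (intro degree_diff_le d)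
    qed
    finally show False using small by simp
  qed
  \<comment> \<open>\<open>X\<close> is the point at infinity of \<open>s *s X + Y\<close>. With
    \<open>\<tau> = 1 / s\<close> and homogeneity it is reached as \<open>\<tau>\<close> tends to
    0.\<close>
  have scaled: "\<theta> (X + \<tau> *s Y) $ l * (X + \<tau> *s Y) $ l' - \<theta> (X + \<tau> *s Y) $ l' * (X + \<tau> *s Y) $ l = 0" if \<tau>: "\<tau> \<noteq> 0" for \<tau>
  proof -
    have e: "X + \<tau> *s Y = \<tau> *s z (1 / \<tau>)" using \<tau> by (simp add: z_def vec_eq_iff algebra_simps)
    have "poly M (1 / \<tau>) = 0" using \<open>M = 0\<close> by simp
    then have "\<theta> (z (1 / \<tau>)) $ l * z (1 / \<tau>) $ l' = \<theta> (z (1 / \<tau>)) $ l' * z (1 / \<tau>) $ l" by (simp add: Mz)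
    then show ?thesis unfolding e \<theta>_scale by (simp add: mult_ac)
  qed
  have "(\<lambda>\<tau>. \<theta> (X + \<tau> *s Y) $ l * (X + \<tau> *s Y) $ l' - \<theta> (X + \<tau> *s Y) $ l' * (X + \<tau> *s Y) $ l) 0 = (\<lambda>\<tau>. 0) (0::complex)"
    by (rule continuous_eq_at_0[OF _ _ scaled]) (intro continuous_intros)+
  then show ?thesis by simp
qed

lemma \<theta>_vanishes:
  assumes X: "\<And>a. a < k \<Longrightarrow> ev (q a) X \<noteq> 0"
  shows "\<theta> X = 0"
proof -
  have X0: "X \<noteq> 0" using X[OF k_pos] ev_0[OF hom[OF k_pos]] by auto
  obtain m where m: "X $ m \<noteq> 0" using X0 by (auto simp: vec_eq_iff)
  define \<mu> where "\<mu> = \<theta> X $ m / X $ m"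
  have "\<theta> X $ l = \<mu> * X $ l" for l
    using \<theta>_radial[OF X, of l m] m by (simp add: \<mu>_def field_simps)
  then have \<theta>X: "\<theta> X = \<mu> *s X" by (simp add: vec_eq_iff)
  have "(\<Sum>a<k. \<Phi> a X * (\<Prod>l\<in>{..<k} - {a}. ev (q l) X)) = (\<Sum>a<k. 2 * \<mu> * (\<Prod>l<k. ev (q l) X))"
  proof (rule sum.cong[OF refl])
    fix a assume a: "a \<in> {..<k}"
    then show "\<Phi> a X * (\<Prod>l\<in>{..<k} - {a}. ev (q l) X) = 2 * \<mu> * (\<Prod>l<k. ev (q l) X)"
      using \<Phi>_eigen[of a X \<mu>] \<theta>X by (simp add: prod.remove[of "{..<k}" a] mult_ac)
  qed
  then have "of_nat k * (2 * \<mu> * (\<Prod>l<k. ev (q l) X)) = 0" using log_sum[of X] by simp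
  then have "\<mu> = 0" using k_pos X by auto
  then show ?thesis using \<theta>X by simp
qed

text \<open>On a line through a point where \<open>t l\<close> is nonzero and a point off the curve,
  only finitely many parameters give zeros of \<open>t l\<close> or points of the curve; any other
  parameter contradicts the vanishing of \<open>\<theta>\<close> off the curve.\<close>

lemma syzygy_vanishes:
  assumes f: "(\<Prod>j<k. q j) \<noteq> 0"
  shows "t l = 0"
proof (rule ccontr)
  assume "t l \<noteq> 0"
  then obtain a' where "eval_at a' (t l) \<noteq> 0" by (rule exists_eval_at_nonzero)
  then obtain a where a: "ev (t l) a \<noteq> 0" using vec_nth_vec_lambda[of a'] by metis
  obtain b' where "eval_at b' (\<Prod>j<k. q j) \<noteq> 0" by (rule exists_eval_at_nonzero[OF f])
  then obtain b where "ev (\<Prod>j<k. q j) b \<noteq> 0" using vec_nth_vec_lambda[of b'] by metis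
  then have b: "ev (q j) b \<noteq> 0" if "j < k" for j
    using that by (auto simp: eval_hom_prod[OF is_ring_hom_id])
  define R where "R = line_poly (t l) b a * (\<Prod>j<k. line_poly (q j) b a)"
  have "poly (line_poly (t l) b a) 0 \<noteq> 0" using a by (simp add: poly_line_poly)
  then have "line_poly (t l) b a \<noteq> 0" by auto
  moreover have "(\<Prod>j<k. line_poly (q j) b a) \<noteq> 0" using b by (auto simp: line_poly_conic[OF hom])
  ultimately have "R \<noteq> 0" by (simp add: R_def)
  then obtain s where s: "poly R s \<noteq> 0" using poly_all_0_iff_0 by blast
  then have "ev (q j) (s *s b + a) \<noteq> 0" if "j < k" for j
    using that by (auto simp: R_def poly_prod poly_line_poly)
  then have "\<theta> (s *s b + a) = 0" by (rule \<theta>_vanishes)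
  then have "ev (t l) (s *s b + a) = 0" by (simp add: \<theta>_def vec_eq_iff)
  then show False using s by (simp add: R_def poly_line_poly)
qed

end

section \<open>The bound for the degree of a syzygy\<close>

lemma minimal_syzygy_degree_ge:
  assumes arr: "conic_arrangement k f"
    and sing: "\<forall>P \<in> singular_points f. node f P \<or> tacnode f P \<or> ordinary_triple_point f P"
    and syz: "syzygy_curve (2 * k) f [d1, d2, d3]"
  shows "4 * k \<le> 3 * (d1 + 2)"
proof (rule ccontr)
  assume "\<not> 4 * k \<le> 3 * (d1 + 2)"
  then have small: "3 * (d1 + 2) < 4 * k" by simp
  then have k: "0 < k" by simp
  obtain q where sm: "\<And>i. i < k \<Longrightarrow> smooth_conic (q i)" and inj: "inj_on (\<lambda>i. zero_set (q i)) {..<k}"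
    and fq: "f = (\<Prod>i<k. q i)"
    using arr unfolding conic_arrangement_def by blast
  obtain t where t: "\<And>i. homogeneous (int d1) (t i)" "\<exists>i. t i \<noteq> 0" "(\<Sum>i\<in>UNIV. t i * partial i f) = 0"
    by (rule jacobian_syzygyE[OF syz]) (rule that)
  have red: "homogeneous (int (2 * k)) f" "squarefree f" and d1: "1 \<le> d1"
    using syz by (auto simp: syzygy_curve_def reduced_curve_def)
  have f0: "f \<noteq> 0" using red(2) by auto
  have mild: "mild_point q k P" if "P \<noteq> 0" for P
    by (rule mild_point_conic_arrangement[OF sm that sing[unfolded fq]])
  have "real (3 * (d1 + 2)) < real (4 * k)" using small by (simp only: of_nat_less_iff)
  then have "3 * (real d1 + 2) < 4 * real k" by simp
  then have "2 * ((real d1 + 2) / real (2 * k)) < 4 / 3" using k by (simp add: field_simps)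
  \<comment> \<open>The negated claim says \<open>(d1 + 2) / k < 4 / 3\<close>. Its strictness
    leaves room for an exponent \<open>e\<close> that the volume estimate reaches and that still
    exceeds \<open>2 * \<alpha>\<close>.\<close>
  then obtain e where e: "2 * ((real d1 + 2) / real (2 * k)) < e" "e < 4 / 3" using dense by blast
  define K where "K = {z::complex^3. 1 \<le> norm z \<and> norm z \<le> 2}"
  have "K = cball 0 2 - ball 0 1" by (auto simp: K_def)
  then have K: "compact K" by (simp add: compact_diff)
  have vs: "vsmall P e (\<lambda>\<eta> x. cmod (ev f x) \<le> \<eta>)" if "P \<in> K" for P
  proof -
    have P: "P \<noteq> 0" using that by (auto simp: K_def)
    show ?thesis unfolding fq by (rule vsmall_arrangement[OF sm mild[OF P] P e(2)])
  qed
  obtain C where C: "0 \<le> C" "\<And>\<eta>. 0 < \<eta> \<Longrightarrow> \<eta> \<le> 1 \<Longrightarrow> {x \<in> K. cmod (ev f x) \<le> \<eta>} \<in> sets lborel \<Longrightarrow>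
      emeasure lborel {x \<in> K. cmod (ev f x) \<le> \<eta>} \<le> ennreal (C * \<eta> powr e)"
    by (rule volume_annulus[OF K vs], assumption) (rule that)
  have vol: "emeasure lborel {z. 1 \<le> norm z \<and> norm z \<le> 2 \<and> cmod (ev f z) \<le> \<eta>} \<le> ennreal (C * \<eta> powr e)"
    if "0 < \<eta>" "\<eta> \<le> 1" for \<eta>
  proof -
    have "closed (K \<inter> {x. cmod (ev f x) \<le> \<eta>})"
      by (intro closed_Int compact_imp_closed K closed_Collect_le continuous_intros continuous_on_ev_UNIV)
    moreover have "K \<inter> {x. cmod (ev f x) \<le> \<eta>} = {x \<in> K. cmod (ev f x) \<le> \<eta>}" by blast
    ultimately have "{x \<in> K. cmod (ev f x) \<le> \<eta>} \<in> sets lborel" by (simp add: borel_closed)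
    from C(2)[OF that this] show ?thesis by (simp add: K_def conj_assoc)
  qed
  have div: "(\<Sum>i\<in>UNIV. ev (partial i (t i)) P) = 0" if "P \<noteq> 0" for P
    by (rule divergence_vanishes[OF red(1) t(1) t(3) _ d1 e(1) C(1) vol that]) (use k in simp)
  interpret mild_conic_syzygy q k t d1
  proof unfold_locales
    show "zero_set (q i) \<noteq> zero_set (q j)" if "i < k" "j < k" "i \<noteq> j" for i j
      using inj_onD[OF inj, of i j] that by auto
    show "(\<Sum>i\<in>UNIV. t i * partial i (\<Prod>j<k. q j)) = 0" using t(3) by (simp add: fq)
  qed (rule sm t(1) mild div small; assumption?)+
  have "t i = 0" for i by (rule syzygy_vanishes) (use f0 fq in simp)
  then show False using t(2) by simp
qed

theorem proposition3p3:
  fixes k d1 d2 d3 :: nat and f :: S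
  assumes "k \<ge> 2"
    and "conic_arrangement k f"
    and "\<forall>P \<in> singular_points f. node f P \<or> tacnode f P \<or> ordinary_triple_point f P"
    and "plus_one_generated (2 * k) f d1 d2 d3"
  shows "(4 / 3 * real k - 2 \<le> real d1 \<and> d1 \<le> k) \<and> k \<le> 6"
proof -
  have syz: "syzygy_curve (2 * k) f [d1, d2, d3]" and d: "d1 + d2 = 2 * k"
    using assms(4) by (auto simp: plus_one_generated_def)
  \<comment> \<open>With \<open>d1 + d2 = 2 * k\<close> this gives \<open>d1 \<le> k\<close>; then
    \<open>4 * k \<le> 3 * (k + 2)\<close>, so \<open>k \<le> 6\<close>.\<close>
  have "d1 \<le> d2" using syz by (simp add: syzygy_curve_def)
  moreover have "4 * k \<le> 3 * (d1 + 2)" by (rule minimal_syzygy_degree_ge[OF assms(2,3) syz])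
  moreover from this have "real (4 * k) \<le> real (3 * (d1 + 2))" by (simp only: of_nat_le_iff)
  ultimately show ?thesis using d by auto
qed

end
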